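(* Let $(\xi_n)_{n\in\mathbb{Z}}$ be a stationary ergodic Markov chain with state space $(S,\mathcal{A})$, marginal distribution $\pi$ and Markov operator $Q$. Let $f\in\mathbb{L}_2^0(\pi)$, $X_i=f(\xi_i)$, $S_n=\sum_{i=1}^n X_i$. For integers $m,k\ge 1$ put $f_m=\frac1m(Q+\dots+Q^m)f$ and $\bar R_k^m=\sum_{j=1}^k f_m(\xi_j)$. Assume that for every $\varepsilon>0$ $$\lim_{m\to\infty}\limsup_{n\to\infty}\mathbb{P}^x\Big(\max_{1\le j\le n}\frac{|\bar R_j^m|}{\sqrt n}>\varepsilon\Big)=0\quad\text{for }\pi\text{-almost every }x .$$ Then the quenched functional CLT holds: there are a constant $\sigma\in[0,\infty)$ and a set $S'\subset S$ with $\pi(S')=1$ such that for every $x\in S'$, $S_{[nt]}/\sqrt n\Rightarrow\sigma W(t)$ under $\mathbb{P}^x$ as $n\to\infty$.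
   Context: Setting: $(\xi_n)_{n\in\mathbb{Z}}$ is a stationary Markov chain on a probability space $(\Omega,\mathcal{F},\mathbb{P})$ with values in a measurable space $(S,\mathcal{A})$, $\pi(A)=\mathbb{P}(\xi_0\in A)$, with regular conditional distribution (transition kernel) $Q(x,A)=\mathbb{P}(\xi_1\in A\mid\xi_0=x)$; $Q$ also denotes the operator $(Qf)(x)=\int_S f(s)\,Q(x,ds)$. The chain is constructed canonically on the space of $S$-valued sequences with $\xi_n$ the coordinate maps, and is assumed ergodic (the shift is ergodic under $\mathbb{P}$). $\mathbb{L}_p^0(\pi)$ is the set of measurable real functions $f$ on $S$ with $\int|f|^p\,d\pi<\infty$ and $\int f\,d\pi=0$. $\mathbb{P}^x$ is the law of the chain with transition kernel $Q$ started at $\xi_0=x$ (initial distribution $\delta_x$); $\mathbb{P}(A)=\int\mathbb{P}^x(A)\,\pi(dx)$. $[u]$ is the integer part of $u$. $W(t)$, $t\in[0,1]$, is standard Brownian motion, and $\Rightarrow$ denotes convergence in distribution, here in the space of right-continuous functions with left limits on the unit interval endowed with the Skorohod topology. *)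

theory Defs
  imports "HOL-Probability.Probability"
begin

section \<open>Stationary ergodic Markov chains\<close>

text \<open>The two-sided chain is given canonically: \<open>P\<close> is a law on the space of \<open>S\<close>-valued
  sequences indexed by the integers, and \<open>\<xi> n\<close> is the coordinate map \<open>\<lambda>\<omega>. \<omega> n\<close>.\<close>

definition shift :: "(int \<Rightarrow> 'a) \<Rightarrow> int \<Rightarrow> 'a" where
  "shift \<omega> = (\<lambda>n. \<omega> (n + 1))"

text \<open>The \<open>\<sigma>\<close>-algebra generated by the coordinates with index at most \<open>n\<close>.\<close>

definition past :: "'a measure \<Rightarrow> int \<Rightarrow> (int \<Rightarrow> 'a) measure" where
  "past S n = vimage_algebra (space (PiM UNIV (\<lambda>_. S)))
     (\<lambda>\<omega>. restrict \<omega> {..n}) (PiM {..n} (\<lambda>_. S))"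

locale stationary_ergodic_markov_chain = prob_space P
  for S :: "'a measure" and \<pi> :: "'a measure" and Q :: "'a \<Rightarrow> 'a measure"
    and P :: "(int \<Rightarrow> 'a) measure" +
  assumes sets_law: "sets P = sets (PiM UNIV (\<lambda>_. S))"
    and kernel: "Q \<in> S \<rightarrow>\<^sub>M prob_algebra S"
    and markov: "\<And>n A. A \<in> sets S \<Longrightarrow>
      AE \<omega> in P. real_cond_exp P (past S n) (indicator {\<omega> \<in> space P. \<omega> (n + 1) \<in> A}) \<omega>
        = measure (Q (\<omega> n)) A"
    and marginal: "\<pi> = distr P S (\<lambda>\<omega>. \<omega> 0)"
    and stationary: "distr P P shift = P"
    and ergodic: "\<And>A. A \<in> sets P \<Longrightarrow> shift -` A \<inter> space P = A \<Longrightarrow> prob A = 0 \<or> prob A = 1"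

definition markov_op :: "('a \<Rightarrow> 'a measure) \<Rightarrow> ('a \<Rightarrow> real) \<Rightarrow> 'a \<Rightarrow> real" where
  "markov_op Q f x = (\<integral>s. f s \<partial>Q x)"

definition markov_avg :: "('a \<Rightarrow> 'a measure) \<Rightarrow> ('a \<Rightarrow> real) \<Rightarrow> nat \<Rightarrow> 'a \<Rightarrow> real" where
  "markov_avg Q f m x = (\<Sum>i=1..m. (markov_op Q ^^ i) f x) / real m"

definition L20 :: "'a measure \<Rightarrow> ('a \<Rightarrow> real) set" where
  "L20 \<pi> = {f \<in> borel_measurable \<pi>. integrable \<pi> (\<lambda>x. (f x)\<^sup>2) \<and> (\<integral>x. f x \<partial>\<pi>) = 0}"


section \<open>The law of the chain started at a point\<close>

text \<open>Kernels for the Ionescu-Tulcea construction: coordinate \<open>0\<close> has law \<open>\<delta>\<^sub>x\<close>, and coordinate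
  \<open>n > 0\<close> has law \<open>Q (\<omega> (n - 1))\<close> given the coordinates \<open>\<omega> 0, \<dots>, \<omega> (n - 1)\<close>.\<close>

definition chain_kernel ::
  "'a measure \<Rightarrow> ('a \<Rightarrow> 'a measure) \<Rightarrow> 'a \<Rightarrow> nat \<Rightarrow> (nat \<Rightarrow> 'a) \<Rightarrow> 'a measure" where
  "chain_kernel S Q x n \<omega> = (if n = 0 then return S x else Q (\<omega> (n - 1)))"

definition chain_law ::
  "'a measure \<Rightarrow> ('a \<Rightarrow> 'a measure) \<Rightarrow> 'a \<Rightarrow> (nat \<Rightarrow> 'a) measure" where
  "chain_law S Q x = projective_family.lim UNIV
     (Ionescu_Tulcea.CI (chain_kernel S Q x) (\<lambda>_. S)) (\<lambda>_. S)"

lemma Ionescu_Tulcea_chain: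
  assumes Q: "Q \<in> S \<rightarrow>\<^sub>M prob_algebra S" and x: "x \<in> space S"
  shows "Ionescu_Tulcea (chain_kernel S Q x) (\<lambda>_. S)"
proof (rule Ionescu_Tulcea.intro)
  fix i :: nat
  note [measurable] = measurable_prob_algebraD[OF Q]
  show "chain_kernel S Q x i \<in> PiM {0..<i} (\<lambda>_. S) \<rightarrow>\<^sub>M subprob_algebra S"
  proof (cases "i = 0")
    case True
    have "return S x \<in> space (subprob_algebra S)"
      using x by (simp add: space_subprob_algebra prob_space_return prob_space_imp_subprob_space)
    then show ?thesis using True by (simp add: chain_kernel_def[abs_def])
  next
    case False
    then have "(\<lambda>\<omega>. \<omega> (i - 1)) \<in> PiM {0..<i} (\<lambda>_. S) \<rightarrow>\<^sub>M S"
      by (intro measurable_component_singleton) auto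
    then have "(\<lambda>\<omega>. Q (\<omega> (i - 1))) \<in> PiM {0..<i} (\<lambda>_. S) \<rightarrow>\<^sub>M subprob_algebra S"
      by measurable
    then show ?thesis using False by (simp add: chain_kernel_def[abs_def])
  qed
next
  fix i :: nat and \<omega> assume \<omega>: "\<omega> \<in> space (PiM {0..<i} (\<lambda>_. S))"
  show "prob_space (chain_kernel S Q x i \<omega>)"
  proof (cases "i = 0")
    case False
    then have "\<omega> (i - 1) \<in> space S" using \<omega> by (auto simp: space_PiM PiE_iff)
    then have "Q (\<omega> (i - 1)) \<in> space (prob_algebra S)" using Q by (rule measurable_space[rotated])
    then show ?thesis using False by (simp add: chain_kernel_def space_prob_algebra)
  qed (simp add: chain_kernel_def x prob_space_return)
qed

lemma sets_chain_law:
  assumes "Q \<in> S \<rightarrow>\<^sub>M prob_algebra S" and "x \<in> space S"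
  shows "sets (chain_law S Q x) = sets (PiM UNIV (\<lambda>_. S))"
proof -
  interpret Ionescu_Tulcea "chain_kernel S Q x" "\<lambda>_. S"
    using assms by (rule Ionescu_Tulcea_chain)
  show ?thesis by (simp add: chain_law_def)
qed

lemma distr_chain_law_restrict:
  assumes "Q \<in> S \<rightarrow>\<^sub>M prob_algebra S" and "x \<in> space S" and "finite J"
  shows "distr (chain_law S Q x) (PiM J (\<lambda>_. S)) (\<lambda>\<omega>. restrict \<omega> J)
    = Ionescu_Tulcea.CI (chain_kernel S Q x) (\<lambda>_. S) J"
proof -
  interpret Ionescu_Tulcea "chain_kernel S Q x" "\<lambda>_. S"
    using assms(1,2) by (rule Ionescu_Tulcea_chain)
  show ?thesis using distr_lim[OF assms(3)] by (simp add: chain_law_def)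
qed

lemma prob_space_chain_law:
  assumes "Q \<in> S \<rightarrow>\<^sub>M prob_algebra S" and "x \<in> space S"
  shows "prob_space (chain_law S Q x)"
proof -
  interpret Ionescu_Tulcea "chain_kernel S Q x" "\<lambda>_. S"
    using assms by (rule Ionescu_Tulcea_chain)
  have "prob_space (distr PF.lim (PiM {} (\<lambda>_. S)) (\<lambda>\<omega>. restrict \<omega> {}))"
    unfolding distr_lim[OF finite.emptyI] by (rule PF.prob_space_P) auto
  then have "prob_space PF.lim"
    by (rule prob_space_distrD[rotated]) (auto intro!: measurable_restrict)
  then show ?thesis by (simp add: chain_law_def)
qed


section \<open>The Skorohod space on the unit interval\<close>

text \<open>Paths are functions on the reals that are \<^const>\<open>undefined\<close> off the unit interval, so that
  equality of paths is equality on the unit interval.\<close>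

definition skorohod_space :: "(real \<Rightarrow> real) set" where
  "skorohod_space = {x \<in> extensional {0..1}.
     (\<forall>t\<in>{0..<1}. continuous (at_right t) x) \<and> (\<forall>t\<in>{0<..1}. \<exists>l. (x \<longlongrightarrow> l) (at_left t))}"

definition time_changes :: "(real \<Rightarrow> real) set" where
  "time_changes = {l. strict_mono_on {0..1} l \<and> continuous_on {0..1} l \<and> l ` {0..1} = {0..1}}"

definition skorohod_close :: "real \<Rightarrow> (real \<Rightarrow> real) \<Rightarrow> (real \<Rightarrow> real) \<Rightarrow> bool" where
  "skorohod_close e x y \<longleftrightarrow> (\<exists>l\<in>time_changes. \<forall>t\<in>{0..1}. \<bar>l t - t\<bar> \<le> e \<and> \<bar>x t - y (l t)\<bar> \<le> e)"

text \<open>The value off the carrier is irrelevant; it is fixed because the locale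
  \<^locale>\<open>Metric_space\<close> asks for non-negativity and symmetry on the whole type.\<close>

definition skorohod_dist :: "(real \<Rightarrow> real) \<Rightarrow> (real \<Rightarrow> real) \<Rightarrow> real" where
  "skorohod_dist x y = (if x \<in> skorohod_space \<and> y \<in> skorohod_space
     then Inf {e. 0 < e \<and> skorohod_close e x y} else 0)"

definition skorohod_topology :: "(real \<Rightarrow> real) topology" where
  "skorohod_topology = Metric_space.mtopology skorohod_space skorohod_dist"

lemma skorohod_space_bounded:
  assumes "x \<in> skorohod_space"
  obtains K where "\<And>t. t \<in> {0..1} \<Longrightarrow> \<bar>x t\<bar> \<le> K"
proof -
  have loc: "\<exists>U. open U \<and> t \<in> U \<and> (\<exists>K. \<forall>s\<in>U \<inter> {0..1}. \<bar>x s\<bar> \<le> K)" if t: "t \<in> {0..1}" for t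
  proof -
    have "\<exists>b>t. \<exists>K. \<forall>s. t < s \<and> s < b \<and> s \<in> {0..1} \<longrightarrow> \<bar>x s\<bar> \<le> K"
    proof (cases "t < 1")
      case True
      then have "(x \<longlongrightarrow> x t) (at_right t)"
        using assms t by (auto simp: skorohod_space_def continuous_within)
      then have "eventually (\<lambda>s. dist (x s) (x t) < 1) (at_right t)" by (rule tendstoD) simp
      then obtain b where "b > t" "\<And>s. t < s \<Longrightarrow> s < b \<Longrightarrow> dist (x s) (x t) < 1"
        unfolding eventually_at_right_field by blast
      moreover have "\<bar>x s\<bar> \<le> \<bar>x t\<bar> + 1" if "dist (x s) (x t) < 1" for s
        using that by (simp add: dist_real_def)
      ultimately show ?thesis by meson
    next
      case False
      then show ?thesis using t by (intro exI[of _ "t + 1"]) auto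
    qed
    then obtain b K1 where b: "b > t" "\<And>s. t < s \<Longrightarrow> s < b \<Longrightarrow> s \<in> {0..1} \<Longrightarrow> \<bar>x s\<bar> \<le> K1" by blast
    have "\<exists>a<t. \<exists>K. \<forall>s. a < s \<and> s < t \<and> s \<in> {0..1} \<longrightarrow> \<bar>x s\<bar> \<le> K"
    proof (cases "t > 0")
      case True
      then obtain l where "(x \<longlongrightarrow> l) (at_left t)"
        using assms t unfolding skorohod_space_def by fastforce
      then have "eventually (\<lambda>s. dist (x s) l < 1) (at_left t)" by (rule tendstoD) simp
      then obtain a where "a < t" "\<And>s. a < s \<Longrightarrow> s < t \<Longrightarrow> dist (x s) l < 1"
        unfolding eventually_at_left_field by blast
      moreover have "\<bar>x s\<bar> \<le> \<bar>l\<bar> + 1" if "dist (x s) l < 1" for s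
        using that by (simp add: dist_real_def)
      ultimately show ?thesis by meson
    next
      case False
      then show ?thesis using t by (intro exI[of _ "t - 1"]) auto
    qed
    then obtain a K2 where a: "a < t" "\<And>s. a < s \<Longrightarrow> s < t \<Longrightarrow> s \<in> {0..1} \<Longrightarrow> \<bar>x s\<bar> \<le> K2" by blast
    have "\<bar>x s\<bar> \<le> max \<bar>x t\<bar> (max K1 K2)" if "s \<in> {a<..<b} \<inter> {0..1}" for s
      using a(2)[of s] b(2)[of s] that by (cases s t rule: linorder_cases) auto
    then have "\<exists>K. \<forall>s\<in>{a<..<b} \<inter> {0..1}. \<bar>x s\<bar> \<le> K" by blast
    then show ?thesis using a(1) b(1) by (intro exI[of _ "{a<..<b}"]) auto
  qed
  define \<U> where "\<U> = {U. open U \<and> (\<exists>K. \<forall>s\<in>U \<inter> {0..1}. \<bar>x s\<bar> \<le> K)}"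
  have "{0..1} \<subseteq> \<Union>\<U>" using loc by (auto simp: \<U>_def) meson
  then obtain \<V> where V: "\<V> \<subseteq> \<U>" "finite \<V>" "{0..1} \<subseteq> \<Union>\<V>"
    using compactE[OF compact_Icc[of "0::real" 1], of \<U>] unfolding \<U>_def by blast
  have "\<forall>U\<in>\<V>. \<exists>K. \<forall>s\<in>U \<inter> {0..1}. \<bar>x s\<bar> \<le> K" using V(1) by (auto simp: \<U>_def)
  then obtain K where K: "\<And>U s. U \<in> \<V> \<Longrightarrow> s \<in> U \<inter> {0..1} \<Longrightarrow> \<bar>x s\<bar> \<le> K U" by metis
  have "\<bar>x s\<bar> \<le> (\<Sum>U\<in>\<V>. \<bar>K U\<bar>)" if s: "s \<in> {0..1}" for s
  proof -
    obtain U where "U \<in> \<V>" "s \<in> U" using V(3) s by blast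
    then have "\<bar>x s\<bar> \<le> \<bar>K U\<bar>" using K[of U s] s by auto
    also have "\<dots> \<le> (\<Sum>U\<in>\<V>. \<bar>K U\<bar>)" using V \<open>U \<in> \<V>\<close> by (intro member_le_sum) auto
    finally show ?thesis .
  qed
  then show ?thesis by (rule that)
qed

lemma id_time_changes: "(\<lambda>t. t) \<in> time_changes"
  by (auto simp: time_changes_def strict_mono_on_def)

lemma time_changes_compose:
  assumes "l \<in> time_changes" "k \<in> time_changes"
  shows "(\<lambda>t. k (l t)) \<in> time_changes"
proof -
  have "(\<lambda>t. k (l t)) ` {0..1} = k ` (l ` {0..1})" by auto
  moreover have "continuous_on {0..1} (\<lambda>t. k (l t))"
    using assms by (intro continuous_on_compose2[of "{0..1}" k "{0..1}" l]) (auto simp: time_changes_def)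
  moreover have "strict_mono_on {0..1} (\<lambda>t. k (l t))"
    unfolding strict_mono_on_def
  proof safe
    fix r s :: real assume rs: "r \<in> {0..1}" "s \<in> {0..1}" "r < s"
    then have "l r < l s" "l r \<in> {0..1}" "l s \<in> {0..1}"
      using assms(1) by (auto simp only: time_changes_def strict_mono_on_def mem_Collect_eq)
    then show "k (l r) < k (l s)"
      using assms(2) by (auto simp only: time_changes_def strict_mono_on_def mem_Collect_eq)
  qed
  ultimately show ?thesis using assms by (auto simp: time_changes_def)
qed

lemma time_changes_inverse:
  assumes "l \<in> time_changes"
  obtains k where "k \<in> time_changes" "\<And>t. t \<in> {0..1} \<Longrightarrow> l (k t) = t"
proof -
  define k where "k = inv_into {0..1} l"
  have sm: "strict_mono_on {0..1} l" and c: "continuous_on {0..1} l" and im: "l ` {0..1} = {0..1}"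
    using assms by (auto simp: time_changes_def)
  have inj: "inj_on l {0..1}" using sm by (rule strict_mono_on_imp_inj_on)
  have lk: "l (k t) = t" if "t \<in> {0..1}" for t
    unfolding k_def by (rule f_inv_into_f) (use that im in simp)
  have k01: "k t \<in> {0..1}" if "t \<in> {0..1}" for t
    unfolding k_def by (rule inv_into_into) (use that im in simp)
  have kl: "k (l t) = t" if "t \<in> {0..1}" for t
    using that inj by (simp add: k_def)
  have "continuous_on (l ` {0..1}) k" using c kl by (intro continuous_on_inv) auto
  moreover have "k ` {0..1} = {0..1}"
    using inv_into_image_cancel[OF inj subset_refl] unfolding im by (simp add: k_def)
  moreover have "strict_mono_on {0..1} k"
    unfolding strict_mono_on_def
  proof safe
    fix r s :: real assume rs: "r \<in> {0..1}" "s \<in> {0..1}" "r < s"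
    show "k r < k s"
    proof (rule ccontr)
      assume "\<not> k r < k s"
      then have "l (k s) \<le> l (k r)"
        using sm k01[OF rs(1)] k01[OF rs(2)] by (cases "k s = k r") (auto simp: strict_mono_on_def less_imp_le)
      then show False using lk rs by simp
    qed
  qed
  ultimately have "k \<in> time_changes" using im by (simp add: time_changes_def)
  then show ?thesis using lk by (rule that)
qed

lemma skorohod_close_sym:
  assumes "skorohod_close e x y" shows "skorohod_close e y x"
proof -
  obtain l where l: "l \<in> time_changes" "\<And>t. t \<in> {0..1} \<Longrightarrow> \<bar>l t - t\<bar> \<le> e \<and> \<bar>x t - y (l t)\<bar> \<le> e"
    using assms by (auto simp: skorohod_close_def)
  obtain k where k: "k \<in> time_changes" "\<And>t. t \<in> {0..1} \<Longrightarrow> l (k t) = t"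
    using time_changes_inverse[OF l(1)] by blast
  have "\<bar>k t - t\<bar> \<le> e \<and> \<bar>y t - x (k t)\<bar> \<le> e" if t: "t \<in> {0..1}" for t
  proof -
    have "k t \<in> {0..1}" using k(1) t by (auto simp: time_changes_def)
    then show ?thesis using l(2)[of "k t"] k(2)[OF t] by (auto simp: abs_minus_commute)
  qed
  then show ?thesis unfolding skorohod_close_def by (intro bexI[OF _ k(1)]) blast
qed

lemma skorohod_close_trans:
  assumes "skorohod_close d x y" "skorohod_close e y z" shows "skorohod_close (d + e) x z"
proof -
  obtain l where l: "l \<in> time_changes" "\<And>t. t \<in> {0..1} \<Longrightarrow> \<bar>l t - t\<bar> \<le> d \<and> \<bar>x t - y (l t)\<bar> \<le> d"
    using assms by (auto simp: skorohod_close_def)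
  obtain k where k: "k \<in> time_changes" "\<And>t. t \<in> {0..1} \<Longrightarrow> \<bar>k t - t\<bar> \<le> e \<and> \<bar>y t - z (k t)\<bar> \<le> e"
    using assms by (auto simp: skorohod_close_def)
  have "\<bar>k (l t) - t\<bar> \<le> d + e \<and> \<bar>x t - z (k (l t))\<bar> \<le> d + e" if t: "t \<in> {0..1}" for t
  proof -
    have "l t \<in> {0..1}" using l(1) t by (auto simp: time_changes_def)
    then show ?thesis using l(2)[OF t] k(2)[of "l t"] by linarith
  qed
  then show ?thesis unfolding skorohod_close_def
    by (intro bexI[OF _ time_changes_compose[OF l(1) k(1)]]) blast
qed

lemma skorohod_close_ex:
  assumes "x \<in> skorohod_space" "y \<in> skorohod_space"
  shows "{e. 0 < e \<and> skorohod_close e x y} \<noteq> {}"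
proof -
  obtain K L where KL: "\<And>t. t \<in> {0..1} \<Longrightarrow> \<bar>x t\<bar> \<le> K" "\<And>t. t \<in> {0..1} \<Longrightarrow> \<bar>y t\<bar> \<le> L"
    using skorohod_space_bounded assms by metis
  have "\<bar>x t - y t\<bar> \<le> \<bar>K\<bar> + \<bar>L\<bar> + 1" if "t \<in> {0..1}" for t
    using KL(1)[OF that] KL(2)[OF that] by linarith
  then have "skorohod_close (\<bar>K\<bar> + \<bar>L\<bar> + 1) x y"
    unfolding skorohod_close_def by (intro bexI[OF _ id_time_changes]) auto
  then show ?thesis by (auto intro!: exI[of _ "\<bar>K\<bar> + \<bar>L\<bar> + 1"])
qed

lemma skorohod_dist_less:
  assumes "x \<in> skorohod_space" "y \<in> skorohod_space" "skorohod_dist x y < r"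
  obtains e where "0 < e" "e < r" "skorohod_close e x y"
proof -
  have "Inf {e. 0 < e \<and> skorohod_close e x y} < r" using assms by (simp add: skorohod_dist_def)
  then have "\<exists>e\<in>{e. 0 < e \<and> skorohod_close e x y}. e < r"
    using skorohod_close_ex[OF assms(1,2)] by (intro cInf_lessD)
  then show ?thesis using that by blast
qed

lemma skorohod_dist_le:
  assumes "x \<in> skorohod_space" "y \<in> skorohod_space" "0 < e" "skorohod_close e x y"
  shows "skorohod_dist x y \<le> e"
  using assms by (auto simp: skorohod_dist_def intro!: cInf_lower bdd_belowI[of _ 0])

lemma skorohod_dist_zero_imp_eq:
  assumes x: "x \<in> skorohod_space" and y: "y \<in> skorohod_space" and 0: "skorohod_dist x y = 0"
  shows "x = y"
proof (rule extensionalityI)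
  show "x \<in> extensional {0..1}" "y \<in> extensional {0..1}" using x y by (auto simp: skorohod_space_def)
  fix t :: real assume t: "t \<in> {0..1}"
  have "\<bar>x t - y t\<bar> \<le> 0 + r" if r: "r > 0" for r
  proof (cases "t < 1")
    case False
    obtain e where e: "0 < e" "e < r" "skorohod_close e x y"
      using skorohod_dist_less[OF x y, of r] 0 r by auto
    then obtain l where l: "l \<in> time_changes" "\<bar>x 1 - y (l 1)\<bar> \<le> e"
      by (auto simp: skorohod_close_def)
    obtain s where s: "s \<in> {0..1}" "l s = 1" using l(1)
      by (auto simp: time_changes_def) (metis atLeastAtMost_iff imageE order_refl zero_le_one)
    have "l 1 \<in> {0..1}" and sm: "strict_mono_on {0..1} l" using l(1) by (auto simp: time_changes_def)
    moreover have "l s < l 1" if "s < 1" using that s(1) sm by (auto simp: strict_mono_on_def)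
    ultimately have "l 1 = 1" using s by (cases "s = 1") (simp, force)
    then show ?thesis using l e t False by auto
  next
    case True
    have "(x \<longlongrightarrow> x t) (at_right t)" "(y \<longlongrightarrow> y t) (at_right t)"
      using x y t True by (auto simp: skorohod_space_def continuous_within)
    then have "eventually (\<lambda>s. dist (x s) (x t) < r/3 \<and> dist (y s) (y t) < r/3) (at_right t)"
      using r by (intro eventually_conj tendstoD) auto
    then obtain b where b: "b > t" "\<And>s. t < s \<Longrightarrow> s < b \<Longrightarrow> dist (x s) (x t) < r/3 \<and> dist (y s) (y t) < r/3"
      unfolding eventually_at_right_field by blast
    define h where "h = min (b - t) (1 - t)"
    have h: "h > 0" "t + h \<le> b" "t + h \<le> 1" using b True by (auto simp: h_def)
    obtain e where e: "0 < e" "e < min (r/3) (h/4)" "skorohod_close e x y"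
      using skorohod_dist_less[OF x y, of "min (r/3) (h/4)"] 0 r h by auto
    define s where "s = t + h/2"
    have s: "s \<in> {0..1}" "t < s" "s < b" using h t by (auto simp: s_def)
    obtain l where l: "\<bar>l s - s\<bar> \<le> e" "\<bar>x s - y (l s)\<bar> \<le> e"
      using e(3) s(1) unfolding skorohod_close_def by blast
    have "t < l s" "l s < b" using l(1) e(2) h by (auto simp: s_def abs_le_iff)
    then have "\<bar>y (l s) - y t\<bar> < r/3" using b(2) by (simp add: dist_real_def)
    moreover have "\<bar>x s - x t\<bar> < r/3" using b(2) s by (simp add: dist_real_def)
    ultimately show ?thesis using l(2) e(2) by linarith
  qed
  then have "\<bar>x t - y t\<bar> \<le> 0" by (rule field_le_epsilon)
  then show "x t = y t" by simp
qed

lemma Metric_space_skorohod: "Metric_space skorohod_space skorohod_dist"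
proof
  fix x y z :: "real \<Rightarrow> real"
  show "0 \<le> skorohod_dist x y"
    using skorohod_close_ex[of x y] by (auto simp: skorohod_dist_def intro!: cInf_greatest)
  have "skorohod_close e x y \<longleftrightarrow> skorohod_close e y x" for e
    using skorohod_close_sym by blast
  then show "skorohod_dist x y = skorohod_dist y x" by (auto simp: skorohod_dist_def)
  assume x: "x \<in> skorohod_space" and y: "y \<in> skorohod_space"
  have "skorohod_dist x x \<le> 0 + e" if "e > 0" for e
    using skorohod_dist_le[OF x x that] that id_time_changes by (force simp: skorohod_close_def)
  then have "skorohod_dist x x \<le> 0" by (rule field_le_epsilon)
  moreover have "0 \<le> skorohod_dist x x"
    using skorohod_close_ex[of x x] by (auto simp: skorohod_dist_def intro!: cInf_greatest)
  ultimately show "skorohod_dist x y = 0 \<longleftrightarrow> x = y"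
    using skorohod_dist_zero_imp_eq[OF x y] by auto
  assume z: "z \<in> skorohod_space"
  have "skorohod_dist x z \<le> (skorohod_dist x y + skorohod_dist y z) + r" if r: "r > 0" for r
  proof -
    obtain d where d: "0 < d" "d < skorohod_dist x y + r/2" "skorohod_close d x y"
      using skorohod_dist_less[OF x y, of "skorohod_dist x y + r/2"] r by auto
    obtain e where e: "0 < e" "e < skorohod_dist y z + r/2" "skorohod_close e y z"
      using skorohod_dist_less[OF y z, of "skorohod_dist y z + r/2"] r by auto
    have "skorohod_dist x z \<le> d + e"
      using d e by (intro skorohod_dist_le[OF x z] skorohod_close_trans) auto
    then show ?thesis using d e by simp
  qed
  then show "skorohod_dist x z \<le> skorohod_dist x y + skorohod_dist y z" by (rule field_le_epsilon)
qed


section \<open>Brownian motion and convergence in distribution\<close>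

definition brownian_motion :: "'b measure \<Rightarrow> (real \<Rightarrow> 'b \<Rightarrow> real) \<Rightarrow> bool" where
  "brownian_motion B W \<longleftrightarrow> prob_space B
     \<and> (\<forall>t\<in>{0..1}. W t \<in> borel_measurable B)
     \<and> (AE \<omega> in B. W 0 \<omega> = 0)
     \<and> (\<forall>\<omega>\<in>space B. continuous_on {0..1} (\<lambda>t. W t \<omega>))
     \<and> (\<forall>s t. 0 \<le> s \<and> s < t \<and> t \<le> 1 \<longrightarrow>
          distributed B lborel (\<lambda>\<omega>. W t \<omega> - W s \<omega>) (normal_density 0 (sqrt (t - s))))
     \<and> (\<forall>(n::nat) (t::nat \<Rightarrow> real). 0 \<le> t 0 \<and> (\<forall>i<n. t i \<le> t (Suc i)) \<and> t n \<le> 1 \<longrightarrow>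
          prob_space.indep_vars B (\<lambda>_. borel) (\<lambda>i \<omega>. W (t (Suc i)) \<omega> - W (t i) \<omega>) {..<n})"

definition borel_sigma :: "'d topology \<Rightarrow> 'd measure" where
  "borel_sigma T = sigma (topspace T) {U. openin T U}"

definition converges_in_distribution ::
  "'d topology \<Rightarrow> 'a measure \<Rightarrow> (nat \<Rightarrow> 'a \<Rightarrow> 'd) \<Rightarrow> 'b measure \<Rightarrow> ('b \<Rightarrow> 'd) \<Rightarrow> bool" where
  "converges_in_distribution T M Y B Z \<longleftrightarrow>
     (\<forall>n. Y n \<in> M \<rightarrow>\<^sub>M borel_sigma T) \<and> Z \<in> B \<rightarrow>\<^sub>M borel_sigma T
     \<and> (\<forall>h. continuous_map T euclideanreal h \<and> bounded (h ` topspace T) \<longrightarrow>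
          (\<lambda>n. \<integral>\<omega>. h (Y n \<omega>) \<partial>M) \<longlonglongrightarrow> (\<integral>\<omega>. h (Z \<omega>) \<partial>B))"

definition partial_sum :: "('a \<Rightarrow> real) \<Rightarrow> nat \<Rightarrow> (nat \<Rightarrow> 'a) \<Rightarrow> real" where
  "partial_sum f n \<omega> = (\<Sum>i=1..n. f (\<omega> i))"

definition sum_process :: "('a \<Rightarrow> real) \<Rightarrow> nat \<Rightarrow> (nat \<Rightarrow> 'a) \<Rightarrow> real \<Rightarrow> real" where
  "sum_process f n \<omega> = (\<lambda>t\<in>{0..1}. partial_sum f (nat \<lfloor>real n * t\<rfloor>) \<omega> / sqrt (real n))"

end

theory Submission
  imports Defs "HOL-Real_Asymp.Real_Asymp"
begin

text \<open>Write \<open>P\<^sup>x\<close> for the law of the chain started at \<open>x\<close> and \<open>M\<^sub>n(g)\<close> for the martingale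
  \<open>(\<Sum>k<n. g(\<xi>\<^sub>k\<^sub>+\<^sub>1) - Q g(\<xi>\<^sub>k))\<close>. The average \<open>f\<^sub>m\<close> of \<open>Q f, \<dots>, Q\<^sup>m f\<close> differs from \<open>f\<close> by a
  coboundary: \<open>f - f\<^sub>m = g\<^sub>m - Q g\<^sub>m\<close> with a square integrable \<open>g\<^sub>m\<close> (lemma
  \<open>poisson_equation\<close>). Summing along the chain, \<open>S\<^sub>n\<close> is \<open>M\<^sub>n(g\<^sub>m)\<close> plus the partial sum of \<open>f\<^sub>m\<close>, plus
  two boundary terms. The hypothesis makes the partial sums of \<open>f\<^sub>m\<close> negligible for large \<open>m\<close>, and the
  boundary terms are \<open>o(sqrt n)\<close> by the ergodic theorem. After \<open>g\<^sub>m\<close> has been truncated, at the price of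
  another martingale that is small by Lenglart's inequality, \<open>S\<close> is approximated under \<open>P\<^sup>x\<close>,
  uniformly up to time \<open>n\<close> on the scale \<open>sqrt n\<close>, by martingales \<open>M(c\<^sub>m)\<close> with bounded \<open>c\<^sub>m\<close>; this is
  \<open>quenched_martingale_approximation\<close>.

  The conditional variances of \<open>M(c\<^sub>m)\<close> are functions of the current state, so by the ergodic theorem
  their averages converge to a constant \<open>\<sigma>\<^sub>m\<^sup>2\<close>, almost surely under the stationary law and hence, for
  almost every \<open>x\<close>, almost surely under \<open>P\<^sup>x\<close> (\<open>future_law\<close>, \<open>chain_ergodic_theorem\<close>). With bounded
  differences this yields the functional central limit theorem for \<open>M(c\<^sub>m)\<close>
  (\<open>bounded_martingale_fclt\<close>): the joint characteristic functions of the increments over \<open>k\<close> equal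
  blocks converge (\<open>cf_limit\<close>), which gives the limit of the path sampled at the \<open>k\<close> grid points
  (\<open>fdd_convergence\<close>), and Freedman's exponential inequality bounds the oscillation inside the blocks
  (\<open>block_oscillation\<close>). Comparing the characteristic functions of \<open>M\<^sub>n(c\<^sub>m) / sqrt n\<close> for different
  \<open>m\<close> shows that \<open>\<sigma>\<^sub>m\<close> converges to some \<open>\<sigma>\<close>, and \<open>\<sigma> W\<close> is the limit.

  Prokhorov's theorem is avoided. Convergence in distribution is tested on bounded functions that are
  Lipschitz for the Skorohod distance (\<open>converges_in_distribution_lipschitz\<close>), and these only see
  uniform distances of paths.\<close>

section \<open>The pointwise ergodic theorem\<close>

context prob_space
begin

lemma integral_measure_preserving:
  fixes u :: "'a \<Rightarrow> real"
  assumes T: "T \<in> M \<rightarrow>\<^sub>M M" "distr M M T = M" and u: "u \<in> borel_measurable M"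
  shows "(\<integral>x. u (T x) \<partial>M) = (\<integral>x. u x \<partial>M)" and "integrable M (\<lambda>x. u (T x)) \<longleftrightarrow> integrable M u"
  using integral_distr[OF T(1) u] integrable_distr_eq[OF T(1) u] T(2) by auto

text \<open>If \<open>u\<close> has negative mean, the event \<open>A\<close> that its Birkhoff sums are unbounded above is
  invariant, and on \<open>A\<close> the running maxima \<open>\<Phi> n\<close> satisfy
  \<open>\<Phi> (n + 1) - \<Phi> n \<circ> T \<down> u\<close>. Each of these differences has a nonnegative integral over \<open>A\<close>, so \<open>A\<close>
  cannot have full measure.\<close>

lemma ergodic_sums_bounded_above:
  fixes u :: "'a \<Rightarrow> real"
  assumes T[measurable]: "T \<in> M \<rightarrow>\<^sub>M M" and inv: "distr M M T = M"
    and erg: "\<And>A. A \<in> sets M \<Longrightarrow> T -` A \<inter> space M = A \<Longrightarrow> prob A = 0 \<or> prob A = 1"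
    and u: "integrable M u" and neg: "(\<integral>x. u x \<partial>M) < 0"
  shows "AE x in M. \<exists>K. \<forall>n. (\<Sum>j<n. u ((T ^^ j) x)) \<le> K"
proof -
  note [measurable] = borel_measurable_integrable[OF u]
  have Tj[measurable]: "T ^^ j \<in> M \<rightarrow>\<^sub>M M" for j by (induct j) auto
  define s where "s n x = (\<Sum>j<n. u ((T ^^ j) x))" for n x
  have s_meas[measurable]: "s n \<in> borel_measurable M" for n unfolding s_def by measurable
  have s_Suc: "s (Suc n) x = u x + s n (T x)" for n x
    unfolding s_def by (subst sum.lessThan_Suc_shift) (simp add: funpow_swap1)
  define \<Phi> where "\<Phi> n x = Max ((\<lambda>k. s (Suc k) x) ` {..n})" for n x
  have \<Phi>_0: "\<Phi> 0 x = u x" for x by (simp add: \<Phi>_def s_def)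
  have \<Phi>_ge: "s (Suc k) x \<le> \<Phi> n x" if "k \<le> n" for k n x
    unfolding \<Phi>_def using that by (intro Max_ge) auto
  have \<Phi>_rec: "\<Phi> (Suc n) x = u x + max 0 (\<Phi> n (T x))" for n x
  proof (rule antisym)
    show "\<Phi> (Suc n) x \<le> u x + max 0 (\<Phi> n (T x))"
      unfolding \<Phi>_def[of "Suc n"]
    proof (rule Max.boundedI)
      fix a assume "a \<in> (\<lambda>k. s (Suc k) x) ` {..Suc n}"
      then obtain k where k: "k \<le> Suc n" "a = s (Suc k) x" by auto
      show "a \<le> u x + max 0 (\<Phi> n (T x))"
      proof (cases k)
        case 0 then show ?thesis using k by (simp add: s_def)
      next
        case (Suc k') then show ?thesis
          using k \<Phi>_ge[of k' n "T x"] by (simp add: s_Suc[of "Suc k'"])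
      qed
    qed auto
    have "\<Phi> n (T x) \<in> (\<lambda>k. s (Suc k) (T x)) ` {..n}" unfolding \<Phi>_def by (rule Max_in) auto
    then obtain k where k: "k \<le> n" "\<Phi> n (T x) = s (Suc k) (T x)" by auto
    have "u x + \<Phi> n (T x) \<le> \<Phi> (Suc n) x"
      using \<Phi>_ge[of "Suc k" "Suc n" x] k by (simp add: s_Suc[of "Suc k"])
    moreover have "u x \<le> \<Phi> (Suc n) x" using \<Phi>_ge[of 0 "Suc n" x] by (simp add: s_def)
    ultimately show "u x + max 0 (\<Phi> n (T x)) \<le> \<Phi> (Suc n) x" by linarith
  qed
  have \<Phi>_int: "integrable M (\<Phi> n)" for n
  proof (induct n)
    case 0 then show ?case using u by (simp add: \<Phi>_0)
  next
    case (Suc n)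
    then show ?case
      using u integral_measure_preserving(2)[OF T inv borel_measurable_integrable[OF Suc]]
      by (simp add: \<Phi>_rec)
  qed
  note [measurable] = borel_measurable_integrable[OF \<Phi>_int]
  have \<Phi>_mono: "\<Phi> n x \<le> \<Phi> (Suc n) x" for n x
    unfolding \<Phi>_def by (intro Max_mono) auto
  define A where "A = {x \<in> space M. \<forall>K::nat. \<exists>n. s n x > real K}"
  have A_sets[measurable]: "A \<in> sets M" unfolding A_def by measurable
  have A_iff: "x \<in> A \<longleftrightarrow> x \<in> space M \<and> (\<forall>K. \<exists>n. s n x > K)" for x
  proof -
    have "(\<forall>K::nat. \<exists>n. s n x > real K) \<longleftrightarrow> (\<forall>K. \<exists>n. s n x > K)"
      by (meson less_trans reals_Archimedean2)
    then show ?thesis by (simp add: A_def)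
  qed
  have A_inv: "T x \<in> A \<longleftrightarrow> x \<in> A" if x: "x \<in> space M" for x
  proof
    assume a: "T x \<in> A"
    have "\<exists>n. s n x > K" for K
    proof -
      obtain n where "s n (T x) > K - u x" using a unfolding A_iff by blast
      then show ?thesis by (intro exI[of _ "Suc n"]) (simp add: s_Suc)
    qed
    then show "x \<in> A" using x by (simp add: A_iff)
  next
    assume a: "x \<in> A"
    have "\<exists>n. s n (T x) > K" for K
    proof -
      obtain n where n: "s n x > max 0 (K + u x)" using a unfolding A_iff by blast
      then obtain m where "n = Suc m" by (cases n) (auto simp: s_def)
      then show ?thesis using n by (intro exI[of _ m]) (simp add: s_Suc)
    qed
    then show "T x \<in> A" using x measurable_space[OF T x] by (simp add: A_iff)
  qed
  have "T -` A \<inter> space M = A" using A_inv by (auto simp: A_def)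
  then have "prob A = 0 \<or> prob A = 1" by (intro erg) auto
  moreover have "prob A \<noteq> 1"
  proof
    assume one: "prob A = 1"
    then have AE_A: "AE x in M. x \<in> A" using A_sets by (simp add: AE_in_set_eq_1)
    define d where "d n x = \<Phi> (Suc n) x - \<Phi> n (T x)" for n x
    have \<Phi>T_int: "integrable M (\<lambda>x. \<Phi> n (T x))" "(\<integral>x. \<Phi> n (T x) \<partial>M) = (\<integral>x. \<Phi> n x \<partial>M)" for n
      using integral_measure_preserving[OF T inv, of "\<Phi> n"] \<Phi>_int[of n] by auto
    have "0 \<le> (\<integral>x. d n x \<partial>M)" for n
      using integral_mono[OF \<Phi>_int \<Phi>_int \<Phi>_mono, of n] \<Phi>_int \<Phi>T_int by (simp add: d_def)
    moreover have "(\<lambda>n. \<integral>x. d n x \<partial>M) \<longlonglongrightarrow> (\<integral>x. u x \<partial>M)"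
    proof (rule integral_dominated_convergence[where w="\<lambda>x. \<bar>u x\<bar> + \<bar>u (T x)\<bar>"])
      show "integrable M (\<lambda>x. \<bar>u x\<bar> + \<bar>u (T x)\<bar>)"
        using u integral_measure_preserving(2)[OF T inv, of u] by auto
      show "AE x in M. (\<lambda>n. d n x) \<longlonglongrightarrow> u x"
        using AE_A
      proof eventually_elim
        case (elim x)
        then have "T x \<in> A" using A_inv by (simp add: A_def)
        then obtain n where n: "s n (T x) > 0" unfolding A_iff by blast
        then obtain m where m: "n = Suc m" by (cases n) (auto simp: s_def)
        have "d k x = u x" if "k \<ge> m" for k
          using \<Phi>_ge[OF that, of "T x"] n m by (simp add: d_def \<Phi>_rec)
        then show ?case
          by (intro tendsto_eventually eventually_sequentiallyI[of m]) auto
      qed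
      show "AE x in M. norm (d n x) \<le> \<bar>u x\<bar> + \<bar>u (T x)\<bar>" for n
      proof (rule AE_I2)
        fix x
        have "u (T x) \<le> \<Phi> n (T x)" using \<Phi>_ge[of 0 n "T x"] by (simp add: s_def)
        then show "norm (d n x) \<le> \<bar>u x\<bar> + \<bar>u (T x)\<bar>" by (simp add: d_def \<Phi>_rec)
      qed
    qed (auto simp: d_def)
    ultimately have "0 \<le> (\<integral>x. u x \<partial>M)" by (intro LIMSEQ_le_const) auto
    then show False using neg by simp
  qed
  ultimately have "prob A = 0" by simp
  then have "AE x in M. x \<notin> A" using A_sets by (intro AE_not_in) (simp add: null_sets_def emeasure_eq_measure)
  then show ?thesis
    by (rule AE_mp) (auto intro!: AE_I2 simp: A_iff s_def not_less)
qed

theorem birkhoff_ergodic: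
  fixes u :: "'a \<Rightarrow> real"
  assumes T[measurable]: "T \<in> M \<rightarrow>\<^sub>M M" and inv: "distr M M T = M"
    and erg: "\<And>A. A \<in> sets M \<Longrightarrow> T -` A \<inter> space M = A \<Longrightarrow> prob A = 0 \<or> prob A = 1"
    and u: "integrable M u"
  shows "AE x in M. (\<lambda>n. (\<Sum>j<n. u ((T ^^ j) x)) / real n) \<longlonglongrightarrow> (\<integral>x. u x \<partial>M)"
proof -
  have upper: "AE x in M. \<forall>c>0. \<forall>\<^sub>F n in sequentially.
      (\<Sum>j<n. v ((T ^^ j) x)) / real n < (\<integral>x. v x \<partial>M) + c" if v: "integrable M v" for v :: "'a \<Rightarrow> real"
  proof -
    define I where "I = (\<integral>x. v x \<partial>M)"
    have "AE x in M. \<exists>K. \<forall>n. (\<Sum>j<n. (v ((T ^^ j) x) - (I + inverse (real (Suc p))))) \<le> K" for p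
      by (rule ergodic_sums_bounded_above[OF T inv erg]) (use v in \<open>auto simp: I_def prob_space\<close>)
    then have "AE x in M. \<forall>p. \<exists>K. \<forall>n. (\<Sum>j<n. (v ((T ^^ j) x) - (I + inverse (real (Suc p))))) \<le> K"
      by (simp add: AE_all_countable)
    then show ?thesis
    proof eventually_elim
      case (elim x)
      show ?case
      proof (intro allI impI)
        fix c :: real assume "c > 0"
        then obtain p where p: "inverse (real (Suc p)) < c" using reals_Archimedean by blast
        define e where "e = inverse (real (Suc p))"
        obtain K where K: "\<And>n. (\<Sum>j<n. (v ((T ^^ j) x) - (I + e))) \<le> K"
          using elim unfolding e_def by blast
        have "(\<lambda>n. K / real n) \<longlonglongrightarrow> 0" by real_asymp
        then have "\<forall>\<^sub>F n in sequentially. K / real n < c - e"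
          using p by (intro order_tendstoD) (auto simp: e_def)
        then show "\<forall>\<^sub>F n in sequentially. (\<Sum>j<n. v ((T ^^ j) x)) / real n < (\<integral>x. v x \<partial>M) + c"
          using eventually_gt_at_top[of 0]
        proof eventually_elim
          case (elim n)
          have "(\<Sum>j<n. v ((T ^^ j) x)) \<le> K + real n * (I + e)"
            using K[of n] by (simp add: sum_subtractf)
          then have "(\<Sum>j<n. v ((T ^^ j) x)) / real n \<le> (K + real n * (I + e)) / real n"
            using elim by (intro divide_right_mono) auto
          also have "\<dots> = K / real n + (I + e)" using elim by (simp add: add_divide_distrib)
          finally show ?case using elim by (simp add: I_def)
        qed
      qed
    qed
  qed
  have "integrable M (\<lambda>x. - u x)" using u by simp
  from upper[OF this] upper[OF u] show ?thesis
  proof eventually_elim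
    case (elim x)
    show ?case
    proof (rule order_tendstoI)
      fix a assume a: "a < (\<integral>x. u x \<partial>M)"
      show "\<forall>\<^sub>F n in sequentially. a < (\<Sum>j<n. u ((T ^^ j) x)) / real n"
        using elim(1)[rule_format, of "(\<integral>x. u x \<partial>M) - a"] a by (simp add: sum_negf)
    next
      fix a assume a: "(\<integral>x. u x \<partial>M) < a"
      show "\<forall>\<^sub>F n in sequentially. (\<Sum>j<n. u ((T ^^ j) x)) / real n < a"
        using elim(2)[rule_format, of "a - (\<integral>x. u x \<partial>M)"] a by simp
    qed
  qed
qed

end

section \<open>The chain started at a point\<close>

text \<open>Adaptedness is a pointwise condition here, not measurability for a sub-\<open>\<sigma>\<close>-algebra, because
  the Markov property is used by overwriting one coordinate of a path.\<close>

definition determined_by :: "nat \<Rightarrow> ((nat \<Rightarrow> 'a) \<Rightarrow> 'b) \<Rightarrow> bool" where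
  "determined_by n G \<longleftrightarrow> (\<forall>\<omega> \<omega>'. (\<forall>i\<le>n. \<omega> i = \<omega>' i) \<longrightarrow> G \<omega> = G \<omega>')"

lemma determined_byD: "determined_by n G \<Longrightarrow> (\<And>i. i \<le> n \<Longrightarrow> \<omega> i = \<omega>' i) \<Longrightarrow> G \<omega> = G \<omega>'"
  unfolding determined_by_def by blast

lemma determined_by_comp: "determined_by n G \<Longrightarrow> determined_by n (\<lambda>\<omega>. h (G \<omega>))"
  unfolding determined_by_def by (metis (no_types))

lemma integral_measurable_subprob_algebra2:
  fixes f :: "'a \<Rightarrow> 'b \<Rightarrow> 'c::{banach, second_countable_topology}"
  assumes f[measurable]: "(\<lambda>(x, y). f x y) \<in> borel_measurable (M \<Otimes>\<^sub>M N)"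
    and L[measurable]: "L \<in> M \<rightarrow>\<^sub>M subprob_algebra N"
  shows "(\<lambda>x. integral\<^sup>L (L x) (f x)) \<in> borel_measurable M"
proof -
  note measurable_distr2[measurable]
  have "(\<lambda>x. integral\<^sup>L (distr (L x) (M \<Otimes>\<^sub>M N) (\<lambda>y. (x, y))) (\<lambda>(x, y). f x y)) \<in> borel_measurable M"
    by measurable
  then show ?thesis
    by (rule measurable_cong[THEN iffD1, rotated]) (simp add: integral_distr)
qed

abbreviation path_algebra :: "'a measure \<Rightarrow> (nat \<Rightarrow> 'a) measure" where
  "path_algebra S \<equiv> PiM UNIV (\<lambda>_::nat. S)"

text \<open>Integrating out the last coordinate of such a product against the kernel gives a product of the
  same shape with one factor less; this drives the inductions that identify laws of chains.\<close>

definition cylinder_test ::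
  "nat \<Rightarrow> (nat \<Rightarrow> 'a set) \<Rightarrow> ('a \<Rightarrow> ennreal) \<Rightarrow> (nat \<Rightarrow> 'a) \<Rightarrow> ennreal" where
  "cylinder_test n A u \<omega> = (\<Prod>i<n. indicator (A i) (\<omega> i)) * u (\<omega> n)"

lemma cylinder_test_measurable[measurable]:
  assumes "\<And>i. i < n \<Longrightarrow> A i \<in> sets S" and [measurable]: "u \<in> borel_measurable S"
  shows "cylinder_test n A u \<in> borel_measurable (path_algebra S)"
proof -
  have "(\<lambda>\<omega>. indicator (A i) (\<omega> i) :: ennreal) \<in> borel_measurable (path_algebra S)" if "i < n" for i
    using assms(1)[OF that] by measurable
  then have "(\<lambda>\<omega>. \<Prod>i<n. indicator (A i) (\<omega> i) :: ennreal) \<in> borel_measurable (path_algebra S)"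
    by (intro borel_measurable_prod_ennreal) auto
  then show ?thesis unfolding cylinder_test_def by measurable
qed

lemma emb_eq_cylinder:
  assumes "finite J" and A: "\<And>i. i \<in> J \<Longrightarrow> A i \<in> sets S"
  shows "\<exists>n A'. (\<forall>i. A' i \<in> sets S) \<and> (\<forall>\<omega>\<in>space (path_algebra S).
      indicator (prod_emb UNIV (\<lambda>_. S) J (Pi\<^sub>E J A)) \<omega> = cylinder_test n A' (indicator (A' n)) \<omega>)"
proof -
  obtain n :: nat where n: "\<And>i. i \<in> J \<Longrightarrow> i \<le> n"
    using \<open>finite J\<close> unfolding finite_nat_set_iff_bounded_le by auto
  define A' where "A' i = (if i \<in> J then A i else space S)" for i
  have "A' i \<in> sets S" for i using A by (auto simp: A'_def)
  moreover have "indicator (prod_emb UNIV (\<lambda>_. S) J (Pi\<^sub>E J A)) \<omega> = cylinder_test n A' (indicator (A' n)) \<omega>"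
    if \<omega>: "\<omega> \<in> space (path_algebra S)" for \<omega>
  proof -
    have "cylinder_test n A' (indicator (A' n)) \<omega> = (\<Prod>i\<le>n. indicator (A' i) (\<omega> i))"
      by (simp add: cylinder_test_def lessThan_Suc_atMost[symmetric])
    also have "\<dots> = (\<Prod>i\<le>n. if i \<in> J then indicator (A i) (\<omega> i) else 1)"
      using \<omega> by (intro prod.cong) (auto simp: A'_def space_PiM PiE_iff split: split_indicator)
    also have "\<dots> = (if \<forall>i\<in>J. \<omega> i \<in> A i then 1 else 0)"
    proof (cases "\<forall>i\<in>J. \<omega> i \<in> A i")
      case True then show ?thesis by (auto intro!: prod.neutral)
    next
      case False
      then obtain i where i: "i \<in> J" "\<omega> i \<notin> A i" by blast
      then have "\<exists>i\<in>{..n}. (if i \<in> J then indicator (A i) (\<omega> i) else 1) = (0::ennreal)"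
        using n[of i] by (intro bexI[of _ i]) auto
      then show ?thesis using False by (subst prod_zero) auto
    qed
    also have "\<dots> = indicator (prod_emb UNIV (\<lambda>_. S) J (Pi\<^sub>E J A)) \<omega>"
      using \<omega> by (auto simp: prod_emb_def space_PiM PiE_iff split: split_indicator)
    finally show ?thesis by simp
  qed
  ultimately show ?thesis by blast
qed

locale markov_kernel =
  fixes S :: "'a measure" and Q :: "'a \<Rightarrow> 'a measure"
  assumes kernel: "Q \<in> S \<rightarrow>\<^sub>M prob_algebra S"
begin

abbreviation "law \<equiv> chain_law S Q"
abbreviation "paths \<equiv> path_algebra S"

lemma kernel_subprob[measurable]: "Q \<in> S \<rightarrow>\<^sub>M subprob_algebra S"
  using kernel by (rule measurable_prob_algebraD)

lemma prob_space_kernel: "x \<in> space S \<Longrightarrow> prob_space (Q x)"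
  using measurable_space[OF kernel] by (simp add: space_prob_algebra)

lemma sets_kernel: "x \<in> space S \<Longrightarrow> sets (Q x) = sets S"
  using measurable_space[OF kernel] by (simp add: space_prob_algebra)

lemma space_kernel: "x \<in> space S \<Longrightarrow> space (Q x) = space S"
  using sets_kernel sets_eq_imp_space_eq by blast

lemma prob_space_law: "x \<in> space S \<Longrightarrow> prob_space (law x)"
  using kernel by (rule prob_space_chain_law)

lemma sets_law: "x \<in> space S \<Longrightarrow> sets (law x) = sets paths"
  using kernel by (rule sets_chain_law)

lemma space_law: "x \<in> space S \<Longrightarrow> space (law x) = space paths"
  using sets_law sets_eq_imp_space_eq by blast

lemma measurable_law: "x \<in> space S \<Longrightarrow> measurable (law x) N = measurable paths N"
  by (rule measurable_cong_sets) (auto simp: sets_law)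

lemma path_in_space: "\<omega> \<in> space paths \<Longrightarrow> \<omega> n \<in> space S"
  by (auto simp: space_PiM)

lemma path_update_measurable:
  assumes "\<omega> \<in> space paths"
  shows "(\<lambda>y. fun_upd \<omega> n y) \<in> S \<rightarrow>\<^sub>M paths"
proof (rule measurable_PiM_single')
  fix i
  have "\<omega> i \<in> space S" using assms by (rule path_in_space)
  then show "(\<lambda>y. fun_upd \<omega> n y i) \<in> S \<rightarrow>\<^sub>M S" by (cases "i = n") auto
qed (use assms in \<open>auto simp: space_PiM\<close>)

lemma path_update_measurable2:
  "(\<lambda>(\<omega>, y). fun_upd \<omega> n y) \<in> paths \<Otimes>\<^sub>M S \<rightarrow>\<^sub>M paths"
proof (rule measurable_PiM_single')
  fix i
  show "(\<lambda>p. (case p of (\<omega>, y) \<Rightarrow> fun_upd \<omega> n y) i) \<in> paths \<Otimes>\<^sub>M S \<rightarrow>\<^sub>M S"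
    by (cases "i = n") (auto simp: split_beta')
qed (auto simp: space_PiM space_pair_measure)

lemma kernel_nn_integral_measurable[measurable]:
  assumes "(\<lambda>(x, y). u x y) \<in> borel_measurable (S \<Otimes>\<^sub>M S)"
  shows "(\<lambda>x. \<integral>\<^sup>+y. u x y \<partial>Q x) \<in> borel_measurable S"
  using assms kernel_subprob by (rule nn_integral_measurable_subprob_algebra2)

lemma kernel_integral_measurable[measurable]:
  fixes u :: "'a \<Rightarrow> 'a \<Rightarrow> real"
  assumes "(\<lambda>(x, y). u x y) \<in> borel_measurable (S \<Otimes>\<^sub>M S)"
  shows "(\<lambda>x. \<integral>y. u x y \<partial>Q x) \<in> borel_measurable S"
  using assms kernel_subprob by (rule integral_measurable_subprob_algebra2)

lemma law_restrict:
  assumes x: "x \<in> space S"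
  shows "distr (law x) (PiM {0..<m} (\<lambda>_. S)) (\<lambda>\<omega>. restrict \<omega> {0..<m})
    = Ionescu_Tulcea.C (chain_kernel S Q x) (\<lambda>_. S) 0 m (\<lambda>_. undefined)"
proof -
  interpret IT: Ionescu_Tulcea "chain_kernel S Q x" "\<lambda>_. S"
    using kernel x by (rule Ionescu_Tulcea_chain)
  have "IT.up_to {0..<m} = m"
    unfolding IT.up_to_def by (rule Least_equality) (auto simp: not_le[symmetric])
  then have "IT.CI {0..<m} = distr (IT.C 0 m (\<lambda>_. undefined)) (PiM {0..<m} (\<lambda>_. S)) (\<lambda>f. restrict f {0..<m})"
    by (simp add: IT.CI_def)
  also have "\<dots> = distr (IT.C 0 m (\<lambda>_. undefined)) (IT.C 0 m (\<lambda>_. undefined)) (\<lambda>f. f)"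
    using IT.sets_C[of "\<lambda>_. undefined" 0 m] IT.space_C[of "\<lambda>_. undefined" 0 m]
    by (intro distr_cong) (auto simp: space_PiM)
  finally show ?thesis
    using distr_chain_law_restrict[OF kernel x, of "{0..<m}"] by (simp add: distr_id)
qed

lemma law_initial:
  assumes x: "x \<in> space S" and u[measurable]: "u \<in> borel_measurable S"
  shows "(\<integral>\<^sup>+\<omega>. u (\<omega> 0) \<partial>law x) = u x"
proof -
  interpret IT: Ionescu_Tulcea "chain_kernel S Q x" "\<lambda>_. S"
    using kernel x by (rule Ionescu_Tulcea_chain)
  have u0[measurable]: "(\<lambda>\<omega>. u (\<omega> 0)) \<in> borel_measurable (PiM {0..<Suc 0} (\<lambda>_. S))" by measurable
  have eP0: "IT.eP 0 \<in> return (PiM {0..<0} (\<lambda>_. S)) (\<lambda>_. undefined) \<rightarrow>\<^sub>M subprob_algebra (PiM {0..<Suc 0} (\<lambda>_. S))"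
    using IT.measurable_eP[of 0] unfolding measurable_cong_sets[OF sets_return refl] .
  have "(\<integral>\<^sup>+\<omega>. u (\<omega> 0) \<partial>law x)
      = (\<integral>\<^sup>+\<omega>. u (\<omega> 0) \<partial>distr (law x) (PiM {0..<Suc 0} (\<lambda>_. S)) (\<lambda>\<omega>. restrict \<omega> {0..<Suc 0}))"
    by (subst nn_integral_distr) (auto simp: measurable_law[OF x] intro!: measurable_restrict)
  also have "\<dots> = (\<integral>\<^sup>+\<omega>. \<integral>\<^sup>+\<omega>'. u (\<omega>' 0) \<partial>IT.eP 0 \<omega> \<partial>IT.C 0 0 (\<lambda>_. undefined))"
    unfolding law_restrict[OF x]
    unfolding IT.C.simps add_0 by (rule nn_integral_bind[OF u0 eP0])
  also have "\<dots> = (\<integral>\<^sup>+\<omega>'. u (\<omega>' 0) \<partial>IT.eP 0 (\<lambda>_. undefined))"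
    unfolding IT.C.simps
    using measurable_compose[OF IT.measurable_eP[of 0] nn_integral_measurable_subprob_algebra[OF u0]]
    by (intro nn_integral_return) (auto simp: space_PiM)
  also have "\<dots> = (\<integral>\<^sup>+y. u y \<partial>return S x)"
    by (subst IT.nn_integral_eP) (auto simp: chain_kernel_def)
  also have "\<dots> = u x" using x by (simp add: nn_integral_return)
  finally show ?thesis .
qed

text \<open>The Markov property in the form in which it is used throughout: the coordinate \<open>n + 1\<close> may be
  integrated out against the kernel at the coordinate \<open>n\<close>.\<close>

lemma law_step:
  assumes x: "x \<in> space S" and G[measurable]: "G \<in> borel_measurable paths"
    and det: "determined_by (Suc n) G"
  shows "(\<integral>\<^sup>+\<omega>. G \<omega> \<partial>law x) = (\<integral>\<^sup>+\<omega>. \<integral>\<^sup>+y. G (fun_upd \<omega> (Suc n) y) \<partial>Q (\<omega> n) \<partial>law x)"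
proof -
  interpret IT: Ionescu_Tulcea "chain_kernel S Q x" "\<lambda>_. S"
    using kernel x by (rule Ionescu_Tulcea_chain)
  let ?PM = "\<lambda>m. PiM {0..<m} (\<lambda>_::nat. S)"
  let ?C = "\<lambda>m. IT.C 0 m (\<lambda>_. undefined)"
  define ext where "ext m \<omega> = (\<lambda>i. if i < m then \<omega> i else x)" for m :: nat and \<omega> :: "nat \<Rightarrow> 'a"
  have ext_meas[measurable]: "ext m \<in> ?PM m \<rightarrow>\<^sub>M paths" for m
  proof (rule measurable_PiM_single')
    show "(\<lambda>\<omega>. ext m \<omega> i) \<in> ?PM m \<rightarrow>\<^sub>M S" for i
      using x by (cases "i < m") (auto simp: ext_def)
  qed (use x in \<open>auto simp: space_PiM ext_def PiE_iff\<close>)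
  define H where "H \<omega> = G (ext (Suc (Suc n)) \<omega>)" for \<omega>
  have H_meas[measurable]: "H \<in> borel_measurable (?PM (Suc (Suc n)))" unfolding H_def by measurable
  define K where "K \<omega> = (\<integral>\<^sup>+y. H (fun_upd \<omega> (Suc n) y) \<partial>Q (\<omega> n))" for \<omega>
  have res: "(\<lambda>\<omega>. restrict \<omega> {0..<m}) \<in> law x \<rightarrow>\<^sub>M ?PM m" for m
    by (auto simp: measurable_law[OF x] intro!: measurable_restrict)
  have K_meas: "K \<in> borel_measurable (?PM (Suc n))"
    unfolding K_def
  proof (rule nn_integral_measurable_subprob_algebra2[where N=S])
    have "(\<lambda>(\<omega>, y). fun_upd \<omega> (Suc n) y) \<in> ?PM (Suc n) \<Otimes>\<^sub>M S \<rightarrow>\<^sub>M ?PM (Suc (Suc n))"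
      unfolding split_beta' by (rule measurable_fun_upd[where J="{0..<Suc n}"]) auto
    from measurable_compose[OF this H_meas]
    show "(\<lambda>(\<omega>, y). H (fun_upd \<omega> (Suc n) y)) \<in> borel_measurable (?PM (Suc n) \<Otimes>\<^sub>M S)"
      by (simp add: split_beta')
    show "(\<lambda>\<omega>. Q (\<omega> n)) \<in> ?PM (Suc n) \<rightarrow>\<^sub>M subprob_algebra S" by measurable
  qed
  have "(\<integral>\<^sup>+\<omega>. G \<omega> \<partial>law x) = (\<integral>\<^sup>+\<omega>. H (restrict \<omega> {0..<Suc (Suc n)}) \<partial>law x)"
    unfolding H_def by (intro nn_integral_cong determined_byD[OF det]) (auto simp: ext_def)
  also have "\<dots> = (\<integral>\<^sup>+\<omega>. H \<omega> \<partial>?C (Suc (Suc n)))"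
    unfolding law_restrict[OF x, symmetric] using res by (subst nn_integral_distr) auto
  also have "\<dots> = (\<integral>\<^sup>+\<omega>. \<integral>\<^sup>+\<omega>'. H \<omega>' \<partial>IT.eP (Suc n) \<omega> \<partial>?C (Suc n))"
    unfolding IT.C.simps(2)[of 0 "Suc n"]
    using IT.measurable_eP[of "Suc n"] IT.sets_C[of "\<lambda>_. undefined" 0 "Suc n"]
    by (subst nn_integral_bind[where B="?PM (Suc (Suc n))"])
       (auto simp: measurable_cong_sets[OF IT.sets_C] simp del: IT.C.simps)
  also have "\<dots> = (\<integral>\<^sup>+\<omega>. K \<omega> \<partial>?C (Suc n))"
    using IT.space_C[of "\<lambda>_. undefined" 0 "Suc n"]
    by (intro nn_integral_cong) (auto simp: IT.nn_integral_eP K_def chain_kernel_def simp del: IT.C.simps)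
  also have "\<dots> = (\<integral>\<^sup>+\<omega>. K (restrict \<omega> {0..<Suc n}) \<partial>law x)"
    unfolding law_restrict[OF x, symmetric] using res K_meas by (subst nn_integral_distr) auto
  also have "\<dots> = (\<integral>\<^sup>+\<omega>. \<integral>\<^sup>+y. G (fun_upd \<omega> (Suc n) y) \<partial>Q (\<omega> n) \<partial>law x)"
  proof (rule nn_integral_cong)
    fix \<omega>
    have "H ((restrict \<omega> {0..<Suc n})(Suc n := y)) = G (fun_upd \<omega> (Suc n) y)" for y
      unfolding H_def by (intro determined_byD[OF det]) (auto simp: ext_def)
    then show "K (restrict \<omega> {0..<Suc n}) = (\<integral>\<^sup>+y. G (fun_upd \<omega> (Suc n) y) \<partial>Q (\<omega> n))"
      by (simp add: K_def)
  qed
  finally show ?thesis .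
qed

lemma integral_step_measurable:
  fixes G :: "(nat \<Rightarrow> 'a) \<Rightarrow> real"
  assumes [measurable]: "G \<in> borel_measurable paths"
  shows "(\<lambda>\<omega>. \<integral>y. G (fun_upd \<omega> (Suc n) y) \<partial>Q (\<omega> n)) \<in> borel_measurable paths"
proof (rule integral_measurable_subprob_algebra2[where N=S])
  show "(\<lambda>(\<omega>, y). G (fun_upd \<omega> (Suc n) y)) \<in> borel_measurable (paths \<Otimes>\<^sub>M S)"
    using measurable_compose[OF path_update_measurable2 assms, of "Suc n"] by (simp add: split_beta')
qed measurable

text \<open>Adding a bound of \<open>\<bar>G\<bar>\<close> to \<open>G\<close> reduces this to nonnegative integrands.\<close>

lemma law_step_real:
  fixes G :: "(nat \<Rightarrow> 'a) \<Rightarrow> real"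
  assumes x: "x \<in> space S" and G[measurable]: "G \<in> borel_measurable paths"
    and det: "determined_by (Suc n) G" and bdd: "\<And>\<omega>. \<bar>G \<omega>\<bar> \<le> B"
  shows "(\<integral>\<omega>. G \<omega> \<partial>law x) = (\<integral>\<omega>. (\<integral>y. G (fun_upd \<omega> (Suc n) y) \<partial>Q (\<omega> n)) \<partial>law x)"
proof -
  interpret L: prob_space "law x" using x by (rule prob_space_law)
  have nonneg: "0 \<le> G \<omega> + B" for \<omega> using bdd[of \<omega>] by linarith
  have B: "B \<ge> 0" using bdd[of undefined] by linarith
  let ?R = "\<lambda>\<omega>. \<integral>y. G (fun_upd \<omega> (Suc n) y) \<partial>Q (\<omega> n)"
  have inner: "(\<integral>\<^sup>+y. ennreal (G (fun_upd \<omega> (Suc n) y) + B) \<partial>Q (\<omega> n)) = ennreal (?R \<omega> + B)"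
    and R_bdd: "\<bar>?R \<omega>\<bar> \<le> B"
    if \<omega>: "\<omega> \<in> space paths" for \<omega>
  proof -
    interpret K: prob_space "Q (\<omega> n)" using path_in_space[OF \<omega>] by (rule prob_space_kernel)
    have m: "(\<lambda>y. G (fun_upd \<omega> (Suc n) y)) \<in> borel_measurable (Q (\<omega> n))"
      using measurable_compose[OF path_update_measurable[OF \<omega>] G] sets_kernel[OF path_in_space[OF \<omega>]]
      by (simp cong: measurable_cong_sets)
    have i: "integrable (Q (\<omega> n)) (\<lambda>y. G (fun_upd \<omega> (Suc n) y))"
      by (rule K.integrable_const_bound[OF _ m, where B=B]) (use bdd in auto)
    show "(\<integral>\<^sup>+y. ennreal (G (fun_upd \<omega> (Suc n) y) + B) \<partial>Q (\<omega> n)) = ennreal (?R \<omega> + B)"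
      using i nonneg by (subst nn_integral_eq_integral) (auto simp: K.prob_space)
    have "\<bar>?R \<omega>\<bar> \<le> (\<integral>y. B \<partial>Q (\<omega> n))"
      using i bdd by (intro order_trans[OF integral_abs_bound] integral_mono) auto
    then show "\<bar>?R \<omega>\<bar> \<le> B" by (simp add: K.prob_space)
  qed
  have m: "G \<in> borel_measurable (law x)" "?R \<in> borel_measurable (law x)"
    using integral_step_measurable[OF G] by (auto simp: measurable_law[OF x])
  have i: "integrable (law x) G" "integrable (law x) ?R"
    using bdd R_bdd by (auto intro!: L.integrable_const_bound[where B=B] m AE_I2 simp: space_law[OF x])
  have "ennreal (\<integral>\<omega>. G \<omega> + B \<partial>law x) = (\<integral>\<^sup>+\<omega>. ennreal (G \<omega> + B) \<partial>law x)"
    using i nonneg by (subst nn_integral_eq_integral) auto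
  also have "\<dots> = (\<integral>\<^sup>+\<omega>. \<integral>\<^sup>+y. ennreal (G (fun_upd \<omega> (Suc n) y) + B) \<partial>Q (\<omega> n) \<partial>law x)"
    by (intro law_step[OF x] determined_by_comp[OF det]) auto
  also have "\<dots> = (\<integral>\<^sup>+\<omega>. ennreal (?R \<omega> + B) \<partial>law x)"
    by (intro nn_integral_cong inner) (simp add: space_law[OF x])
  also have "\<dots> = ennreal (\<integral>\<omega>. ?R \<omega> + B \<partial>law x)"
    using i R_bdd by (subst nn_integral_eq_integral) (fastforce intro!: AE_I2 simp: space_law[OF x] abs_le_iff)+
  finally have "(\<integral>\<omega>. G \<omega> + B \<partial>law x) = (\<integral>\<omega>. ?R \<omega> + B \<partial>law x)"
    using nonneg R_bdd
    by (subst (asm) ennreal_inj) (fastforce intro!: integral_nonneg_AE AE_I2 simp: space_law[OF x] abs_le_iff)+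
  then show ?thesis using i by (simp add: L.prob_space)
qed

lemma law_step_complex:
  fixes G :: "(nat \<Rightarrow> 'a) \<Rightarrow> complex"
  assumes x: "x \<in> space S" and G[measurable]: "G \<in> borel_measurable paths"
    and det: "determined_by (Suc n) G" and bdd: "\<And>\<omega>. norm (G \<omega>) \<le> B"
  shows "(\<integral>\<omega>. G \<omega> \<partial>law x) = (\<integral>\<omega>. (\<integral>y. G (fun_upd \<omega> (Suc n) y) \<partial>Q (\<omega> n)) \<partial>law x)"
    and "integrable (law x) (\<lambda>\<omega>. \<integral>y. G (fun_upd \<omega> (Suc n) y) \<partial>Q (\<omega> n))"
proof -
  interpret L: prob_space "law x" using x by (rule prob_space_law)
  have inner: "integrable (Q (\<omega> n)) (\<lambda>y. G (fun_upd \<omega> (Suc n) y))" if \<omega>: "\<omega> \<in> space paths" for \<omega>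
  proof -
    interpret K: prob_space "Q (\<omega> n)" using path_in_space[OF \<omega>] by (rule prob_space_kernel)
    have m: "(\<lambda>y. G (fun_upd \<omega> (Suc n) y)) \<in> borel_measurable (Q (\<omega> n))"
      using measurable_compose[OF path_update_measurable[OF \<omega>] G] sets_kernel[OF path_in_space[OF \<omega>]]
      by (simp cong: measurable_cong_sets)
    show ?thesis by (rule K.integrable_const_bound[OF _ m, where B=B]) (use bdd in auto)
  qed
  let ?R = "\<lambda>\<omega>. \<integral>y. G (fun_upd \<omega> (Suc n) y) \<partial>Q (\<omega> n)"
  have ReIm: "Re (?R \<omega>) = (\<integral>y. Re (G (fun_upd \<omega> (Suc n) y)) \<partial>Q (\<omega> n))"
    "Im (?R \<omega>) = (\<integral>y. Im (G (fun_upd \<omega> (Suc n) y)) \<partial>Q (\<omega> n))" if "\<omega> \<in> space paths" for \<omega>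
    using inner[OF that] by simp_all
  have B0: "0 \<le> B" using bdd[of undefined] norm_ge_zero order_trans by blast
  have bR: "\<bar>\<integral>y. v (G (fun_upd \<omega> (Suc n) y)) \<partial>Q (\<omega> n)\<bar> \<le> B"
    if v: "v = Re \<or> v = Im" and \<omega>: "\<omega> \<in> space paths" for v \<omega>
  proof -
    interpret K: prob_space "Q (\<omega> n)" using path_in_space[OF \<omega>] by (rule prob_space_kernel)
    have "\<bar>v (G \<omega>')\<bar> \<le> B" for \<omega>'
      using v bdd[of \<omega>'] abs_Re_le_cmod[of "G \<omega>'"] abs_Im_le_cmod[of "G \<omega>'"] by auto
    then have "\<bar>\<integral>y. v (G (fun_upd \<omega> (Suc n) y)) \<partial>Q (\<omega> n)\<bar> \<le> (\<integral>y. B \<partial>Q (\<omega> n))"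
      using v inner[OF \<omega>] by (intro order_trans[OF integral_abs_bound] integral_mono) auto
    then show ?thesis by (simp add: K.prob_space)
  qed
  have iv: "integrable (law x) (\<lambda>\<omega>. \<integral>y. v (G (fun_upd \<omega> (Suc n) y)) \<partial>Q (\<omega> n))" if v: "v = Re \<or> v = Im" for v
    using bR[OF v] integral_step_measurable[of "\<lambda>\<omega>. v (G \<omega>)" n] v
    by (intro L.integrable_const_bound[where B=B]) (auto simp: measurable_law[OF x] space_law[OF x])
  have "integrable (law x) (\<lambda>\<omega>. complex_of_real (\<integral>y. Re (G (fun_upd \<omega> (Suc n) y)) \<partial>Q (\<omega> n))
      + \<i> * complex_of_real (\<integral>y. Im (G (fun_upd \<omega> (Suc n) y)) \<partial>Q (\<omega> n)))"
    using iv[of Re] iv[of Im] by (intro Bochner_Integration.integrable_add integrable_mult_right) auto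
  then show R: "integrable (law x) ?R"
    by (rule Bochner_Integration.integrable_cong[THEN iffD1, rotated -1])
       (auto simp: space_law[OF x] complex_eq_iff ReIm)
  have G_int: "integrable (law x) G"
    using bdd by (intro L.integrable_const_bound[where B=B]) (auto simp: measurable_law[OF x])
  have v: "(\<integral>\<omega>. v (G \<omega>) \<partial>law x) = (\<integral>\<omega>. (\<integral>y. v (G (fun_upd \<omega> (Suc n) y)) \<partial>Q (\<omega> n)) \<partial>law x)"
    if v: "v = Re \<or> v = Im" for v
  proof (rule law_step_real[OF x, where B=B])
    show "\<bar>v (G \<omega>')\<bar> \<le> B" for \<omega>'
      using v bdd[of \<omega>'] abs_Re_le_cmod[of "G \<omega>'"] abs_Im_le_cmod[of "G \<omega>'"] by auto
    show "(\<lambda>\<omega>. v (G \<omega>)) \<in> borel_measurable paths" using v by auto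
    show "determined_by (Suc n) (\<lambda>\<omega>. v (G \<omega>))" using det by (rule determined_by_comp)
  qed
  show "(\<integral>\<omega>. G \<omega> \<partial>law x) = (\<integral>\<omega>. ?R \<omega> \<partial>law x)"
  proof (rule complex_eqI)
    have "Re (\<integral>\<omega>. ?R \<omega> \<partial>law x) = (\<integral>\<omega>. Re (?R \<omega>) \<partial>law x)" using R by simp
    also have "\<dots> = (\<integral>\<omega>. (\<integral>y. Re (G (fun_upd \<omega> (Suc n) y)) \<partial>Q (\<omega> n)) \<partial>law x)"
      by (intro Bochner_Integration.integral_cong refl ReIm) (simp add: space_law[OF x])
    finally show "Re (\<integral>\<omega>. G \<omega> \<partial>law x) = Re (\<integral>\<omega>. ?R \<omega> \<partial>law x)" using v[of Re] G_int by simp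
    have "Im (\<integral>\<omega>. ?R \<omega> \<partial>law x) = (\<integral>\<omega>. Im (?R \<omega>) \<partial>law x)" using R by simp
    also have "\<dots> = (\<integral>\<omega>. (\<integral>y. Im (G (fun_upd \<omega> (Suc n) y)) \<partial>Q (\<omega> n)) \<partial>law x)"
      by (intro Bochner_Integration.integral_cong refl ReIm) (simp add: space_law[OF x])
    finally show "Im (\<integral>\<omega>. G \<omega> \<partial>law x) = Im (\<integral>\<omega>. ?R \<omega> \<partial>law x)" using v[of Im] G_int by simp
  qed
qed

lemma kernel_step_test_measurable:
  assumes [measurable]: "A \<in> sets S" "u \<in> borel_measurable S"
  shows "(\<lambda>z. indicator A z * (\<integral>\<^sup>+y. u y \<partial>Q z)) \<in> borel_measurable S"
  by measurable

text \<open>One step of the recursion that determines the law on cylinders; the stationary law obeys the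
  same recursion.\<close>

lemma law_cylinder_Suc:
  assumes x: "x \<in> space S" and A: "\<And>i. i \<le> n \<Longrightarrow> A i \<in> sets S" and u[measurable]: "u \<in> borel_measurable S"
  shows "(\<integral>\<^sup>+\<omega>. cylinder_test (Suc n) A u \<omega> \<partial>law x)
    = (\<integral>\<^sup>+\<omega>. cylinder_test n A (\<lambda>z. indicator (A n) z * (\<integral>\<^sup>+y. u y \<partial>Q z)) \<omega> \<partial>law x)"
proof -
  have "(\<integral>\<^sup>+\<omega>. cylinder_test (Suc n) A u \<omega> \<partial>law x)
      = (\<integral>\<^sup>+\<omega>. \<integral>\<^sup>+y. cylinder_test (Suc n) A u (fun_upd \<omega> (Suc n) y) \<partial>Q (\<omega> n) \<partial>law x)"
    using A by (intro law_step[OF x] cylinder_test_measurable)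
      (auto simp: determined_by_def cylinder_test_def intro!: arg_cong2[where f="(*)"] prod.cong)
  also have "\<dots> = (\<integral>\<^sup>+\<omega>. cylinder_test n A (\<lambda>z. indicator (A n) z * (\<integral>\<^sup>+y. u y \<partial>Q z)) \<omega> \<partial>law x)"
  proof (rule nn_integral_cong)
    fix \<omega> assume "\<omega> \<in> space (law x)"
    then have \<omega>: "\<omega> n \<in> space S" using path_in_space by (simp add: space_law[OF x])
    have "u \<in> borel_measurable (Q (\<omega> n))" using sets_kernel[OF \<omega>] by (simp cong: measurable_cong_sets)
    then show "(\<integral>\<^sup>+y. cylinder_test (Suc n) A u (fun_upd \<omega> (Suc n) y) \<partial>Q (\<omega> n))
        = cylinder_test n A (\<lambda>z. indicator (A n) z * (\<integral>\<^sup>+y. u y \<partial>Q z)) \<omega>"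
      by (simp add: cylinder_test_def nn_integral_cmult mult.assoc)
  qed
  finally show ?thesis .
qed

lemma law_cylinder_measurable:
  assumes "\<And>i. i < n \<Longrightarrow> A i \<in> sets S" "u \<in> borel_measurable S"
  shows "(\<lambda>x. \<integral>\<^sup>+\<omega>. cylinder_test n A u \<omega> \<partial>law x) \<in> borel_measurable S"
  using assms
proof (induct n arbitrary: u)
  case 0
  then show ?case
    by (subst measurable_cong[where g=u]) (auto simp: cylinder_test_def[abs_def] law_initial)
next
  case (Suc n)
  have "(\<lambda>z. indicator (A n) z * (\<integral>\<^sup>+y. u y \<partial>Q z)) \<in> borel_measurable S"
    using Suc(2)[of n] Suc(3) by (intro kernel_step_test_measurable) auto
  from Suc(1)[OF _ this] Suc(2) show ?case
    by (subst measurable_cong[OF law_cylinder_Suc]) (use Suc(3) in auto)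
qed

lemma law_measurable: "law \<in> S \<rightarrow>\<^sub>M prob_algebra paths"
proof (rule measurable_prob_algebra_generated[OF sets_PiM Int_stable_prod_algebra prod_algebra_sets_into_space])
  fix A assume "A \<in> prod_algebra UNIV (\<lambda>_::nat. S)"
  then obtain J X where J: "A = prod_emb UNIV (\<lambda>_. S) J (Pi\<^sub>E J X)" "finite J" "\<And>i. i \<in> J \<Longrightarrow> X i \<in> sets S"
    by (rule prod_algebraE) auto
  have "\<exists>n A'. (\<forall>i. A' i \<in> sets S) \<and> (\<forall>\<omega>\<in>space paths.
      indicator A \<omega> = cylinder_test n A' (indicator (A' n)) \<omega>)"
    unfolding J(1) by (rule emb_eq_cylinder) (use J(2,3) in auto)
  then obtain n A' where A'0: "(\<forall>i. A' i \<in> sets S) \<and> (\<forall>\<omega>\<in>space paths.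
      indicator A \<omega> = cylinder_test n A' (indicator (A' n)) \<omega>)"
    by (elim exE) (rule that)
  then have A': "\<And>i. A' i \<in> sets S"
    "\<And>\<omega>. \<omega> \<in> space paths \<Longrightarrow> indicator A \<omega> = cylinder_test n A' (indicator (A' n)) \<omega>"
    by (simp_all only: conjunct1[OF A'0] conjunct2[OF A'0, rule_format])
  have A_sets: "A \<in> sets paths" unfolding J(1) using J(2,3) by (intro sets_PiM_I) auto
  have "emeasure (law x) A = (\<integral>\<^sup>+\<omega>. cylinder_test n A' (indicator (A' n)) \<omega> \<partial>law x)" if x: "x \<in> space S" for x
  proof -
    have "emeasure (law x) A = (\<integral>\<^sup>+\<omega>. indicator A \<omega> \<partial>law x)"
      using A_sets by (simp add: sets_law[OF x])
    also have "\<dots> = (\<integral>\<^sup>+\<omega>. cylinder_test n A' (indicator (A' n)) \<omega> \<partial>law x)"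
      by (intro nn_integral_cong A'(2)) (simp add: space_law[OF x])
    finally show ?thesis .
  qed
  then show "(\<lambda>x. emeasure (law x) A) \<in> borel_measurable S"
    by (subst measurable_cong) (use A'(1) in \<open>auto intro!: law_cylinder_measurable\<close>)
qed (auto simp: prob_space_law sets_law)

end

section \<open>The stationary chain and the chains started at points\<close>

definition future :: "(int \<Rightarrow> 'a) \<Rightarrow> nat \<Rightarrow> 'a" where
  "future \<omega> n = \<omega> (int n)"

context stationary_ergodic_markov_chain
begin

sublocale K: markov_kernel S Q
  by standard (rule kernel)

lemma space_P: "space P = space (PiM UNIV (\<lambda>_. S))"
  using sets_law by (rule sets_eq_imp_space_eq)

lemma coordinate_measurable[measurable]: "(\<lambda>\<omega>. \<omega> i) \<in> P \<rightarrow>\<^sub>M S"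
  unfolding measurable_cong_sets[OF sets_law refl] by measurable

lemma coordinate_in_space: "\<omega> \<in> space P \<Longrightarrow> \<omega> i \<in> space S"
  using coordinate_measurable by (rule measurable_space)

lemma future_measurable[measurable]: "future \<in> P \<rightarrow>\<^sub>M K.paths"
  unfolding future_def[abs_def]
  by (rule measurable_PiM_single') (auto dest: coordinate_in_space)

lemma shift_measurable[measurable]: "shift \<in> P \<rightarrow>\<^sub>M P"
  unfolding measurable_cong_sets[OF refl sets_law] shift_def[abs_def]
  by (rule measurable_PiM_single') (auto dest: coordinate_in_space)

lemma sets_\<pi>[measurable_cong]: "sets \<pi> = sets S"
  by (simp add: marginal)

lemma space_\<pi>: "space \<pi> = space S"
  by (simp add: marginal)

lemma measurable_\<pi>: "measurable \<pi> N = measurable S N"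
  using sets_\<pi> by (rule measurable_cong_sets) simp

lemma prob_space_\<pi>: "prob_space \<pi>"
  unfolding marginal by (rule prob_space_distr) measurable

lemma nn_integral_\<pi>: "u \<in> borel_measurable S \<Longrightarrow> (\<integral>\<^sup>+x. u x \<partial>\<pi>) = (\<integral>\<^sup>+\<omega>. u (\<omega> 0) \<partial>P)"
  unfolding marginal by (rule nn_integral_distr) auto

lemma past_subalgebra: "subalgebra P (past S n)"
  unfolding subalgebra_def
proof
  show "space (past S n) = space P" by (simp add: past_def space_P)
  show "sets (past S n) \<subseteq> sets P"
    unfolding past_def space_P[symmetric]
    by (rule sets_image_in_sets) (auto intro!: measurable_restrict)
qed

text \<open>The defining property of the conditional expectation, tested on an event \<open>B\<close> of the past.\<close>

lemma stationary_step_event: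
  assumes A: "\<And>i. i \<le> n \<Longrightarrow> A i \<in> sets S" and C: "C \<in> sets S"
  defines "B \<equiv> {\<omega> \<in> space P. \<forall>i\<le>n. \<omega> (int i) \<in> A i}"
  shows "B \<in> sets P"
    and "(\<integral>\<^sup>+\<omega>. indicator B \<omega> * indicator C (\<omega> (int n + 1)) \<partial>P)
      = (\<integral>\<^sup>+\<omega>. indicator B \<omega> * emeasure (Q (\<omega> (int n))) C \<partial>P)"
proof -
  interpret F: finite_measure_subalgebra P "past S (int n)"
    by standard (rule past_subalgebra)
  define B' where "B' = {\<omega> \<in> space (PiM {..int n} (\<lambda>_. S)). \<forall>i\<in>{..n}. \<omega> (int i) \<in> A i}"
  have "B' \<in> sets (PiM {..int n} (\<lambda>_. S))"
    unfolding B'_def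
  proof (rule sets.sets_Collect_finite_All)
    fix i assume "i \<in> {..n}"
    then have "(\<lambda>\<omega>. \<omega> (int i)) \<in> PiM {..int n} (\<lambda>_. S) \<rightarrow>\<^sub>M S" "A i \<in> sets S"
      using A by (auto intro!: measurable_component_singleton)
    then show "{\<omega> \<in> space (PiM {..int n} (\<lambda>_. S)). \<omega> (int i) \<in> A i} \<in> sets (PiM {..int n} (\<lambda>_. S))"
      by measurable
  qed auto
  moreover have "B = (\<lambda>\<omega>. restrict \<omega> {..int n}) -` B' \<inter> space P"
    by (auto simp: B_def B'_def space_PiM space_P)
  ultimately have B: "B \<in> sets (past S (int n))"
    unfolding past_def space_P[symmetric] by (simp add: in_vimage_algebra)
  then show BP[measurable]: "B \<in> sets P" using past_subalgebra by (auto simp: subalgebra_def)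
  note [measurable] = C
  define I :: "_ \<Rightarrow> real" where "I = indicator {\<omega> \<in> space P. \<omega> (int n + 1) \<in> C}"
  have int: "integrable P I"
    unfolding I_def by (rule integrable_real_indicator) (auto simp: emeasure_eq_measure)
  have prob_Q: "prob_space (Q (\<omega> (int n)))" if "\<omega> \<in> space P" for \<omega>
    using that by (intro K.prob_space_kernel coordinate_in_space)
  have "(\<integral>\<^sup>+\<omega>. indicator B \<omega> * indicator C (\<omega> (int n + 1)) \<partial>P) = (\<integral>\<^sup>+\<omega>. ennreal (indicator B \<omega> * I \<omega>) \<partial>P)"
    by (intro nn_integral_cong) (auto simp: I_def split: split_indicator)
  also have "\<dots> = ennreal (\<integral>\<omega>. indicator B \<omega> * I \<omega> \<partial>P)"
    using integrable_mult_indicator[OF BP int]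
    by (intro nn_integral_eq_integral) (auto simp: I_def)
  also have "(\<integral>\<omega>. indicator B \<omega> * I \<omega> \<partial>P) = (\<integral>\<omega>. indicator B \<omega> * real_cond_exp P (past S (int n)) I \<omega> \<partial>P)"
    using F.real_cond_exp_intA[OF int B] by (simp add: set_lebesgue_integral_def)
  also have "\<dots> = (\<integral>\<omega>. indicator B \<omega> * measure (Q (\<omega> (int n))) C \<partial>P)"
    unfolding I_def using markov[OF C, of "int n"] by (intro integral_cong_AE) auto
  also have "ennreal \<dots> = (\<integral>\<^sup>+\<omega>. ennreal (indicator B \<omega> * measure (Q (\<omega> (int n))) C) \<partial>P)"
  proof (rule nn_integral_eq_integral[symmetric])
    show "integrable P (\<lambda>\<omega>. indicator B \<omega> * measure (Q (\<omega> (int n))) C)"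
      using prob_Q by (intro integrable_const_bound[where B=1] AE_I2)
        (auto split: split_indicator intro: prob_space.prob_le_1)
  qed auto
  also have "\<dots> = (\<integral>\<^sup>+\<omega>. indicator B \<omega> * emeasure (Q (\<omega> (int n))) C \<partial>P)"
  proof (intro nn_integral_cong)
    fix \<omega> assume "\<omega> \<in> space P"
    then interpret Qn: prob_space "Q (\<omega> (int n))" by (rule prob_Q)
    show "ennreal (indicator B \<omega> * measure (Q (\<omega> (int n))) C) = indicator B \<omega> * emeasure (Q (\<omega> (int n))) C"
      by (auto simp: Qn.emeasure_eq_measure split: split_indicator)
  qed
  finally show "(\<integral>\<^sup>+\<omega>. indicator B \<omega> * indicator C (\<omega> (int n + 1)) \<partial>P)
      = (\<integral>\<^sup>+\<omega>. indicator B \<omega> * emeasure (Q (\<omega> (int n))) C \<partial>P)" .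
qed

text \<open>For fixed \<open>B\<close>, both sides are integrals of \<open>u\<close> against measures on \<open>S\<close>, which agree on events by the
  previous lemma.\<close>

lemma stationary_step:
  assumes A: "\<And>i. i \<le> n \<Longrightarrow> A i \<in> sets S" and u[measurable]: "u \<in> borel_measurable S"
  defines "B \<equiv> {\<omega> \<in> space P. \<forall>i\<le>n. \<omega> (int i) \<in> A i}"
  shows "(\<integral>\<^sup>+\<omega>. indicator B \<omega> * u (\<omega> (int n + 1)) \<partial>P)
    = (\<integral>\<^sup>+\<omega>. indicator B \<omega> * (\<integral>\<^sup>+y. u y \<partial>Q (\<omega> (int n))) \<partial>P)"
proof -
  have B[measurable]: "B \<in> sets P" unfolding B_def using A by (rule stationary_step_event(1)[OF _ sets.top])
  let ?D = "density P (indicator B)"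
  have Qn: "(\<lambda>\<omega>. Q (\<omega> (int n))) \<in> ?D \<rightarrow>\<^sub>M subprob_algebra S" by measurable
  have "distr ?D S (\<lambda>\<omega>. \<omega> (int n + 1)) = ?D \<bind> (\<lambda>\<omega>. Q (\<omega> (int n)))"
  proof (rule measure_eqI)
    have ne: "space ?D \<noteq> {}" using not_empty by simp
    show sets_eq: "sets (distr ?D S (\<lambda>\<omega>. \<omega> (int n + 1))) = sets (?D \<bind> (\<lambda>\<omega>. Q (\<omega> (int n))))"
      using sets_bind[of ?D "\<lambda>\<omega>. Q (\<omega> (int n))" S] ne coordinate_in_space K.sets_kernel by simp
    fix C assume "C \<in> sets (distr ?D S (\<lambda>\<omega>. \<omega> (int n + 1)))"
    then have C[measurable]: "C \<in> sets S" by simp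
    have "emeasure (distr ?D S (\<lambda>\<omega>. \<omega> (int n + 1))) C = (\<integral>\<^sup>+y. indicator C y \<partial>distr ?D S (\<lambda>\<omega>. \<omega> (int n + 1)))"
      by simp
    also have "\<dots> = (\<integral>\<^sup>+\<omega>. indicator B \<omega> * indicator C (\<omega> (int n + 1)) \<partial>P)"
      by (subst nn_integral_distr) (auto simp: nn_integral_density)
    also have "\<dots> = (\<integral>\<^sup>+\<omega>. indicator B \<omega> * emeasure (Q (\<omega> (int n))) C \<partial>P)"
      unfolding B_def using A C by (rule stationary_step_event(2))
    also have "\<dots> = emeasure (?D \<bind> (\<lambda>\<omega>. Q (\<omega> (int n)))) C"
      by (subst emeasure_bind[OF ne Qn C]) (auto simp: nn_integral_density)
    finally show "emeasure (distr ?D S (\<lambda>\<omega>. \<omega> (int n + 1))) C = emeasure (?D \<bind> (\<lambda>\<omega>. Q (\<omega> (int n)))) C" .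
  qed
  then have "(\<integral>\<^sup>+y. u y \<partial>distr ?D S (\<lambda>\<omega>. \<omega> (int n + 1))) = (\<integral>\<^sup>+y. u y \<partial>(?D \<bind> (\<lambda>\<omega>. Q (\<omega> (int n)))))"
    by simp
  moreover have "(\<integral>\<^sup>+y. u y \<partial>distr ?D S (\<lambda>\<omega>. \<omega> (int n + 1))) = (\<integral>\<^sup>+\<omega>. indicator B \<omega> * u (\<omega> (int n + 1)) \<partial>P)"
    by (subst nn_integral_distr) (auto simp: nn_integral_density)
  moreover have "(\<integral>\<^sup>+y. u y \<partial>(?D \<bind> (\<lambda>\<omega>. Q (\<omega> (int n)))))
      = (\<integral>\<^sup>+\<omega>. indicator B \<omega> * (\<integral>\<^sup>+y. u y \<partial>Q (\<omega> (int n))) \<partial>P)"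
    by (subst nn_integral_bind[OF u Qn]) (auto simp: nn_integral_density)
  ultimately show ?thesis by simp
qed

lemma cylinder_future:
  assumes \<omega>: "\<omega> \<in> space P"
  shows "cylinder_test (Suc n) A u (future \<omega>)
      = indicator {\<omega> \<in> space P. \<forall>i\<le>n. \<omega> (int i) \<in> A i} \<omega> * u (\<omega> (int n + 1))"
    and "cylinder_test n A (\<lambda>z. indicator (A n) z * u z) (future \<omega>)
      = indicator {\<omega> \<in> space P. \<forall>i\<le>n. \<omega> (int i) \<in> A i} \<omega> * u (\<omega> (int n))"
proof -
  have eq: "(\<Prod>i<Suc n. indicator (A i) (\<omega> (int i))) = (indicator {\<omega> \<in> space P. \<forall>i\<le>n. \<omega> (int i) \<in> A i} \<omega> :: ennreal)"
  proof (cases "\<forall>i\<le>n. \<omega> (int i) \<in> A i")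
    case True then show ?thesis using \<omega> by (auto intro!: prod.neutral)
  next
    case False
    then obtain i where i: "i \<le> n" "\<omega> (int i) \<notin> A i" by blast
    then have "(\<Prod>i<Suc n. indicator (A i) (\<omega> (int i))) = (0::ennreal)"
      by (intro prod_zero bexI[of _ i]) auto
    then show ?thesis using False by (auto split: split_indicator)
  qed
  show "cylinder_test (Suc n) A u (future \<omega>)
      = indicator {\<omega> \<in> space P. \<forall>i\<le>n. \<omega> (int i) \<in> A i} \<omega> * u (\<omega> (int n + 1))"
    unfolding eq[symmetric] by (simp add: cylinder_test_def future_def add.commute)
  show "cylinder_test n A (\<lambda>z. indicator (A n) z * u z) (future \<omega>)
      = indicator {\<omega> \<in> space P. \<forall>i\<le>n. \<omega> (int i) \<in> A i} \<omega> * u (\<omega> (int n))"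
    unfolding eq[symmetric] by (simp add: cylinder_test_def future_def mult.assoc)
qed

lemma stationary_cylinder:
  assumes "\<And>i. i < n \<Longrightarrow> A i \<in> sets S" "u \<in> borel_measurable S"
  shows "(\<integral>\<^sup>+\<omega>. cylinder_test n A u (future \<omega>) \<partial>P) = (\<integral>\<^sup>+x. \<integral>\<^sup>+\<omega>. cylinder_test n A u \<omega> \<partial>K.law x \<partial>\<pi>)"
  using assms
proof (induct n arbitrary: u)
  case 0
  have "(\<integral>\<^sup>+x. \<integral>\<^sup>+\<omega>. cylinder_test 0 A u \<omega> \<partial>K.law x \<partial>\<pi>) = (\<integral>\<^sup>+x. u x \<partial>\<pi>)"
    using 0 by (intro nn_integral_cong) (simp add: cylinder_test_def[abs_def] K.law_initial space_\<pi>)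
  then show ?case using 0 by (simp add: nn_integral_\<pi> cylinder_test_def[abs_def] future_def)
next
  case (Suc n)
  let ?v = "\<lambda>z. indicator (A n) z * (\<integral>\<^sup>+y. u y \<partial>Q z)"
  have v: "?v \<in> borel_measurable S"
    using Suc(2)[of n] Suc(3) by (intro K.kernel_step_test_measurable) auto
  have "(\<integral>\<^sup>+\<omega>. cylinder_test (Suc n) A u (future \<omega>) \<partial>P) = (\<integral>\<^sup>+\<omega>. cylinder_test n A ?v (future \<omega>) \<partial>P)"
    using stationary_step[of n A u] Suc(2,3)
    by (simp add: cylinder_future(1) cylinder_future(2)[where u="\<lambda>z. \<integral>\<^sup>+y. u y \<partial>Q z"] cong: nn_integral_cong)
  also have "\<dots> = (\<integral>\<^sup>+x. \<integral>\<^sup>+\<omega>. cylinder_test n A ?v \<omega> \<partial>K.law x \<partial>\<pi>)"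
    using Suc(2) v by (intro Suc(1)) auto
  also have "\<dots> = (\<integral>\<^sup>+x. \<integral>\<^sup>+\<omega>. cylinder_test (Suc n) A u \<omega> \<partial>K.law x \<partial>\<pi>)"
    using Suc(2,3) by (intro nn_integral_cong K.law_cylinder_Suc[symmetric]) (auto simp: space_\<pi>)
  finally show ?case .
qed

text \<open>The disintegration of the stationary law over the starting point: both sides give the same
  integrals to cylinder tests, since they have the same initial law and the same one-step recursion.\<close>

lemma future_law: "distr P K.paths future = \<pi> \<bind> K.law"
proof (rule measure_eqI_PiM_infinite)
  have law[measurable]: "K.law \<in> \<pi> \<rightarrow>\<^sub>M subprob_algebra K.paths"
    using measurable_prob_algebraD[OF K.law_measurable] by (simp add: measurable_\<pi>)
  have ne: "space \<pi> \<noteq> {}" using prob_space.not_empty[OF prob_space_\<pi>] .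
  show "sets (\<pi> \<bind> K.law) = sets K.paths"
    using ne by (intro sets_bind) (auto simp: space_\<pi> K.sets_law)
  show "finite_measure (distr P K.paths future)"
    by (intro finite_measure_distr) auto
  fix X and J :: "nat set" assume J: "finite J" "\<And>i. i \<in> J \<Longrightarrow> X i \<in> sets S"
  let ?E = "prod_emb UNIV (\<lambda>_. S) J (Pi\<^sub>E J X)"
  have "\<exists>n A'. (\<forall>i. A' i \<in> sets S) \<and> (\<forall>\<omega>\<in>space K.paths.
      indicator ?E \<omega> = cylinder_test n A' (indicator (A' n)) \<omega>)"
    by (rule emb_eq_cylinder) (use J in auto)
  then obtain n A' where A'0: "(\<forall>i. A' i \<in> sets S) \<and> (\<forall>\<omega>\<in>space K.paths.
      indicator ?E \<omega> = cylinder_test n A' (indicator (A' n)) \<omega>)"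
    by (elim exE) (rule that)
  then have A': "\<And>i. A' i \<in> sets S"
    "\<And>\<omega>. \<omega> \<in> space K.paths \<Longrightarrow> indicator ?E \<omega> = cylinder_test n A' (indicator (A' n)) \<omega>"
    by (simp_all only: conjunct1[OF A'0] conjunct2[OF A'0, rule_format])
  have E[measurable]: "?E \<in> sets K.paths" using J by (intro sets_PiM_I) auto
  have "emeasure (distr P K.paths future) ?E = (\<integral>\<^sup>+\<omega>. indicator ?E \<omega> \<partial>distr P K.paths future)"
    by simp
  also have "\<dots> = (\<integral>\<^sup>+\<omega>. indicator ?E (future \<omega>) \<partial>P)" by (rule nn_integral_distr) auto
  also have "\<dots> = (\<integral>\<^sup>+\<omega>. cylinder_test n A' (indicator (A' n)) (future \<omega>) \<partial>P)"
    using measurable_space[OF future_measurable] by (intro nn_integral_cong A'(2)) auto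
  also have "\<dots> = (\<integral>\<^sup>+x. \<integral>\<^sup>+\<omega>. cylinder_test n A' (indicator (A' n)) \<omega> \<partial>K.law x \<partial>\<pi>)"
    using A'(1) by (intro stationary_cylinder) auto
  also have "\<dots> = (\<integral>\<^sup>+x. \<integral>\<^sup>+\<omega>. indicator ?E \<omega> \<partial>K.law x \<partial>\<pi>)"
    by (intro nn_integral_cong A'(2)[symmetric]) (auto simp: space_\<pi> K.space_law)
  also have "\<dots> = (\<integral>\<^sup>+x. emeasure (K.law x) ?E \<partial>\<pi>)"
    by (intro nn_integral_cong nn_integral_indicator) (use E in \<open>auto simp: space_\<pi> K.sets_law\<close>)
  also have "\<dots> = emeasure (\<pi> \<bind> K.law) ?E"
    by (rule emeasure_bind[OF ne law E, symmetric])
  finally show "emeasure (distr P K.paths future) ?E = emeasure (\<pi> \<bind> K.law) ?E" .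
qed simp

text \<open>This is how statements about the stationary chain become quenched statements.\<close>

lemma AE_law:
  assumes R: "Measurable.pred K.paths R" and AE: "AE \<omega> in P. R (future \<omega>)"
  shows "AE x in \<pi>. AE \<omega> in K.law x. R \<omega>"
proof -
  have law: "K.law \<in> \<pi> \<rightarrow>\<^sub>M subprob_algebra K.paths"
    using measurable_prob_algebraD[OF K.law_measurable] by (simp add: measurable_\<pi>)
  have "AE \<omega> in distr P K.paths future. R \<omega>"
    using AE R by (subst AE_distr_iff) (auto simp: pred_def)
  then show ?thesis unfolding future_law AE_bind[OF law R] .
qed

lemma AE_law_all_coordinates:
  assumes AE: "AE x in \<pi>. R x" and R[measurable]: "Measurable.pred S R"
  shows "AE x in \<pi>. AE \<omega> in K.law x. \<forall>n. R (\<omega> n)"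
proof (rule AE_law)
  have "AE \<omega> in P. R (\<omega> (int n))" for n
  proof (induct n)
    case 0
    then show ?case using AE unfolding marginal by (auto dest: AE_distrD[rotated])
  next
    case (Suc n)
    then have "AE \<omega> in distr P P shift. R (\<omega> (int n))" unfolding stationary .
    then have "AE \<omega> in P. R (shift \<omega> (int n))" by (rule AE_distrD[OF shift_measurable])
    then show ?case by (simp add: shift_def add.commute)
  qed
  then show "AE \<omega> in P. \<forall>n. R (future \<omega> n)" by (simp add: AE_all_countable future_def)
qed measurable

lemma \<pi>_stationary:
  assumes u[measurable]: "u \<in> borel_measurable S"
  shows "(\<integral>\<^sup>+x. \<integral>\<^sup>+y. u y \<partial>Q x \<partial>\<pi>) = (\<integral>\<^sup>+x. u x \<partial>\<pi>)"
proof -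
  have "(\<integral>\<^sup>+x. \<integral>\<^sup>+y. u y \<partial>Q x \<partial>\<pi>) = (\<integral>\<^sup>+\<omega>. \<integral>\<^sup>+y. u y \<partial>Q (\<omega> 0) \<partial>P)"
    by (rule nn_integral_\<pi>) measurable
  also have "\<dots> = (\<integral>\<^sup>+\<omega>. u (\<omega> 1) \<partial>P)"
    using stationary_step[of 0 "\<lambda>_. space S" u] coordinate_in_space by (simp cong: nn_integral_cong, simp)
  also have "\<dots> = (\<integral>\<^sup>+\<omega>. u (shift \<omega> 0) \<partial>P)" by (simp add: shift_def)
  also have "\<dots> = (\<integral>\<^sup>+\<omega>. u (\<omega> 0) \<partial>distr P P shift)" by (rule nn_integral_distr[symmetric]) auto
  also have "\<dots> = (\<integral>\<^sup>+x. u x \<partial>\<pi>)" by (simp add: stationary nn_integral_\<pi>)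
  finally show ?thesis .
qed

lemma shift_funpow: "(shift ^^ j) \<omega> i = \<omega> (i + int j)"
  by (induct j arbitrary: i) (auto simp: shift_def algebra_simps)

text \<open>Birkhoff's theorem under the stationary law, transferred to the chains started at points.\<close>

lemma chain_ergodic_theorem:
  fixes u :: "'a \<Rightarrow> real"
  assumes u: "integrable \<pi> u"
  shows "AE x in \<pi>. AE \<omega> in K.law x. (\<lambda>n. (\<Sum>j<n. u (\<omega> j)) / real n) \<longlonglongrightarrow> (\<integral>x. u x \<partial>\<pi>)"
proof (rule AE_law)
  have [measurable]: "u \<in> borel_measurable S" using borel_measurable_integrable[OF u] by (simp add: measurable_\<pi>)
  show "Measurable.pred K.paths (\<lambda>\<omega>. (\<lambda>n. (\<Sum>j<n. u (\<omega> j)) / real n) \<longlonglongrightarrow> (\<integral>x. u x \<partial>\<pi>))"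
    by measurable
  have "integrable P (\<lambda>\<omega>. u (\<omega> 0))" "(\<integral>\<omega>. u (\<omega> 0) \<partial>P) = (\<integral>x. u x \<partial>\<pi>)"
    using u by (auto simp: marginal integrable_distr_eq integral_distr)
  with birkhoff_ergodic[OF shift_measurable stationary ergodic, of "\<lambda>\<omega>. u (\<omega> 0)"]
  show "AE \<omega> in P. (\<lambda>n. (\<Sum>j<n. u (future \<omega> j)) / real n) \<longlonglongrightarrow> (\<integral>x. u x \<partial>\<pi>)"
    by (simp add: shift_funpow future_def)
qed

end

section \<open>Maximal inequalities for functionals of the chain\<close>

lemma exp_le_quadratic:
  fixes y :: real
  assumes "\<bar>y\<bar> \<le> 1"
  shows "exp y \<le> 1 + y + y\<^sup>2"
proof (cases "y \<ge> 0")
  case True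
  then show ?thesis using exp_bound assms by auto
next
  case False
  have "1 \<le> (1 - y + y\<^sup>2 / 2) * (1 + y + y\<^sup>2)"
  proof -
    have "(1 - y + y\<^sup>2 / 2) * (1 + y + y\<^sup>2) - 1 = y\<^sup>2 * (1 - y + y\<^sup>2) / 2"
      by (simp add: field_simps power2_eq_square)
    moreover have "0 \<le> y\<^sup>2 * (1 - y + y\<^sup>2) / 2" using False by simp
    ultimately show ?thesis by linarith
  qed
  also have "\<dots> \<le> exp (- y) * (1 + y + y\<^sup>2)"
  proof (rule mult_right_mono)
    show "1 - y + y\<^sup>2 / 2 \<le> exp (- y)" using exp_lower_Taylor_quadratic[of "- y"] False by simp
    show "0 \<le> 1 + y + y\<^sup>2" using assms by (simp add: abs_le_iff add_nonneg_nonneg)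
  qed
  finally show ?thesis by (simp add: exp_minus field_simps)
qed

context markov_kernel
begin

text \<open>Ville's inequality. The process frozen at level \<open>a\<close> when it first crosses \<open>a\<close> is still a
  supermartingale, and it dominates \<open>a\<close> times the indicator of the crossing event.\<close>

lemma ville_inequality:
  fixes z :: "nat \<Rightarrow> (nat \<Rightarrow> 'a) \<Rightarrow> ennreal"
  assumes x: "x \<in> space S" and z[measurable]: "\<And>j. z j \<in> borel_measurable paths"
    and det: "\<And>j. determined_by j (z j)"
    and step: "\<And>j \<omega>. \<omega> \<in> space paths \<Longrightarrow> (\<integral>\<^sup>+y. z (Suc j) (fun_upd \<omega> (Suc j) y) \<partial>Q (\<omega> j)) \<le> z j \<omega>"
    and init: "\<And>\<omega>. \<omega> \<in> space paths \<Longrightarrow> z 0 \<omega> \<le> c"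
  shows "a * emeasure (law x) {\<omega> \<in> space paths. \<exists>j\<le>n. a \<le> z j \<omega>} \<le> c"
proof -
  interpret L: prob_space "law x" using x by (rule prob_space_law)
  define \<phi> where "\<phi> j \<omega> = (if \<exists>i\<le>j. a \<le> z i \<omega> then a else z j \<omega>)" for j \<omega>
  have \<phi>_meas[measurable]: "\<phi> j \<in> borel_measurable paths" for j unfolding \<phi>_def by measurable
  have \<phi>_det: "determined_by j (\<phi> j)" for j
    unfolding determined_by_def
  proof (intro allI impI)
    fix \<omega> \<omega>' :: "nat \<Rightarrow> 'a" assume eq: "\<forall>i\<le>j. \<omega> i = \<omega>' i"
    have "z i \<omega> = z i \<omega>'" if "i \<le> j" for i using eq that by (intro determined_byD[OF det]) auto
    then show "\<phi> j \<omega> = \<phi> j \<omega>'" by (auto simp: \<phi>_def)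
  qed
  have decr: "(\<integral>\<^sup>+\<omega>. \<phi> j \<omega> \<partial>law x) \<le> c" for j
  proof (induct j)
    case 0
    have "(\<integral>\<^sup>+\<omega>. \<phi> 0 \<omega> \<partial>law x) \<le> (\<integral>\<^sup>+\<omega>. c \<partial>law x)"
      using init by (intro nn_integral_mono) (auto simp: \<phi>_def space_law[OF x] intro: order_trans)
    then show ?case by (simp add: L.emeasure_space_1)
  next
    case (Suc j)
    have "(\<integral>\<^sup>+\<omega>. \<phi> (Suc j) \<omega> \<partial>law x) = (\<integral>\<^sup>+\<omega>. \<integral>\<^sup>+y. \<phi> (Suc j) (fun_upd \<omega> (Suc j) y) \<partial>Q (\<omega> j) \<partial>law x)"
      by (rule law_step[OF x \<phi>_meas \<phi>_det])
    also have "\<dots> \<le> (\<integral>\<^sup>+\<omega>. \<phi> j \<omega> \<partial>law x)"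
    proof (rule nn_integral_mono)
      fix \<omega> assume "\<omega> \<in> space (law x)"
      then have \<omega>: "\<omega> \<in> space paths" by (simp add: space_law[OF x])
      interpret Qj: prob_space "Q (\<omega> j)" using path_in_space[OF \<omega>] by (rule prob_space_kernel)
      have past: "z i (fun_upd \<omega> (Suc j) y) = z i \<omega>" if "i \<le> j" for i y
        using that by (intro determined_byD[OF det]) auto
      show "(\<integral>\<^sup>+y. \<phi> (Suc j) (fun_upd \<omega> (Suc j) y) \<partial>Q (\<omega> j)) \<le> \<phi> j \<omega>"
      proof (cases "\<exists>i\<le>j. a \<le> z i \<omega>")
        case True
        then have "\<phi> (Suc j) (fun_upd \<omega> (Suc j) y) = a" for y
          using past by (auto simp: \<phi>_def intro: le_SucI)
        then show ?thesis using True by (simp add: \<phi>_def Qj.emeasure_space_1)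
      next
        case False
        then have "\<phi> (Suc j) (fun_upd \<omega> (Suc j) y) \<le> z (Suc j) (fun_upd \<omega> (Suc j) y)" for y
          using past by (auto simp: \<phi>_def le_Suc_eq)
        then have "(\<integral>\<^sup>+y. \<phi> (Suc j) (fun_upd \<omega> (Suc j) y) \<partial>Q (\<omega> j))
            \<le> (\<integral>\<^sup>+y. z (Suc j) (fun_upd \<omega> (Suc j) y) \<partial>Q (\<omega> j))"
          by (intro nn_integral_mono)
        also have "\<dots> \<le> z j \<omega>" using \<omega> by (rule step)
        also have "z j \<omega> = \<phi> j \<omega>" using False by (auto simp: \<phi>_def)
        finally show ?thesis .
      qed
    qed
    finally show ?case using Suc by simp
  qed
  have ev: "{\<omega> \<in> space paths. \<exists>j\<le>n. a \<le> z j \<omega>} \<in> sets paths" by measurable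
  have "a * emeasure (law x) {\<omega> \<in> space paths. \<exists>j\<le>n. a \<le> z j \<omega>}
      = (\<integral>\<^sup>+\<omega>. a * indicator {\<omega> \<in> space paths. \<exists>j\<le>n. a \<le> z j \<omega>} \<omega> \<partial>law x)"
    using ev by (intro nn_integral_cmult_indicator[symmetric]) (simp add: sets_law[OF x])
  also have "\<dots> \<le> (\<integral>\<^sup>+\<omega>. \<phi> n \<omega> \<partial>law x)"
    by (intro nn_integral_mono) (auto simp: \<phi>_def split: split_indicator)
  also have "\<dots> \<le> c" by (rule decr)
  finally show ?thesis .
qed

definition increments_sum :: "('a \<Rightarrow> 'a \<Rightarrow> real) \<Rightarrow> nat \<Rightarrow> (nat \<Rightarrow> 'a) \<Rightarrow> real" where
  "increments_sum d n \<omega> = (\<Sum>l<n. d (\<omega> l) (\<omega> (Suc l)))"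

lemma pair_measurable_path:
  assumes "(\<lambda>(x, y). d x y) \<in> borel_measurable (S \<Otimes>\<^sub>M S)"
  shows "(\<lambda>\<omega>. d (\<omega> i) (\<omega> j)) \<in> borel_measurable paths"
  using measurable_compose[OF measurable_Pair assms, of "\<lambda>\<omega>. \<omega> i" paths "\<lambda>\<omega>. \<omega> j"] by simp

lemma increments_sum_measurable[measurable]:
  "(\<lambda>(x, y). d x y) \<in> borel_measurable (S \<Otimes>\<^sub>M S) \<Longrightarrow> increments_sum d n \<in> borel_measurable paths"
  unfolding increments_sum_def by (intro borel_measurable_sum pair_measurable_path)

lemma pair_section_measurable:
  assumes "(\<lambda>(x, y). d x y) \<in> borel_measurable (S \<Otimes>\<^sub>M S)" "x \<in> space S"
  shows "d x \<in> borel_measurable (Q x)"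
  using measurable_compose[OF measurable_Pair1'[OF assms(2)] assms(1)] sets_kernel[OF assms(2)]
  by (simp cong: measurable_cong_sets)

text \<open>Lenglart's form of Kolmogorov's inequality: the supermartingale is \<open>M\<^sup>2 + K - V\<close>, switched off
  once the conditional variance \<open>V\<close> exceeds \<open>K\<close>. The conditional variance may be infinite, which is
  why the centering is only asked for where it is finite.\<close>

lemma lenglart_maximal:
  fixes d :: "'a \<Rightarrow> 'a \<Rightarrow> real"
  assumes x: "x \<in> space S" and d[measurable]: "(\<lambda>(x, y). d x y) \<in> borel_measurable (S \<Otimes>\<^sub>M S)"
    and centered: "\<And>y. y \<in> space S \<Longrightarrow> (\<integral>\<^sup>+z. ennreal ((d y z)\<^sup>2) \<partial>Q y) < \<infinity> \<Longrightarrow> (\<integral>z. d y z \<partial>Q y) = 0"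
    and a: "a > 0" and K: "K \<ge> 0"
  shows "measure (law x) {\<omega> \<in> space paths. (\<exists>j\<le>n. a \<le> \<bar>increments_sum d j \<omega>\<bar>) \<and>
      (\<Sum>l<n. \<integral>\<^sup>+z. ennreal ((d (\<omega> l) z)\<^sup>2) \<partial>Q (\<omega> l)) \<le> ennreal K} \<le> K / a\<^sup>2"
proof -
  interpret L: prob_space "law x" using x by (rule prob_space_law)
  define v where "v y = (\<integral>\<^sup>+z. ennreal ((d y z)\<^sup>2) \<partial>Q y)" for y
  have v_meas[measurable]: "v \<in> borel_measurable S" unfolding v_def by measurable
  define V where "V j \<omega> = (\<Sum>l<j. v (\<omega> l))" for j :: nat and \<omega> :: "nat \<Rightarrow> 'a"
  have V_meas[measurable]: "V j \<in> borel_measurable paths" for j unfolding V_def by measurable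
  let ?M = "increments_sum d"
  define z where "z j \<omega> = (if V j \<omega> \<le> ennreal K then ennreal ((?M j \<omega>)\<^sup>2) + (ennreal K - V j \<omega>) else 0)" for j \<omega>
  have z_meas: "z j \<in> borel_measurable paths" for j unfolding z_def by measurable
  have z_det: "determined_by j (z j)" for j
    unfolding determined_by_def
  proof (intro allI impI)
    fix \<omega> \<omega>' :: "nat \<Rightarrow> 'a" assume "\<forall>i\<le>j. \<omega> i = \<omega>' i"
    then have "V j \<omega> = V j \<omega>'" "?M j \<omega> = ?M j \<omega>'" by (auto simp: V_def increments_sum_def intro!: sum.cong)
    then show "z j \<omega> = z j \<omega>'" by (simp add: z_def)
  qed
  have step: "(\<integral>\<^sup>+y. z (Suc j) (fun_upd \<omega> (Suc j) y) \<partial>Q (\<omega> j)) \<le> z j \<omega>" if \<omega>: "\<omega> \<in> space paths" for j \<omega>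
  proof -
    have \<omega>j: "\<omega> j \<in> space S" using \<omega> by (rule path_in_space)
    interpret Qj: prob_space "Q (\<omega> j)" using \<omega>j by (rule prob_space_kernel)
    have dm[measurable]: "d (\<omega> j) \<in> borel_measurable (Q (\<omega> j))" using d \<omega>j by (rule pair_section_measurable)
    have V_eq: "V (Suc j) (fun_upd \<omega> (Suc j) y) = V j \<omega> + v (\<omega> j)" for y by (simp add: V_def)
    have M_eq: "?M (Suc j) (fun_upd \<omega> (Suc j) y) = ?M j \<omega> + d (\<omega> j) y" for y by (simp add: increments_sum_def)
    show ?thesis
    proof (cases "V j \<omega> + v (\<omega> j) \<le> ennreal K")
      case False
      then show ?thesis by (simp add: z_def V_eq)
    next
      case True
      have fin: "V j \<omega> < \<infinity>" "v (\<omega> j) < \<infinity>"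
        using True by (auto simp: top_unique less_top[symmetric])
      have sq: "integrable (Q (\<omega> j)) (\<lambda>y. (d (\<omega> j) y)\<^sup>2)"
        using fin(2) unfolding v_def by (intro integrableI_nonneg) auto
      have i: "integrable (Q (\<omega> j)) (d (\<omega> j))" by (rule Qj.square_integrable_imp_integrable[OF dm sq])
      have i2: "integrable (Q (\<omega> j)) (\<lambda>y. 2 * ?M j \<omega> * d (\<omega> j) y)"
        using i by (intro integrable_mult_right)
      have c: "(\<integral>y. d (\<omega> j) y \<partial>Q (\<omega> j)) = 0" using centered[OF \<omega>j] fin(2) by (simp add: v_def)
      have vj: "v (\<omega> j) = ennreal (\<integral>y. (d (\<omega> j) y)\<^sup>2 \<partial>Q (\<omega> j))"
        unfolding v_def by (rule nn_integral_eq_integral[OF sq]) auto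
      have "(\<integral>\<^sup>+y. ennreal ((?M j \<omega> + d (\<omega> j) y)\<^sup>2) \<partial>Q (\<omega> j)) = ennreal (\<integral>y. (?M j \<omega> + d (\<omega> j) y)\<^sup>2 \<partial>Q (\<omega> j))"
      proof (rule nn_integral_eq_integral)
        show "integrable (Q (\<omega> j)) (\<lambda>y. (?M j \<omega> + d (\<omega> j) y)\<^sup>2)" using sq i2 by (auto simp: power2_sum)
      qed simp
      also have "(\<integral>y. (?M j \<omega> + d (\<omega> j) y)\<^sup>2 \<partial>Q (\<omega> j)) = (?M j \<omega>)\<^sup>2 + (\<integral>y. (d (\<omega> j) y)\<^sup>2 \<partial>Q (\<omega> j))"
        using sq i2 c by (simp add: power2_sum Qj.prob_space)
      also have "ennreal \<dots> = ennreal ((?M j \<omega>)\<^sup>2) + v (\<omega> j)"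
        unfolding vj by (rule ennreal_plus) auto
      finally have Msq: "(\<integral>\<^sup>+y. ennreal ((?M j \<omega> + d (\<omega> j) y)\<^sup>2) \<partial>Q (\<omega> j)) = ennreal ((?M j \<omega>)\<^sup>2) + v (\<omega> j)" .
      have "(\<integral>\<^sup>+y. z (Suc j) (fun_upd \<omega> (Suc j) y) \<partial>Q (\<omega> j))
          = (\<integral>\<^sup>+y. ennreal ((?M j \<omega> + d (\<omega> j) y)\<^sup>2) \<partial>Q (\<omega> j)) + (ennreal K - (V j \<omega> + v (\<omega> j)))"
        using True by (simp add: z_def V_eq M_eq nn_integral_add Qj.emeasure_space_1)
      also have "\<dots> = ennreal ((?M j \<omega>)\<^sup>2) + (v (\<omega> j) + (ennreal K - V j \<omega> - v (\<omega> j)))"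
        using fin by (simp add: Msq diff_add_eq_diff_diff_swap_ennreal add.assoc)
      also have "v (\<omega> j) + (ennreal K - V j \<omega> - v (\<omega> j)) = ennreal K - V j \<omega>"
        using True fin by (intro add_diff_eq_iff_ennreal[THEN iffD2]) (auto simp: ennreal_le_minus_iff add.commute)
      also have "ennreal ((?M j \<omega>)\<^sup>2) + \<dots> = z j \<omega>"
        using True by (auto simp: z_def intro: order_trans[rotated])
      finally show ?thesis by (rule eq_refl)
    qed
  qed
  have "z 0 \<omega> \<le> ennreal K" for \<omega> by (simp add: z_def V_def increments_sum_def)
  from ville_inequality[OF x z_meas z_det step this, where a="ennreal (a\<^sup>2)" and n=n]
  have ville: "ennreal (a\<^sup>2) * emeasure (law x) {\<omega> \<in> space paths. \<exists>j\<le>n. ennreal (a\<^sup>2) \<le> z j \<omega>} \<le> ennreal K" .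
  let ?E = "{\<omega> \<in> space paths. (\<exists>j\<le>n. a \<le> \<bar>?M j \<omega>\<bar>) \<and> V n \<omega> \<le> ennreal K}"
  have sub: "?E \<subseteq> {\<omega> \<in> space paths. \<exists>j\<le>n. ennreal (a\<^sup>2) \<le> z j \<omega>}"
  proof safe
    fix \<omega> j assume j: "j \<le> n" "a \<le> \<bar>?M j \<omega>\<bar>" and V: "V n \<omega> \<le> ennreal K"
    have "V j \<omega> \<le> V n \<omega>" unfolding V_def using j by (intro sum_mono2) auto
    then have "V j \<omega> \<le> ennreal K" using V by simp
    moreover have "a\<^sup>2 \<le> (?M j \<omega>)\<^sup>2" using j a by (metis abs_le_square_iff abs_of_pos)
    moreover have "ennreal ((?M j \<omega>)\<^sup>2) \<le> ennreal ((?M j \<omega>)\<^sup>2) + (ennreal K - V j \<omega>)"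
      by (rule add_increasing2) auto
    ultimately have "ennreal (a\<^sup>2) \<le> z j \<omega>"
      using order_trans[OF ennreal_leI] by (simp add: z_def)
    then show "\<exists>j\<le>n. ennreal (a\<^sup>2) \<le> z j \<omega>" using j by blast
  qed
  have "ennreal (a\<^sup>2) * emeasure (law x) ?E
      \<le> ennreal (a\<^sup>2) * emeasure (law x) {\<omega> \<in> space paths. \<exists>j\<le>n. ennreal (a\<^sup>2) \<le> z j \<omega>}"
    using z_meas by (intro mult_left_mono emeasure_mono sub) (auto simp: sets_law[OF x])
  also note ville
  finally have "ennreal (a\<^sup>2 * measure (law x) ?E) \<le> ennreal K"
    using a by (simp add: L.emeasure_eq_measure ennreal_mult)
  then have "a\<^sup>2 * measure (law x) ?E \<le> K" using K by simp
  then show ?thesis using a by (simp add: V_def v_def field_simps)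
qed

end

text \<open>Martingale differences \<open>d(\<xi>\<^sub>n, \<xi>\<^sub>n\<^sub>+\<^sub>1)\<close> that depend on two consecutive states only; their
  conditional variance is then a function of the current state, to which the ergodic theorem applies.\<close>

locale bounded_increments = markov_kernel S Q
  for S :: "'a measure" and Q +
  fixes d :: "'a \<Rightarrow> 'a \<Rightarrow> real" and B :: real
  assumes d_meas[measurable]: "(\<lambda>(x, y). d x y) \<in> borel_measurable (S \<Otimes>\<^sub>M S)"
    and d_bdd: "\<And>x y. \<bar>d x y\<bar> \<le> B"
    and d_centered: "\<And>x. x \<in> space S \<Longrightarrow> (\<integral>y. d x y \<partial>Q x) = 0"
begin

definition cond_var :: "'a \<Rightarrow> real" where
  "cond_var x = (\<integral>y. (d x y)\<^sup>2 \<partial>Q x)"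

lemma cond_var_measurable[measurable]: "cond_var \<in> borel_measurable S"
  unfolding cond_var_def by measurable

lemma B_nonneg: "0 \<le> B"
  using d_bdd[of undefined undefined] by linarith

lemma cond_var_nonneg: "0 \<le> cond_var x"
  by (simp add: cond_var_def)

lemma sq_bound: "\<bar>t\<bar> \<le> B \<Longrightarrow> t\<^sup>2 \<le> B\<^sup>2"
  by (metis abs_le_square_iff abs_of_nonneg B_nonneg)

lemma d_sq_bdd: "(d x y)\<^sup>2 \<le> B\<^sup>2"
  using d_bdd by (rule sq_bound)

lemma kernel_integrable:
  fixes h :: "real \<Rightarrow> 'c::{banach, second_countable_topology}"
  assumes x: "x \<in> space S" and [measurable]: "h \<in> borel_measurable borel"
    and bdd: "\<And>t. \<bar>t\<bar> \<le> B \<Longrightarrow> norm (h t) \<le> C"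
  shows "integrable (Q x) (\<lambda>y. h (d x y))"
proof -
  interpret Qx: prob_space "Q x" using x by (rule prob_space_kernel)
  have [measurable]: "d x \<in> borel_measurable (Q x)" using d_meas x by (rule pair_section_measurable)
  show ?thesis by (rule Qx.integrable_const_bound[where B=C]) (use bdd d_bdd in auto)
qed

lemma cond_var_le: 
  assumes x: "x \<in> space S"
  shows "cond_var x \<le> B\<^sup>2"
proof -
  interpret Qx: prob_space "Q x" using x by (rule prob_space_kernel)
  have "cond_var x \<le> (\<integral>y. B\<^sup>2 \<partial>Q x)"
    unfolding cond_var_def
    by (intro integral_mono kernel_integrable[OF x, where C="B\<^sup>2"] d_sq_bdd) (auto intro: sq_bound)
  then show ?thesis by (simp add: Qx.prob_space)
qed

text \<open>The exponential supermartingale behind Freedman's inequality: for \<open>\<bar>y\<bar> \<le> 1\<close> one has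
  \<open>exp y \<le> 1 + y + y\<^sup>2\<close>, and the linear term has conditional mean zero.\<close>

lemma exponential_maximal:
  assumes x: "x \<in> space S" and c: "\<And>l. \<bar>c l\<bar> * B \<le> 1"
  shows "measure (law x) {\<omega> \<in> space paths. \<exists>j\<le>n.
      a \<le> (\<Sum>l<j. c l * d (\<omega> l) (\<omega> (Suc l))) - (\<Sum>l<j. (c l)\<^sup>2 * cond_var (\<omega> l))} \<le> exp (- a)"
proof -
  interpret L: prob_space "law x" using x by (rule prob_space_law)
  define e where "e j \<omega> = (\<Sum>l<j. c l * d (\<omega> l) (\<omega> (Suc l))) - (\<Sum>l<j. (c l)\<^sup>2 * cond_var (\<omega> l))"
    for j :: nat and \<omega> :: "nat \<Rightarrow> 'a"
  note [measurable] = pair_measurable_path[OF d_meas]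
  have e_meas[measurable]: "e j \<in> borel_measurable paths" for j unfolding e_def by measurable
  define z where "z j \<omega> = ennreal (exp (e j \<omega>))" for j \<omega>
  have z_meas[measurable]: "z j \<in> borel_measurable paths" for j unfolding z_def by measurable
  have "determined_by j (e j)" for j
    unfolding determined_by_def e_def by (auto intro!: arg_cong2[where f="(-)"] sum.cong)
  then have z_det: "determined_by j (z j)" for j unfolding z_def by (rule determined_by_comp)
  have step: "(\<integral>\<^sup>+y. z (Suc j) (fun_upd \<omega> (Suc j) y) \<partial>Q (\<omega> j)) \<le> z j \<omega>" if \<omega>: "\<omega> \<in> space paths" for j \<omega>
  proof -
    have \<omega>j: "\<omega> j \<in> space S" using \<omega> by (rule path_in_space)
    interpret Qj: prob_space "Q (\<omega> j)" using \<omega>j by (rule prob_space_kernel)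
    let ?d = "d (\<omega> j)"
    have small: "\<bar>c j * t\<bar> \<le> 1" if "\<bar>t\<bar> \<le> B" for t
      using mult_left_mono[OF that, of "\<bar>c j\<bar>"] c[of j] by (simp add: abs_mult)
    have ie: "integrable (Q (\<omega> j)) (\<lambda>y. exp (c j * ?d y))"
      by (rule kernel_integrable[OF \<omega>j, where C="exp 1"]) (use small in \<open>auto simp: abs_le_iff\<close>)
    have i1: "integrable (Q (\<omega> j)) ?d"
      using kernel_integrable[OF \<omega>j, of "\<lambda>t. t" B] by simp
    have i2: "integrable (Q (\<omega> j)) (\<lambda>y. (?d y)\<^sup>2)"
      by (rule kernel_integrable[OF \<omega>j, where C="B\<^sup>2"]) (auto intro: sq_bound)
    have "(\<integral>y. exp (c j * ?d y) \<partial>Q (\<omega> j)) \<le> (\<integral>y. 1 + c j * ?d y + (c j)\<^sup>2 * (?d y)\<^sup>2 \<partial>Q (\<omega> j))"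
      using exp_le_quadratic[OF small[OF d_bdd]] ie i1 i2
      by (intro integral_mono) (auto simp: power_mult_distrib)
    also have "\<dots> = 1 + (c j)\<^sup>2 * cond_var (\<omega> j)"
      using i1 i2 d_centered[OF \<omega>j] by (simp add: Qj.prob_space cond_var_def)
    also have "\<dots> \<le> exp ((c j)\<^sup>2 * cond_var (\<omega> j))" by (rule exp_ge_add_one_self)
    finally have bound: "(\<integral>y. exp (c j * ?d y) \<partial>Q (\<omega> j)) \<le> exp ((c j)\<^sup>2 * cond_var (\<omega> j))" .
    have "z (Suc j) (fun_upd \<omega> (Suc j) y)
        = ennreal (exp (e j \<omega> - (c j)\<^sup>2 * cond_var (\<omega> j)) * exp (c j * ?d y))" for y
      by (simp add: z_def e_def exp_add[symmetric] algebra_simps)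
    then have "(\<integral>\<^sup>+y. z (Suc j) (fun_upd \<omega> (Suc j) y) \<partial>Q (\<omega> j))
        = ennreal (\<integral>y. exp (e j \<omega> - (c j)\<^sup>2 * cond_var (\<omega> j)) * exp (c j * ?d y) \<partial>Q (\<omega> j))"
      using ie by (simp add: nn_integral_eq_integral)
    also have "\<dots> \<le> ennreal (exp (e j \<omega> - (c j)\<^sup>2 * cond_var (\<omega> j)) * exp ((c j)\<^sup>2 * cond_var (\<omega> j)))"
      using bound by (intro ennreal_leI) simp
    also have "\<dots> = z j \<omega>" by (simp add: z_def exp_add[symmetric])
    finally show ?thesis .
  qed
  have "z 0 \<omega> \<le> 1" for \<omega> by (simp add: z_def e_def)
  from ville_inequality[OF x z_meas z_det step this, where a="ennreal (exp a)" and n=n]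
  have "ennreal (exp a) * emeasure (law x) {\<omega> \<in> space paths. \<exists>j\<le>n. a \<le> e j \<omega>} \<le> 1"
    by (simp add: z_def)
  then have "exp a * measure (law x) {\<omega> \<in> space paths. \<exists>j\<le>n. a \<le> e j \<omega>} \<le> 1"
    by (simp add: L.emeasure_eq_measure ennreal_mult[symmetric])
  then show ?thesis by (simp add: e_def exp_minus field_simps)
qed

text \<open>The exponential inequality for the coefficients \<open>\<plusminus>\<kappa> / s\<close> on the block \<open>{p..<q}\<close> and \<open>0\<close>
  elsewhere, where \<open>s\<close> is the scale of the increments. The sign accounts for the absolute value.\<close>

lemma block_maximal:
  assumes x: "x \<in> space S" and pq: "p \<le> q" and s: "s > 0" "0 < \<kappa>" "\<kappa> * B \<le> s"
  shows "measure (law x) {\<omega> \<in> space paths.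
      (\<exists>j\<in>{p..q}. \<epsilon> * s \<le> \<bar>increments_sum d j \<omega> - increments_sum d p \<omega>\<bar>)
      \<and> (\<Sum>l\<in>{p..<q}. cond_var (\<omega> l)) \<le> w * s\<^sup>2} \<le> 2 * exp (\<kappa>\<^sup>2 * w - \<kappa> * \<epsilon>)"
proof -
  interpret L: prob_space "law x" using x by (rule prob_space_law)
  define c where "c r l = (if l \<in> {p..<q} then r * \<kappa> / s else 0)" for r :: real and l
  let ?N = "\<lambda>r. {\<omega> \<in> space paths. \<exists>j\<le>q. \<kappa> * \<epsilon> - \<kappa>\<^sup>2 * w \<le> (\<Sum>l<j. c r l * d (\<omega> l) (\<omega> (Suc l)))
      - (\<Sum>l<j. (c r l)\<^sup>2 * cond_var (\<omega> l))}"
  note [measurable] = pair_measurable_path[OF d_meas]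
  have N_sets: "?N r \<in> sets (law x)" for r unfolding sets_law[OF x] by measurable
  have N: "measure (law x) (?N r) \<le> exp (- (\<kappa> * \<epsilon> - \<kappa>\<^sup>2 * w))" if r: "\<bar>r\<bar> = 1" for r
  proof (rule exponential_maximal[OF x])
    fix l
    have "\<bar>c r l\<bar> \<le> \<kappa> / s" using r s by (auto simp: c_def abs_mult)
    then have "\<bar>c r l\<bar> * B \<le> \<kappa> / s * B" using B_nonneg by (rule mult_right_mono)
    also have "\<dots> \<le> 1" using s by (simp add: field_simps)
    finally show "\<bar>c r l\<bar> * B \<le> 1" .
  qed
  let ?E = "{\<omega> \<in> space paths. (\<exists>j\<in>{p..q}. \<epsilon> * s \<le> \<bar>increments_sum d j \<omega> - increments_sum d p \<omega>\<bar>)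
      \<and> (\<Sum>l\<in>{p..<q}. cond_var (\<omega> l)) \<le> w * s\<^sup>2}"
  have "?E \<subseteq> ?N 1 \<union> ?N (- 1)"
  proof
    fix \<omega> assume "\<omega> \<in> ?E"
    then obtain j where \<omega>: "\<omega> \<in> space paths" and j: "p \<le> j" "j \<le> q"
      and big: "\<epsilon> * s \<le> \<bar>increments_sum d j \<omega> - increments_sum d p \<omega>\<bar>"
      and V: "(\<Sum>l\<in>{p..<q}. cond_var (\<omega> l)) \<le> w * s\<^sup>2" by auto
    define m where "m = (\<Sum>l\<in>{p..<j}. d (\<omega> l) (\<omega> (Suc l)))"
    have m: "m = increments_sum d j \<omega> - increments_sum d p \<omega>"
      unfolding m_def increments_sum_def using sum_diff_nat_ivl[of 0 p j "\<lambda>l. d (\<omega> l) (\<omega> (Suc l))"] j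
      by (simp add: atLeast0LessThan)
    obtain r :: real where r: "\<bar>r\<bar> = 1" "r * m = \<bar>m\<bar>" "r = 1 \<or> r = - 1"
      by (cases "m \<ge> 0") (auto intro: that[of 1] that[of "-1"])
    have restr: "(\<Sum>l<j. if l \<in> {p..<q} then h l else 0) = (\<Sum>l\<in>{p..<j}. h l)" for h :: "nat \<Rightarrow> real"
      using j by (intro sum.mono_neutral_cong_right) auto
    have "(\<Sum>l<j. c r l * d (\<omega> l) (\<omega> (Suc l)))
        = (\<Sum>l<j. if l \<in> {p..<q} then r * \<kappa> / s * d (\<omega> l) (\<omega> (Suc l)) else 0)"
      by (intro sum.cong) (auto simp: c_def)
    also have "\<dots> = \<kappa> / s * \<bar>m\<bar>"
      unfolding restr r(2)[symmetric] unfolding m_def by (simp add: sum_distrib_left sum_divide_distrib mult_ac)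
    finally have 1: "(\<Sum>l<j. c r l * d (\<omega> l) (\<omega> (Suc l))) = \<kappa> / s * \<bar>m\<bar>" .
    have "(\<Sum>l<j. (c r l)\<^sup>2 * cond_var (\<omega> l)) = (\<Sum>l<j. if l \<in> {p..<q} then \<kappa>\<^sup>2 / s\<^sup>2 * cond_var (\<omega> l) else 0)"
      using r(3) by (intro sum.cong) (auto simp: c_def power_divide power_mult_distrib)
    also have "\<dots> = \<kappa>\<^sup>2 / s\<^sup>2 * (\<Sum>l\<in>{p..<j}. cond_var (\<omega> l))"
      unfolding restr by (simp add: sum_distrib_left)
    also have "\<dots> \<le> \<kappa>\<^sup>2 / s\<^sup>2 * (\<Sum>l\<in>{p..<q}. cond_var (\<omega> l))"
      using j by (intro mult_left_mono sum_mono2 cond_var_nonneg) auto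
    also have "\<dots> \<le> \<kappa>\<^sup>2 / s\<^sup>2 * (w * s\<^sup>2)" using V by (intro mult_left_mono) auto
    also have "\<dots> = \<kappa>\<^sup>2 * w" using s by simp
    finally have 2: "(\<Sum>l<j. (c r l)\<^sup>2 * cond_var (\<omega> l)) \<le> \<kappa>\<^sup>2 * w" .
    have "\<kappa> * \<epsilon> = \<kappa> / s * (\<epsilon> * s)" using s by simp
    also have "\<dots> \<le> \<kappa> / s * \<bar>m\<bar>" using big s unfolding m by (intro mult_left_mono) auto
    finally have "\<omega> \<in> ?N r" using \<omega> j 1 2 by auto
    then show "\<omega> \<in> ?N 1 \<union> ?N (- 1)" using r(3) by auto
  qed
  then have "measure (law x) ?E \<le> measure (law x) (?N 1 \<union> ?N (- 1))"
    using N_sets by (intro L.finite_measure_mono sets.Un)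
  also have "\<dots> \<le> measure (law x) (?N 1) + measure (law x) (?N (- 1))"
    using N_sets by (intro measure_Un_le)
  also have "\<dots> \<le> 2 * exp (\<kappa>\<^sup>2 * w - \<kappa> * \<epsilon>)" using N[of 1] N[of "-1"] by simp
  finally show ?thesis .
qed

end

section \<open>Characteristic functions of weighted sums of martingale differences\<close>

lemma exp_mult_one_minus_bound:
  fixes a :: real
  assumes "0 \<le> a" "a \<le> 1"
  shows "\<bar>exp a * (1 - a) - 1\<bar> \<le> a\<^sup>2"
proof -
  have "exp a * (1 - a) \<le> exp a * exp (- a)"
    using exp_ge_add_one_self[of "- a"] by (intro mult_left_mono) auto
  then have "exp a * (1 - a) \<le> 1" by (simp add: exp_minus)
  moreover have "(1 + a) * (1 - a) \<le> exp a * (1 - a)"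
    using assms by (intro mult_right_mono) auto
  moreover have "(1 + a) * (1 - a) = 1 - a\<^sup>2" by (simp add: power2_eq_square algebra_simps)
  ultimately show ?thesis by (simp add: abs_le_iff)
qed

context bounded_increments
begin

text \<open>The second order Taylor polynomial of the characteristic function is \<open>1 - a\<close> with
  \<open>a = c\<^sup>2 v / 2\<close>, and \<open>exp a * (1 - a)\<close> is \<open>1\<close> up to \<open>a\<^sup>2\<close>.\<close>

lemma cf_one_step:
  assumes x: "x \<in> space S" and c: "\<bar>c\<bar> * B \<le> 1"
  shows "norm (complex_of_real (exp (c\<^sup>2 * cond_var x / 2)) * (\<integral>y. iexp (c * d x y) \<partial>Q x) - 1) \<le> (\<bar>c\<bar> * B) ^ 3 + (\<bar>c\<bar> * B) ^ 4"
proof -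
  interpret Qx: prob_space "Q x" using x by (rule prob_space_kernel)
  define s where "s = \<bar>c\<bar> * B"
  define a where "a = c\<^sup>2 * cond_var x / 2"
  have s: "0 \<le> s" "s \<le> 1" using c B_nonneg by (auto simp: s_def)
  have ss: "c\<^sup>2 * B\<^sup>2 = s\<^sup>2" by (simp add: s_def power_mult_distrib)
  have a: "0 \<le> a" "a \<le> s\<^sup>2 / 2"
    using mult_left_mono[OF cond_var_le[OF x], of "c\<^sup>2"] cond_var_nonneg[of x] by (auto simp: a_def ss[symmetric])
  have a_half: "a \<le> 1 / 2" using a(2) power_le_one[OF s, of 2] by linarith
  define q where "q t = (1 + \<i> * complex_of_real (c * t) - complex_of_real (c\<^sup>2 / 2 * t\<^sup>2))" for t
  have taylor: "norm (iexp (c * t) - q t) \<le> s ^ 3 / 6" if "\<bar>t\<bar> \<le> B" for t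
  proof -
    have "norm (iexp (c * t) - q t) \<le> \<bar>c * t\<bar> ^ 3 / 6"
      using iexp_approx1[of "c * t" 2]
      by (simp add: q_def numeral_eq_Suc fact_reduce power2_eq_square algebra_simps)
    also have "\<dots> \<le> s ^ 3 / 6"
      using that by (intro divide_right_mono power_mono) (auto simp: s_def abs_mult intro: mult_left_mono)
    finally show ?thesis .
  qed
  have i_exp: "integrable (Q x) (\<lambda>y. iexp (c * d x y))"
    by (rule kernel_integrable[OF x, where C=1]) auto
  have i1: "integrable (Q x) (\<lambda>y. d x y)"
    using kernel_integrable[OF x, of "\<lambda>t. t" B] by simp
  have i2: "integrable (Q x) (\<lambda>y. (d x y)\<^sup>2)"
    by (rule kernel_integrable[OF x, where C="B\<^sup>2"]) (auto intro: sq_bound)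
  have iq: "integrable (Q x) (\<lambda>y. q (d x y))"
    unfolding q_def by (intro Bochner_Integration.integrable_diff Bochner_Integration.integrable_add
      integrable_mult_right integrable_of_real i1 i2) auto
  have "(\<integral>y. q (d x y) \<partial>Q x) = 1 + \<i> * complex_of_real (c * (\<integral>y. d x y \<partial>Q x)) - complex_of_real (c\<^sup>2 * (\<integral>y. (d x y)\<^sup>2 \<partial>Q x) / 2)"
    unfolding q_def using i1 i2 by (simp add: Qx.prob_space del: of_real_mult of_real_power of_real_divide)
  also have "\<dots> = complex_of_real (1 - a)"
    using d_centered[OF x] by (simp add: a_def cond_var_def)
  finally have q_int: "(\<integral>y. q (d x y) \<partial>Q x) = complex_of_real (1 - a)" .
  have "norm ((\<integral>y. iexp (c * d x y) \<partial>Q x) - complex_of_real (1 - a)) = norm (\<integral>y. iexp (c * d x y) - q (d x y) \<partial>Q x)"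
    unfolding q_int[symmetric] using i_exp iq by (simp only: Bochner_Integration.integral_diff)
  also have "\<dots> \<le> (\<integral>y. norm (iexp (c * d x y) - q (d x y)) \<partial>Q x)" by (rule integral_norm_bound)
  also have "\<dots> \<le> (\<integral>y. s ^ 3 / 6 \<partial>Q x)"
    using i_exp iq by (intro integral_mono taylor d_bdd) auto
  finally have phi: "norm ((\<integral>y. iexp (c * d x y) \<partial>Q x) - complex_of_real (1 - a)) \<le> s ^ 3 / 6"
    by (simp add: Qx.prob_space)
  have "exp a \<le> 1 + a + a\<^sup>2" using a a_half by (intro exp_bound) auto
  also have "\<dots> \<le> 2" using a a_half power_mono[of a "1/2" 2] by (simp add: power2_eq_square)
  finally have ea: "exp a \<le> 2" .
  have "norm (complex_of_real (exp a) * (\<integral>y. iexp (c * d x y) \<partial>Q x) - 1)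
      = norm (complex_of_real (exp a) * ((\<integral>y. iexp (c * d x y) \<partial>Q x) - complex_of_real (1 - a)) + complex_of_real (exp a * (1 - a) - 1))"
    by (simp add: algebra_simps)
  also have "\<dots> \<le> exp a * (s ^ 3 / 6) + a\<^sup>2"
  proof (rule order_trans[OF norm_triangle_ineq add_mono])
    show "norm (complex_of_real (exp a) * ((\<integral>y. iexp (c * d x y) \<partial>Q x) - complex_of_real (1 - a))) \<le> exp a * (s ^ 3 / 6)"
      using phi by (simp add: norm_mult)
    show "norm (complex_of_real (exp a * (1 - a) - 1)) \<le> a\<^sup>2"
      unfolding norm_of_real using a a_half by (intro exp_mult_one_minus_bound) auto
  qed
  also have "\<dots> \<le> s ^ 3 + s ^ 4"
  proof (rule add_mono)
    show "exp a * (s ^ 3 / 6) \<le> s ^ 3" using mult_right_mono[OF ea, of "s ^ 3 / 6"] zero_le_power[OF s(1), of 3] by linarith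
    have "a\<^sup>2 \<le> (s\<^sup>2)\<^sup>2" using a by (intro power_mono) auto
    then show "a\<^sup>2 \<le> s ^ 4" by simp
  qed
  finally show ?thesis by (simp add: a_def s_def)
qed

text \<open>Weighting \<open>exp (i T\<^sub>n)\<close> by \<open>exp (V\<^sub>n / 2)\<close> makes it almost a martingale: each step changes the
  expectation by a third order term.\<close>

lemma cf_compensated:
  assumes x: "x \<in> space S" and c: "\<And>l. \<bar>c l\<bar> \<le> \<theta> / sqrt n" and n: "n > 0" and small: "\<theta> * B \<le> sqrt n"
  shows "norm ((\<integral>\<omega>. iexp (\<Sum>l<n. c l * d (\<omega> l) (\<omega> (Suc l)))
        * complex_of_real (exp ((\<Sum>l<n. (c l)\<^sup>2 * cond_var (\<omega> l)) / 2)) \<partial>law x) - 1)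
      \<le> exp ((\<theta> * B)\<^sup>2) * ((\<theta> * B) ^ 3 / sqrt n + (\<theta> * B) ^ 4 / n)"
proof -
  interpret L: prob_space "law x" using x by (rule prob_space_law)
  define s where "s = \<theta> * B / sqrt n"
  have \<theta>: "0 \<le> \<theta>" using order_trans[OF abs_ge_zero c] n by (simp add: zero_le_divide_iff)
  have s: "0 \<le> s" "s \<le> 1" "\<bar>c l\<bar> * B \<le> s" for l
    using \<theta> B_nonneg n small mult_right_mono[OF c B_nonneg, of l] by (auto simp: s_def field_simps)
  have ns: "real n * s\<^sup>2 = (\<theta> * B)\<^sup>2" using n by (simp add: s_def power_divide)
  define V where "V j \<omega> = (\<Sum>l<j. (c l)\<^sup>2 * cond_var (\<omega> l)) / 2" for j :: nat and \<omega> :: "nat \<Rightarrow> 'a"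
  \<comment> \<open>On the path space and for \<open>j \<le> n\<close> the minimum is \<open>V j \<omega>\<close>; it keeps \<open>G\<close> bounded everywhere.\<close>
  define G where "G j \<omega> = iexp (\<Sum>l<j. c l * d (\<omega> l) (\<omega> (Suc l))) * complex_of_real (exp (min (V j \<omega>) ((\<theta> * B)\<^sup>2)))"
    for j :: nat and \<omega> :: "nat \<Rightarrow> 'a"
  note [measurable] = pair_measurable_path[OF d_meas]
  have V_meas[measurable]: "V j \<in> borel_measurable paths" for j unfolding V_def by measurable
  have G_meas[measurable]: "G j \<in> borel_measurable paths" for j unfolding G_def by measurable
  have G_bdd: "norm (G j \<omega>) \<le> exp ((\<theta> * B)\<^sup>2)" for j \<omega> by (simp add: G_def norm_mult)
  have G_det: "determined_by j (G j)" for j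
    unfolding determined_by_def
  proof (intro allI impI)
    fix \<omega> \<omega>' :: "nat \<Rightarrow> 'a" assume "\<forall>i\<le>j. \<omega> i = \<omega>' i"
    then have "V j \<omega> = V j \<omega>'" "(\<Sum>l<j. c l * d (\<omega> l) (\<omega> (Suc l))) = (\<Sum>l<j. c l * d (\<omega>' l) (\<omega>' (Suc l)))"
      by (auto simp: V_def intro!: sum.cong)
    then show "G j \<omega> = G j \<omega>'" by (simp add: G_def)
  qed
  have V_le: "V j \<omega> \<le> (\<theta> * B)\<^sup>2" if "\<omega> \<in> space paths" "j \<le> n" for j \<omega>
  proof -
    have "(c l)\<^sup>2 * cond_var (\<omega> l) \<le> s\<^sup>2" for l
    proof -
      have "(c l)\<^sup>2 * cond_var (\<omega> l) \<le> (c l)\<^sup>2 * B\<^sup>2"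
        using that by (intro mult_left_mono cond_var_le path_in_space) auto
      also have "\<dots> = (\<bar>c l\<bar> * B)\<^sup>2" by (simp add: power_mult_distrib)
      also have "\<dots> \<le> s\<^sup>2" using s B_nonneg by (intro power_mono) auto
      finally show ?thesis .
    qed
    then have "(\<Sum>l<j. (c l)\<^sup>2 * cond_var (\<omega> l)) \<le> (\<Sum>l<j. s\<^sup>2)" by (intro sum_mono)
    also have "\<dots> \<le> real n * s\<^sup>2" using that by (simp add: mult_right_mono)
    finally show ?thesis unfolding V_def ns by (simp add: sum_nonneg) (smt (verit) zero_le_power2)
  qed
  have G_eq: "G j \<omega> = iexp (\<Sum>l<j. c l * d (\<omega> l) (\<omega> (Suc l))) * complex_of_real (exp (V j \<omega>))"
    if "\<omega> \<in> space paths" "j \<le> n" for j \<omega>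
    using V_le[OF that] by (simp add: G_def min_absorb1)
  have G_int: "integrable (law x) (G j)" for j
    using G_bdd by (intro L.integrable_const_bound) (auto simp: measurable_law[OF x])
  have inc: "norm ((\<integral>\<omega>. G (Suc j) \<omega> \<partial>law x) - (\<integral>\<omega>. G j \<omega> \<partial>law x)) \<le> exp ((\<theta> * B)\<^sup>2) * (s ^ 3 + s ^ 4)"
    if j: "j < n" for j
  proof -
    let ?R = "\<lambda>\<omega>. \<integral>y. G (Suc j) (fun_upd \<omega> (Suc j) y) \<partial>Q (\<omega> j)"
    note step = law_step_complex[OF x G_meas G_det G_bdd, of j]
    have pointwise: "norm (?R \<omega> - G j \<omega>) \<le> exp ((\<theta> * B)\<^sup>2) * (s ^ 3 + s ^ 4)"
      if \<omega>: "\<omega> \<in> space paths" for \<omega>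
    proof -
      have \<omega>j: "\<omega> j \<in> space S" using \<omega> by (rule path_in_space)
      have upd: "fun_upd \<omega> (Suc j) y \<in> space paths" if "y \<in> space S" for y
        using path_update_measurable[OF \<omega>] that by (rule measurable_space)
      let ?e = "complex_of_real (exp ((c j)\<^sup>2 * cond_var (\<omega> j) / 2))"
      have "?R \<omega> = (\<integral>y. G j \<omega> * ?e * iexp (c j * d (\<omega> j) y) \<partial>Q (\<omega> j))"
      proof (rule Bochner_Integration.integral_cong[OF refl])
        fix y assume "y \<in> space (Q (\<omega> j))"
        then have y: "y \<in> space S" by (simp add: space_kernel[OF \<omega>j])
        have "V (Suc j) (fun_upd \<omega> (Suc j) y) = V j \<omega> + (c j)\<^sup>2 * cond_var (\<omega> j) / 2"
          by (simp add: V_def add_divide_distrib)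
        then show "G (Suc j) (fun_upd \<omega> (Suc j) y) = G j \<omega> * ?e * iexp (c j * d (\<omega> j) y)"
          using j G_eq[OF upd[OF y], of "Suc j"] G_eq[OF \<omega>, of j]
          by (simp add: exp_add distrib_left exp_of_real)
      qed
      also have "\<dots> = G j \<omega> * (?e * (\<integral>y. iexp (c j * d (\<omega> j) y) \<partial>Q (\<omega> j)))"
        using kernel_integrable[OF \<omega>j, of "\<lambda>t. iexp (c j * t)" 1] by (simp add: mult.assoc)
      finally have "?R \<omega> - G j \<omega> = G j \<omega> * (?e * (\<integral>y. iexp (c j * d (\<omega> j) y) \<partial>Q (\<omega> j)) - 1)"
        by (simp add: algebra_simps)
      then have "norm (?R \<omega> - G j \<omega>) = norm (G j \<omega>) * norm (?e * (\<integral>y. iexp (c j * d (\<omega> j) y) \<partial>Q (\<omega> j)) - 1)"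
        by (simp only: norm_mult)
      also have "\<dots> \<le> exp ((\<theta> * B)\<^sup>2) * ((\<bar>c j\<bar> * B) ^ 3 + (\<bar>c j\<bar> * B) ^ 4)"
        using s(2) s(3)[of j] B_nonneg by (intro mult_mono cf_one_step[OF \<omega>j] G_bdd) (auto intro: order_trans)
      also have "\<dots> \<le> exp ((\<theta> * B)\<^sup>2) * (s ^ 3 + s ^ 4)"
        using s(3)[of j] B_nonneg by (intro mult_left_mono add_mono power_mono) auto
      finally show ?thesis .
    qed
    have "norm ((\<integral>\<omega>. G (Suc j) \<omega> \<partial>law x) - (\<integral>\<omega>. G j \<omega> \<partial>law x)) = norm (\<integral>\<omega>. ?R \<omega> - G j \<omega> \<partial>law x)"
      using step G_int by simp
    also have "\<dots> \<le> (\<integral>\<omega>. norm (?R \<omega> - G j \<omega>) \<partial>law x)" by (rule integral_norm_bound)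
    also have "\<dots> \<le> (\<integral>\<omega>. exp ((\<theta> * B)\<^sup>2) * (s ^ 3 + s ^ 4) \<partial>law x)"
      using step(2) G_int pointwise by (intro integral_mono) (auto simp: space_law[OF x])
    finally show ?thesis by (simp add: L.prob_space)
  qed
  have tele: "norm ((\<integral>\<omega>. G j \<omega> \<partial>law x) - 1) \<le> real j * (exp ((\<theta> * B)\<^sup>2) * (s ^ 3 + s ^ 4))" if "j \<le> n" for j
    using that
  proof (induct j)
    case 0
    then show ?case by (simp add: G_def V_def L.prob_space)
  next
    case (Suc j)
    then show ?case
      using inc[of j] norm_triangle_ineq[of "(\<integral>\<omega>. G (Suc j) \<omega> \<partial>law x) - (\<integral>\<omega>. G j \<omega> \<partial>law x)" "(\<integral>\<omega>. G j \<omega> \<partial>law x) - 1"]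
      by (simp add: algebra_simps)
  qed
  have "real n * (s ^ 3 + s ^ 4) = (\<theta> * B) ^ 3 / sqrt n + (\<theta> * B) ^ 4 / n"
  proof -
    have "real n * s ^ 3 = real n * s\<^sup>2 * s" "real n * s ^ 4 = real n * s\<^sup>2 * s\<^sup>2"
      by (simp_all add: power2_eq_square numeral_eq_Suc)
    then have "real n * s ^ 3 = (\<theta> * B)\<^sup>2 * (\<theta> * B / sqrt n)" "real n * s ^ 4 = (\<theta> * B)\<^sup>2 * (\<theta> * B / sqrt n)\<^sup>2"
      unfolding ns by (simp_all add: s_def)
    then show ?thesis by (simp add: distrib_left power_divide) (simp add: numeral_eq_Suc)
  qed
  then have bound: "real n * (exp ((\<theta> * B)\<^sup>2) * (s ^ 3 + s ^ 4))
      = exp ((\<theta> * B)\<^sup>2) * ((\<theta> * B) ^ 3 / sqrt n + (\<theta> * B) ^ 4 / n)"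
    by (simp only: mult.left_commute[of "real n" "exp ((\<theta> * B)\<^sup>2)"])
  have "(\<integral>\<omega>. iexp (\<Sum>l<n. c l * d (\<omega> l) (\<omega> (Suc l)))
        * complex_of_real (exp ((\<Sum>l<n. (c l)\<^sup>2 * cond_var (\<omega> l)) / 2)) \<partial>law x) = (\<integral>\<omega>. G n \<omega> \<partial>law x)"
    by (intro Bochner_Integration.integral_cong) (auto simp: G_eq V_def space_law[OF x])
  then show ?thesis using tele[of n] bound by simp
qed

text \<open>Since the conditional variances \<open>V\<^sub>n\<close> are bounded and converge to the constant \<open>\<tau>\<close>, the compensator
  \<open>exp (V\<^sub>n / 2)\<close> may be replaced by \<open>exp (\<tau> / 2)\<close> and taken out of the expectation.\<close>

lemma cf_limit:
  fixes c :: "nat \<Rightarrow> nat \<Rightarrow> real"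
  assumes x: "x \<in> space S" and c: "\<And>n l. \<bar>c n l\<bar> \<le> \<theta> / sqrt n"
    and V: "AE \<omega> in law x. (\<lambda>n. \<Sum>l<n. (c n l)\<^sup>2 * cond_var (\<omega> l)) \<longlonglongrightarrow> \<tau>"
  shows "(\<lambda>n. \<integral>\<omega>. iexp (\<Sum>l<n. c n l * d (\<omega> l) (\<omega> (Suc l))) \<partial>law x) \<longlonglongrightarrow> complex_of_real (exp (- \<tau> / 2))"
proof -
  interpret L: prob_space "law x" using x by (rule prob_space_law)
  define T where "T n \<omega> = (\<Sum>l<n. c n l * d (\<omega> l) (\<omega> (Suc l)))" for n and \<omega> :: "nat \<Rightarrow> 'a"
  define V where "V n \<omega> = (\<Sum>l<n. (c n l)\<^sup>2 * cond_var (\<omega> l))" for n and \<omega> :: "nat \<Rightarrow> 'a"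
  note [measurable] = pair_measurable_path[OF d_meas]
  have T_meas: "T n \<in> borel_measurable (law x)" for n unfolding measurable_law[OF x] T_def by measurable
  have V_meas: "V n \<in> borel_measurable (law x)" for n unfolding measurable_law[OF x] V_def by measurable
  note [measurable] = T_meas V_meas
  define C where "C = (\<theta> * B)\<^sup>2"
  have V_bdd: "V n \<omega> \<le> C" if "\<omega> \<in> space paths" for n \<omega>
  proof (cases "n = 0")
    case True then show ?thesis by (simp add: V_def C_def)
  next
    case False
    have "(c n l)\<^sup>2 * cond_var (\<omega> l) \<le> C / n" for l
    proof -
      have "(c n l)\<^sup>2 * cond_var (\<omega> l) \<le> (\<theta> / sqrt n)\<^sup>2 * B\<^sup>2"
        using c[of n l] power_mono[OF c[of n l], of 2]
        by (intro mult_mono cond_var_le path_in_space that cond_var_nonneg) auto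
      then show ?thesis by (simp add: C_def power_divide power_mult_distrib)
    qed
    then have "V n \<omega> \<le> (\<Sum>l<n. C / n)" unfolding V_def by (intro sum_mono)
    then show ?thesis using False by simp
  qed
  have V_nonneg: "0 \<le> V n \<omega>" for n \<omega> unfolding V_def by (intro sum_nonneg mult_nonneg_nonneg cond_var_nonneg) auto
  have A: "(\<lambda>n. \<integral>\<omega>. iexp (T n \<omega>) * complex_of_real (exp (V n \<omega> / 2)) \<partial>law x) \<longlonglongrightarrow> 1"
  proof (rule Lim_null[THEN iffD2], rule Lim_null_comparison)
    show "(\<lambda>n. exp ((\<theta> * B)\<^sup>2) * ((\<theta> * B) ^ 3 / sqrt n + (\<theta> * B) ^ 4 / n)) \<longlonglongrightarrow> 0"
      by real_asymp
    have "\<forall>\<^sub>F n in sequentially. \<theta> * B \<le> sqrt (real n)" by real_asymp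
    then show "\<forall>\<^sub>F n in sequentially. norm ((\<integral>\<omega>. iexp (T n \<omega>) * complex_of_real (exp (V n \<omega> / 2)) \<partial>law x) - 1)
        \<le> exp ((\<theta> * B)\<^sup>2) * ((\<theta> * B) ^ 3 / sqrt n + (\<theta> * B) ^ 4 / n)"
      using eventually_gt_at_top[of 0] unfolding T_def V_def
      by eventually_elim (rule cf_compensated[OF x c])
  qed
  have B: "(\<lambda>n. \<integral>\<omega>. iexp (T n \<omega>) * complex_of_real (exp (V n \<omega> / 2) - exp (\<tau> / 2)) \<partial>law x) \<longlonglongrightarrow> 0"
  proof (rule Lim_null_comparison)
    show "\<forall>\<^sub>F n in sequentially. norm (\<integral>\<omega>. iexp (T n \<omega>) * complex_of_real (exp (V n \<omega> / 2) - exp (\<tau> / 2)) \<partial>law x)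
        \<le> (\<integral>\<omega>. \<bar>exp (V n \<omega> / 2) - exp (\<tau> / 2)\<bar> \<partial>law x)"
      by (intro always_eventually allI order_trans[OF integral_norm_bound] eq_refl
        Bochner_Integration.integral_cong refl) (simp add: norm_mult del: of_real_diff)
    have "(\<lambda>n. \<integral>\<omega>. \<bar>exp (V n \<omega> / 2) - exp (\<tau> / 2)\<bar> \<partial>law x) \<longlonglongrightarrow> (\<integral>\<omega>. 0 \<partial>law x)"
    proof (rule integral_dominated_convergence[where w="\<lambda>_. exp C + exp (\<tau> / 2)"])
      show "AE \<omega> in law x. (\<lambda>n. \<bar>exp (V n \<omega> / 2) - exp (\<tau> / 2)\<bar>) \<longlonglongrightarrow> 0"
        using V[folded V_def]
      proof eventually_elim
        case (elim \<omega>)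
        then have "(\<lambda>n. \<bar>exp (V n \<omega> / 2) - exp (\<tau> / 2)\<bar>) \<longlonglongrightarrow> \<bar>exp (\<tau> / 2) - exp (\<tau> / 2)\<bar>"
          by (intro tendsto_intros) auto
        then show ?case by simp
      qed
      show "AE \<omega> in law x. norm \<bar>exp (V n \<omega> / 2) - exp (\<tau> / 2)\<bar> \<le> exp C + exp (\<tau> / 2)" for n
      proof (rule AE_I2)
        fix \<omega> assume "\<omega> \<in> space (law x)"
        then have "V n \<omega> \<le> C" by (intro V_bdd) (simp add: space_law[OF x])
        then have "exp (V n \<omega> / 2) \<le> exp C" using V_nonneg[of n \<omega>] by simp
        moreover have "0 < exp (V n \<omega> / 2)" "0 < exp (\<tau> / 2)" by simp_all
        ultimately show "norm \<bar>exp (V n \<omega> / 2) - exp (\<tau> / 2)\<bar> \<le> exp C + exp (\<tau> / 2)"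
          unfolding real_norm_def abs_abs by linarith
      qed
    qed auto
    then show "(\<lambda>n. \<integral>\<omega>. \<bar>exp (V n \<omega> / 2) - exp (\<tau> / 2)\<bar> \<partial>law x) \<longlonglongrightarrow> 0" by simp
  qed
  have int: "integrable (law x) (\<lambda>\<omega>. iexp (T n \<omega>) * complex_of_real (exp (V n \<omega> / 2)))"
    "integrable (law x) (\<lambda>\<omega>. iexp (T n \<omega>))" for n
  proof -
    show "integrable (law x) (\<lambda>\<omega>. iexp (T n \<omega>) * complex_of_real (exp (V n \<omega> / 2)))"
    proof (rule L.integrable_const_bound[where B="exp C"])
      show "AE \<omega> in law x. norm (iexp (T n \<omega>) * complex_of_real (exp (V n \<omega> / 2))) \<le> exp C"
      proof (rule AE_I2)
        fix \<omega> assume "\<omega> \<in> space (law x)"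
        then have "V n \<omega> \<le> C" by (intro V_bdd) (simp add: space_law[OF x])
        then have "exp (V n \<omega> / 2) \<le> exp C" using V_nonneg[of n \<omega>] by simp
        then show "norm (iexp (T n \<omega>) * complex_of_real (exp (V n \<omega> / 2))) \<le> exp C"
          by (simp only: norm_mult norm_exp_i_times norm_of_real abs_exp_cancel mult_1)
      qed
    qed measurable
    show "integrable (law x) (\<lambda>\<omega>. iexp (T n \<omega>))"
      by (rule L.integrable_const_bound[where B=1]) auto
  qed
  have split: "(\<integral>\<omega>. iexp (T n \<omega>) * complex_of_real (exp (V n \<omega> / 2)) \<partial>law x)
      - (\<integral>\<omega>. iexp (T n \<omega>) * complex_of_real (exp (V n \<omega> / 2) - exp (\<tau> / 2)) \<partial>law x)
      = complex_of_real (exp (\<tau> / 2)) * (\<integral>\<omega>. iexp (T n \<omega>) \<partial>law x)" for n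
    using int[of n] by (simp add: right_diff_distrib mult.commute)
  have "(\<lambda>n. complex_of_real (exp (- \<tau> / 2)) * (complex_of_real (exp (\<tau> / 2)) * (\<integral>\<omega>. iexp (T n \<omega>) \<partial>law x)))
      \<longlonglongrightarrow> complex_of_real (exp (- \<tau> / 2)) * (1 - 0)"
    unfolding split[symmetric] by (intro tendsto_mult tendsto_diff tendsto_const A B)
  moreover have "complex_of_real (exp (- \<tau> / 2)) * (complex_of_real (exp (\<tau> / 2)) * z) = z" for z
    by (simp only: mult.assoc[symmetric] of_real_mult[symmetric] exp_add[symmetric]) simp
  ultimately have "(\<lambda>n. \<integral>\<omega>. iexp (T n \<omega>) \<partial>law x) \<longlonglongrightarrow> complex_of_real (exp (- \<tau> / 2)) * (1 - 0)"
    by (simp only:)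
  then show ?thesis unfolding T_def by (simp only: diff_zero mult_1_right)
qed

end

section \<open>Joint convergence from characteristic functions\<close>

lemma tendsto_by_approximation:
  fixes a :: "nat \<Rightarrow> 'x::metric_space"
  assumes "\<And>e. e > 0 \<Longrightarrow> \<exists>b \<beta>. b \<longlonglongrightarrow> \<beta> \<and> (\<forall>\<^sub>F n in sequentially. dist (a n) (b n) \<le> e) \<and> dist \<beta> \<alpha> \<le> e"
  shows "a \<longlonglongrightarrow> \<alpha>"
proof (rule tendstoI)
  fix e :: real assume e: "e > 0"
  then obtain b \<beta> where b: "b \<longlonglongrightarrow> \<beta>" "\<forall>\<^sub>F n in sequentially. dist (a n) (b n) \<le> e / 4" "dist \<beta> \<alpha> \<le> e / 4"
    using assms[of "e / 4"] by auto
  have "\<forall>\<^sub>F n in sequentially. dist (b n) \<beta> < e / 4" using b(1) e by (intro tendstoD) auto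
  then show "\<forall>\<^sub>F n in sequentially. dist (a n) \<alpha> < e"
    using b(2)
  proof eventually_elim
    case (elim n)
    have "dist (a n) \<alpha> \<le> dist (a n) (b n) + dist (b n) \<beta> + dist \<beta> \<alpha>"
      using dist_triangle[of "a n" \<alpha> "b n"] dist_triangle[of "b n" \<alpha> \<beta>] by linarith
    then show ?case using elim b(3) e by linarith
  qed
qed

text \<open>The law of \<open>Y\<close> after tilting \<open>M\<close> by the density \<open>v / a\<close>. The lower bound \<open>c\<close> keeps the
  normalisation \<open>a\<close> away from zero.\<close>

lemma weighted_distribution:
  fixes v :: "'a \<Rightarrow> real" and Y :: "'a \<Rightarrow> real"
  assumes M: "prob_space M" and [measurable]: "v \<in> borel_measurable M" "Y \<in> borel_measurable M"
    and v: "\<And>\<omega>. c \<le> v \<omega>" "\<And>\<omega>. v \<omega> \<le> C" and c: "c > 0"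
  defines "a \<equiv> (\<integral>\<omega>. v \<omega> \<partial>M)"
  defines "\<mu> \<equiv> distr (density M (\<lambda>\<omega>. ennreal (v \<omega> / a))) borel Y"
  shows "a \<ge> c" "real_distribution \<mu>"
    and "\<And>h :: real \<Rightarrow> 'c::{banach, second_countable_topology}. h \<in> borel_measurable borel \<Longrightarrow>
      (\<integral>x. h x \<partial>\<mu>) = (\<integral>\<omega>. v \<omega> *\<^sub>R h (Y \<omega>) \<partial>M) /\<^sub>R a"
proof -
  interpret M: prob_space M by (rule M)
  have int: "integrable M v"
  proof (rule M.integrable_const_bound[where B=C])
    have "norm (v \<omega>) \<le> C" for \<omega> using v(1)[of \<omega>] v(2)[of \<omega>] c unfolding real_norm_def by linarith
    then show "AE \<omega> in M. norm (v \<omega>) \<le> C" by simp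
  qed simp
  have "(\<integral>\<omega>. c \<partial>M) \<le> a" unfolding a_def using int v by (intro integral_mono) auto
  then show a: "a \<ge> c" by (simp add: M.prob_space)
  have vpos: "0 \<le> v \<omega> / a" for \<omega> using v(1)[of \<omega>] a c by simp
  have "(\<integral>\<^sup>+\<omega>. ennreal (v \<omega> / a) \<partial>M) = ennreal (\<integral>\<omega>. v \<omega> / a \<partial>M)"
    using int vpos by (intro nn_integral_eq_integral) auto
  also have "(\<integral>\<omega>. v \<omega> / a \<partial>M) = 1" using a c by (simp add: a_def)
  finally have "emeasure (density M (\<lambda>\<omega>. ennreal (v \<omega> / a))) (space M) = 1"
    by (simp add: emeasure_density cong: nn_integral_cong)
  then interpret D: prob_space "density M (\<lambda>\<omega>. ennreal (v \<omega> / a))" by (intro prob_spaceI) simp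
  show "real_distribution \<mu>" unfolding \<mu>_def by (rule D.real_distribution_distr) simp
  fix h :: "real \<Rightarrow> 'c" assume [measurable]: "h \<in> borel_measurable borel"
  have "(\<integral>x. h x \<partial>\<mu>) = (\<integral>\<omega>. h (Y \<omega>) \<partial>density M (\<lambda>\<omega>. ennreal (v \<omega> / a)))"
    unfolding \<mu>_def by (rule integral_distr) auto
  also have "\<dots> = (\<integral>\<omega>. (v \<omega> / a) *\<^sub>R h (Y \<omega>) \<partial>M)"
    using vpos by (intro integral_density) auto
  also have "\<dots> = (\<integral>\<omega>. inverse a *\<^sub>R (v \<omega> *\<^sub>R h (Y \<omega>)) \<partial>M)" by (simp add: divide_inverse mult.commute del: integral_scaleR_right)
  finally show "(\<integral>x. h x \<partial>\<mu>) = (\<integral>\<omega>. v \<omega> *\<^sub>R h (Y \<omega>) \<partial>M) /\<^sub>R a" unfolding integral_scaleR_right .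
qed

text \<open>The hypothesis says that the characteristic functions of the tilted laws converge, up to the
  normalising constants; these converge as well, by the case \<open>t = 0\<close>.\<close>

lemma positive_weight_levy:
  fixes v :: "nat \<Rightarrow> 'a \<Rightarrow> real" and Y :: "nat \<Rightarrow> 'a \<Rightarrow> real" and u :: "'b \<Rightarrow> real" and Z :: "'b \<Rightarrow> real"
  assumes M: "prob_space M" and N: "prob_space N"
    and meas: "\<And>n. v n \<in> borel_measurable M" "\<And>n. Y n \<in> borel_measurable M" "u \<in> borel_measurable N" "Z \<in> borel_measurable N"
    and v: "\<And>n \<omega>. c \<le> v n \<omega>" "\<And>n \<omega>. v n \<omega> \<le> C" and u: "\<And>\<omega>. c \<le> u \<omega>" "\<And>\<omega>. u \<omega> \<le> C" and c: "c > 0"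
    and cf: "\<And>t. (\<lambda>n. \<integral>\<omega>. v n \<omega> *\<^sub>R iexp (t * Y n \<omega>) \<partial>M) \<longlonglongrightarrow> (\<integral>\<omega>. u \<omega> *\<^sub>R iexp (t * Z \<omega>) \<partial>N)"
    and f: "\<And>x. isCont f x" "\<And>x. \<bar>f x\<bar> \<le> (K::real)"
  shows "(\<lambda>n. \<integral>\<omega>. v n \<omega> * f (Y n \<omega>) \<partial>M) \<longlonglongrightarrow> (\<integral>\<omega>. u \<omega> * f (Z \<omega>) \<partial>N)"
proof -
  have f_meas: "f \<in> borel_measurable borel"
    using f(1) by (intro borel_measurable_continuous_onI continuous_at_imp_continuous_on) auto
  define a where "a n = (\<integral>\<omega>. v n \<omega> \<partial>M)" for n
  define b where "b = (\<integral>\<omega>. u \<omega> \<partial>N)"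
  define \<mu> where "\<mu> n = distr (density M (\<lambda>\<omega>. ennreal (v n \<omega> / a n))) borel (Y n)" for n
  define \<nu> where "\<nu> = distr (density N (\<lambda>\<omega>. ennreal (u \<omega> / b))) borel Z"
  note W = weighted_distribution[of M "v n" "Y n" c C for n, OF M meas(1,2) v c, folded a_def, folded \<mu>_def]
  note U = weighted_distribution[of N u Z c C, OF N meas(3,4) u c, folded b_def, folded \<nu>_def]
  have "(\<lambda>n. \<integral>\<omega>. complex_of_real (v n \<omega>) \<partial>M) \<longlonglongrightarrow> (\<integral>\<omega>. complex_of_real (u \<omega>) \<partial>N)"
    using cf[of 0] by (simp add: scaleR_conv_of_real)
  then have ab: "a \<longlonglongrightarrow> b"
    unfolding a_def b_def integral_complex_of_real by (simp add: tendsto_of_real_iff)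
  have "b > 0" "\<And>n. a n > 0" using W(1) U(1) c by (auto intro: less_le_trans)
  have "weak_conv_m \<mu> \<nu>"
  proof (rule levy_continuity[OF W(2) U(2)])
    fix t
    have "(\<lambda>n. (\<integral>\<omega>. v n \<omega> *\<^sub>R iexp (t * Y n \<omega>) \<partial>M) /\<^sub>R a n) \<longlonglongrightarrow> (\<integral>\<omega>. u \<omega> *\<^sub>R iexp (t * Z \<omega>) \<partial>N) /\<^sub>R b"
      using \<open>b > 0\<close> by (intro tendsto_scaleR tendsto_inverse ab cf) auto
    then show "(\<lambda>n. char (\<mu> n) t) \<longlonglongrightarrow> char \<nu> t"
      unfolding char_def by (subst W(3), simp) (subst U(3), simp_all)
  qed
  then have "(\<lambda>n. \<integral>x. f x \<partial>\<mu> n) \<longlonglongrightarrow> (\<integral>x. f x \<partial>\<nu>)"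
    using f by (intro weak_conv_imp_integral_bdd_continuous_conv[OF W(2) U(2)]) auto
  then have "(\<lambda>n. a n * (\<integral>x. f x \<partial>\<mu> n)) \<longlonglongrightarrow> b * (\<integral>x. f x \<partial>\<nu>)" by (intro tendsto_mult ab)
  moreover have "a n * (\<integral>x. f x \<partial>\<mu> n) = (\<integral>\<omega>. v n \<omega> * f (Y n \<omega>) \<partial>M)" for n
    using \<open>a n > 0\<close> by (simp add: W(3)[OF f_meas])
  moreover have "b * (\<integral>x. f x \<partial>\<nu>) = (\<integral>\<omega>. u \<omega> * f (Z \<omega>) \<partial>N)"
    using \<open>b > 0\<close> by (simp add: U(3)[OF f_meas])
  ultimately show ?thesis by simp
qed

text \<open>Levy's continuity theorem with bounded complex weights: adding a large constant to the real and
  to the imaginary part of the weights turns them into densities of probability measures, up to a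
  normalisation.\<close>

lemma complex_weight_levy:
  fixes w :: "nat \<Rightarrow> 'a \<Rightarrow> complex" and Y :: "nat \<Rightarrow> 'a \<Rightarrow> real" and u :: "'b \<Rightarrow> complex" and Z :: "'b \<Rightarrow> real"
  assumes M: "prob_space M" and N: "prob_space N"
    and meas[measurable]: "\<And>n. w n \<in> borel_measurable M" "\<And>n. Y n \<in> borel_measurable M" "u \<in> borel_measurable N" "Z \<in> borel_measurable N"
    and w: "\<And>n \<omega>. norm (w n \<omega>) \<le> c" and u: "\<And>\<omega>. norm (u \<omega>) \<le> c"
    and cf1: "\<And>t. (\<lambda>n. \<integral>\<omega>. iexp (t * Y n \<omega>) \<partial>M) \<longlonglongrightarrow> (\<integral>\<omega>. iexp (t * Z \<omega>) \<partial>N)"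
    and cf: "\<And>t. (\<lambda>n. \<integral>\<omega>. w n \<omega> * iexp (t * Y n \<omega>) \<partial>M) \<longlonglongrightarrow> (\<integral>\<omega>. u \<omega> * iexp (t * Z \<omega>) \<partial>N)"
    and f: "\<And>x. isCont f x" "\<And>x. \<bar>f x\<bar> \<le> (K::real)"
  shows "(\<lambda>n. \<integral>\<omega>. w n \<omega> * complex_of_real (f (Y n \<omega>)) \<partial>M) \<longlonglongrightarrow> (\<integral>\<omega>. u \<omega> * complex_of_real (f (Z \<omega>)) \<partial>N)"
proof -
  interpret M: prob_space M by (rule M)
  interpret N: prob_space N by (rule N)
  have f_meas[measurable]: "f \<in> borel_measurable borel"
    using f(1) by (intro borel_measurable_continuous_onI continuous_at_imp_continuous_on) auto
  have c0: "0 \<le> c" using u norm_ge_zero order_trans by blast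
  define b where "b = 2 * c + 1"
  have real_weight: "(\<lambda>n. \<integral>\<omega>. v n \<omega> * f (Y n \<omega>) \<partial>M) \<longlonglongrightarrow> (\<integral>\<omega>. r \<omega> * f (Z \<omega>) \<partial>N)"
    if [measurable]: "\<And>n. v n \<in> borel_measurable M" "r \<in> borel_measurable N"
      and v: "\<And>n \<omega>. \<bar>v n \<omega>\<bar> \<le> c" and r: "\<And>\<omega>. \<bar>r \<omega>\<bar> \<le> c"
      and cfv: "\<And>t. (\<lambda>n. \<integral>\<omega>. v n \<omega> *\<^sub>R iexp (t * Y n \<omega>) \<partial>M) \<longlonglongrightarrow> (\<integral>\<omega>. r \<omega> *\<^sub>R iexp (t * Z \<omega>) \<partial>N)"
    for v :: "nat \<Rightarrow> 'a \<Rightarrow> real" and r :: "'b \<Rightarrow> real"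
  proof -
    have iv: "integrable M (\<lambda>\<omega>. v n \<omega> *\<^sub>R iexp (t * Y n \<omega>))" "integrable M (\<lambda>\<omega>. v n \<omega> * f (Y n \<omega>))"
      "integrable M (\<lambda>\<omega>. iexp (t * Y n \<omega>))" "integrable M (\<lambda>\<omega>. f (Y n \<omega>))" for n t
      by (rule M.integrable_const_bound[where B=c], use v in simp, measurable)
         (rule M.integrable_const_bound[where B="c * K"], use v f(2) c0 in \<open>simp add: abs_mult mult_mono\<close>, measurable,
          rule M.integrable_const_bound[where B=1], simp, measurable,
          rule M.integrable_const_bound[where B=K], use f(2) in simp, measurable)
    have ir: "integrable N (\<lambda>\<omega>. r \<omega> *\<^sub>R iexp (t * Z \<omega>))" "integrable N (\<lambda>\<omega>. r \<omega> * f (Z \<omega>))"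
      "integrable N (\<lambda>\<omega>. iexp (t * Z \<omega>))" "integrable N (\<lambda>\<omega>. f (Z \<omega>))" for t
      by (rule N.integrable_const_bound[where B=c], use r in simp, measurable)
         (rule N.integrable_const_bound[where B="c * K"], use r f(2) c0 in \<open>simp add: abs_mult mult_mono\<close>, measurable,
          rule N.integrable_const_bound[where B=1], simp, measurable,
          rule N.integrable_const_bound[where B=K], use f(2) in simp, measurable)
    have "(\<lambda>n. \<integral>\<omega>. (v n \<omega> + b) * f (Y n \<omega>) \<partial>M) \<longlonglongrightarrow> (\<integral>\<omega>. (r \<omega> + b) * f (Z \<omega>) \<partial>N)"
    proof (rule positive_weight_levy[OF M N, where v="\<lambda>n \<omega>. v n \<omega> + b" and Y=Y and u="\<lambda>\<omega>. r \<omega> + b" and Z=Z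
        and f=f and c="c + 1" and C="3 * c + 1"])
      fix t
      have "(\<lambda>n. (\<integral>\<omega>. v n \<omega> *\<^sub>R iexp (t * Y n \<omega>) \<partial>M) + b *\<^sub>R (\<integral>\<omega>. iexp (t * Y n \<omega>) \<partial>M))
          \<longlonglongrightarrow> (\<integral>\<omega>. r \<omega> *\<^sub>R iexp (t * Z \<omega>) \<partial>N) + b *\<^sub>R (\<integral>\<omega>. iexp (t * Z \<omega>) \<partial>N)"
        by (intro tendsto_intros cfv cf1)
      then show "(\<lambda>n. \<integral>\<omega>. (v n \<omega> + b) *\<^sub>R iexp (t * Y n \<omega>) \<partial>M) \<longlonglongrightarrow> (\<integral>\<omega>. (r \<omega> + b) *\<^sub>R iexp (t * Z \<omega>) \<partial>N)"
        using iv ir by (simp only: scaleR_left_distrib Bochner_Integration.integral_add integrable_scaleR_right integral_scaleR_right)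
    next
      show "c + 1 \<le> v n \<omega> + b" "v n \<omega> + b \<le> 3 * c + 1" for n \<omega>
        using v[of n \<omega>] by (auto simp: b_def abs_le_iff)
      show "c + 1 \<le> r \<omega> + b" "r \<omega> + b \<le> 3 * c + 1" for \<omega>
        using r[of \<omega>] by (auto simp: b_def abs_le_iff)
    qed (use f c0 in auto)
    moreover have "(\<lambda>n. \<integral>\<omega>. 1 * f (Y n \<omega>) \<partial>M) \<longlonglongrightarrow> (\<integral>\<omega>. 1 * f (Z \<omega>) \<partial>N)"
      by (rule positive_weight_levy[OF M N, where v="\<lambda>_ _. 1" and Y=Y and u="\<lambda>_. 1" and Z=Z and f=f and c=1 and C=1]) (use f cf1 in auto)
    ultimately have "(\<lambda>n. (\<integral>\<omega>. (v n \<omega> + b) * f (Y n \<omega>) \<partial>M) - b * (\<integral>\<omega>. 1 * f (Y n \<omega>) \<partial>M))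
        \<longlonglongrightarrow> (\<integral>\<omega>. (r \<omega> + b) * f (Z \<omega>) \<partial>N) - b * (\<integral>\<omega>. 1 * f (Z \<omega>) \<partial>N)"
      by (intro tendsto_intros)
    then show ?thesis using iv ir by (simp add: distrib_right)
  qed
  have iw: "integrable M (\<lambda>\<omega>. w n \<omega> * iexp (t * Y n \<omega>))" "integrable M (\<lambda>\<omega>. w n \<omega> * complex_of_real (f (Y n \<omega>)))" for n t
    by (rule M.integrable_const_bound[where B=c], use w in \<open>simp add: norm_mult\<close>, measurable)
       (rule M.integrable_const_bound[where B="c * K"], use w f(2) c0 in \<open>simp add: norm_mult mult_mono\<close>, measurable)
  have iu: "integrable N (\<lambda>\<omega>. u \<omega> * iexp (t * Z \<omega>))" "integrable N (\<lambda>\<omega>. u \<omega> * complex_of_real (f (Z \<omega>)))" for t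
    by (rule N.integrable_const_bound[where B=c], use u in \<open>simp add: norm_mult\<close>, measurable)
       (rule N.integrable_const_bound[where B="c * K"], use u f(2) c0 in \<open>simp add: norm_mult mult_mono\<close>, measurable)
  have cnj_exp: "cnj (z * iexp (- t * y)) = cnj z * iexp (t * y)" for z t y
    by (simp add: exp_cnj)
  have conj: "(\<lambda>n. \<integral>\<omega>. cnj (w n \<omega>) * iexp (t * Y n \<omega>) \<partial>M) \<longlonglongrightarrow> (\<integral>\<omega>. cnj (u \<omega>) * iexp (t * Z \<omega>) \<partial>N)" for t
    using tendsto_cnj[OF cf[of "- t"]] unfolding cnj_exp[symmetric] Bochner_Integration.integral_cnj .
  have [measurable]: "cnj \<in> borel_measurable borel"
    by (intro borel_measurable_continuous_onI continuous_intros)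
  have icw: "integrable M (\<lambda>\<omega>. cnj (w n \<omega>) * iexp (t * Y n \<omega>))" for n t
    using w by (auto intro!: M.integrable_const_bound[where B=c] AE_I2 simp: norm_mult)
  have icu: "integrable N (\<lambda>\<omega>. cnj (u \<omega>) * iexp (t * Z \<omega>))" for t
    using u by (auto intro!: N.integrable_const_bound[where B=c] AE_I2 simp: norm_mult)
  have Re_eq: "Re z *\<^sub>R e = (z * e + cnj z * e) / 2" and Im_eq: "Im z *\<^sub>R e = (z * e - cnj z * e) / (2 * \<i>)" for z e
    by (simp_all add: scaleR_conv_of_real distrib_right[symmetric] left_diff_distrib[symmetric] complex_add_cnj complex_diff_cnj,
        simp add: complex_eq_iff)
  have R: "(\<lambda>n. \<integral>\<omega>. Re (w n \<omega>) * f (Y n \<omega>) \<partial>M) \<longlonglongrightarrow> (\<integral>\<omega>. Re (u \<omega>) * f (Z \<omega>) \<partial>N)"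
  proof (rule real_weight)
    fix t
    have "(\<lambda>n. ((\<integral>\<omega>. w n \<omega> * iexp (t * Y n \<omega>) \<partial>M) + (\<integral>\<omega>. cnj (w n \<omega>) * iexp (t * Y n \<omega>) \<partial>M)) / 2)
        \<longlonglongrightarrow> ((\<integral>\<omega>. u \<omega> * iexp (t * Z \<omega>) \<partial>N) + (\<integral>\<omega>. cnj (u \<omega>) * iexp (t * Z \<omega>) \<partial>N)) / 2"
      by (intro tendsto_intros cf conj) auto
    then show "(\<lambda>n. \<integral>\<omega>. Re (w n \<omega>) *\<^sub>R iexp (t * Y n \<omega>) \<partial>M) \<longlonglongrightarrow> (\<integral>\<omega>. Re (u \<omega>) *\<^sub>R iexp (t * Z \<omega>) \<partial>N)"
      unfolding Re_eq using iw(1) icw iu(1) icu by (simp only: integral_divide_zero Bochner_Integration.integral_add)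
  qed (auto intro: order_trans[OF abs_Re_le_cmod] w u)
  have I: "(\<lambda>n. \<integral>\<omega>. Im (w n \<omega>) * f (Y n \<omega>) \<partial>M) \<longlonglongrightarrow> (\<integral>\<omega>. Im (u \<omega>) * f (Z \<omega>) \<partial>N)"
  proof (rule real_weight)
    fix t
    have "(\<lambda>n. ((\<integral>\<omega>. w n \<omega> * iexp (t * Y n \<omega>) \<partial>M) - (\<integral>\<omega>. cnj (w n \<omega>) * iexp (t * Y n \<omega>) \<partial>M)) / (2 * \<i>))
        \<longlonglongrightarrow> ((\<integral>\<omega>. u \<omega> * iexp (t * Z \<omega>) \<partial>N) - (\<integral>\<omega>. cnj (u \<omega>) * iexp (t * Z \<omega>) \<partial>N)) / (2 * \<i>)"
      by (intro tendsto_intros cf conj) auto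
    then show "(\<lambda>n. \<integral>\<omega>. Im (w n \<omega>) *\<^sub>R iexp (t * Y n \<omega>) \<partial>M) \<longlonglongrightarrow> (\<integral>\<omega>. Im (u \<omega>) *\<^sub>R iexp (t * Z \<omega>) \<partial>N)"
      unfolding Im_eq using iw(1) icw iu(1) icu by (simp only: integral_divide_zero Bochner_Integration.integral_diff)
  qed (auto intro: order_trans[OF abs_Im_le_cmod] w u)
  have split: "(\<integral>\<omega>. W \<omega> * complex_of_real (f (X \<omega>)) \<partial>L) = Complex (\<integral>\<omega>. Re (W \<omega>) * f (X \<omega>) \<partial>L) (\<integral>\<omega>. Im (W \<omega>) * f (X \<omega>) \<partial>L)"
    if "integrable L (\<lambda>\<omega>. W \<omega> * complex_of_real (f (X \<omega>)))" for L :: "'l measure" and W X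
    using integral_Re[OF that] integral_Im[OF that] by (simp add: complex_eq_iff)
  show ?thesis
    unfolding split[OF iw(2)] split[OF iu(2)] by (intro tendsto_Complex R I)
qed

text \<open>The tent functions \<open>ramp (t + 1 - a) - ramp (t - a)\<close>, one for every integer \<open>a\<close>, form a
  partition of unity; finite sums of them telescope.\<close>

definition ramp :: "real \<Rightarrow> real" where
  "ramp t = max 0 (min 1 t)"

definition tent :: "real \<Rightarrow> real" where
  "tent t = ramp (t + 1) - ramp t"

lemma isCont_tent: "isCont tent x"
  unfolding tent_def ramp_def by (intro continuous_intros)

lemma tent_bounds: "0 \<le> tent t" "tent t \<le> 1" and tent_support: "tent t \<noteq> 0 \<Longrightarrow> \<bar>t\<bar> < 1"
  by (auto simp: tent_def ramp_def max_def min_def split: if_splits)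

definition tent_sum :: "nat \<Rightarrow> real \<Rightarrow> real" where
  "tent_sum K t = (\<Sum>j\<le>2 * K. tent (t - (real j - real K)))"

lemma tent_sum_eq: "tent_sum K t = ramp (t + real K + 1) - ramp (t - real K)"
proof -
  have "(\<Sum>j\<le>m. tent (t - (real j - real K))) = ramp (t + real K + 1) - ramp (t + real K - real m)" for m
    by (induct m) (auto simp: tent_def algebra_simps)
  then show ?thesis by (simp add: tent_sum_def)
qed

lemma tent_sum_bounds: "0 \<le> tent_sum K t" "tent_sum K t \<le> 1" and tent_sum_one: "\<bar>t\<bar> \<le> real K \<Longrightarrow> tent_sum K t = 1"
  by (auto simp: tent_sum_eq ramp_def max_def min_def split: if_splits)

text \<open>A point sees only the tents of grid points within distance \<open>\<delta>\<close>, where \<open>\<phi>\<close> differs by at most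
  \<open>L \<delta>\<close>; the missing mass \<open>1 - tent_sum\<close> is charged with the bound of \<open>\<phi>\<close>.\<close>

lemma tent_sum_approx:
  fixes \<phi> :: "real \<Rightarrow> real"
  assumes \<delta>: "\<delta> > 0" and lip: "\<And>s t. \<bar>\<phi> s - \<phi> t\<bar> \<le> L * \<bar>s - t\<bar>" and bdd: "\<And>t. \<bar>\<phi> t\<bar> \<le> H" and L: "0 \<le> L"
  shows "\<bar>\<phi> t - (\<Sum>j\<le>2 * K. \<phi> ((real j - real K) * \<delta>) * tent (t / \<delta> - (real j - real K)))\<bar>
    \<le> L * \<delta> + H * (1 - tent_sum K (t / \<delta>))"
proof -
  let ?a = "\<lambda>j. real j - real K"
  let ?\<tau> = "\<lambda>j. tent (t / \<delta> - ?a j)"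
  have "\<phi> t - (\<Sum>j\<le>2 * K. \<phi> (?a j * \<delta>) * ?\<tau> j) = (\<Sum>j\<le>2 * K. (\<phi> t - \<phi> (?a j * \<delta>)) * ?\<tau> j) + \<phi> t * (1 - tent_sum K (t / \<delta>))"
    by (simp add: tent_sum_def sum_subtractf left_diff_distrib right_diff_distrib sum_distrib_left)
  also have "\<bar>\<dots>\<bar> \<le> (\<Sum>j\<le>2 * K. \<bar>(\<phi> t - \<phi> (?a j * \<delta>)) * ?\<tau> j\<bar>) + \<bar>\<phi> t * (1 - tent_sum K (t / \<delta>))\<bar>"
    by (intro order_trans[OF abs_triangle_ineq] add_mono sum_abs) auto
  also have "\<dots> \<le> (\<Sum>j\<le>2 * K. L * \<delta> * ?\<tau> j) + H * (1 - tent_sum K (t / \<delta>))"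
  proof (intro add_mono sum_mono)
    fix j
    show "\<bar>(\<phi> t - \<phi> (?a j * \<delta>)) * ?\<tau> j\<bar> \<le> L * \<delta> * ?\<tau> j"
    proof (cases "?\<tau> j = 0")
      case False
      then have "\<bar>t / \<delta> - ?a j\<bar> < 1" by (rule tent_support)
      then have "\<bar>t - ?a j * \<delta>\<bar> \<le> \<delta>" using \<delta> by (simp add: field_simps abs_less_iff abs_le_iff)
      then have "\<bar>\<phi> t - \<phi> (?a j * \<delta>)\<bar> \<le> L * \<delta>"
        using L by (intro order_trans[OF lip] mult_left_mono)
      then show ?thesis using tent_bounds by (simp add: abs_mult mult_right_mono)
    qed simp
    show "\<bar>\<phi> t * (1 - tent_sum K (t / \<delta>))\<bar> \<le> H * (1 - tent_sum K (t / \<delta>))"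
      using bdd[of t] tent_sum_bounds[of K "t / \<delta>"] by (simp add: abs_mult mult_right_mono)
  qed
  also have "(\<Sum>j\<le>2 * K. L * \<delta> * ?\<tau> j) = L * \<delta> * tent_sum K (t / \<delta>)" by (simp add: tent_sum_def sum_distrib_left)
  also have "\<dots> \<le> L * \<delta>" using tent_sum_bounds[of K "t / \<delta>"] L \<delta> by (simp add: mult_left_le)
  finally show ?thesis by simp
qed

text \<open>Induction on the number \<open>l\<close> of coordinates in which a Lipschitz function has replaced the
  characters. In the step, the coordinate \<open>l\<close> is discretised by tents, and for each tent the weighted
  continuity theorem applies to the real variable \<open>X n l\<close>, the weight being the rest of the
  integrand.\<close>

lemma fdd_convergence_partial:
  fixes X :: "nat \<Rightarrow> 'a \<Rightarrow> nat \<Rightarrow> real" and Y :: "'b \<Rightarrow> nat \<Rightarrow> real" and F :: "(nat \<Rightarrow> real) \<Rightarrow> real"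
  assumes M: "prob_space M" and N: "prob_space N"
    and X[measurable]: "\<And>n. X n \<in> M \<rightarrow>\<^sub>M PiM UNIV (\<lambda>_. borel)" and Y[measurable]: "Y \<in> N \<rightarrow>\<^sub>M PiM UNIV (\<lambda>_. borel)"
    and cf: "\<And>\<theta>. (\<lambda>n. \<integral>\<omega>. iexp (\<Sum>i<k. \<theta> i * X n \<omega> i) \<partial>M) \<longlonglongrightarrow> (\<integral>\<omega>. iexp (\<Sum>i<k. \<theta> i * Y \<omega> i) \<partial>N)"
    and l: "l \<le> k" and F: "F \<in> borel_measurable (PiM UNIV (\<lambda>_. borel))" and H: "\<And>y. \<bar>F y\<bar> \<le> H"
    and L: "0 \<le> L" "\<And>y z. \<bar>F y - F z\<bar> \<le> L * (\<Sum>i<l. \<bar>y i - z i\<bar>)"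
  shows "(\<lambda>n. \<integral>\<omega>. complex_of_real (F (X n \<omega>)) * iexp (\<Sum>i\<in>{l..<k}. \<theta> i * X n \<omega> i) \<partial>M)
    \<longlonglongrightarrow> (\<integral>\<omega>. complex_of_real (F (Y \<omega>)) * iexp (\<Sum>i\<in>{l..<k}. \<theta> i * Y \<omega> i) \<partial>N)"
  using l F H L
proof (induct l arbitrary: F \<theta>)
  case 0
  define r where "r = F (\<lambda>_. 0)"
  have "F y = r" for y using 0(5)[of y "\<lambda>_. 0"] by (simp add: r_def)
  with tendsto_mult[OF tendsto_const[of "complex_of_real r"] cf[of \<theta>]]
  show ?case by (simp only: integral_mult_right_zero atLeast0LessThan)
next
  case (Suc l)
  interpret M: prob_space M by (rule M)
  interpret N: prob_space N by (rule N)
  note [measurable] = Suc(3)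
  have coord[measurable]: "(\<lambda>\<omega>. X n \<omega> i) \<in> borel_measurable M" "(\<lambda>\<omega>. Y \<omega> i) \<in> borel_measurable N" for n i
    by measurable
  have cf1: "(\<lambda>n. \<integral>\<omega>. iexp (t * X n \<omega> l) \<partial>M) \<longlonglongrightarrow> (\<integral>\<omega>. iexp (t * Y \<omega> l) \<partial>N)" for t
  proof -
    have "(\<Sum>i<k. (if i = l then t else 0) * y i) = t * y l" for y :: "nat \<Rightarrow> real"
      using Suc(2) by (subst sum.remove[of _ l]) auto
    then show ?thesis using cf[of "\<lambda>i. if i = l then t else 0"] by simp
  qed
  have H0: "0 \<le> H" using Suc(4) abs_ge_zero order_trans by blast
  define e where "e y = iexp (\<Sum>i\<in>{Suc l..<k}. \<theta> i * y i)" for y :: "nat \<Rightarrow> real"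
  have e_norm: "norm (e y) = 1" for y by (simp add: e_def)
  have e_meas[measurable]: "(\<lambda>\<omega>. e (X n \<omega>)) \<in> borel_measurable M" "(\<lambda>\<omega>. e (Y \<omega>)) \<in> borel_measurable N" for n
    unfolding e_def by measurable
  have upd_meas: "(\<lambda>y. F (fun_upd y l a)) \<in> borel_measurable (PiM UNIV (\<lambda>_. borel))" for a :: real
  proof -
    have "(\<lambda>y. fun_upd y l a) \<in> PiM UNIV (\<lambda>_. borel) \<rightarrow>\<^sub>M PiM UNIV (\<lambda>_. borel :: real measure)"
    proof (rule measurable_PiM_single')
      fix i show "(\<lambda>y. fun_upd y l a i) \<in> PiM UNIV (\<lambda>_. borel) \<rightarrow>\<^sub>M (borel :: real measure)" by (cases "i = l") auto
    qed auto
    then show ?thesis by measurable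
  qed
  note [measurable] = measurable_compose[OF X upd_meas] measurable_compose[OF Y upd_meas]
  have grid: "(\<lambda>n. \<integral>\<omega>. (complex_of_real (F (fun_upd (X n \<omega>) l a)) * e (X n \<omega>)) * complex_of_real (g (X n \<omega> l)) \<partial>M)
      \<longlonglongrightarrow> (\<integral>\<omega>. (complex_of_real (F (fun_upd (Y \<omega>) l a)) * e (Y \<omega>)) * complex_of_real (g (Y \<omega> l)) \<partial>N)"
    if g: "\<And>x. isCont g x" "\<And>x. \<bar>g x\<bar> \<le> 1" for a and g :: "real \<Rightarrow> real"
  proof (rule complex_weight_levy[OF M N, where w="\<lambda>n \<omega>. complex_of_real (F (fun_upd (X n \<omega>) l a)) * e (X n \<omega>)"
      and Y="\<lambda>n \<omega>. X n \<omega> l" and u="\<lambda>\<omega>. complex_of_real (F (fun_upd (Y \<omega>) l a)) * e (Y \<omega>)"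
      and Z="\<lambda>\<omega>. Y \<omega> l" and f=g and c=H and K=1])
    fix t
    have lip: "\<bar>F (fun_upd y l a) - F (fun_upd z l a)\<bar> \<le> L * (\<Sum>i<l. \<bar>y i - z i\<bar>)" for y z
    proof -
      have eq: "(\<Sum>i<Suc l. \<bar>fun_upd y l a i - fun_upd z l a i\<bar>) = (\<Sum>i<l. \<bar>y i - z i\<bar>)" by simp
      show ?thesis using Suc(6)[of "fun_upd y l a" "fun_upd z l a"] unfolding eq .
    qed
    have sum: "(\<Sum>i\<in>{l..<k}. fun_upd \<theta> l t i * y i) = t * y l + (\<Sum>i\<in>{Suc l..<k}. \<theta> i * y i)" for y :: "nat \<Rightarrow> real"
      using Suc(2) by (subst sum.atLeast_Suc_lessThan) auto
    have exps: "complex_of_real (F (fun_upd y l a)) * iexp (\<Sum>i\<in>{l..<k}. fun_upd \<theta> l t i * y i)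
        = (complex_of_real (F (fun_upd y l a)) * e y) * iexp (t * y l)" for y
      unfolding sum e_def by (simp add: distrib_left exp_add)
    show "(\<lambda>n. \<integral>\<omega>. (complex_of_real (F (fun_upd (X n \<omega>) l a)) * e (X n \<omega>)) * iexp (t * X n \<omega> l) \<partial>M)
      \<longlonglongrightarrow> (\<integral>\<omega>. (complex_of_real (F (fun_upd (Y \<omega>) l a)) * e (Y \<omega>)) * iexp (t * Y \<omega> l) \<partial>N)"
      using Suc(1)[OF _ upd_meas Suc(4) Suc(5) lip, of "fun_upd \<theta> l t"] Suc(2) unfolding exps by simp
  qed (use g cf1 Suc(4) in \<open>auto simp: norm_mult e_norm\<close>)
  show ?case
  proof (rule tendsto_by_approximation)
    fix \<epsilon> :: real assume \<epsilon>: "\<epsilon> > 0"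
    define \<delta> where "\<delta> = \<epsilon> / (4 * (L + 1))"
    have \<delta>: "\<delta> > 0" "L * \<delta> \<le> \<epsilon> / 4" using \<epsilon> Suc(5) by (auto simp: \<delta>_def field_simps)
    have "(\<lambda>K. \<integral>\<omega>. 1 - tent_sum K (Y \<omega> l / \<delta>) \<partial>N) \<longlonglongrightarrow> (\<integral>\<omega>. 0 \<partial>N)"
    proof (rule integral_dominated_convergence[where w="\<lambda>_. 1"])
      show "AE \<omega> in N. (\<lambda>K. 1 - tent_sum K (Y \<omega> l / \<delta>)) \<longlonglongrightarrow> 0"
      proof (rule AE_I2)
        fix \<omega>
        obtain K0 :: nat where K0: "\<bar>Y \<omega> l / \<delta>\<bar> \<le> real K0" using real_arch_simple by blast
        show "(\<lambda>K. 1 - tent_sum K (Y \<omega> l / \<delta>)) \<longlonglongrightarrow> 0"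
          by (intro tendsto_eventually eventually_sequentiallyI[of K0]) (use K0 in \<open>simp add: tent_sum_one\<close>)
      qed
      show "AE \<omega> in N. norm (1 - tent_sum K (Y \<omega> l / \<delta>)) \<le> 1" for K
        using tent_sum_bounds[of K] by (simp add: abs_le_iff)
    qed (simp_all add: tent_sum_eq ramp_def)
    then have "\<forall>\<^sub>F K in sequentially. (\<integral>\<omega>. 1 - tent_sum K (Y \<omega> l / \<delta>) \<partial>N) < \<epsilon> / (4 * (H + 1))"
      using \<epsilon> H0 by (intro order_tendstoD(2)) auto
    then obtain K where K: "(\<integral>\<omega>. 1 - tent_sum K (Y \<omega> l / \<delta>) \<partial>N) < \<epsilon> / (4 * (H + 1))"
      unfolding eventually_sequentially by blast
    let ?a = "\<lambda>j. (real j - real K) * \<delta>"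
    let ?\<tau> = "\<lambda>j t. tent (t / \<delta> - (real j - real K))"
    define G where "G y = (\<Sum>j\<le>2 * K. (complex_of_real (F (fun_upd y l (?a j))) * e y) * complex_of_real (?\<tau> j (y l)))" for y
    have \<tau>: "isCont (?\<tau> j) t" for j t
    proof (rule isCont_o2[OF _ isCont_tent])
      show "isCont (\<lambda>t. t / \<delta> - (real j - real K)) t" using \<delta>(1) by (intro continuous_intros) simp
    qed
    have \<tau>_meas[measurable]: "?\<tau> j \<in> borel_measurable borel" for j
      using \<tau> by (intro borel_measurable_continuous_onI continuous_at_imp_continuous_on) auto
    have \<tau>_bdd: "\<bar>?\<tau> j t\<bar> \<le> 1" for j t
      using tent_bounds[of "t / \<delta> - (real j - real K)"] by linarith
    have int: "integrable M (\<lambda>\<omega>. (complex_of_real (F (fun_upd (X n \<omega>) l (?a j))) * e (X n \<omega>)) * complex_of_real (?\<tau> j (X n \<omega> l)))"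
      "integrable N (\<lambda>\<omega>. (complex_of_real (F (fun_upd (Y \<omega>) l (?a j))) * e (Y \<omega>)) * complex_of_real (?\<tau> j (Y \<omega> l)))" for n j
    proof -
      have nb: "norm ((complex_of_real (F (fun_upd y l (?a j))) * e y) * complex_of_real (?\<tau> j (y l))) \<le> H" for y
      proof -
        have "\<bar>F (fun_upd y l (?a j))\<bar> * \<bar>?\<tau> j (y l)\<bar> \<le> H * 1"
          by (intro mult_mono Suc(4) \<tau>_bdd H0) auto
        then show ?thesis by (simp add: norm_mult e_norm)
      qed
      show "integrable M (\<lambda>\<omega>. (complex_of_real (F (fun_upd (X n \<omega>) l (?a j))) * e (X n \<omega>)) * complex_of_real (?\<tau> j (X n \<omega> l)))"
        "integrable N (\<lambda>\<omega>. (complex_of_real (F (fun_upd (Y \<omega>) l (?a j))) * e (Y \<omega>)) * complex_of_real (?\<tau> j (Y \<omega> l)))"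
        by (rule M.integrable_const_bound[where B=H, OF AE_I2], rule nb, measurable)
           (rule N.integrable_const_bound[where B=H, OF AE_I2], rule nb, measurable)
    qed
    have G_conv: "(\<lambda>n. \<integral>\<omega>. G (X n \<omega>) \<partial>M) \<longlonglongrightarrow> (\<integral>\<omega>. G (Y \<omega>) \<partial>N)"
      unfolding G_def Bochner_Integration.integral_sum[OF int(1)] Bochner_Integration.integral_sum[OF int(2)]
      by (intro tendsto_sum grid \<tau> \<tau>_bdd)
    have G_int: "integrable M (\<lambda>\<omega>. G (X n \<omega>))" "integrable N (\<lambda>\<omega>. G (Y \<omega>))" for n
      unfolding G_def using int by auto
    have F_int: "integrable M (\<lambda>\<omega>. complex_of_real (F (X n \<omega>)) * e (X n \<omega>))" "integrable N (\<lambda>\<omega>. complex_of_real (F (Y \<omega>)) * e (Y \<omega>))" for n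
      by (rule M.integrable_const_bound[where B=H, OF AE_I2], use Suc(4) in \<open>simp add: norm_mult e_norm\<close>, measurable)
         (rule N.integrable_const_bound[where B=H, OF AE_I2], use Suc(4) in \<open>simp add: norm_mult e_norm\<close>, measurable)
    have pointwise: "norm (complex_of_real (F y) * e y - G y) \<le> L * \<delta> + H * (1 - tent_sum K (y l / \<delta>))" for y
    proof -
      have "G y = complex_of_real (\<Sum>j\<le>2 * K. F (fun_upd y l (?a j)) * ?\<tau> j (y l)) * e y"
        unfolding G_def of_real_sum sum_distrib_right by (intro sum.cong refl) (simp add: mult_ac)
      then have "complex_of_real (F y) * e y - G y
          = complex_of_real (F y - (\<Sum>j\<le>2 * K. F (fun_upd y l (?a j)) * ?\<tau> j (y l))) * e y"
        by (simp only: of_real_diff left_diff_distrib)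
      then have "norm (complex_of_real (F y) * e y - G y)
          = \<bar>F (fun_upd y l (y l)) - (\<Sum>j\<le>2 * K. F (fun_upd y l (?a j)) * ?\<tau> j (y l))\<bar>"
        by (simp only: norm_mult e_norm mult_1_right norm_of_real fun_upd_triv)
      also have "\<dots> \<le> L * \<delta> + H * (1 - tent_sum K (y l / \<delta>))"
      proof (rule tent_sum_approx[OF \<delta>(1) _ Suc(4) Suc(5)])
        fix s t
        have eq: "(\<Sum>i<Suc l. \<bar>fun_upd y l s i - fun_upd y l t i\<bar>) = \<bar>s - t\<bar>" by simp
        show "\<bar>F (fun_upd y l s) - F (fun_upd y l t)\<bar> \<le> L * \<bar>s - t\<bar>"
          using Suc(6)[of "fun_upd y l s" "fun_upd y l t"] unfolding eq .
      qed
      finally show ?thesis .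
    qed
    have s_int: "integrable M (\<lambda>\<omega>. 1 - tent_sum K (X n \<omega> l / \<delta>))" "integrable N (\<lambda>\<omega>. 1 - tent_sum K (Y \<omega> l / \<delta>))" for n
    proof -
      have [measurable]: "tent_sum K \<in> borel_measurable borel" unfolding tent_sum_eq[abs_def] ramp_def by measurable
      show "integrable M (\<lambda>\<omega>. 1 - tent_sum K (X n \<omega> l / \<delta>))"
        by (rule M.integrable_const_bound[where B=1, OF AE_I2], use tent_sum_bounds[of K] in \<open>simp add: abs_le_iff\<close>, measurable)
      show "integrable N (\<lambda>\<omega>. 1 - tent_sum K (Y \<omega> l / \<delta>))"
        by (rule N.integrable_const_bound[where B=1, OF AE_I2], use tent_sum_bounds[of K] in \<open>simp add: abs_le_iff\<close>, measurable)
    qed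
    have XF: "norm ((\<integral>\<omega>. complex_of_real (F (X n \<omega>)) * e (X n \<omega>) \<partial>M) - (\<integral>\<omega>. G (X n \<omega>) \<partial>M))
        \<le> L * \<delta> + H * (\<integral>\<omega>. 1 - tent_sum K (X n \<omega> l / \<delta>) \<partial>M)" for n
    proof -
      have "norm ((\<integral>\<omega>. complex_of_real (F (X n \<omega>)) * e (X n \<omega>) \<partial>M) - (\<integral>\<omega>. G (X n \<omega>) \<partial>M))
          = norm (\<integral>\<omega>. complex_of_real (F (X n \<omega>)) * e (X n \<omega>) - G (X n \<omega>) \<partial>M)"
        using F_int G_int by simp
      also have "\<dots> \<le> (\<integral>\<omega>. norm (complex_of_real (F (X n \<omega>)) * e (X n \<omega>) - G (X n \<omega>)) \<partial>M)" by (rule integral_norm_bound)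
      also have "\<dots> \<le> (\<integral>\<omega>. L * \<delta> + H * (1 - tent_sum K (X n \<omega> l / \<delta>)) \<partial>M)"
        using F_int G_int s_int by (intro integral_mono pointwise) auto
      also have "\<dots> = L * \<delta> + H * (\<integral>\<omega>. 1 - tent_sum K (X n \<omega> l / \<delta>) \<partial>M)"
        using s_int(1)[of n] by (simp add: M.prob_space del: Bochner_Integration.integral_diff)
      finally show ?thesis .
    qed
    have YF: "norm ((\<integral>\<omega>. complex_of_real (F (Y \<omega>)) * e (Y \<omega>) \<partial>N) - (\<integral>\<omega>. G (Y \<omega>) \<partial>N))
        \<le> L * \<delta> + H * (\<integral>\<omega>. 1 - tent_sum K (Y \<omega> l / \<delta>) \<partial>N)"
    proof -
      have "norm ((\<integral>\<omega>. complex_of_real (F (Y \<omega>)) * e (Y \<omega>) \<partial>N) - (\<integral>\<omega>. G (Y \<omega>) \<partial>N))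
          = norm (\<integral>\<omega>. complex_of_real (F (Y \<omega>)) * e (Y \<omega>) - G (Y \<omega>) \<partial>N)"
        using F_int G_int by simp
      also have "\<dots> \<le> (\<integral>\<omega>. norm (complex_of_real (F (Y \<omega>)) * e (Y \<omega>) - G (Y \<omega>)) \<partial>N)" by (rule integral_norm_bound)
      also have "\<dots> \<le> (\<integral>\<omega>. L * \<delta> + H * (1 - tent_sum K (Y \<omega> l / \<delta>)) \<partial>N)"
        using F_int G_int s_int by (intro integral_mono pointwise) auto
      also have "\<dots> = L * \<delta> + H * (\<integral>\<omega>. 1 - tent_sum K (Y \<omega> l / \<delta>) \<partial>N)"
        using s_int(2) by (simp add: N.prob_space del: Bochner_Integration.integral_diff)
      finally show ?thesis .
    qed
    have H_small: "H * r \<le> \<epsilon> / 4" if "r < \<epsilon> / (4 * (H + 1))" "0 \<le> r" for r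
    proof -
      have "H * r \<le> (H + 1) * (\<epsilon> / (4 * (H + 1)))" using that H0 by (intro mult_mono) auto
      also have "\<dots> = \<epsilon> / 4" using H0 by (simp add: divide_simps)
      finally show ?thesis .
    qed
    have s_conv: "(\<lambda>n. \<integral>\<omega>. 1 - tent_sum K (X n \<omega> l / \<delta>) \<partial>M) \<longlonglongrightarrow> (\<integral>\<omega>. 1 - tent_sum K (Y \<omega> l / \<delta>) \<partial>N)"
    proof -
      have "(\<lambda>n. \<integral>\<omega>. 1 * (1 - tent_sum K (X n \<omega> l / \<delta>)) \<partial>M) \<longlonglongrightarrow> (\<integral>\<omega>. 1 * (1 - tent_sum K (Y \<omega> l / \<delta>)) \<partial>N)"
      proof (rule positive_weight_levy[OF M N, where v="\<lambda>_ _. 1" and Y="\<lambda>n \<omega>. X n \<omega> l" and u="\<lambda>_. 1" and Z="\<lambda>\<omega>. Y \<omega> l"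
          and f="\<lambda>t. 1 - tent_sum K (t / \<delta>)" and c=1 and C=1 and K=1])
        show "isCont (\<lambda>t. 1 - tent_sum K (t / \<delta>)) t" for t
          unfolding tent_sum_eq ramp_def using \<delta>(1) by (intro continuous_intros) auto
        show "\<bar>1 - tent_sum K (t / \<delta>)\<bar> \<le> 1" for t using tent_sum_bounds[of K "t / \<delta>"] by (simp add: abs_le_iff)
      qed (use cf1 in auto)
      then show ?thesis by simp
    qed
    then have "\<forall>\<^sub>F n in sequentially. (\<integral>\<omega>. 1 - tent_sum K (X n \<omega> l / \<delta>) \<partial>M) < \<epsilon> / (4 * (H + 1))"
      using K by (rule order_tendstoD(2))
    then have ev: "\<forall>\<^sub>F n in sequentially. dist (\<integral>\<omega>. complex_of_real (F (X n \<omega>)) * e (X n \<omega>) \<partial>M) (\<integral>\<omega>. G (X n \<omega>) \<partial>M) \<le> \<epsilon>"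
    proof eventually_elim
      case (elim n)
      have "0 \<le> (\<integral>\<omega>. 1 - tent_sum K (X n \<omega> l / \<delta>) \<partial>M)" using tent_sum_bounds[of K] by (intro integral_nonneg_AE) auto
      then show ?case using XF[of n] H_small[OF elim] \<delta>(2) \<epsilon> unfolding dist_norm by linarith
    qed
    have nonneg: "0 \<le> (\<integral>\<omega>. 1 - tent_sum K (Y \<omega> l / \<delta>) \<partial>N)" using tent_sum_bounds[of K] by (intro integral_nonneg_AE) auto
    have "dist (\<integral>\<omega>. G (Y \<omega>) \<partial>N) (\<integral>\<omega>. complex_of_real (F (Y \<omega>)) * e (Y \<omega>) \<partial>N) \<le> \<epsilon>"
      using YF H_small[OF K nonneg] \<delta>(2) \<epsilon> by (subst dist_commute, unfold dist_norm, linarith)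
    with G_conv ev show "\<exists>b \<beta>. b \<longlonglongrightarrow> \<beta> \<and> (\<forall>\<^sub>F n in sequentially.
        dist (\<integral>\<omega>. complex_of_real (F (X n \<omega>)) * iexp (\<Sum>i\<in>{Suc l..<k}. \<theta> i * X n \<omega> i) \<partial>M) (b n) \<le> \<epsilon>) \<and>
        dist \<beta> (\<integral>\<omega>. complex_of_real (F (Y \<omega>)) * iexp (\<Sum>i\<in>{Suc l..<k}. \<theta> i * Y \<omega> i) \<partial>N) \<le> \<epsilon>"
      unfolding e_def by blast
  qed
qed

theorem fdd_convergence:
  fixes X :: "nat \<Rightarrow> 'a \<Rightarrow> nat \<Rightarrow> real" and Y :: "'b \<Rightarrow> nat \<Rightarrow> real" and F :: "(nat \<Rightarrow> real) \<Rightarrow> real"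
  assumes M: "prob_space M" and N: "prob_space N"
    and X: "\<And>n. X n \<in> M \<rightarrow>\<^sub>M PiM UNIV (\<lambda>_. borel)" and Y: "Y \<in> N \<rightarrow>\<^sub>M PiM UNIV (\<lambda>_. borel)"
    and cf: "\<And>\<theta>. (\<lambda>n. \<integral>\<omega>. iexp (\<Sum>i<k. \<theta> i * X n \<omega> i) \<partial>M) \<longlonglongrightarrow> (\<integral>\<omega>. iexp (\<Sum>i<k. \<theta> i * Y \<omega> i) \<partial>N)"
    and F: "F \<in> borel_measurable (PiM UNIV (\<lambda>_. borel))" and H: "\<And>y. \<bar>F y\<bar> \<le> H"
    and L: "0 \<le> L" "\<And>y z. \<bar>F y - F z\<bar> \<le> L * (\<Sum>i<k. \<bar>y i - z i\<bar>)"
  shows "(\<lambda>n. \<integral>\<omega>. F (X n \<omega>) \<partial>M) \<longlonglongrightarrow> (\<integral>\<omega>. F (Y \<omega>) \<partial>N)"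
  using fdd_convergence_partial[OF M N X Y cf order_refl F H L, of "\<lambda>_. 0"]
  by (simp add: tendsto_of_real_iff)

section \<open>Random elements of the Skorohod space\<close>

interpretation Sk: Metric_space skorohod_space skorohod_dist
  by (rule Metric_space_skorohod)

lemma openin_skorohod:
  "openin skorohod_topology U \<longleftrightarrow> U \<subseteq> skorohod_space \<and>
    (\<forall>x\<in>U. \<exists>r>0. \<forall>y\<in>skorohod_space. skorohod_dist x y < r \<longrightarrow> y \<in> U)"
proof -
  have "Sk.mball x r \<subseteq> U \<longleftrightarrow> (\<forall>y\<in>skorohod_space. skorohod_dist x y < r \<longrightarrow> y \<in> U)"
    if "U \<subseteq> skorohod_space" "x \<in> U" for x r
    using that by (auto simp: subset_iff)
  then show ?thesis
    unfolding skorohod_topology_def Sk.openin_mtopology Ball_def[of U] by (simp cong: conj_cong)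
qed

lemma topspace_skorohod: "topspace skorohod_topology = skorohod_space"
  by (simp add: skorohod_topology_def)

lemma space_borel_skorohod: "space (borel_sigma skorohod_topology) = skorohod_space"
  unfolding borel_sigma_def topspace_skorohod by (rule space_measure_of) (auto simp: openin_skorohod)

lemma openin_sets_borel_skorohod: "openin skorohod_topology U \<Longrightarrow> U \<in> sets (borel_sigma skorohod_topology)"
  unfolding borel_sigma_def topspace_skorohod
  by (subst sets_measure_of) (auto simp: openin_skorohod)

lemma measurable_into_skorohod:
  assumes "Y \<in> space M \<rightarrow> skorohod_space"
    and "\<And>U. openin skorohod_topology U \<Longrightarrow> Y -` U \<inter> space M \<in> sets M"
  shows "Y \<in> M \<rightarrow>\<^sub>M borel_sigma skorohod_topology"
  unfolding borel_sigma_def topspace_skorohod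
  by (rule measurable_measure_of) (use assms in \<open>auto simp: openin_skorohod\<close>)

lemma skorohod_dist_le_sup:
  assumes x: "x \<in> skorohod_space" and y: "y \<in> skorohod_space" and e: "0 \<le> e"
    and sup: "\<And>t. t \<in> {0..1} \<Longrightarrow> \<bar>x t - y t\<bar> \<le> e"
  shows "skorohod_dist x y \<le> e"
proof (rule field_le_epsilon)
  fix r :: real assume "r > 0"
  moreover have "skorohod_close (e + r) x y"
    unfolding skorohod_close_def by (rule bexI[OF _ id_time_changes]) (use sup e \<open>r > 0\<close> in force)
  ultimately show "skorohod_dist x y \<le> e + r" using x y e by (intro skorohod_dist_le) auto
qed

definition skorohod_lipschitz :: "real \<Rightarrow> ((real \<Rightarrow> real) \<Rightarrow> real) \<Rightarrow> bool" where
  "skorohod_lipschitz L h \<longleftrightarrow> 0 \<le> L \<and>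
    (\<forall>x\<in>skorohod_space. \<forall>y\<in>skorohod_space. \<bar>h x - h y\<bar> \<le> L * skorohod_dist x y)"

lemma continuous_map_borel_skorohod:
  assumes h: "continuous_map skorohod_topology euclideanreal h"
  shows "h \<in> borel_sigma skorohod_topology \<rightarrow>\<^sub>M borel"
proof (rule borel_measurableI)
  fix S :: "real set" assume "open S"
  then have "openin skorohod_topology {x \<in> topspace skorohod_topology. h x \<in> S}"
    using h by (auto simp: continuous_map_def)
  moreover have "{x \<in> topspace skorohod_topology. h x \<in> S} = h -` S \<inter> space (borel_sigma skorohod_topology)"
    by (auto simp: topspace_skorohod space_borel_skorohod)
  ultimately show "h -` S \<inter> space (borel_sigma skorohod_topology) \<in> sets (borel_sigma skorohod_topology)"
    by (simp add: openin_sets_borel_skorohod)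
qed

lemma skorohod_lipschitz_continuous:
  assumes h: "skorohod_lipschitz L h"
  shows "continuous_map skorohod_topology euclideanreal h"
  unfolding continuous_map_def
proof (intro conjI allI impI)
  fix S assume "openin euclideanreal S"
  then have S: "open S" by simp
  show "openin skorohod_topology {x \<in> topspace skorohod_topology. h x \<in> S}"
    unfolding openin_skorohod topspace_skorohod
  proof (intro conjI ballI)
    fix x assume "x \<in> {x \<in> skorohod_space. h x \<in> S}"
    then have x: "x \<in> skorohod_space" "h x \<in> S" by auto
    obtain e where e: "e > 0" "\<And>y. dist y (h x) < e \<Longrightarrow> y \<in> S" using S x(2) by (auto simp: open_dist)
    have L: "0 \<le> L" using h by (simp add: skorohod_lipschitz_def)
    show "\<exists>r>0. \<forall>y\<in>skorohod_space. skorohod_dist x y < r \<longrightarrow> y \<in> {x \<in> skorohod_space. h x \<in> S}"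
    proof (intro exI[of _ "e / (L + 1)"] conjI ballI impI)
      show "0 < e / (L + 1)" using e L by simp
      fix y assume y: "y \<in> skorohod_space" "skorohod_dist x y < e / (L + 1)"
      have "\<bar>h y - h x\<bar> \<le> L * skorohod_dist x y"
        using h x y by (auto simp: skorohod_lipschitz_def abs_minus_commute)
      also have "\<dots> \<le> (L + 1) * skorohod_dist x y" using Sk.nonneg by (simp add: mult_right_mono)
      also have "\<dots> < e" using y(2) L by (simp add: field_simps)
      finally show "y \<in> {x \<in> skorohod_space. h x \<in> S}" using y e(2)[of "h y"] by (simp add: dist_real_def)
    qed
  qed auto
qed auto

text \<open>Two uses: with \<open>h = 0\<close> this is the distance to \<open>A\<close>, and with \<open>A\<close> the whole space it approximates
  \<open>h\<close> from below as \<open>L\<close> grows.\<close>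

lemma infimum_convolution_lipschitz:
  assumes A: "A \<subseteq> skorohod_space" "A \<noteq> {}" and b: "\<And>y. y \<in> A \<Longrightarrow> b \<le> h y" and L: "0 \<le> L"
  shows "skorohod_lipschitz L (\<lambda>x. INF y\<in>A. h y + L * skorohod_dist x y)"
proof -
  have bdd: "bdd_below ((\<lambda>y. h y + L * skorohod_dist x y) ` A)" for x
    by (rule bdd_belowI2[where m=b]) (use b L in \<open>auto intro!: add_increasing2 mult_nonneg_nonneg\<close>)
  have "(INF y\<in>A. h y + L * skorohod_dist x y) \<le> (INF y\<in>A. h y + L * skorohod_dist x' y) + L * skorohod_dist x x'"
    if x: "x \<in> skorohod_space" "x' \<in> skorohod_space" for x x'
  proof -
    have "(INF y\<in>A. h y + L * skorohod_dist x y) - L * skorohod_dist x x' \<le> (INF y\<in>A. h y + L * skorohod_dist x' y)"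
    proof (rule cINF_greatest[OF A(2)])
      fix y assume y: "y \<in> A"
      have "(INF y\<in>A. h y + L * skorohod_dist x y) \<le> h y + L * skorohod_dist x y"
        using bdd y by (rule cINF_lower)
      also have "\<dots> \<le> h y + L * (skorohod_dist x x' + skorohod_dist x' y)"
        using L A y x by (intro add_left_mono mult_left_mono Sk.triangle) auto
      finally show "(INF y\<in>A. h y + L * skorohod_dist x y) - L * skorohod_dist x x' \<le> h y + L * skorohod_dist x' y"
        by (simp add: algebra_simps)
    qed
    then show ?thesis by simp
  qed
  note * = this
  show ?thesis
    unfolding skorohod_lipschitz_def
  proof (intro conjI L ballI)
    fix x y assume "x \<in> skorohod_space" "y \<in> skorohod_space"
    then show "\<bar>(INF z\<in>A. h z + L * skorohod_dist x z) - (INF z\<in>A. h z + L * skorohod_dist y z)\<bar> \<le> L * skorohod_dist x y"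
      using *[of x y] *[of y x] by (simp add: Sk.commute[of y x] abs_le_iff)
  qed
qed

text \<open>An open set consists of the points at positive distance from its complement, and the distance to
  the complement is continuous along the limit.\<close>

lemma measurable_skorohod_limit:
  assumes Y: "\<And>k. Y k \<in> M \<rightarrow>\<^sub>M borel_sigma skorohod_topology" and Z: "Z \<in> space M \<rightarrow> skorohod_space"
    and lim: "\<And>\<omega>. \<omega> \<in> space M \<Longrightarrow> (\<lambda>k. skorohod_dist (Y k \<omega>) (Z \<omega>)) \<longlonglongrightarrow> 0"
  shows "Z \<in> M \<rightarrow>\<^sub>M borel_sigma skorohod_topology"
proof (rule measurable_into_skorohod[OF Z])
  fix U assume U: "openin skorohod_topology U"
  define A where "A = skorohod_space - U"
  show "Z -` U \<inter> space M \<in> sets M"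
  proof (cases "A = {}")
    case True
    then have "Z -` U \<inter> space M = space M" using Z by (auto simp: A_def)
    then show ?thesis by simp
  next
    case False
    define g where "g x = (INF y\<in>A. 0 + 1 * skorohod_dist x y)" for x
    have g: "skorohod_lipschitz 1 g"
      unfolding g_def by (rule infimum_convolution_lipschitz[where b=0]) (use False in \<open>auto simp: A_def\<close>)
    note g_meas = continuous_map_borel_skorohod[OF skorohod_lipschitz_continuous[OF g]]
    have Y_space: "Y k \<omega> \<in> skorohod_space" if "\<omega> \<in> space M" for k \<omega>
      using measurable_space[OF Y that] by (simp add: space_borel_skorohod)
    have gZ: "(\<lambda>\<omega>. g (Z \<omega>)) \<in> borel_measurable M"
    proof (rule borel_measurable_LIMSEQ_metric)
      show "(\<lambda>\<omega>. g (Y k \<omega>)) \<in> borel_measurable M" for k by (rule measurable_compose[OF Y g_meas])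
      fix \<omega> assume \<omega>: "\<omega> \<in> space M"
      have "(\<lambda>k. g (Y k \<omega>) - g (Z \<omega>)) \<longlonglongrightarrow> 0"
      proof (rule Lim_null_comparison)
        show "\<forall>\<^sub>F k in sequentially. norm (g (Y k \<omega>) - g (Z \<omega>)) \<le> skorohod_dist (Y k \<omega>) (Z \<omega>)"
          using g Y_space[OF \<omega>] Z \<omega> by (intro always_eventually) (auto simp: skorohod_lipschitz_def Pi_iff)
      qed (rule lim[OF \<omega>])
      then show "(\<lambda>k. g (Y k \<omega>)) \<longlonglongrightarrow> g (Z \<omega>)" by (rule Lim_null[THEN iffD2])
    qed
    have iff: "x \<in> U \<longleftrightarrow> g x > 0" if x: "x \<in> skorohod_space" for x
    proof
      assume "x \<in> U"
      then obtain r where r: "r > 0" "\<And>y. y \<in> skorohod_space \<Longrightarrow> skorohod_dist x y < r \<Longrightarrow> y \<in> U"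
        using U by (auto simp: openin_skorohod)
      have "r \<le> g x" unfolding g_def using False r(2) by (intro cINF_greatest) (auto simp: A_def not_less[symmetric])
      then show "g x > 0" using r by simp
    next
      assume "g x > 0"
      show "x \<in> U"
      proof (rule ccontr)
        assume "x \<notin> U"
        then have "x \<in> A" using x by (simp add: A_def)
        then have "g x \<le> 0 + 1 * skorohod_dist x x" unfolding g_def
          by (intro cINF_lower bdd_belowI2[where m=0]) auto
        then show False using \<open>g x > 0\<close> x by simp
      qed
    qed
    have "Z -` U \<inter> space M = {\<omega> \<in> space M. g (Z \<omega>) > 0}"
      using iff Z by (auto simp: Pi_iff)
    then show ?thesis using gZ by simp
  qed
qed

text \<open>Convergence in distribution only has to be tested on bounded Lipschitz functions: a bounded
  continuous \<open>h\<close> is the increasing limit of its Lipschitz infimum convolutions, which gives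
  \<open>liminf E h(Y\<^sub>n) \<ge> E h(Z)\<close>; apply this to \<open>- h\<close> as well.\<close>

lemma converges_in_distribution_lipschitz:
  assumes M: "prob_space M" and N: "prob_space N"
    and Y: "\<And>n. Y n \<in> M \<rightarrow>\<^sub>M borel_sigma skorohod_topology" and Z: "Z \<in> N \<rightarrow>\<^sub>M borel_sigma skorohod_topology"
    and lip: "\<And>h L H. skorohod_lipschitz L h \<Longrightarrow> (\<And>x. x \<in> skorohod_space \<Longrightarrow> \<bar>h x\<bar> \<le> H) \<Longrightarrow>
      (\<lambda>n. \<integral>\<omega>. h (Y n \<omega>) \<partial>M) \<longlonglongrightarrow> (\<integral>\<omega>. h (Z \<omega>) \<partial>N)"
  shows "converges_in_distribution skorohod_topology M Y N Z"
proof -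
  interpret M: prob_space M by (rule M)
  interpret N: prob_space N by (rule N)
  have Y_space: "Y n \<omega> \<in> skorohod_space" if "\<omega> \<in> space M" for n \<omega>
    using measurable_space[OF Y that] by (simp add: space_borel_skorohod)
  have Z_space: "Z \<omega> \<in> skorohod_space" if "\<omega> \<in> space N" for \<omega>
    using measurable_space[OF Z that] by (simp add: space_borel_skorohod)
  have lower: "\<forall>\<^sub>F n in sequentially. a < (\<integral>\<omega>. h (Y n \<omega>) \<partial>M)"
    if h: "continuous_map skorohod_topology euclideanreal h" and H: "\<And>x. x \<in> skorohod_space \<Longrightarrow> \<bar>h x\<bar> \<le> H"
      and a: "a < (\<integral>\<omega>. h (Z \<omega>) \<partial>N)" for h H a
  proof -
    have ne: "skorohod_space \<noteq> {}" using M.not_empty Y_space by blast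
    define g where "g L x = (INF y\<in>skorohod_space. h y + real L * skorohod_dist x y)" for L :: nat and x
    have g_lip: "skorohod_lipschitz (real L) (g L)" for L
      unfolding g_def using H ne by (intro infimum_convolution_lipschitz[where b="- H"]) (auto simp: abs_le_iff minus_le_iff)
    have bdd: "bdd_below ((\<lambda>y. h y + real L * skorohod_dist x y) ` skorohod_space)" for L x
      by (rule bdd_belowI2[where m="- H"]) (use H in \<open>force intro!: add_increasing2 mult_nonneg_nonneg simp: abs_le_iff\<close>)
    have g_le: "g L x \<le> h x" if "x \<in> skorohod_space" for L x
      unfolding g_def using cINF_lower[OF bdd that, of L x] that by simp
    have g_ge: "- H \<le> g L x" for L x
      unfolding g_def using ne H by (intro cINF_greatest) (force intro!: add_increasing2 mult_nonneg_nonneg simp: abs_le_iff)+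
    have H0: "0 \<le> H" using ne H by (metis abs_ge_zero equals0I order_trans)
    have g_bdd: "\<bar>g L x\<bar> \<le> H" if "x \<in> skorohod_space" for L x
      using g_le[OF that, of L] g_ge[of L x] H[OF that] by (auto simp: abs_le_iff)
    have g_conv: "(\<lambda>L. g L x) \<longlonglongrightarrow> h x" if x: "x \<in> skorohod_space" for x
    proof (rule tendstoI)
      fix e :: real assume e: "e > 0"
      have "openin skorohod_topology {y \<in> topspace skorohod_topology. h y \<in> {h x - e / 2<..}}"
        using h[unfolded continuous_map_def, THEN conjunct2, rule_format, of "{h x - e / 2<..}"] by simp
      then obtain r where r: "r > 0" "\<And>y. y \<in> skorohod_space \<Longrightarrow> skorohod_dist x y < r \<Longrightarrow> h x - e / 2 < h y"
        using x e unfolding openin_skorohod topspace_skorohod by force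
      obtain L0 :: nat where L0: "2 * H / r \<le> real L0" using real_arch_simple by blast
      have "h x - e / 2 \<le> g L x" if L: "L \<ge> L0" for L
        unfolding g_def
      proof (rule cINF_greatest[OF ne])
        fix y assume y: "y \<in> skorohod_space"
        show "h x - e / 2 \<le> h y + real L * skorohod_dist x y"
        proof (cases "skorohod_dist x y < r")
          case True
          then show ?thesis using r(2)[OF y] by (intro add_increasing2) auto
        next
          case False
          have "2 * H \<le> real L * r" using L0 L r(1) by (simp add: field_simps) (smt (verit) mult_left_mono of_nat_mono)
          also have "\<dots> \<le> real L * skorohod_dist x y" using False by (intro mult_left_mono) auto
          finally show ?thesis using H[OF x] H[OF y] e by (simp add: abs_le_iff)
        qed
      qed
      then have "dist (g L x) (h x) < e" if "L \<ge> L0" for L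
        using that g_le[OF x, of L] e by (force simp: dist_real_def abs_less_iff)
      then show "\<forall>\<^sub>F L in sequentially. dist (g L x) (h x) < e" by (rule eventually_sequentiallyI)
    qed
    have g_meas: "g L \<in> borel_measurable (borel_sigma skorohod_topology)" for L
      by (rule continuous_map_borel_skorohod[OF skorohod_lipschitz_continuous[OF g_lip]])
    have h_meas: "h \<in> borel_measurable (borel_sigma skorohod_topology)"
      by (rule continuous_map_borel_skorohod[OF h])
    have "(\<lambda>L. \<integral>\<omega>. g L (Z \<omega>) \<partial>N) \<longlonglongrightarrow> (\<integral>\<omega>. h (Z \<omega>) \<partial>N)"
    proof (rule integral_dominated_convergence[where w="\<lambda>_. H"])
      show "(\<lambda>\<omega>. h (Z \<omega>)) \<in> borel_measurable N" by (rule measurable_compose[OF Z h_meas])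
      show "(\<lambda>\<omega>. g L (Z \<omega>)) \<in> borel_measurable N" for L by (rule measurable_compose[OF Z g_meas])
    qed (use g_conv g_bdd Z_space in auto)
    then have "\<forall>\<^sub>F L in sequentially. a < (\<integral>\<omega>. g L (Z \<omega>) \<partial>N)" using a by (rule order_tendstoD(1))
    then obtain L where L: "a < (\<integral>\<omega>. g L (Z \<omega>) \<partial>N)" unfolding eventually_sequentially by blast
    have "(\<lambda>n. \<integral>\<omega>. g L (Y n \<omega>) \<partial>M) \<longlonglongrightarrow> (\<integral>\<omega>. g L (Z \<omega>) \<partial>N)"
      using g_lip g_bdd by (rule lip)
    then have "\<forall>\<^sub>F n in sequentially. a < (\<integral>\<omega>. g L (Y n \<omega>) \<partial>M)" using L by (rule order_tendstoD(1))
    then show ?thesis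
    proof eventually_elim
      case (elim n)
      have "(\<integral>\<omega>. g L (Y n \<omega>) \<partial>M) \<le> (\<integral>\<omega>. h (Y n \<omega>) \<partial>M)"
      proof (rule integral_mono)
        show "integrable M (\<lambda>\<omega>. g L (Y n \<omega>))"
          by (rule M.integrable_const_bound[where B=H]) (use g_bdd Y_space measurable_compose[OF Y g_meas] in auto)
        show "integrable M (\<lambda>\<omega>. h (Y n \<omega>))"
          by (rule M.integrable_const_bound[where B=H]) (use H Y_space measurable_compose[OF Y h_meas] in auto)
      qed (use g_le Y_space in auto)
      then show ?case using elim by simp
    qed
  qed
  show ?thesis
    unfolding converges_in_distribution_def topspace_skorohod
  proof (intro conjI allI impI Y Z)
    fix h assume h: "continuous_map skorohod_topology euclideanreal h \<and> bounded (h ` skorohod_space)"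
    then obtain H where H: "\<And>x. x \<in> skorohod_space \<Longrightarrow> \<bar>h x\<bar> \<le> H" by (auto simp: bounded_iff)
    show "(\<lambda>n. \<integral>\<omega>. h (Y n \<omega>) \<partial>M) \<longlonglongrightarrow> (\<integral>\<omega>. h (Z \<omega>) \<partial>N)"
    proof (rule order_tendstoI)
      fix a assume "a < (\<integral>\<omega>. h (Z \<omega>) \<partial>N)"
      then show "\<forall>\<^sub>F n in sequentially. a < (\<integral>\<omega>. h (Y n \<omega>) \<partial>M)" using h H lower by blast
    next
      fix a assume a: "(\<integral>\<omega>. h (Z \<omega>) \<partial>N) < a"
      have "continuous_map skorohod_topology euclideanreal (\<lambda>x. - h x)"
        using h by (intro continuous_map_minus) auto
      from lower[OF this, of H "- a"] H a
      have "\<forall>\<^sub>F n in sequentially. - a < (\<integral>\<omega>. - h (Y n \<omega>) \<partial>M)" by simp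
      then show "\<forall>\<^sub>F n in sequentially. (\<integral>\<omega>. h (Y n \<omega>) \<partial>M) < a" by simp
    qed
  qed
qed

section \<open>Step paths\<close>

definition step_path :: "nat \<Rightarrow> (nat \<Rightarrow> real) \<Rightarrow> real \<Rightarrow> real" where
  "step_path k y = (\<lambda>t\<in>{0..1}. y (nat \<lfloor>real k * t\<rfloor>))"

lemma step_index_le: "t \<in> {0..1} \<Longrightarrow> nat \<lfloor>real k * t\<rfloor> \<le> k"
proof -
  assume "t \<in> {0..1}"
  then have "real k * t \<le> real k" by (simp add: mult_left_le)
  then have "\<lfloor>real k * t\<rfloor> \<le> int k" by (simp add: floor_le_iff)
  then show ?thesis by simp
qed

lemma step_path_in_skorohod: "step_path k y \<in> skorohod_space"
proof -
  have right: "continuous (at_right t) (step_path k y)" if t: "t \<in> {0..<1}" for t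
  proof -
    define b where "b = (if k = 0 then 1 else min 1 ((real_of_int \<lfloor>real k * t\<rfloor> + 1) / real k))"
    have b: "t < b" using t floor_correct[of "real k * t"] by (auto simp: b_def field_simps)
    have "step_path k y s = step_path k y t" if s: "t < s" "s < b" for s
    proof -
      have "\<lfloor>real k * s\<rfloor> = \<lfloor>real k * t\<rfloor>"
      proof (cases "k = 0")
        case False
        then have "real k * s < real_of_int \<lfloor>real k * t\<rfloor> + 1" using s by (simp add: b_def field_simps)
        moreover have "real k * t \<le> real k * s" using s by (simp add: mult_left_mono)
        ultimately show ?thesis using of_int_floor_le[of "real k * t"] by (intro floor_unique) linarith+
      qed simp
      moreover have "s \<le> 1" using s by (auto simp: b_def split: if_splits)
      ultimately show ?thesis using t s by (simp add: step_path_def)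
    qed
    then have "\<forall>\<^sub>F s in at_right t. step_path k y s = step_path k y t"
      unfolding eventually_at_right_field using b by blast
    then have "(step_path k y \<longlongrightarrow> step_path k y t) (at_right t)" by (rule tendsto_eventually)
    then show ?thesis by (simp add: continuous_within)
  qed
  have left: "\<exists>l. (step_path k y \<longlongrightarrow> l) (at_left t)" if t: "t \<in> {0<..1}" for t
  proof -
    define c where "c = \<lceil>real k * t\<rceil> - 1"
    define a where "a = (if k = 0 then 0 else max 0 (real_of_int c / real k))"
    have a: "a < t" using t ceiling_correct[of "real k * t"] by (auto simp: a_def c_def field_simps)
    have "step_path k y s = y (if k = 0 then 0 else nat c)" if s: "a < s" "s < t" for s
    proof -
      have s0: "0 < s" using s by (auto simp: a_def split: if_splits)
      have "\<lfloor>real k * s\<rfloor> = (if k = 0 then 0 else c)"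
      proof (cases "k = 0")
        case False
        then have "real_of_int c < real k * s" using s by (simp add: a_def field_simps)
        moreover have "real k * s < real k * t" using s False by simp
        then have "real k * s < real_of_int \<lceil>real k * t\<rceil>" by (rule less_le_trans[OF _ le_of_int_ceiling])
        then have "real k * s < real_of_int c + 1" by (simp add: c_def)
        ultimately have "\<lfloor>real k * s\<rfloor> = c" by (intro floor_unique) linarith+
        then show ?thesis using False by simp
      qed simp
      then show ?thesis using t s s0 by (simp add: step_path_def)
    qed
    then have "\<forall>\<^sub>F s in at_left t. step_path k y s = y (if k = 0 then 0 else nat c)"
      unfolding eventually_at_left_field using a by blast
    then show ?thesis by (intro exI tendsto_eventually)
  qed
  show ?thesis using right left by (auto simp: skorohod_space_def step_path_def[of k y] intro!: restrict_extensional)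
qed

lemma continuous_path_in_skorohod:
  assumes x: "continuous_on {0..1} x"
  shows "restrict x {0..1} \<in> skorohod_space"
proof -
  have c: "continuous_on {0..1} (restrict x {0..1})"
    using x by (rule continuous_on_eq) auto
  have right: "continuous (at_right t) (restrict x {0..1})" if t: "t \<in> {0..<1}" for t :: real
  proof -
    have "continuous (at t within {0..1}) (restrict x {0..1})"
      by (rule c[unfolded continuous_on_eq_continuous_within, rule_format]) (use t in auto)
    then have "continuous (at t within {t..1}) (restrict x {0..1})"
      by (rule continuous_within_subset) (use t in auto)
    then show ?thesis using t by (simp add: at_within_Icc_at_right continuous_within)
  qed
  have left: "(restrict x {0..1} \<longlongrightarrow> restrict x {0..1} t) (at_left t)" if t: "t \<in> {0<..1}" for t :: real
  proof -
    have "continuous (at t within {0..1}) (restrict x {0..1})"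
      by (rule c[unfolded continuous_on_eq_continuous_within, rule_format]) (use t in auto)
    then have "continuous (at t within {0..t}) (restrict x {0..1})"
      by (rule continuous_within_subset) (use t in auto)
    then show ?thesis using t by (simp add: at_within_Icc_at_left continuous_within)
  qed
  show ?thesis
    unfolding skorohod_space_def using right left by (blast intro: restrict_extensional)
qed

lemma step_path_dist:
  assumes "0 \<le> e" "\<And>i. i \<le> k \<Longrightarrow> \<bar>y i - z i\<bar> \<le> e"
  shows "skorohod_dist (step_path k y) (step_path k z) \<le> e"
  using assms step_index_le by (intro skorohod_dist_le_sup step_path_in_skorohod) (auto simp: step_path_def)

text \<open>The map is continuous for the product topology, as it depends on finitely many values only;
  the Borel sets of the countable product topology are the product \<open>\<sigma>\<close>-algebra.\<close>

lemma step_path_measurable: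
  "step_path k \<in> PiM UNIV (\<lambda>_. borel) \<rightarrow>\<^sub>M borel_sigma skorohod_topology"
proof (rule measurable_into_skorohod)
  fix U assume U: "openin skorohod_topology U"
  have "open (step_path k -` U)"
  proof (subst open_subopen, rule ballI)
    fix y assume "y \<in> step_path k -` U"
    then obtain r where r: "r > 0" "\<And>x. x \<in> skorohod_space \<Longrightarrow> skorohod_dist (step_path k y) x < r \<Longrightarrow> x \<in> U"
      using U by (auto simp: openin_skorohod)
    define T where "T = (\<Inter>i\<in>{..k}. (\<lambda>z. z i) -` ball (y i) (r / 2))"
    have "open T"
      unfolding T_def by (intro open_INT ballI open_vimage) (auto intro: continuous_on_product_coordinates)
    moreover have "y \<in> T" using r(1) by (simp add: T_def)
    moreover have "T \<subseteq> step_path k -` U"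
    proof
      fix z assume "z \<in> T"
      then have "\<bar>y i - z i\<bar> \<le> r / 2" if "i \<le> k" for i
        using that by (force simp: T_def dist_real_def)
      then have "skorohod_dist (step_path k y) (step_path k z) \<le> r / 2"
        using r(1) by (intro step_path_dist) auto
      then show "z \<in> step_path k -` U" using r step_path_in_skorohod by auto
    qed
    ultimately show "\<exists>T. open T \<and> y \<in> T \<and> T \<subseteq> step_path k -` U" by blast
  qed
  then have "step_path k -` U \<in> sets (PiM UNIV (\<lambda>_. borel))"
    unfolding sets_PiM_equal_borel by simp
  then show "step_path k -` U \<inter> space (PiM UNIV (\<lambda>_. borel)) \<in> sets (PiM UNIV (\<lambda>_. borel))"
    by (simp add: space_PiM)
qed (auto intro: step_path_in_skorohod)

text \<open>Sampling a step path with \<open>n\<close> steps on the coarser grid of mesh \<open>1/k\<close> changes it by at most the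
  oscillation over the blocks \<open>{n * i div k..n * Suc i div k}\<close>.\<close>

lemma step_path_resample:
  assumes k: "k > 0" and e: "0 \<le> e"
    and osc: "\<And>i j. i < k \<Longrightarrow> n * i div k \<le> j \<Longrightarrow> j \<le> n * Suc i div k \<Longrightarrow> \<bar>a j - a (n * i div k)\<bar> \<le> e"
  shows "skorohod_dist (step_path n a) (step_path k (\<lambda>i. a (n * i div k))) \<le> e"
proof (rule skorohod_dist_le_sup[OF step_path_in_skorohod step_path_in_skorohod e])
  fix t :: real assume t: "t \<in> {0..1}"
  define i where "i = nat \<lfloor>real k * t\<rfloor>"
  define j where "j = nat \<lfloor>real n * t\<rfloor>"
  have i: "real i \<le> real k * t" "real k * t < real i + 1"
    and j: "real j \<le> real n * t" "real n * t < real j + 1"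
    using t floor_correct[of "real k * t"] floor_correct[of "real n * t"] by (auto simp: i_def j_def)
  have "i \<le> k" using t unfolding i_def by (rule step_index_le)
  have lower: "n * i div k \<le> j"
  proof -
    have "real n * real i \<le> real n * (real k * t)" using i(1) by (rule mult_left_mono) simp
    also have "\<dots> = real k * (real n * t)" by simp
    also have "\<dots> < real k * (real j + 1)" using j(2) k by (intro mult_strict_left_mono) auto
    finally have "real (n * i) < real (Suc j * k)" by (simp add: algebra_simps)
    then have "n * i < Suc j * k" unfolding of_nat_less_iff .
    then have "n * i div k < Suc j" using k by (simp only: div_less_iff_less_mult)
    then show ?thesis by simp
  qed
  have "\<bar>a j - a (n * i div k)\<bar> \<le> e"
  proof (cases "i < k")
    case True
    have "real j * real k \<le> real n * (real i + 1)"
    proof -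
      have "real j * real k \<le> real n * t * real k" using j(1) by (rule mult_right_mono) simp
      also have "\<dots> = real n * (real k * t)" by simp
      also have "\<dots> \<le> real n * (real i + 1)" using i(2) by (intro mult_left_mono) auto
      finally show ?thesis .
    qed
    then have "real (j * k) \<le> real (n * Suc i)" by (simp add: algebra_simps)
    then have "j * k \<le> n * Suc i" unfolding of_nat_le_iff .
    then have "j \<le> n * Suc i div k" using k by (simp add: less_eq_div_iff_mult_less_eq)
    then show ?thesis using True lower by (intro osc)
  next
    case False
    then have "i = k" using \<open>i \<le> k\<close> by simp
    then have "n \<le> j" using lower k by simp
    moreover have "j \<le> n" using t unfolding j_def by (rule step_index_le)
    ultimately show ?thesis using \<open>i = k\<close> k e by simp
  qed
  then show "\<bar>step_path n a t - step_path k (\<lambda>i. a (n * i div k)) t\<bar> \<le> e"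
    using t by (simp add: step_path_def i_def j_def)
qed

lemma continuous_path_resample:
  assumes x: "continuous_on {0..1} x"
  shows "(\<lambda>k. skorohod_dist (step_path k (\<lambda>i. x (real i / real k))) (restrict x {0..1})) \<longlonglongrightarrow> 0"
proof (rule LIMSEQ_I)
  fix r :: real assume r: "r > 0"
  have "uniformly_continuous_on {0..1} x" using x by (rule compact_uniformly_continuous) simp
  then obtain d where d: "d > 0" "\<And>s t. s \<in> {0..1} \<Longrightarrow> t \<in> {0..1} \<Longrightarrow> dist s t < d \<Longrightarrow> dist (x s) (x t) < r / 2"
    unfolding uniformly_continuous_on_def using r by (metis half_gt_zero)
  obtain k0 :: nat where k0: "1 / d < real k0" using reals_Archimedean2 by blast
  have "norm (skorohod_dist (step_path k (\<lambda>i. x (real i / real k))) (restrict x {0..1}) - 0) < r" if k: "k \<ge> k0" for k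
  proof -
    have "1 / d < real k" using k0 k by simp
    moreover have "0 < 1 / d" using d(1) by simp
    ultimately have kpos: "real k > 0" by linarith
    then have kd: "1 / real k < d" using \<open>1 / d < real k\<close> d(1) by (simp add: field_simps)
    have "skorohod_dist (step_path k (\<lambda>i. x (real i / real k))) (restrict x {0..1}) \<le> r / 2"
    proof (rule skorohod_dist_le_sup[OF step_path_in_skorohod continuous_path_in_skorohod[OF x]])
      fix t :: real assume t: "t \<in> {0..1}"
      define i where "i = nat \<lfloor>real k * t\<rfloor>"
      have i: "real i \<le> real k * t" "real k * t < real i + 1"
        using t floor_correct[of "real k * t"] by (auto simp: i_def)
      have "i \<le> k" using t unfolding i_def by (rule step_index_le)
      then have "real i / real k \<in> {0..1}" using kpos by simp
      moreover have "dist (real i / real k) t < d"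
      proof -
        have "t < (real i + 1) / real k" "real i / real k \<le> t"
          using i kpos by (simp_all add: pos_less_divide_eq pos_divide_le_eq mult.commute)
        then show ?thesis using kd by (simp add: dist_real_def add_divide_distrib)
      qed
      ultimately have "dist (x (real i / real k)) (x t) < r / 2" using t by (intro d(2))
      then show "\<bar>step_path k (\<lambda>i. x (real i / real k)) t - restrict x {0..1} t\<bar> \<le> r / 2"
        using t by (simp add: step_path_def i_def dist_real_def)
    qed (use r in simp)
    then show ?thesis using r by simp
  qed
  then show "\<exists>no. \<forall>k\<ge>no. norm (skorohod_dist (step_path k (\<lambda>i. x (real i / real k))) (restrict x {0..1}) - 0) < r" by blast
qed

section \<open>Brownian motion\<close>

lemma gaussian_cf:
  assumes N: "prob_space N" and Z: "distributed N lborel Z (normal_density 0 s)" and s: "s > 0"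
  shows "(\<integral>\<omega>. iexp (c * Z \<omega>) \<partial>N) = complex_of_real (exp (- (c * s)\<^sup>2 / 2))"
proof -
  interpret N: prob_space N by (rule N)
  have std: "distributed N lborel (\<lambda>\<omega>. Z \<omega> / s) std_normal_density"
    using Z unfolding N.normal_standard_normal_convert[OF s] by simp
  have m[measurable]: "(\<lambda>\<omega>. Z \<omega> / s) \<in> borel_measurable N" using distributed_measurable[OF std] by simp
  have "(\<integral>\<omega>. iexp (c * Z \<omega>) \<partial>N) = (\<integral>\<omega>. iexp (c * s * (Z \<omega> / s)) \<partial>N)"
    using s by simp
  also have "\<dots> = (\<integral>x. iexp (c * s * x) \<partial>distr N lborel (\<lambda>\<omega>. Z \<omega> / s))"
    by (subst integral_distr) auto
  also have "\<dots> = char std_normal_distribution (c * s)"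
    unfolding distributed_distr_eq_density[OF std] char_def by simp
  finally show ?thesis by (simp add: char_std_normal_distribution)
qed

lemma brownian_increments_cf:
  assumes W: "brownian_motion N W" and k: "k > 0"
  shows "(\<integral>\<omega>. iexp (\<Sum>i<k. c i * (W (real (Suc i) / real k) \<omega> - W (real i / real k) \<omega>)) \<partial>N)
    = complex_of_real (exp (- (\<Sum>i<k. (c i)\<^sup>2) / (2 * real k)))"
proof -
  have N: "prob_space N" using W by (simp add: brownian_motion_def)
  interpret N: prob_space N by (rule N)
  define D where "D i \<omega> = W (real (Suc i) / real k) \<omega> - W (real i / real k) \<omega>" for i \<omega>
  have "N.indep_vars (\<lambda>_. borel) D {..<k}"
    unfolding D_def using W k
    by (auto simp: brownian_motion_def divide_right_mono dest!: spec[of _ k] spec[of _ "\<lambda>i. real i / real k"])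
  then have "N.indep_vars (\<lambda>_. borel) (\<lambda>i \<omega>. iexp (c i * D i \<omega>)) {..<k}"
    by (rule N.indep_vars_compose2[where Y="\<lambda>i x. iexp (c i * x)"]) auto
  then have "(\<integral>\<omega>. (\<Prod>i<k. iexp (c i * D i \<omega>)) \<partial>N) = (\<Prod>i<k. \<integral>\<omega>. iexp (c i * D i \<omega>) \<partial>N)"
    by (intro N.indep_vars_lebesgue_integral)
       (auto intro!: N.integrable_const_bound[where B=1] dest: N.indep_vars_def2[THEN iffD1])
  also have "\<dots> = (\<Prod>i<k. complex_of_real (exp (- (c i)\<^sup>2 / (2 * real k))))"
  proof (intro prod.cong refl)
    fix i assume "i \<in> {..<k}"
    then have "0 \<le> real i / real k \<and> real i / real k < real (Suc i) / real k \<and> real (Suc i) / real k \<le> 1"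
      using k by (auto simp: divide_strict_right_mono)
    then have "distributed N lborel (D i) (normal_density 0 (sqrt (real (Suc i) / real k - real i / real k)))"
      using W unfolding D_def brownian_motion_def by blast
    moreover have eq: "real (Suc i) / real k - real i / real k = 1 / real k" by (simp add: diff_divide_distrib[symmetric])
    ultimately have d: "distributed N lborel (D i) (normal_density 0 (sqrt (1 / real k)))" by simp
    have "- (c i * sqrt (1 / real k))\<^sup>2 / 2 = - (c i)\<^sup>2 / (2 * real k)" by (simp add: power_mult_distrib)
    then show "(\<integral>\<omega>. iexp (c i * D i \<omega>) \<partial>N) = complex_of_real (exp (- (c i)\<^sup>2 / (2 * real k)))"
      using gaussian_cf[OF N d, of "c i"] k by simp
  qed
  also have "\<dots> = complex_of_real (exp (- (\<Sum>i<k. (c i)\<^sup>2) / (2 * real k)))"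
    by (simp add: exp_sum[symmetric] of_real_prod[symmetric] sum_negf[symmetric] sum_divide_distrib del: of_real_prod)
  finally have "(\<integral>\<omega>. (\<Prod>i<k. iexp (c i * D i \<omega>)) \<partial>N) = complex_of_real (exp (- (\<Sum>i<k. (c i)\<^sup>2) / (2 * real k)))" .
  moreover have "(\<Prod>i<k. iexp (c i * D i \<omega>)) = iexp (\<Sum>i<k. c i * D i \<omega>)" for \<omega>
    by (simp add: exp_sum sum_distrib_left)
  ultimately show ?thesis by (simp only: D_def)
qed

definition brownian_path :: "(real \<Rightarrow> 'b \<Rightarrow> real) \<Rightarrow> real \<Rightarrow> 'b \<Rightarrow> real \<Rightarrow> real" where
  "brownian_path W \<sigma> \<omega> = (\<lambda>t\<in>{0..1}. \<sigma> * W t \<omega>)"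

lemma brownian_path_in_skorohod:
  assumes "brownian_motion N W" "\<omega> \<in> space N"
  shows "brownian_path W \<sigma> \<omega> \<in> skorohod_space"
  unfolding brownian_path_def
  by (rule continuous_path_in_skorohod) (use assms in \<open>auto simp: brownian_motion_def intro!: continuous_intros\<close>)

lemma brownian_grid_measurable:
  assumes W: "brownian_motion N W"
  shows "(\<lambda>\<omega> i. if i \<le> k then \<sigma> * W (real i / real k) \<omega> else 0) \<in> N \<rightarrow>\<^sub>M PiM UNIV (\<lambda>_. borel)"
proof (rule measurable_PiM_single')
  fix i
  show "(\<lambda>\<omega>. if i \<le> k then \<sigma> * W (real i / real k) \<omega> else 0) \<in> borel_measurable N"
  proof (cases "i \<le> k")
    case True
    then have "real i / real k \<in> {0..1}" by (cases "k = 0") auto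
    then have "W (real i / real k) \<in> borel_measurable N" using W by (auto simp: brownian_motion_def)
    then show ?thesis by simp
  qed simp
qed auto

lemma step_path_cong: "(\<And>i. i \<le> k \<Longrightarrow> y i = z i) \<Longrightarrow> step_path k y = step_path k z"
  using step_index_le by (auto simp: step_path_def fun_eq_iff restrict_def)

lemma brownian_path_approx:
  assumes W: "brownian_motion N W" and \<omega>: "\<omega> \<in> space N"
  shows "(\<lambda>k. skorohod_dist (step_path k (\<lambda>i. if i \<le> k then \<sigma> * W (real i / real k) \<omega> else 0)) (brownian_path W \<sigma> \<omega>)) \<longlonglongrightarrow> 0"
proof -
  have "continuous_on {0..1} (\<lambda>t. \<sigma> * W t \<omega>)"
    using W \<omega> by (auto simp: brownian_motion_def intro!: continuous_intros)
  from continuous_path_resample[OF this] show ?thesis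
    unfolding brownian_path_def
    by (rule filterlim_cong[THEN iffD1, rotated -1, OF _ refl refl always_eventually])
       (auto intro!: arg_cong2[where f=skorohod_dist] step_path_cong)
qed

lemma brownian_path_measurable:
  assumes W: "brownian_motion N W"
  shows "brownian_path W \<sigma> \<in> N \<rightarrow>\<^sub>M borel_sigma skorohod_topology"
proof (rule measurable_skorohod_limit)
  show "(\<lambda>\<omega>. step_path k (\<lambda>i. if i \<le> k then \<sigma> * W (real i / real k) \<omega> else 0)) \<in> N \<rightarrow>\<^sub>M borel_sigma skorohod_topology" for k
    by (rule measurable_compose[OF brownian_grid_measurable[OF W] step_path_measurable])
qed (use brownian_path_in_skorohod[OF W] brownian_path_approx[OF W] in auto)

lemma lipschitz_bounded_measurable:
  assumes h: "skorohod_lipschitz L h" and Y: "Y \<in> M \<rightarrow>\<^sub>M borel_sigma skorohod_topology"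
  shows "(\<lambda>\<omega>. h (Y \<omega>)) \<in> borel_measurable M"
  by (rule measurable_compose[OF Y continuous_map_borel_skorohod[OF skorohod_lipschitz_continuous[OF h]]])

lemma lipschitz_bounded_integrable:
  assumes M: "prob_space M" and h: "skorohod_lipschitz L h" and H: "\<And>x. x \<in> skorohod_space \<Longrightarrow> \<bar>h x\<bar> \<le> H"
    and Y: "Y \<in> M \<rightarrow>\<^sub>M borel_sigma skorohod_topology"
  shows "integrable M (\<lambda>\<omega>. h (Y \<omega>))"
proof -
  interpret prob_space M by (rule M)
  show ?thesis
    by (rule integrable_const_bound[where B=H, OF AE_I2 lipschitz_bounded_measurable[OF h Y]])
       (use measurable_space[OF Y] H in \<open>auto simp: space_borel_skorohod\<close>)
qed

lemma lipschitz_expectation_limit: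
  assumes M: "prob_space M" and h: "skorohod_lipschitz L h" and H: "\<And>x. x \<in> skorohod_space \<Longrightarrow> \<bar>h x\<bar> \<le> H"
    and Y: "\<And>k. Y k \<in> M \<rightarrow>\<^sub>M borel_sigma skorohod_topology" and Z: "Z \<in> M \<rightarrow>\<^sub>M borel_sigma skorohod_topology"
    and lim: "\<And>\<omega>. \<omega> \<in> space M \<Longrightarrow> (\<lambda>k. skorohod_dist (Y k \<omega>) (Z \<omega>)) \<longlonglongrightarrow> 0"
  shows "(\<lambda>k. \<integral>\<omega>. h (Y k \<omega>) \<partial>M) \<longlonglongrightarrow> (\<integral>\<omega>. h (Z \<omega>) \<partial>M)"
proof -
  interpret prob_space M by (rule M)
  have sp: "Y k \<omega> \<in> skorohod_space" "Z \<omega> \<in> skorohod_space" if "\<omega> \<in> space M" for k \<omega>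
    using measurable_space[OF Y that] measurable_space[OF Z that] by (auto simp: space_borel_skorohod)
  show ?thesis
  proof (rule integral_dominated_convergence[where w="\<lambda>_. H"])
    show "AE \<omega> in M. (\<lambda>k. h (Y k \<omega>)) \<longlonglongrightarrow> h (Z \<omega>)"
    proof (rule AE_I2)
      fix \<omega> assume \<omega>: "\<omega> \<in> space M"
      have "(\<lambda>k. h (Y k \<omega>) - h (Z \<omega>)) \<longlonglongrightarrow> 0"
      proof (rule Lim_null_comparison)
        show "\<forall>\<^sub>F k in sequentially. norm (h (Y k \<omega>) - h (Z \<omega>)) \<le> L * skorohod_dist (Y k \<omega>) (Z \<omega>)"
          using h sp[OF \<omega>] by (intro always_eventually) (auto simp: skorohod_lipschitz_def)
        show "(\<lambda>k. L * skorohod_dist (Y k \<omega>) (Z \<omega>)) \<longlonglongrightarrow> 0"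
          using tendsto_mult[OF tendsto_const lim[OF \<omega>], of L] by simp
      qed
      then show "(\<lambda>k. h (Y k \<omega>)) \<longlonglongrightarrow> h (Z \<omega>)" by (rule Lim_null[THEN iffD2])
    qed
  qed (use lipschitz_bounded_measurable[OF h] Y Z sp H in auto)
qed

text \<open>Off \<open>E\<close> the integrands differ by at most \<open>L e\<close>, and on \<open>E\<close> by at most \<open>2 H\<close>.\<close>

lemma lipschitz_expectation_close:
  assumes M: "prob_space M" and h: "skorohod_lipschitz L h" and H: "\<And>x. x \<in> skorohod_space \<Longrightarrow> \<bar>h x\<bar> \<le> H"
    and Y: "Y \<in> M \<rightarrow>\<^sub>M borel_sigma skorohod_topology" and Z: "Z \<in> M \<rightarrow>\<^sub>M borel_sigma skorohod_topology"
    and E: "E \<in> sets M" and e: "0 \<le> e"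
    and close: "\<And>\<omega>. \<omega> \<in> space M \<Longrightarrow> \<omega> \<notin> E \<Longrightarrow> skorohod_dist (Y \<omega>) (Z \<omega>) \<le> e"
  shows "\<bar>(\<integral>\<omega>. h (Y \<omega>) \<partial>M) - (\<integral>\<omega>. h (Z \<omega>) \<partial>M)\<bar> \<le> L * e + 2 * H * measure M E"
proof -
  interpret prob_space M by (rule M)
  have sp: "Y \<omega> \<in> skorohod_space" "Z \<omega> \<in> skorohod_space" if "\<omega> \<in> space M" for \<omega>
    using measurable_space[OF Y that] measurable_space[OF Z that] by (auto simp: space_borel_skorohod)
  have L: "0 \<le> L" using h by (simp add: skorohod_lipschitz_def)
  note int = lipschitz_bounded_integrable[OF M h H Y] lipschitz_bounded_integrable[OF M h H Z]
  have intE: "integrable M (\<lambda>\<omega>. L * e + 2 * H * indicator E \<omega>)"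
    using E by (intro Bochner_Integration.integrable_add integrable_mult_right integrable_real_indicator) (auto simp: emeasure_eq_measure)
  have "\<bar>(\<integral>\<omega>. h (Y \<omega>) \<partial>M) - (\<integral>\<omega>. h (Z \<omega>) \<partial>M)\<bar> = \<bar>\<integral>\<omega>. h (Y \<omega>) - h (Z \<omega>) \<partial>M\<bar>"
    using int by simp
  also have "\<dots> \<le> (\<integral>\<omega>. \<bar>h (Y \<omega>) - h (Z \<omega>)\<bar> \<partial>M)" by (rule integral_abs_bound)
  also have "\<dots> \<le> (\<integral>\<omega>. L * e + 2 * H * indicator E \<omega> \<partial>M)"
  proof (rule integral_mono[OF _ intE])
    show "integrable M (\<lambda>\<omega>. \<bar>h (Y \<omega>) - h (Z \<omega>)\<bar>)" using int by auto
    fix \<omega> assume \<omega>: "\<omega> \<in> space M"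
    show "\<bar>h (Y \<omega>) - h (Z \<omega>)\<bar> \<le> L * e + 2 * H * indicator E \<omega>"
    proof (cases "\<omega> \<in> E")
      case True
      have "0 \<le> L * e" using L e by simp
      then show ?thesis using True H[OF sp(1)[OF \<omega>]] H[OF sp(2)[OF \<omega>]] by simp
    next
      case False
      have "\<bar>h (Y \<omega>) - h (Z \<omega>)\<bar> \<le> L * skorohod_dist (Y \<omega>) (Z \<omega>)"
        using h sp[OF \<omega>] by (simp add: skorohod_lipschitz_def)
      also have "\<dots> \<le> L * e" using L close[OF \<omega> False] by (rule mult_left_mono[rotated])
      finally show ?thesis using False by simp
    qed
  qed
  also have "\<dots> = L * e + 2 * H * measure M E"
  proof -
    have "integrable M (indicator E :: _ \<Rightarrow> real)" using E by (intro integrable_real_indicator) (auto simp: emeasure_eq_measure)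
    then show ?thesis using E by (simp add: prob_space)
  qed
  finally show ?thesis .
qed

lemma AE_eventually_not_imp_prob_tendsto_0:
  assumes M: "prob_space M" and E: "\<And>n. E n \<in> sets M" and AE: "AE \<omega> in M. \<forall>\<^sub>F n in sequentially. \<omega> \<notin> E n"
  shows "(\<lambda>n. measure M (E n)) \<longlonglongrightarrow> 0"
proof -
  interpret prob_space M by (rule M)
  have "(\<lambda>n. \<integral>\<omega>. indicator (E n) \<omega> \<partial>M) \<longlonglongrightarrow> (\<integral>\<omega>. (0::real) \<partial>M)"
  proof (rule integral_dominated_convergence[where w="\<lambda>_. 1"])
    show "AE \<omega> in M. (\<lambda>n. indicator (E n) \<omega> :: real) \<longlonglongrightarrow> 0"
      using AE
    proof eventually_elim
      case (elim \<omega>)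
      then show ?case by (rule tendsto_eventually[OF eventually_mono]) simp
    qed
  qed (use E in auto)
  then show ?thesis using E by simp
qed

section \<open>The functional central limit theorem for bounded martingale differences\<close>

lemma grid_ratio_tendsto:
  assumes k: "k > 0"
  shows "(\<lambda>n. real (n * i div k) / real n) \<longlonglongrightarrow> real i / real k"
proof (rule Lim_null[THEN iffD2], rule Lim_null_comparison)
  show "(\<lambda>n. 1 / real n) \<longlonglongrightarrow> 0" by real_asymp
  show "\<forall>\<^sub>F n in sequentially. norm (real (n * i div k) / real n - real i / real k) \<le> 1 / real n"
    using eventually_gt_at_top[of 0]
  proof eventually_elim
    case (elim n)
    define q where "q = n * i div k"
    have "n * i = q * k + n * i mod k" by (simp add: q_def)
    moreover have "n * i mod k < k" using k by simp
    ultimately have "real n * real i = real q * real k + real (n * i mod k)" "real (n * i mod k) < real k"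
      by (metis of_nat_add of_nat_mult, simp)
    then have "real i / real k = real q / real n + real (n * i mod k) / (real n * real k)"
      using k elim by (simp add: field_simps)
    moreover have "real (n * i mod k) / (real n * real k) \<le> 1 / real n"
      using \<open>real (n * i mod k) < real k\<close> k elim by (simp add: field_simps mult_left_mono)
    ultimately show ?case by (simp add: q_def[symmetric])
  qed
qed

text \<open>The grid point \<open>n * i div k\<close> tends to infinity and is asymptotic to \<open>n i / k\<close>; only \<open>i = 0\<close> is
  exceptional.\<close>

lemma grid_average_tendsto:
  fixes A :: "nat \<Rightarrow> real"
  assumes k: "k > 0" and A: "(\<lambda>m. A m / real m) \<longlonglongrightarrow> s" and A0: "A 0 = 0"
  shows "(\<lambda>n. A (n * i div k) / real n) \<longlonglongrightarrow> s * (real i / real k)"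
proof (cases "i = 0")
  case True
  then show ?thesis using A0 by simp
next
  case False
  have "filterlim (\<lambda>n. n * i div k) at_top sequentially"
    unfolding filterlim_at_top eventually_sequentially
  proof (intro allI exI impI)
    fix Z n assume "Z * k \<le> n"
    also have "n \<le> n * i" using False by simp
    finally show "Z \<le> n * i div k" using k by (simp add: less_eq_div_iff_mult_less_eq)
  qed
  with A have "(\<lambda>n. A (n * i div k) / real (n * i div k)) \<longlonglongrightarrow> s" by (rule filterlim_compose)
  from tendsto_mult[OF this grid_ratio_tendsto[OF k, of i]]
  show ?thesis
    by (rule Lim_transform_eventually) (auto intro!: always_eventually simp: A0)
qed

lemma block_unique:
  assumes "n * i div k \<le> (l::nat)" "l < n * Suc i div k" "n * j div k \<le> l" "l < n * Suc j div k"
  shows "i = j"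
proof (rule ccontr)
  have mono: "n * a div k \<le> n * b div k" if "a \<le> b" for a b using that by (intro div_le_mono) simp
  assume "i \<noteq> j"
  then have "Suc i \<le> j \<or> Suc j \<le> i" by linarith
  then show False using mono[of "Suc i" j] mono[of "Suc j" i] assms by linarith
qed

text \<open>The step function of \<open>l\<close> with value \<open>\<theta> i\<close> on the \<open>i\<close>-th of \<open>k\<close> blocks of \<open>{..<n}\<close>. The sum has
  at most one nonzero term, and writing it as a sum allows the exchange with sums over \<open>l\<close>.\<close>

definition block_coeff :: "nat \<Rightarrow> (nat \<Rightarrow> real) \<Rightarrow> nat \<Rightarrow> nat \<Rightarrow> real" where
  "block_coeff k \<theta> n l = (\<Sum>i<k. if n * i div k \<le> l \<and> l < n * Suc i div k then \<theta> i else 0)"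

lemma block_coeff_bound: "\<bar>block_coeff k \<theta> n l\<bar> \<le> (\<Sum>i<k. \<bar>\<theta> i\<bar>)"
  unfolding block_coeff_def by (intro order_trans[OF sum_abs] sum_mono) auto

lemma block_coeff_square: "(block_coeff k \<theta> n l)\<^sup>2 = block_coeff k (\<lambda>i. (\<theta> i)\<^sup>2) n l"
proof (cases "\<exists>i<k. n * i div k \<le> l \<and> l < n * Suc i div k")
  case True
  then obtain j where j: "j < k" "n * j div k \<le> l" "l < n * Suc j div k" by blast
  have iff: "(n * i div k \<le> l \<and> l < n * Suc i div k) \<longleftrightarrow> i = j" for i
    using block_unique[of n i k l j] j by blast
  show ?thesis unfolding block_coeff_def iff using j(1) by simp
next
  case False
  then have "block_coeff k t n l = 0" for t
    unfolding block_coeff_def by (intro sum.neutral) auto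
  then show ?thesis by simp
qed

lemma block_coeff_sum:
  fixes u :: "nat \<Rightarrow> real"
  assumes k: "k > 0"
  shows "(\<Sum>l<n. block_coeff k \<theta> n l * u l) = (\<Sum>i<k. \<theta> i * ((\<Sum>l<n * Suc i div k. u l) - (\<Sum>l<n * i div k. u l)))"
proof -
  have "(\<Sum>l<n. block_coeff k \<theta> n l * u l) = (\<Sum>i<k. \<Sum>l<n. (if n * i div k \<le> l \<and> l < n * Suc i div k then \<theta> i else 0) * u l)"
    unfolding block_coeff_def sum_distrib_right by (rule sum.swap)
  also have "\<dots> = (\<Sum>i<k. \<theta> i * ((\<Sum>l<n * Suc i div k. u l) - (\<Sum>l<n * i div k. u l)))"
  proof (intro sum.cong refl)
    fix i assume i: "i \<in> {..<k}"
    have "n * Suc i div k \<le> n * k div k" using i by (intro div_le_mono mult_le_mono2) auto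
    then have le: "n * Suc i div k \<le> n" "n * i div k \<le> n * Suc i div k" using k by (auto intro: div_le_mono)
    have "(\<Sum>l<n. (if n * i div k \<le> l \<and> l < n * Suc i div k then \<theta> i else 0) * u l)
        = (\<Sum>l\<in>{n * i div k..<n * Suc i div k}. \<theta> i * u l)"
      using le by (intro sum.mono_neutral_cong_right) auto
    also have "\<dots> = \<theta> i * ((\<Sum>l<n * Suc i div k. u l) - (\<Sum>l<n * i div k. u l))"
      using sum_diff_nat_ivl[of 0 "n * i div k" "n * Suc i div k" u] le
      by (simp add: sum_distrib_left[symmetric] atLeast0LessThan)
    finally show "(\<Sum>l<n. (if n * i div k \<le> l \<and> l < n * Suc i div k then \<theta> i else 0) * u l)
        = \<theta> i * ((\<Sum>l<n * Suc i div k. u l) - (\<Sum>l<n * i div k. u l))" .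
  qed
  finally show ?thesis .
qed

context bounded_increments
begin

text \<open>A linear combination of the block increments is a weighted sum of the martingale differences
  with weights constant on blocks. Its conditional variance converges because the ergodic averages
  converge along the grid points.\<close>

lemma increments_fdd:
  assumes x: "x \<in> space S" and k: "k > 0"
    and V: "AE \<omega> in law x. (\<lambda>n. (\<Sum>l<n. cond_var (\<omega> l)) / real n) \<longlonglongrightarrow> \<sigma>\<^sup>2"
  shows "(\<lambda>n. \<integral>\<omega>. iexp (\<Sum>i<k. \<theta> i * ((increments_sum d (n * Suc i div k) \<omega> - increments_sum d (n * i div k) \<omega>) / sqrt n)) \<partial>law x)
    \<longlonglongrightarrow> complex_of_real (exp (- (\<Sum>i<k. (\<theta> i * \<sigma>)\<^sup>2) / (2 * real k)))"
proof -
  let ?c = "\<lambda>n l. block_coeff k \<theta> n l / sqrt n"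
  have "(\<lambda>n. \<integral>\<omega>. iexp (\<Sum>l<n. ?c n l * d (\<omega> l) (\<omega> (Suc l))) \<partial>law x)
      \<longlonglongrightarrow> complex_of_real (exp (- ((\<Sum>i<k. (\<theta> i * \<sigma>)\<^sup>2) / real k) / 2))"
  proof (rule cf_limit[OF x])
    show "\<bar>?c n l\<bar> \<le> (\<Sum>i<k. \<bar>\<theta> i\<bar>) / sqrt n" for n l
      using block_coeff_bound[of k \<theta> n l] by (simp add: divide_right_mono)
    show "AE \<omega> in law x. (\<lambda>n. \<Sum>l<n. (?c n l)\<^sup>2 * cond_var (\<omega> l)) \<longlonglongrightarrow> (\<Sum>i<k. (\<theta> i * \<sigma>)\<^sup>2) / real k"
      using V
    proof eventually_elim
      case (elim \<omega>)
      define A where "A m = (\<Sum>l<m. cond_var (\<omega> l))" for m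
      have grid: "(\<lambda>n. A (n * i div k) / real n) \<longlonglongrightarrow> \<sigma>\<^sup>2 * (real i / real k)" for i
        using k elim by (intro grid_average_tendsto) (auto simp: A_def)
      have "(\<lambda>n. \<Sum>i<k. (\<theta> i)\<^sup>2 * (A (n * Suc i div k) / real n - A (n * i div k) / real n))
          \<longlonglongrightarrow> (\<Sum>i<k. (\<theta> i)\<^sup>2 * (\<sigma>\<^sup>2 * (real (Suc i) / real k) - \<sigma>\<^sup>2 * (real i / real k)))"
        by (intro tendsto_sum tendsto_mult tendsto_const tendsto_diff grid)
      also have "(\<Sum>i<k. (\<theta> i)\<^sup>2 * (\<sigma>\<^sup>2 * (real (Suc i) / real k) - \<sigma>\<^sup>2 * (real i / real k))) = (\<Sum>i<k. (\<theta> i * \<sigma>)\<^sup>2) / real k"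
        unfolding sum_divide_distrib right_diff_distrib[symmetric] diff_divide_distrib[symmetric]
        by (simp add: power_mult_distrib)
      also have "(\<lambda>n. \<Sum>i<k. (\<theta> i)\<^sup>2 * (A (n * Suc i div k) / real n - A (n * i div k) / real n))
          = (\<lambda>n. \<Sum>l<n. (?c n l)\<^sup>2 * cond_var (\<omega> l))"
      proof
        fix n
        have "(\<Sum>l<n. (?c n l)\<^sup>2 * cond_var (\<omega> l)) = (\<Sum>l<n. block_coeff k (\<lambda>i. (\<theta> i)\<^sup>2) n l * cond_var (\<omega> l)) / real n"
          by (simp add: power_divide block_coeff_square sum_divide_distrib)
        also have "\<dots> = (\<Sum>i<k. (\<theta> i)\<^sup>2 * (A (n * Suc i div k) / real n - A (n * i div k) / real n))"
          unfolding block_coeff_sum[OF k] sum_divide_distrib by (simp add: A_def diff_divide_distrib[symmetric])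
        finally show "(\<Sum>i<k. (\<theta> i)\<^sup>2 * (A (n * Suc i div k) / real n - A (n * i div k) / real n))
          = (\<Sum>l<n. (?c n l)\<^sup>2 * cond_var (\<omega> l))" by simp
      qed
      finally show ?case .
    qed
  qed
  then have lim: "(\<lambda>n. \<integral>\<omega>. iexp (\<Sum>l<n. ?c n l * d (\<omega> l) (\<omega> (Suc l))) \<partial>law x)
      \<longlonglongrightarrow> complex_of_real (exp (- (\<Sum>i<k. (\<theta> i * \<sigma>)\<^sup>2) / (2 * real k)))"
    by (simp only: minus_divide_left divide_divide_eq_left mult.commute[of 2])
  have eq: "(\<Sum>l<n. ?c n l * d (\<omega> l) (\<omega> (Suc l)))
      = (\<Sum>i<k. \<theta> i * ((increments_sum d (n * Suc i div k) \<omega> - increments_sum d (n * i div k) \<omega>) / sqrt n))" for n \<omega>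
    using block_coeff_sum[OF k, of \<theta> n "\<lambda>l. d (\<omega> l) (\<omega> (Suc l))"]
    by (simp add: increments_sum_def sum_divide_distrib[symmetric])
  show ?thesis using lim unfolding eq .
qed

definition martingale_path :: "nat \<Rightarrow> (nat \<Rightarrow> 'a) \<Rightarrow> real \<Rightarrow> real" where
  "martingale_path n \<omega> = step_path n (\<lambda>j. increments_sum d j \<omega> / sqrt n)"

lemma scaled_path_measurable:
  assumes x: "x \<in> space S" and b: "\<And>i. b i \<in> borel_measurable paths"
  shows "(\<lambda>\<omega>. step_path n (\<lambda>i. b i \<omega>)) \<in> law x \<rightarrow>\<^sub>M borel_sigma skorohod_topology"
proof (rule measurable_compose[OF _ step_path_measurable])
  show "(\<lambda>\<omega> i. b i \<omega>) \<in> law x \<rightarrow>\<^sub>M PiM UNIV (\<lambda>_. borel)"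
    unfolding measurable_law[OF x] using b by (intro measurable_PiM_single') auto
qed

lemma martingale_path_measurable:
  assumes x: "x \<in> space S"
  shows "martingale_path n \<in> law x \<rightarrow>\<^sub>M borel_sigma skorohod_topology"
  unfolding martingale_path_def
  by (intro scaled_path_measurable[OF x] borel_measurable_divide increments_sum_measurable d_meas) auto

text \<open>The path sampled on the grid is a Lipschitz function of the finitely many block increments.\<close>

lemma sampled_martingale_limit:
  fixes N :: "'b measure"
  assumes x: "x \<in> space S" and k: "k > 0" and W: "brownian_motion N W" and \<sigma>: "0 \<le> \<sigma>"
    and V: "AE \<omega> in law x. (\<lambda>n. (\<Sum>l<n. cond_var (\<omega> l)) / real n) \<longlonglongrightarrow> \<sigma>\<^sup>2"
    and h: "skorohod_lipschitz L h" and H: "\<And>y. y \<in> skorohod_space \<Longrightarrow> \<bar>h y\<bar> \<le> H"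
  shows "(\<lambda>n. \<integral>\<omega>. h (step_path k (\<lambda>i. increments_sum d (n * i div k) \<omega> / sqrt n)) \<partial>law x)
    \<longlonglongrightarrow> (\<integral>\<omega>. h (step_path k (\<lambda>i. if i \<le> k then \<sigma> * W (real i / real k) \<omega> else 0)) \<partial>N)"
proof -
  have N: "prob_space N" using W by (simp add: brownian_motion_def)
  interpret L: prob_space "law x" using x by (rule prob_space_law)
  interpret N: prob_space N by (rule N)
  define X where "X n \<omega> i = (increments_sum d (n * Suc i div k) \<omega> - increments_sum d (n * i div k) \<omega>) / sqrt n"
    for n \<omega> and i :: nat
  define w where "w \<omega> i = (if i \<le> k then \<sigma> * W (real i / real k) \<omega> else 0)" for \<omega> i
  define Y where "Y \<omega> i = w \<omega> (Suc i) - w \<omega> i" for \<omega> i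
  define F where "F y = h (step_path k (\<lambda>i. \<Sum>l<i. y l))" for y :: "nat \<Rightarrow> real"
  have X_meas: "X n \<in> law x \<rightarrow>\<^sub>M PiM UNIV (\<lambda>_. borel)" for n
    unfolding measurable_law[OF x] X_def[abs_def] by (intro measurable_PiM_single') auto
  have w_meas: "(\<lambda>\<omega>. w \<omega> i) \<in> borel_measurable N" for i
    using measurable_compose[OF brownian_grid_measurable[OF W, of k \<sigma>] measurable_component_singleton[of i]]
    by (simp add: w_def)
  have Y_meas: "Y \<in> N \<rightarrow>\<^sub>M PiM UNIV (\<lambda>_. borel)"
    unfolding Y_def[abs_def] using w_meas by (intro measurable_PiM_single') auto
  have sum_meas: "(\<lambda>y i. \<Sum>l<i. y l) \<in> PiM UNIV (\<lambda>_. borel) \<rightarrow>\<^sub>M PiM UNIV (\<lambda>_. borel :: real measure)"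
    by (intro measurable_PiM_single') auto
  have F_meas: "F \<in> borel_measurable (PiM UNIV (\<lambda>_. borel))"
    unfolding F_def by (intro lipschitz_bounded_measurable[OF h] measurable_compose[OF sum_meas step_path_measurable])
  have L0: "0 \<le> L" using h by (simp add: skorohod_lipschitz_def)
  have F_lip: "\<bar>F y - F z\<bar> \<le> L * (\<Sum>i<k. \<bar>y i - z i\<bar>)" for y z
  proof -
    have "\<bar>F y - F z\<bar> \<le> L * skorohod_dist (step_path k (\<lambda>i. \<Sum>l<i. y l)) (step_path k (\<lambda>i. \<Sum>l<i. z l))"
      using h step_path_in_skorohod by (simp add: F_def skorohod_lipschitz_def)
    also have "\<dots> \<le> L * (\<Sum>i<k. \<bar>y i - z i\<bar>)"
    proof (intro mult_left_mono step_path_dist L0)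
      fix i assume i: "i \<le> k"
      have "\<bar>(\<Sum>l<i. y l) - (\<Sum>l<i. z l)\<bar> \<le> (\<Sum>l<i. \<bar>y l - z l\<bar>)"
        unfolding sum_subtractf[symmetric] by (rule sum_abs)
      also have "\<dots> \<le> (\<Sum>l<k. \<bar>y l - z l\<bar>)" using i by (intro sum_mono2) auto
      finally show "\<bar>(\<Sum>l<i. y l) - (\<Sum>l<i. z l)\<bar> \<le> (\<Sum>i<k. \<bar>y i - z i\<bar>)" .
    qed (simp add: sum_nonneg)
    finally show ?thesis .
  qed
  have Y_eq: "(\<Sum>i<k. \<theta> i * Y \<omega> i) = (\<Sum>i<k. (\<theta> i * \<sigma>) * (W (real (Suc i) / real k) \<omega> - W (real i / real k) \<omega>))" for \<theta> \<omega>
    by (intro sum.cong) (auto simp: Y_def w_def algebra_simps)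
  have "(\<lambda>n. \<integral>\<omega>. F (X n \<omega>) \<partial>law x) \<longlonglongrightarrow> (\<integral>\<omega>. F (Y \<omega>) \<partial>N)"
  proof (rule fdd_convergence[OF L.prob_space_axioms N X_meas Y_meas _ F_meas _ L0 F_lip])
    show "(\<lambda>n. \<integral>\<omega>. iexp (\<Sum>i<k. \<theta> i * X n \<omega> i) \<partial>law x) \<longlonglongrightarrow> (\<integral>\<omega>. iexp (\<Sum>i<k. \<theta> i * Y \<omega> i) \<partial>N)" for \<theta>
      unfolding Y_eq brownian_increments_cf[OF W k] X_def by (rule increments_fdd[OF x k V])
    show "\<bar>F y\<bar> \<le> H" for y unfolding F_def by (rule H[OF step_path_in_skorohod])
  qed
  moreover have "F (X n \<omega>) = h (step_path k (\<lambda>i. increments_sum d (n * i div k) \<omega> / sqrt n))" for n \<omega>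
  proof -
    have "(\<Sum>l<i. X n \<omega> l) = increments_sum d (n * i div k) \<omega> / sqrt n" for i
      by (induct i) (simp_all add: X_def increments_sum_def add_divide_distrib[symmetric] del: mult_Suc_right)
    then show ?thesis by (simp add: F_def)
  qed
  moreover have "(\<integral>\<omega>. F (Y \<omega>) \<partial>N) = (\<integral>\<omega>. h (step_path k (w \<omega>)) \<partial>N)"
  proof (rule integral_cong_AE)
    show "(\<lambda>\<omega>. F (Y \<omega>)) \<in> borel_measurable N" by (rule measurable_compose[OF Y_meas F_meas])
    show "(\<lambda>\<omega>. h (step_path k (w \<omega>))) \<in> borel_measurable N"
      unfolding w_def[abs_def]
      by (intro lipschitz_bounded_measurable[OF h] measurable_compose[OF brownian_grid_measurable[OF W] step_path_measurable])
    have "AE \<omega> in N. W 0 \<omega> = 0" using W by (simp add: brownian_motion_def)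
    then show "AE \<omega> in N. F (Y \<omega>) = h (step_path k (w \<omega>))"
    proof eventually_elim
      case (elim \<omega>)
      have "(\<Sum>l<i. Y \<omega> l) = w \<omega> i" for i
        by (induct i) (use elim in \<open>simp_all add: Y_def w_def\<close>)
      then show ?case by (simp add: F_def)
    qed
  qed
  ultimately show ?thesis by (simp add: w_def[abs_def])
qed

text \<open>On one block the conditional variance is about \<open>n \<sigma>\<^sup>2 / k\<close>. The exponential inequality with
  parameter \<open>\<kappa> = sqrt k\<close> then gives the bound \<open>exp (\<sigma>\<^sup>2 + 1 - \<epsilon> sqrt k)\<close>, which is small enough to be
  summed over the \<open>k\<close> blocks and still vanish as \<open>k\<close> grows.\<close>

lemma block_oscillation:
  assumes x: "x \<in> space S" and k: "k > 0" and \<epsilon>: "\<epsilon> > 0" and \<eta>: "\<eta> > 0"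
    and V: "AE \<omega> in law x. (\<lambda>n. (\<Sum>l<n. cond_var (\<omega> l)) / real n) \<longlonglongrightarrow> \<sigma>\<^sup>2"
  defines "E \<equiv> \<lambda>n. {\<omega> \<in> space paths. \<exists>i<k. \<exists>j\<in>{n * i div k..n * Suc i div k}.
      \<epsilon> * sqrt n \<le> \<bar>increments_sum d j \<omega> - increments_sum d (n * i div k) \<omega>\<bar>}"
  shows "\<forall>\<^sub>F n in sequentially. measure (law x) (E n) \<le> 2 * real k * exp (\<sigma>\<^sup>2 + 1 - \<epsilon> * sqrt k) + \<eta>"
proof -
  interpret L: prob_space "law x" using x by (rule prob_space_law)
  \<comment> \<open>The summand \<open>1\<close> leaves room above the limit \<open>\<sigma>\<^sup>2 / k\<close> of the block variances.\<close>
  define w where "w = (\<sigma>\<^sup>2 + 1) / real k"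
  define D where "D n i = {\<omega> \<in> space paths. w * real n < (\<Sum>l\<in>{n * i div k..<n * Suc i div k}. cond_var (\<omega> l))}" for n i
  define G where "G n i = {\<omega> \<in> space paths.
      (\<exists>j\<in>{n * i div k..n * Suc i div k}. \<epsilon> * sqrt n \<le> \<bar>increments_sum d j \<omega> - increments_sum d (n * i div k) \<omega>\<bar>)
      \<and> (\<Sum>l\<in>{n * i div k..<n * Suc i div k}. cond_var (\<omega> l)) \<le> w * (sqrt n)\<^sup>2}" for n i
  note [measurable] = increments_sum_measurable[OF d_meas]
  have D_sets: "D n i \<in> sets (law x)" for n i unfolding D_def sets_law[OF x] by measurable
  have G_sets: "G n i \<in> sets (law x)" for n i unfolding G_def sets_law[OF x] by measurable
  have mono: "n * i div k \<le> n * Suc i div k" for n i by (intro div_le_mono) simp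
  have D_small: "(\<lambda>n. measure (law x) (D n i)) \<longlonglongrightarrow> 0" for i
  proof (rule AE_eventually_not_imp_prob_tendsto_0[OF L.prob_space_axioms D_sets])
    show "AE \<omega> in law x. \<forall>\<^sub>F n in sequentially. \<omega> \<notin> D n i"
      using V
    proof eventually_elim
      case (elim \<omega>)
      define A where "A m = (\<Sum>l<m. cond_var (\<omega> l))" for m
      have "(\<lambda>n. A (n * Suc i div k) / real n - A (n * i div k) / real n)
          \<longlonglongrightarrow> \<sigma>\<^sup>2 * (real (Suc i) / real k) - \<sigma>\<^sup>2 * (real i / real k)"
        using k elim by (intro tendsto_diff grid_average_tendsto) (auto simp: A_def)
      moreover have "\<sigma>\<^sup>2 * (real (Suc i) / real k) - \<sigma>\<^sup>2 * (real i / real k) < w"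
        using k unfolding right_diff_distrib[symmetric] diff_divide_distrib[symmetric] w_def
        by (simp add: divide_strict_right_mono)
      ultimately have "\<forall>\<^sub>F n in sequentially. A (n * Suc i div k) / real n - A (n * i div k) / real n < w"
        by (rule order_tendstoD(2))
      then show ?case
        using eventually_gt_at_top[of 0]
      proof eventually_elim
        case (elim n)
        have "(\<Sum>l\<in>{n * i div k..<n * Suc i div k}. cond_var (\<omega> l)) = A (n * Suc i div k) - A (n * i div k)"
          unfolding A_def using sum_diff_nat_ivl[of 0 "n * i div k" "n * Suc i div k" "\<lambda>l. cond_var (\<omega> l)"] mono[of n i]
          by (simp add: atLeast0LessThan)
        then show ?case using elim by (simp add: D_def diff_divide_distrib[symmetric] divide_less_eq)
      qed
    qed
  qed
  have "(\<lambda>n. \<Sum>i<k. measure (law x) (D n i)) \<longlonglongrightarrow> (\<Sum>i<k. 0)" by (intro tendsto_sum D_small)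
  then have "\<forall>\<^sub>F n in sequentially. (\<Sum>i<k. measure (law x) (D n i)) < \<eta>"
    using \<eta> by (intro order_tendstoD(2)) auto
  moreover have "\<forall>\<^sub>F n in sequentially. sqrt (real k) * B \<le> sqrt (real n)" by real_asymp
  ultimately show ?thesis
    using eventually_gt_at_top[of 0]
  proof eventually_elim
    case (elim n)
    have G_bound: "measure (law x) (G n i) \<le> 2 * exp (\<sigma>\<^sup>2 + 1 - \<epsilon> * sqrt k)" for i
    proof -
      have "measure (law x) (G n i) \<le> 2 * exp ((sqrt (real k))\<^sup>2 * w - sqrt (real k) * \<epsilon>)"
        unfolding G_def using elim k by (intro block_maximal[OF x mono]) auto
      then show ?thesis using k by (simp add: w_def mult.commute)
    qed
    have "E n \<subseteq> (\<Union>i<k. G n i \<union> D n i)"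
      by (force simp: E_def G_def D_def)
    then have "measure (law x) (E n) \<le> measure (law x) (\<Union>i<k. G n i \<union> D n i)"
      using G_sets D_sets by (intro L.finite_measure_mono) auto
    also have "\<dots> \<le> (\<Sum>i<k. measure (law x) (G n i \<union> D n i))"
      using G_sets D_sets by (intro measure_UNION_le) auto
    also have "\<dots> \<le> (\<Sum>i<k. 2 * exp (\<sigma>\<^sup>2 + 1 - \<epsilon> * sqrt k) + measure (law x) (D n i))"
      using G_sets D_sets G_bound by (intro sum_mono order_trans[OF measure_Un_le] add_mono) auto
    also have "\<dots> = 2 * real k * exp (\<sigma>\<^sup>2 + 1 - \<epsilon> * sqrt k) + (\<Sum>i<k. measure (law x) (D n i))"
      by (simp add: sum.distrib)
    finally show ?case using elim by simp
  qed
qed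

text \<open>Both the martingale path and the Brownian path are close to their samples on a grid of mesh
  \<open>1 / k\<close>, and for fixed \<open>k\<close> the sampled paths converge.\<close>

theorem bounded_martingale_fclt:
  fixes N :: "'b measure"
  assumes x: "x \<in> space S" and W: "brownian_motion N W" and \<sigma>: "0 \<le> \<sigma>"
    and V: "AE \<omega> in law x. (\<lambda>n. (\<Sum>l<n. cond_var (\<omega> l)) / real n) \<longlonglongrightarrow> \<sigma>\<^sup>2"
    and h: "skorohod_lipschitz L h" and H: "\<And>y. y \<in> skorohod_space \<Longrightarrow> \<bar>h y\<bar> \<le> H"
  shows "(\<lambda>n. \<integral>\<omega>. h (martingale_path n \<omega>) \<partial>law x) \<longlonglongrightarrow> (\<integral>\<omega>. h (brownian_path W \<sigma> \<omega>) \<partial>N)"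
proof (rule tendsto_by_approximation)
  interpret L: prob_space "law x" using x by (rule prob_space_law)
  have N: "prob_space N" using W by (simp add: brownian_motion_def)
  have L0: "0 \<le> L" using h by (simp add: skorohod_lipschitz_def)
  have H0: "0 \<le> H" using order_trans[OF abs_ge_zero H[OF step_path_in_skorohod]] .
  fix e :: real assume e: "e > 0"
  define \<epsilon> where "\<epsilon> = e / (4 * (L + 1))"
  have \<epsilon>: "\<epsilon> > 0" "L * \<epsilon> \<le> e / 4" using e L0 by (auto simp: \<epsilon>_def field_simps)
  define \<eta> where "\<eta> = e / (8 * (H + 1))"
  have \<eta>: "\<eta> > 0" "2 * H * \<eta> \<le> e / 4" using e H0 by (auto simp: \<eta>_def field_simps)
  define w where "w k \<omega> i = (if i \<le> k then \<sigma> * W (real i / real k) \<omega> else 0)" for k \<omega> i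
  have "(\<lambda>k. \<integral>\<omega>. h (step_path k (w k \<omega>)) \<partial>N) \<longlonglongrightarrow> (\<integral>\<omega>. h (brownian_path W \<sigma> \<omega>) \<partial>N)"
    unfolding w_def[abs_def]
    by (intro lipschitz_expectation_limit[OF N h H] brownian_path_approx[OF W] brownian_path_measurable[OF W]
      measurable_compose[OF brownian_grid_measurable[OF W] step_path_measurable])
  then have "\<forall>\<^sub>F k in sequentially. dist (\<integral>\<omega>. h (step_path k (w k \<omega>)) \<partial>N) (\<integral>\<omega>. h (brownian_path W \<sigma> \<omega>) \<partial>N) < e"
    using e by (rule tendstoD)
  moreover have "(\<lambda>k. 2 * real k * exp (\<sigma>\<^sup>2 + 1 - \<epsilon> * sqrt k)) \<longlonglongrightarrow> 0"
    using \<epsilon>(1) by real_asymp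
  then have "\<forall>\<^sub>F k in sequentially. 2 * real k * exp (\<sigma>\<^sup>2 + 1 - \<epsilon> * sqrt k) < \<eta>"
    using \<eta>(1) by (rule order_tendstoD(2))
  ultimately have "\<forall>\<^sub>F k in sequentially. 0 < k \<and> 2 * real k * exp (\<sigma>\<^sup>2 + 1 - \<epsilon> * sqrt k) < \<eta>
      \<and> dist (\<integral>\<omega>. h (step_path k (w k \<omega>)) \<partial>N) (\<integral>\<omega>. h (brownian_path W \<sigma> \<omega>) \<partial>N) < e"
    using eventually_gt_at_top[of 0] by eventually_elim simp
  then obtain k where k: "0 < k" "2 * real k * exp (\<sigma>\<^sup>2 + 1 - \<epsilon> * sqrt k) < \<eta>"
    and kd: "dist (\<integral>\<omega>. h (step_path k (w k \<omega>)) \<partial>N) (\<integral>\<omega>. h (brownian_path W \<sigma> \<omega>) \<partial>N) < e"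
    unfolding eventually_sequentially by blast
  let ?M = "increments_sum d"
  define E where "E n = {\<omega> \<in> space paths. \<exists>i<k. \<exists>j\<in>{n * i div k..n * Suc i div k}.
      \<epsilon> * sqrt n \<le> \<bar>?M j \<omega> - ?M (n * i div k) \<omega>\<bar>}" for n
  note [measurable] = increments_sum_measurable[OF d_meas]
  have E_sets: "E n \<in> sets (law x)" for n unfolding E_def sets_law[OF x] by measurable
  let ?b = "\<lambda>n. \<integral>\<omega>. h (step_path k (\<lambda>i. ?M (n * i div k) \<omega> / sqrt n)) \<partial>law x"
  have b_lim: "?b \<longlonglongrightarrow> (\<integral>\<omega>. h (step_path k (w k \<omega>)) \<partial>N)"
    unfolding w_def by (rule sampled_martingale_limit[OF x k(1) W \<sigma> V h H])
  have "\<forall>\<^sub>F n in sequentially. measure (law x) (E n) \<le> 2 * real k * exp (\<sigma>\<^sup>2 + 1 - \<epsilon> * sqrt k) + \<eta>"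
    unfolding E_def by (rule block_oscillation[OF x k(1) \<epsilon>(1) \<eta>(1) V])
  then have close: "\<forall>\<^sub>F n in sequentially. dist (\<integral>\<omega>. h (martingale_path n \<omega>) \<partial>law x) (?b n) \<le> e"
    using eventually_gt_at_top[of 0]
  proof eventually_elim
    case (elim n)
    have "\<bar>(\<integral>\<omega>. h (martingale_path n \<omega>) \<partial>law x) - ?b n\<bar> \<le> L * \<epsilon> + 2 * H * measure (law x) (E n)"
    proof (rule lipschitz_expectation_close[OF L.prob_space_axioms h H martingale_path_measurable[OF x] _ E_sets])
      show "(\<lambda>\<omega>. step_path k (\<lambda>i. ?M (n * i div k) \<omega> / sqrt n)) \<in> law x \<rightarrow>\<^sub>M borel_sigma skorohod_topology"
        by (intro scaled_path_measurable[OF x]) measurable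
      fix \<omega> assume \<omega>: "\<omega> \<in> space (law x)" "\<omega> \<notin> E n"
      show "skorohod_dist (martingale_path n \<omega>) (step_path k (\<lambda>i. ?M (n * i div k) \<omega> / sqrt n)) \<le> \<epsilon>"
        unfolding martingale_path_def
      proof (rule step_path_resample[OF k(1)])
        fix i j assume ij: "i < k" "n * i div k \<le> j" "j \<le> n * Suc i div k"
        then have "\<bar>?M j \<omega> - ?M (n * i div k) \<omega>\<bar> < \<epsilon> * sqrt n"
          using \<omega> by (auto simp: E_def space_law[OF x] not_le)
        moreover have "\<bar>?M j \<omega> / sqrt n - ?M (n * i div k) \<omega> / sqrt n\<bar> = \<bar>?M j \<omega> - ?M (n * i div k) \<omega>\<bar> / sqrt n"
          by (simp add: diff_divide_distrib[symmetric])
        ultimately show "\<bar>?M j \<omega> / sqrt n - ?M (n * i div k) \<omega> / sqrt n\<bar> \<le> \<epsilon>"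
          using elim(2) by (simp add: pos_divide_le_eq)
      qed (rule less_imp_le[OF \<epsilon>(1)])
    qed (assumption, rule less_imp_le[OF \<epsilon>(1)])
    also have "2 * H * measure (law x) (E n) \<le> 2 * H * (2 * \<eta>)"
      using elim(1) k(2) H0 by (intro mult_left_mono) auto
    finally show ?case using \<epsilon>(2) \<eta>(2) by (simp add: dist_real_def)
  qed
  show "\<exists>b \<beta>. b \<longlonglongrightarrow> \<beta> \<and> (\<forall>\<^sub>F n in sequentially. dist (\<integral>\<omega>. h (martingale_path n \<omega>) \<partial>law x) (b n) \<le> e)
      \<and> dist \<beta> (\<integral>\<omega>. h (brownian_path W \<sigma> \<omega>) \<partial>N) \<le> e"
    using b_lim close kd by (intro exI[of _ ?b] exI[of _ "\<integral>\<omega>. h (step_path k (w k \<omega>)) \<partial>N"]) simp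
qed

text \<open>The marginal at time one; it identifies the limiting variances in \<open>scale_converges\<close>.\<close>

lemma martingale_cf_limit:
  assumes x: "x \<in> space S"
    and V: "AE \<omega> in law x. (\<lambda>n. (\<Sum>l<n. cond_var (\<omega> l)) / real n) \<longlonglongrightarrow> \<sigma>\<^sup>2"
  shows "(\<lambda>n. \<integral>\<omega>. iexp (t * (increments_sum d n \<omega> / sqrt n)) \<partial>law x) \<longlonglongrightarrow> complex_of_real (exp (- (t * \<sigma>)\<^sup>2 / 2))"
  using increments_fdd[OF x _ V, of 1 "\<lambda>_. t"] by (simp add: increments_sum_def)

end

section \<open>Martingale approximation through the Poisson equation\<close>

text \<open>Large indices \<open>i\<close> are controlled by \<open>a i\<^sup>2 < \<delta>\<^sup>2 i\<close>, and the finitely many small ones by a constant.\<close>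

lemma running_maximum_negligible:
  fixes a :: "nat \<Rightarrow> real"
  assumes lim: "(\<lambda>n. (a n)\<^sup>2 / real n) \<longlonglongrightarrow> 0" and \<delta>: "\<delta> > 0"
  shows "\<forall>\<^sub>F n in sequentially. \<forall>i\<le>n. \<bar>a i\<bar> < \<delta> * sqrt n"
proof -
  have "\<forall>\<^sub>F n in sequentially. (a n)\<^sup>2 / real n < \<delta>\<^sup>2" using lim \<delta> by (intro order_tendstoD(2)) auto
  then obtain n0 where n0: "\<And>n. n \<ge> n0 \<Longrightarrow> (a n)\<^sup>2 / real n < \<delta>\<^sup>2" unfolding eventually_sequentially by blast
  define A where "A = (\<Sum>i\<le>n0. \<bar>a i\<bar>)"
  have "\<forall>\<^sub>F n in sequentially. A < \<delta> * sqrt (real n)" using \<delta> by real_asymp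
  then show ?thesis
    using eventually_gt_at_top[of 0]
  proof eventually_elim
    case (elim n)
    show ?case
    proof (intro allI impI)
      fix i assume i: "i \<le> n"
      show "\<bar>a i\<bar> < \<delta> * sqrt n"
      proof (cases "i \<le> n0")
        case True
        then have "\<bar>a i\<bar> \<le> A" unfolding A_def by (intro member_le_sum) auto
        then show ?thesis using elim by simp
      next
        case False
        then have "(a i)\<^sup>2 < \<delta>\<^sup>2 * real i" using n0[of i] by (simp add: divide_less_eq)
        also have "\<dots> \<le> \<delta>\<^sup>2 * real n" using i by (intro mult_left_mono) auto
        also have "\<dots> = (\<delta> * sqrt n)\<^sup>2" by (simp add: power_mult_distrib)
        finally have "\<bar>a i\<bar>\<^sup>2 < (\<delta> * sqrt n)\<^sup>2" by simp
        then show ?thesis by (rule power_less_imp_less_base) (use \<delta> in simp)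
      qed
    qed
  qed
qed

lemma last_term_negligible:
  fixes u :: "nat \<Rightarrow> real"
  assumes lim: "(\<lambda>n. (\<Sum>j<n. u j) / real n) \<longlonglongrightarrow> s"
  shows "(\<lambda>n. u n / real n) \<longlonglongrightarrow> 0"
proof -
  have "(\<lambda>n. (\<Sum>j<Suc n. u j) / real (Suc n) * (real (Suc n) / real n) - (\<Sum>j<n. u j) / real n) \<longlonglongrightarrow> s * 1 - s"
  proof (intro tendsto_diff tendsto_mult lim)
    show "(\<lambda>n. (\<Sum>j<Suc n. u j) / real (Suc n)) \<longlonglongrightarrow> s" using lim by (rule LIMSEQ_Suc)
    show "(\<lambda>n. real (Suc n) / real n) \<longlonglongrightarrow> 1" by real_asymp
  qed
  moreover have "(\<Sum>j<Suc n. u j) / real (Suc n) * (real (Suc n) / real n) - (\<Sum>j<n. u j) / real n = u n / real n" for n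
  proof -
    have "(\<Sum>j<Suc n. u j) / real (Suc n) * (real (Suc n) / real n) = (\<Sum>j<Suc n. u j) / real n" by simp
    then show ?thesis by (simp add: add_divide_distrib)
  qed
  ultimately show ?thesis by simp
qed

context markov_kernel
begin

text \<open>For \<open>y\<close> outside \<open>S\<close> nothing is known about \<open>Q y\<close>; the indicator makes the difference bounded on
  the whole type as soon as \<open>g\<close> is.\<close>

definition mart_diff :: "('a \<Rightarrow> real) \<Rightarrow> 'a \<Rightarrow> 'a \<Rightarrow> real" where
  "mart_diff g y z = g z - indicator (space S) y * markov_op Q g y"

lemma markov_op_measurable[measurable]:
  assumes [measurable]: "g \<in> borel_measurable S"
  shows "markov_op Q g \<in> borel_measurable S"
  unfolding markov_op_def by (rule kernel_integral_measurable) measurable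

lemma mart_diff_measurable[measurable]:
  assumes [measurable]: "g \<in> borel_measurable S"
  shows "(\<lambda>(y, z). mart_diff g y z) \<in> borel_measurable (S \<Otimes>\<^sub>M S)"
  unfolding mart_diff_def by measurable

lemma kernel_measurable: "y \<in> space S \<Longrightarrow> g \<in> borel_measurable S \<Longrightarrow> g \<in> borel_measurable (Q y)"
  using sets_kernel by (simp cong: measurable_cong_sets)

lemma square_integrable_kernel:
  assumes y: "y \<in> space S" and g: "g \<in> borel_measurable S" and fin: "(\<integral>\<^sup>+z. ennreal ((g z)\<^sup>2) \<partial>Q y) < \<infinity>"
  shows "integrable (Q y) (\<lambda>z. (g z)\<^sup>2)" "integrable (Q y) g"
proof -
  interpret Qy: prob_space "Q y" using y by (rule prob_space_kernel)
  note [measurable] = kernel_measurable[OF y g]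
  show sq: "integrable (Q y) (\<lambda>z. (g z)\<^sup>2)" using fin by (intro integrableI_nonneg) auto
  show "integrable (Q y) g" by (rule Qy.square_integrable_imp_integrable[OF _ sq]) measurable
qed

text \<open>Both bounds come from \<open>E (X - E X)\<^sup>2 = E X\<^sup>2 - (E X)\<^sup>2\<close> under \<open>Q y\<close>.\<close>

lemma markov_op_square_le:
  assumes y: "y \<in> space S" and g: "g \<in> borel_measurable S"
  shows "ennreal ((markov_op Q g y)\<^sup>2) \<le> (\<integral>\<^sup>+z. ennreal ((g z)\<^sup>2) \<partial>Q y)"
    and "(\<integral>\<^sup>+z. ennreal ((mart_diff g y z)\<^sup>2) \<partial>Q y) \<le> (\<integral>\<^sup>+z. ennreal ((g z)\<^sup>2) \<partial>Q y)"
proof -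
  interpret Qy: prob_space "Q y" using y by (rule prob_space_kernel)
  show "ennreal ((markov_op Q g y)\<^sup>2) \<le> (\<integral>\<^sup>+z. ennreal ((g z)\<^sup>2) \<partial>Q y)"
    and "(\<integral>\<^sup>+z. ennreal ((mart_diff g y z)\<^sup>2) \<partial>Q y) \<le> (\<integral>\<^sup>+z. ennreal ((g z)\<^sup>2) \<partial>Q y)"
  proof (atomize (full), cases "(\<integral>\<^sup>+z. ennreal ((g z)\<^sup>2) \<partial>Q y) < \<infinity>")
    case False
    then have "(\<integral>\<^sup>+z. ennreal ((g z)\<^sup>2) \<partial>Q y) = \<infinity>" by (simp add: not_less top_unique)
    then show "ennreal ((markov_op Q g y)\<^sup>2) \<le> (\<integral>\<^sup>+z. ennreal ((g z)\<^sup>2) \<partial>Q y) \<and>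
        (\<integral>\<^sup>+z. ennreal ((mart_diff g y z)\<^sup>2) \<partial>Q y) \<le> (\<integral>\<^sup>+z. ennreal ((g z)\<^sup>2) \<partial>Q y)" by simp
  next
    case True
    note int = square_integrable_kernel[OF y g True]
    define c where "c = markov_op Q g y"
    have c: "(\<integral>z. g z \<partial>Q y) = c" by (simp add: c_def markov_op_def)
    have eq: "(g z - c)\<^sup>2 = (g z)\<^sup>2 - 2 * c * g z + c\<^sup>2" for z by (simp add: power2_diff)
    have i: "integrable (Q y) (\<lambda>z. (g z - c)\<^sup>2)" unfolding eq using int by simp
    have var: "(\<integral>z. (g z - c)\<^sup>2 \<partial>Q y) = (\<integral>z. (g z)\<^sup>2 \<partial>Q y) - c\<^sup>2"
      unfolding eq using int by (simp add: c Qy.prob_space power2_eq_square)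
    have "0 \<le> (\<integral>z. (g z - c)\<^sup>2 \<partial>Q y)" by simp
    then have le: "c\<^sup>2 \<le> (\<integral>z. (g z)\<^sup>2 \<partial>Q y)" "(\<integral>z. (g z - c)\<^sup>2 \<partial>Q y) \<le> (\<integral>z. (g z)\<^sup>2 \<partial>Q y)"
      using var by auto
    have nn: "(\<integral>\<^sup>+z. ennreal ((g z)\<^sup>2) \<partial>Q y) = ennreal (\<integral>z. (g z)\<^sup>2 \<partial>Q y)"
      "(\<integral>\<^sup>+z. ennreal ((mart_diff g y z)\<^sup>2) \<partial>Q y) = ennreal (\<integral>z. (g z - c)\<^sup>2 \<partial>Q y)"
      using int i y by (auto simp: mart_diff_def c_def nn_integral_eq_integral)
    show "ennreal ((markov_op Q g y)\<^sup>2) \<le> (\<integral>\<^sup>+z. ennreal ((g z)\<^sup>2) \<partial>Q y) \<and>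
        (\<integral>\<^sup>+z. ennreal ((mart_diff g y z)\<^sup>2) \<partial>Q y) \<le> (\<integral>\<^sup>+z. ennreal ((g z)\<^sup>2) \<partial>Q y)"
      unfolding nn c_def[symmetric] using le by (simp add: ennreal_leI)
  qed
qed

text \<open>If \<open>g\<close> minus a constant is square integrable under \<open>Q y\<close>, then \<open>g\<close> is integrable and the constant
  is its mean. Otherwise the conditional variance is infinite.\<close>

lemma mart_diff_centered:
  assumes y: "y \<in> space S" and g: "g \<in> borel_measurable S"
    and fin: "(\<integral>\<^sup>+z. ennreal ((mart_diff g y z)\<^sup>2) \<partial>Q y) < \<infinity>"
  shows "(\<integral>z. mart_diff g y z \<partial>Q y) = 0"
proof -
  interpret Qy: prob_space "Q y" using y by (rule prob_space_kernel)
  have [measurable]: "g \<in> borel_measurable (Q y)" by (rule kernel_measurable[OF y g])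
  define c where "c = markov_op Q g y"
  have md: "mart_diff g y z = g z - c" for z using y by (simp add: mart_diff_def c_def)
  have "integrable (Q y) (\<lambda>z. (g z - c)\<^sup>2)" using fin unfolding md by (intro integrableI_nonneg) auto
  then have "integrable (Q y) (\<lambda>z. g z - c)" by (rule Qy.square_integrable_imp_integrable[rotated]) simp
  then have "integrable (Q y) (\<lambda>z. (g z - c) + c)" by (intro Bochner_Integration.integrable_add) auto
  then have "integrable (Q y) g" by simp
  then show ?thesis unfolding md by (simp add: Qy.prob_space c_def markov_op_def)
qed

lemma bounded_increments_mart_diff:
  assumes g: "g \<in> borel_measurable S" and C: "\<And>z. \<bar>g z\<bar> \<le> C"
  shows "bounded_increments S Q (mart_diff g) (2 * C)"
proof
  show "(\<lambda>(y, z). mart_diff g y z) \<in> borel_measurable (S \<Otimes>\<^sub>M S)" using g by measurable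
  have gi: "integrable (Q y) g" if y: "y \<in> space S" for y
  proof -
    interpret Qy: prob_space "Q y" using y by (rule prob_space_kernel)
    show ?thesis by (rule Qy.integrable_const_bound[where B=C]) (use C kernel_measurable[OF y g] in auto)
  qed
  show "\<bar>mart_diff g y z\<bar> \<le> 2 * C" for y z
  proof (cases "y \<in> space S")
    case True
    interpret Qy: prob_space "Q y" using True by (rule prob_space_kernel)
    have "\<bar>markov_op Q g y\<bar> \<le> (\<integral>z. C \<partial>Q y)"
      unfolding markov_op_def using gi[OF True] C by (intro order_trans[OF integral_abs_bound] integral_mono) auto
    then show ?thesis using True C[of z] by (simp add: mart_diff_def Qy.prob_space)
  next
    case False
    then show ?thesis using C[of z] by (simp add: mart_diff_def)
  qed
  show "(\<integral>z. mart_diff g y z \<partial>Q y) = 0" if y: "y \<in> space S" for y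
  proof -
    interpret Qy: prob_space "Q y" using y by (rule prob_space_kernel)
    show ?thesis using gi[OF y] y by (simp add: mart_diff_def markov_op_def Qy.prob_space)
  qed
qed

text \<open>The solution of the Poisson equation \<open>f - f\<^sub>m = g - Q g\<close> for the average \<open>f\<^sub>m\<close> of
  \<open>Q f, \<dots>, Q\<^sup>m f\<close>.\<close>

definition poisson_solution :: "('a \<Rightarrow> real) \<Rightarrow> nat \<Rightarrow> 'a \<Rightarrow> real" where
  "poisson_solution f m x = (\<Sum>i=1..m. \<Sum>j<i. (markov_op Q ^^ j) f x) / real m"

lemma iterates_measurable[measurable]: "f \<in> borel_measurable S \<Longrightarrow> (markov_op Q ^^ j) f \<in> borel_measurable S"
  by (induct j) auto

text \<open>For each \<open>i\<close>, the difference \<open>f - Q\<^sup>i f\<close> telescopes into \<open>(1 - Q) (f + \<dots> + Q\<^sup>i\<^sup>-\<^sup>1 f)\<close>.\<close>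

lemma poisson_equation:
  assumes y: "y \<in> space S" and int: "\<And>j. integrable (Q y) ((markov_op Q ^^ j) f)" and m: "m > 0"
  shows "integrable (Q y) (poisson_solution f m)"
    and "f y - markov_avg Q f m y = poisson_solution f m y - markov_op Q (poisson_solution f m) y"
proof -
  let ?F = "\<lambda>j. (markov_op Q ^^ j) f"
  show "integrable (Q y) (poisson_solution f m)"
    unfolding poisson_solution_def using int by auto
  have "markov_op Q (poisson_solution f m) y = (\<Sum>i=1..m. \<Sum>j<i. ?F (Suc j) y) / real m"
  proof -
    have "markov_op Q (poisson_solution f m) y = (\<Sum>i=1..m. \<Sum>j<i. \<integral>z. ?F j z \<partial>Q y) / real m"
      unfolding markov_op_def[of Q "poisson_solution f m"] poisson_solution_def using int by simp
    moreover have "(\<integral>z. ?F j z \<partial>Q y) = ?F (Suc j) y" for j by (simp add: markov_op_def[of Q "?F j"])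
    ultimately show ?thesis by (simp only:)
  qed
  then have "poisson_solution f m y - markov_op Q (poisson_solution f m) y
      = (\<Sum>i=1..m. (\<Sum>j<i. ?F j y - ?F (Suc j) y)) / real m"
    by (simp add: poisson_solution_def diff_divide_distrib[symmetric] sum_subtractf)
  also have "\<dots> = (\<Sum>i=1..m. f y - ?F i y) / real m"
  proof -
    have "(\<Sum>j<i. ?F j y - ?F (Suc j) y) = f y - ?F i y" for i
      using sum_lessThan_telescope'[of "\<lambda>j. ?F j y" i] by simp
    then show ?thesis by (simp only:)
  qed
  also have "\<dots> = f y - markov_avg Q f m y"
    using m by (simp add: sum_subtractf diff_divide_distrib markov_avg_def)
  finally show "f y - markov_avg Q f m y = poisson_solution f m y - markov_op Q (poisson_solution f m) y" by simp
qed

text \<open>Along the path, \<open>g - Q g\<close> at consecutive states is a martingale difference up to the coboundary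
  of \<open>Q g\<close>, which leaves the two boundary terms. The martingale of \<open>g\<close> is split into those of \<open>c\<close>
  and of \<open>g - c\<close>.\<close>

lemma martingale_decomposition:
  assumes \<omega>: "\<omega> \<in> space paths" and int: "\<And>i j. integrable (Q (\<omega> i)) ((markov_op Q ^^ j) f)" and m: "m > 0"
    and c: "c \<in> borel_measurable S" "\<And>z. \<bar>c z\<bar> \<le> C"
  defines "g \<equiv> poisson_solution f m"
  shows "partial_sum f n \<omega> - increments_sum (mart_diff c) n \<omega>
    = partial_sum (markov_avg Q f m) n \<omega> + increments_sum (mart_diff (\<lambda>z. g z - c z)) n \<omega>
      + markov_op Q g (\<omega> 0) - markov_op Q g (\<omega> n)"
proof (induct n)
  case 0
  then show ?case by (simp add: partial_sum_def increments_sum_def)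
next
  case (Suc n)
  have sp: "\<omega> i \<in> space S" for i using \<omega> by (rule path_in_space)
  interpret Qn: prob_space "Q (\<omega> n)" using sp by (rule prob_space_kernel)
  have ci: "integrable (Q (\<omega> n)) c"
    by (rule Qn.integrable_const_bound[where B=C]) (use c kernel_measurable[OF sp c(1)] in auto)
  have lin: "markov_op Q (\<lambda>z. g z - c z) (\<omega> n) = markov_op Q g (\<omega> n) - markov_op Q c (\<omega> n)"
    unfolding markov_op_def using poisson_equation(1)[OF sp int m] ci by (simp add: g_def)
  have "f (\<omega> (Suc n)) - markov_avg Q f m (\<omega> (Suc n)) = g (\<omega> (Suc n)) - markov_op Q g (\<omega> (Suc n))"
    unfolding g_def by (rule poisson_equation(2)[OF sp int m])
  then show ?case using Suc sp lin by (simp add: partial_sum_def increments_sum_def mart_diff_def)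
qed

end

context stationary_ergodic_markov_chain
begin

definition square_integrable :: "('a \<Rightarrow> real) \<Rightarrow> bool" where
  "square_integrable g \<longleftrightarrow> g \<in> borel_measurable S \<and> (\<integral>\<^sup>+x. ennreal ((g x)\<^sup>2) \<partial>\<pi>) < \<infinity>"

lemma square_integrable_real:
  assumes "square_integrable g"
  shows "integrable \<pi> (\<lambda>x. (g x)\<^sup>2)"
  using assms by (intro integrableI_nonneg) (auto simp: square_integrable_def measurable_\<pi>)

lemma square_integrable_add:
  assumes "square_integrable g" "square_integrable h"
  shows "square_integrable (\<lambda>x. g x + h x)"
proof -
  have [measurable]: "g \<in> borel_measurable S" "h \<in> borel_measurable S" using assms by (auto simp: square_integrable_def)
  have "(\<integral>\<^sup>+x. ennreal ((g x + h x)\<^sup>2) \<partial>\<pi>) \<le> (\<integral>\<^sup>+x. ennreal (2 * (g x)\<^sup>2 + 2 * (h x)\<^sup>2) \<partial>\<pi>)"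
  proof (intro nn_integral_mono ennreal_leI)
    fix x show "(g x + h x)\<^sup>2 \<le> 2 * (g x)\<^sup>2 + 2 * (h x)\<^sup>2"
      using sum_squares_ge_zero[of "g x - h x" 0] by (simp add: power2_eq_square algebra_simps)
  qed
  also have "\<dots> = 2 * (\<integral>\<^sup>+x. ennreal ((g x)\<^sup>2) \<partial>\<pi>) + 2 * (\<integral>\<^sup>+x. ennreal ((h x)\<^sup>2) \<partial>\<pi>)"
    by (simp add: ennreal_mult nn_integral_add nn_integral_cmult measurable_\<pi>)
  also have "\<dots> < \<infinity>" using assms by (simp add: square_integrable_def ennreal_mult_less_top)
  finally show ?thesis by (simp add: square_integrable_def)
qed

lemma square_integrable_cmult:
  assumes "square_integrable g"
  shows "square_integrable (\<lambda>x. c * g x)"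
proof -
  have [measurable]: "g \<in> borel_measurable S" using assms by (auto simp: square_integrable_def)
  have "(\<integral>\<^sup>+x. ennreal ((c * g x)\<^sup>2) \<partial>\<pi>) = ennreal (c\<^sup>2) * (\<integral>\<^sup>+x. ennreal ((g x)\<^sup>2) \<partial>\<pi>)"
    by (simp add: power_mult_distrib ennreal_mult nn_integral_cmult measurable_\<pi>)
  also have "\<dots> < \<infinity>" using assms by (simp add: square_integrable_def ennreal_mult_less_top)
  finally show ?thesis by (simp add: square_integrable_def)
qed

lemma square_integrable_sum:
  assumes "\<And>i. i \<in> I \<Longrightarrow> square_integrable (g i)"
  shows "square_integrable (\<lambda>x. \<Sum>i\<in>I. g i x)"
  using assms
proof (induct I rule: infinite_finite_induct)
  case (insert i I)
  then show ?case using square_integrable_add[of "g i" "\<lambda>x. \<Sum>i\<in>I. g i x"] by simp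
qed (auto simp: square_integrable_def)

lemma square_integrable_markov_op:
  assumes g: "square_integrable g"
  shows "square_integrable (markov_op Q g)"
proof -
  have m[measurable]: "g \<in> borel_measurable S" using g by (auto simp: square_integrable_def)
  have "(\<integral>\<^sup>+x. ennreal ((markov_op Q g x)\<^sup>2) \<partial>\<pi>) \<le> (\<integral>\<^sup>+x. \<integral>\<^sup>+y. ennreal ((g y)\<^sup>2) \<partial>Q x \<partial>\<pi>)"
    using K.markov_op_square_le(1)[OF _ m] by (intro nn_integral_mono) (simp add: space_\<pi>)
  also have "\<dots> < \<infinity>" using g by (subst \<pi>_stationary) (auto simp: square_integrable_def)
  finally show ?thesis using K.markov_op_measurable[OF m] by (simp add: square_integrable_def)
qed

lemma square_integrable_iterates: "square_integrable f \<Longrightarrow> square_integrable ((markov_op Q ^^ j) f)"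
  by (induct j) (auto intro: square_integrable_markov_op)

lemma square_integrable_poisson_solution:
  assumes f: "square_integrable f"
  shows "square_integrable (K.poisson_solution f m)"
proof -
  have "square_integrable (\<lambda>x. (1 / real m) * (\<Sum>i=1..m. \<Sum>j<i. (markov_op Q ^^ j) f x))"
    by (intro square_integrable_cmult square_integrable_sum square_integrable_iterates f)
  then show ?thesis by (simp add: K.poisson_solution_def[abs_def])
qed

lemma AE_square_integrable_kernel:
  assumes g: "square_integrable g"
  shows "AE x in \<pi>. (\<integral>\<^sup>+y. ennreal ((g y)\<^sup>2) \<partial>Q x) < \<infinity>"
proof -
  have [measurable]: "g \<in> borel_measurable S" using g by (auto simp: square_integrable_def)
  have "(\<integral>\<^sup>+x. \<integral>\<^sup>+y. ennreal ((g y)\<^sup>2) \<partial>Q x \<partial>\<pi>) \<noteq> \<infinity>"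
    using g by (subst \<pi>_stationary) (auto simp: square_integrable_def)
  then show ?thesis
    by (rule AE_mp[OF nn_integral_PInf_AE[rotated]]) (auto simp: measurable_\<pi> less_top intro!: AE_I2)
qed

lemma AE_iterates_integrable:
  assumes f: "square_integrable f"
  shows "AE x in \<pi>. AE \<omega> in K.law x. \<forall>i j. integrable (Q (\<omega> i)) ((markov_op Q ^^ j) f)"
proof -
  have m: "(markov_op Q ^^ j) f \<in> borel_measurable S" for j
    using square_integrable_iterates[OF f] by (simp add: square_integrable_def)
  note [measurable] = m
  have "AE x in \<pi>. \<forall>j. (\<integral>\<^sup>+y. ennreal (((markov_op Q ^^ j) f y)\<^sup>2) \<partial>Q x) < \<infinity>"
    unfolding AE_all_countable by (intro allI AE_square_integrable_kernel square_integrable_iterates f)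
  then have "AE x in \<pi>. AE \<omega> in K.law x. \<forall>i. \<forall>j. (\<integral>\<^sup>+y. ennreal (((markov_op Q ^^ j) f y)\<^sup>2) \<partial>Q (\<omega> i)) < \<infinity>"
    by (rule AE_law_all_coordinates) measurable
  from this AE_space show ?thesis
  proof eventually_elim
    case (elim x)
    then have x: "x \<in> space S" by (simp add: space_\<pi>)
    from elim(1) AE_space show ?case
    proof eventually_elim
      case (elim \<omega>)
      then have "\<omega> i \<in> space S" for i by (intro K.path_in_space) (simp add: K.space_law[OF x])
      then show ?case using elim(1) by (intro allI K.square_integrable_kernel(2) m) auto
    qed
  qed
qed

text \<open>The ergodic theorem for \<open>g\<^sup>2\<close> implies \<open>g(\<xi>\<^sub>n)\<^sup>2 = o(n)\<close> almost surely.\<close>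

lemma AE_running_maximum:
  assumes g: "square_integrable g"
  shows "AE x in \<pi>. AE \<omega> in K.law x. \<forall>\<delta>>0. \<forall>\<^sub>F n in sequentially. \<forall>i\<le>n. \<bar>g (\<omega> i)\<bar> < \<delta> * sqrt n"
proof -
  have "AE x in \<pi>. AE \<omega> in K.law x. (\<lambda>n. (\<Sum>j<n. (g (\<omega> j))\<^sup>2) / real n) \<longlonglongrightarrow> (\<integral>x. (g x)\<^sup>2 \<partial>\<pi>)"
    by (rule chain_ergodic_theorem[OF square_integrable_real[OF g]])
  then show ?thesis
  proof eventually_elim
    case (elim x)
    then show ?case
      by eventually_elim (auto intro: running_maximum_negligible dest: last_term_negligible)
  qed
qed

definition truncation :: "('a \<Rightarrow> real) \<Rightarrow> nat \<Rightarrow> 'a \<Rightarrow> real" where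
  "truncation g K x = max (- real K) (min (real K) (g x))"

lemma truncation_bdd: "\<bar>truncation g K x\<bar> \<le> real K"
  by (auto simp: truncation_def)

lemma truncation_close:
  assumes g: "square_integrable g" and e: "e > 0"
  shows "\<exists>K. (\<integral>\<^sup>+x. ennreal ((g x - truncation g K x)\<^sup>2) \<partial>\<pi>) \<le> ennreal e"
proof -
  have [measurable]: "g \<in> borel_measurable S" using g by (auto simp: square_integrable_def)
  have le: "(g x - truncation g K x)\<^sup>2 \<le> (g x)\<^sup>2" for K x
    by (rule abs_le_square_iff[THEN iffD1]) (auto simp: truncation_def)
  have tm: "(\<lambda>x. (g x - truncation g K x)\<^sup>2) \<in> borel_measurable \<pi>" for K
    unfolding truncation_def measurable_\<pi> by measurable
  have "(\<lambda>K. \<integral>x. (g x - truncation g K x)\<^sup>2 \<partial>\<pi>) \<longlonglongrightarrow> (\<integral>x. 0 \<partial>\<pi>)"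
  proof (rule integral_dominated_convergence[where w="\<lambda>x. (g x)\<^sup>2"])
    show "AE x in \<pi>. (\<lambda>K. (g x - truncation g K x)\<^sup>2) \<longlonglongrightarrow> 0"
    proof (rule AE_I2)
      fix x
      obtain K0 :: nat where "\<bar>g x\<bar> \<le> real K0" using real_arch_simple by blast
      then have "(g x - truncation g K x)\<^sup>2 = 0" if "K \<ge> K0" for K
        using that by (auto simp: truncation_def)
      then show "(\<lambda>K. (g x - truncation g K x)\<^sup>2) \<longlonglongrightarrow> 0"
        by (intro tendsto_eventually eventually_sequentiallyI[of K0]) auto
    qed
  qed (use tm le square_integrable_real[OF g] in auto)
  then have "\<forall>\<^sub>F K in sequentially. (\<integral>x. (g x - truncation g K x)\<^sup>2 \<partial>\<pi>) < e"
    using e by (intro order_tendstoD(2)) auto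
  then obtain K where K: "(\<integral>x. (g x - truncation g K x)\<^sup>2 \<partial>\<pi>) < e" unfolding eventually_sequentially by blast
  have "integrable \<pi> (\<lambda>x. (g x - truncation g K x)\<^sup>2)"
    by (rule Bochner_Integration.integrable_bound[OF square_integrable_real[OF g] tm]) (use le in auto)
  then have "(\<integral>\<^sup>+x. ennreal ((g x - truncation g K x)\<^sup>2) \<partial>\<pi>) = ennreal (\<integral>x. (g x - truncation g K x)\<^sup>2 \<partial>\<pi>)"
    by (intro nn_integral_eq_integral) auto
  then show ?thesis using K by (intro exI[of _ K]) (simp add: ennreal_leI)
qed

text \<open>The mean of the conditional variance is at most the second moment of \<open>r\<close>, so by the ergodic
  theorem the conditional variance at time \<open>n\<close> is eventually at most \<open>2 v n\<close>, and Lenglart's inequality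
  applies with this bound.\<close>

lemma small_martingale:
  assumes r: "r \<in> borel_measurable S" and v: "(\<integral>\<^sup>+x. ennreal ((r x)\<^sup>2) \<partial>\<pi>) \<le> ennreal v" and v0: "0 < v"
  shows "AE x in \<pi>. \<forall>\<epsilon>>0. \<forall>\<eta>>0. \<forall>\<^sub>F n in sequentially.
    measure (K.law x) {\<omega> \<in> space K.paths. \<exists>j\<le>n. \<epsilon> * sqrt n \<le> \<bar>K.increments_sum (K.mart_diff r) j \<omega>\<bar>} \<le> 2 * v / \<epsilon>\<^sup>2 + \<eta>"
proof -
  note [measurable] = r
  define V where "V y = (\<integral>\<^sup>+z. ennreal ((K.mart_diff r y z)\<^sup>2) \<partial>Q y)" for y
  have V_meas[measurable]: "V \<in> borel_measurable S"
    unfolding V_def using K.mart_diff_measurable[OF r] by measurable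
  have "(\<integral>\<^sup>+y. V y \<partial>\<pi>) \<le> (\<integral>\<^sup>+y. \<integral>\<^sup>+z. ennreal ((r z)\<^sup>2) \<partial>Q y \<partial>\<pi>)"
    unfolding V_def by (rule nn_integral_mono, rule K.markov_op_square_le(2)[OF _ r]) (simp add: space_\<pi>)
  also have "\<dots> \<le> ennreal v" using v by (subst \<pi>_stationary) auto
  finally have V_int: "(\<integral>\<^sup>+y. V y \<partial>\<pi>) \<le> ennreal v" .
  then have "(\<integral>\<^sup>+y. V y \<partial>\<pi>) \<noteq> \<infinity>" by (auto simp: top_unique)
  then have V_fin: "AE y in \<pi>. V y \<noteq> \<infinity>" by (intro nn_integral_PInf_AE) (auto simp: measurable_\<pi>)
  define u where "u y = enn2real (V y)" for y
  have u_meas[measurable]: "u \<in> borel_measurable S" unfolding u_def by measurable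
  have Vu: "(\<integral>\<^sup>+y. ennreal (u y) \<partial>\<pi>) = (\<integral>\<^sup>+y. V y \<partial>\<pi>)"
    using V_fin by (intro nn_integral_cong_AE) (auto simp: u_def less_top)
  have u_int: "integrable \<pi> u"
    using Vu V_int by (intro integrableI_nonneg) (auto simp: measurable_\<pi> u_def intro: le_less_trans)
  have "(\<integral>\<^sup>+y. ennreal (u y) \<partial>\<pi>) = ennreal (\<integral>y. u y \<partial>\<pi>)"
    by (rule nn_integral_eq_integral[OF u_int]) (simp add: u_def)
  then have "ennreal (\<integral>y. u y \<partial>\<pi>) \<le> ennreal v" using Vu V_int by simp
  then have u_le: "(\<integral>y. u y \<partial>\<pi>) \<le> v" using v0 by simp
  have "AE x in \<pi>. AE \<omega> in K.law x. (\<lambda>n. (\<Sum>j<n. u (\<omega> j)) / real n) \<longlonglongrightarrow> (\<integral>y. u y \<partial>\<pi>)"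
    by (rule chain_ergodic_theorem[OF u_int])
  moreover have "AE x in \<pi>. AE \<omega> in K.law x. \<forall>i. V (\<omega> i) \<noteq> \<infinity>"
    using V_fin by (rule AE_law_all_coordinates) measurable
  ultimately show ?thesis
  proof (rule AE_mp[OF AE_conjI AE_I2[OF impI]])
    fix x assume "x \<in> space \<pi>"
      and good: "(AE \<omega> in K.law x. (\<lambda>n. (\<Sum>j<n. u (\<omega> j)) / real n) \<longlonglongrightarrow> (\<integral>y. u y \<partial>\<pi>)) \<and> (AE \<omega> in K.law x. \<forall>i. V (\<omega> i) \<noteq> \<infinity>)"
    then have x: "x \<in> space S" by (simp add: space_\<pi>)
    interpret L: prob_space "K.law x" using x by (rule K.prob_space_law)
    define A where "A n = {\<omega> \<in> space K.paths. \<not> (\<Sum>l<n. V (\<omega> l)) \<le> ennreal (2 * v * real n)}" for n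
    have A_sets: "A n \<in> sets (K.law x)" for n unfolding A_def K.sets_law[OF x] by measurable
    have A_small: "(\<lambda>n. measure (K.law x) (A n)) \<longlonglongrightarrow> 0"
    proof (rule AE_eventually_not_imp_prob_tendsto_0[OF L.prob_space_axioms A_sets])
      show "AE \<omega> in K.law x. \<forall>\<^sub>F n in sequentially. \<omega> \<notin> A n"
        using good[THEN conjunct1] good[THEN conjunct2]
      proof eventually_elim
        case (elim \<omega>)
        have "\<forall>\<^sub>F n in sequentially. (\<Sum>j<n. u (\<omega> j)) / real n < 2 * v"
          using elim(1) u_le v0 by (intro order_tendstoD(2)) auto
        then show ?case
          using eventually_gt_at_top[of 0]
        proof eventually_elim
          case n: (elim n)
          have "(\<Sum>l<n. V (\<omega> l)) = (\<Sum>l<n. ennreal (u (\<omega> l)))"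
            using elim(2) by (intro sum.cong) (auto simp: u_def less_top)
          also have "\<dots> = ennreal (\<Sum>l<n. u (\<omega> l))" by (intro sum_ennreal) (simp add: u_def)
          also have "\<dots> \<le> ennreal (2 * v * real n)"
            using n by (intro ennreal_leI) (simp add: divide_less_eq)
          finally show ?case by (simp add: A_def)
        qed
      qed
    qed
    show "\<forall>\<epsilon>>0. \<forall>\<eta>>0. \<forall>\<^sub>F n in sequentially.
      measure (K.law x) {\<omega> \<in> space K.paths. \<exists>j\<le>n. \<epsilon> * sqrt n \<le> \<bar>K.increments_sum (K.mart_diff r) j \<omega>\<bar>} \<le> 2 * v / \<epsilon>\<^sup>2 + \<eta>"
    proof (intro allI impI)
      fix \<epsilon> \<eta> :: real assume \<epsilon>: "\<epsilon> > 0" and \<eta>: "\<eta> > 0"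
      have "\<forall>\<^sub>F n in sequentially. measure (K.law x) (A n) < \<eta>"
        using A_small \<eta> by (rule order_tendstoD(2))
      then show "\<forall>\<^sub>F n in sequentially.
        measure (K.law x) {\<omega> \<in> space K.paths. \<exists>j\<le>n. \<epsilon> * sqrt n \<le> \<bar>K.increments_sum (K.mart_diff r) j \<omega>\<bar>} \<le> 2 * v / \<epsilon>\<^sup>2 + \<eta>"
        using eventually_gt_at_top[of 0]
      proof eventually_elim
        case (elim n)
        let ?M = "K.increments_sum (K.mart_diff r)"
        let ?G = "{\<omega> \<in> space K.paths. (\<exists>j\<le>n. \<epsilon> * sqrt n \<le> \<bar>?M j \<omega>\<bar>) \<and> (\<Sum>l<n. V (\<omega> l)) \<le> ennreal (2 * v * real n)}"
        note [measurable] = K.increments_sum_measurable[OF K.mart_diff_measurable[OF r]]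
        have G_sets: "?G \<in> sets (K.law x)" unfolding K.sets_law[OF x] by measurable
        have "measure (K.law x) ?G \<le> (2 * v * real n) / (\<epsilon> * sqrt n)\<^sup>2"
          unfolding V_def using \<epsilon> v0 elim K.mart_diff_centered[OF _ r]
          by (intro K.lenglart_maximal[OF x K.mart_diff_measurable[OF r]]) auto
        also have "\<dots> = 2 * v / \<epsilon>\<^sup>2" using elim by (simp add: power_mult_distrib)
        finally have G: "measure (K.law x) ?G \<le> 2 * v / \<epsilon>\<^sup>2" .
        have "measure (K.law x) {\<omega> \<in> space K.paths. \<exists>j\<le>n. \<epsilon> * sqrt n \<le> \<bar>?M j \<omega>\<bar>} \<le> measure (K.law x) (?G \<union> A n)"
        proof (rule L.finite_measure_mono)
          show "{\<omega> \<in> space K.paths. \<exists>j\<le>n. \<epsilon> * sqrt n \<le> \<bar>?M j \<omega>\<bar>} \<subseteq> ?G \<union> A n" unfolding A_def by blast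
          show "?G \<union> A n \<in> sets (K.law x)" using G_sets A_sets by (rule sets.Un)
        qed
        also have "\<dots> \<le> measure (K.law x) ?G + measure (K.law x) (A n)"
          using G_sets A_sets by (rule measure_Un_le)
        finally show ?case using G elim(1) by linarith
      qed
    qed
  qed
qed

end

section \<open>The quenched functional central limit theorem\<close>

lemma partial_sum_measurable:
  assumes "f \<in> borel_measurable S"
  shows "partial_sum f n \<in> borel_measurable (path_algebra S)"
  unfolding partial_sum_def using assms by measurable

lemma markov_avg_measurable:
  assumes "markov_kernel S Q" "f \<in> borel_measurable S"
  shows "markov_avg Q f m \<in> borel_measurable S"
proof -
  interpret markov_kernel S Q by (rule assms)
  show ?thesis unfolding markov_avg_def using iterates_measurable[OF assms(2)] by measurable
qed

context stationary_ergodic_markov_chain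
begin

text \<open>The functions \<open>c m\<close> are truncations of the solutions of the Poisson equations, with an error of
  at most \<open>1 / (m + 1)\<close> in mean square. The error of the approximation consists of the partial sums of
  \<open>f\<^sub>m\<close>, the martingale of the truncation error and the boundary terms.\<close>

lemma quenched_martingale_approximation:
  assumes f: "square_integrable f"
    and maximal: "\<And>\<epsilon>::real. \<epsilon> > 0 \<Longrightarrow> AE x in \<pi>.
      (\<lambda>m. limsup (\<lambda>n. ereal (\<P>(\<omega> in K.law x.
         (MAX j\<in>{1..n}. \<bar>partial_sum (markov_avg Q f m) j \<omega>\<bar> / sqrt (real n)) > \<epsilon>)))) \<longlonglongrightarrow> 0"
  shows "\<exists>(c :: nat \<Rightarrow> 'a \<Rightarrow> real) C. (\<forall>m. c m \<in> borel_measurable S) \<and> (\<forall>m z. \<bar>c m z\<bar> \<le> C m) \<and>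
    (AE x in \<pi>. \<forall>\<epsilon>>0. \<forall>\<eta>>0. \<exists>m0. \<forall>m\<ge>m0. \<forall>\<^sub>F n in sequentially.
      measure (K.law x) {\<omega> \<in> space K.paths. \<exists>j\<le>n. \<epsilon> * sqrt n
        \<le> \<bar>partial_sum f j \<omega> - K.increments_sum (K.mart_diff (c m)) j \<omega>\<bar>} \<le> \<eta>)"
proof -
  define g where "g m = K.poisson_solution f m" for m
  have g: "square_integrable (g m)" for m unfolding g_def by (rule square_integrable_poisson_solution[OF f])
  have "\<exists>k. (\<integral>\<^sup>+x. ennreal ((g m x - truncation (g m) k x)\<^sup>2) \<partial>\<pi>) \<le> ennreal (1 / real (Suc m))" for m
    by (rule truncation_close[OF g]) simp
  then obtain k where k: "\<And>m. (\<integral>\<^sup>+x. ennreal ((g m x - truncation (g m) (k m) x)\<^sup>2) \<partial>\<pi>) \<le> ennreal (1 / real (Suc m))"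
    by metis
  define c where "c m = truncation (g m) (k m)" for m
  have g_meas[measurable]: "g m \<in> borel_measurable S" for m using g by (simp add: square_integrable_def)
  have c_meas[measurable]: "c m \<in> borel_measurable S" for m unfolding c_def truncation_def by measurable
  have c_bdd: "\<bar>c m z\<bar> \<le> real (k m)" for m z unfolding c_def by (rule truncation_bdd)
  have f_meas[measurable]: "f \<in> borel_measurable S" using f by (simp add: square_integrable_def)
  have avg_meas: "markov_avg Q f m \<in> borel_measurable S" for m
    by (rule markov_avg_measurable[OF K.markov_kernel_axioms f_meas])
  have r_meas[measurable]: "(\<lambda>z. g m z - c m z) \<in> borel_measurable S" for m by measurable
  have "AE x in \<pi>. \<forall>p. (\<lambda>m. limsup (\<lambda>n. ereal (\<P>(\<omega> in K.law x.
         (MAX j\<in>{1..n}. \<bar>partial_sum (markov_avg Q f m) j \<omega>\<bar> / sqrt (real n)) > inverse (real (Suc p)))))) \<longlonglongrightarrow> 0"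
    unfolding AE_all_countable by (intro allI maximal) simp
  moreover have "AE x in \<pi>. AE \<omega> in K.law x. \<forall>i j. integrable (Q (\<omega> i)) ((markov_op Q ^^ j) f)"
    by (rule AE_iterates_integrable[OF f])
  moreover have "AE x in \<pi>. \<forall>m. AE \<omega> in K.law x. \<forall>\<delta>>0. \<forall>\<^sub>F n in sequentially. \<forall>i\<le>n. \<bar>markov_op Q (g m) (\<omega> i)\<bar> < \<delta> * sqrt n"
    unfolding AE_all_countable by (intro allI AE_running_maximum square_integrable_markov_op g)
  moreover have "AE x in \<pi>. \<forall>m. \<forall>\<epsilon>>0. \<forall>\<eta>>0. \<forall>\<^sub>F n in sequentially.
    measure (K.law x) {\<omega> \<in> space K.paths. \<exists>j\<le>n. \<epsilon> * sqrt n \<le> \<bar>K.increments_sum (K.mart_diff (\<lambda>z. g m z - c m z)) j \<omega>\<bar>}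
      \<le> 2 * (1 / real (Suc m)) / \<epsilon>\<^sup>2 + \<eta>"
    unfolding AE_all_countable using k by (intro allI small_martingale r_meas) (auto simp: c_def)
  ultimately have "AE x in \<pi>. \<forall>\<epsilon>>0. \<forall>\<eta>>0. \<exists>m0. \<forall>m\<ge>m0. \<forall>\<^sub>F n in sequentially.
      measure (K.law x) {\<omega> \<in> space K.paths. \<exists>j\<le>n. \<epsilon> * sqrt n
        \<le> \<bar>partial_sum f j \<omega> - K.increments_sum (K.mart_diff (c m)) j \<omega>\<bar>} \<le> \<eta>"
    using AE_space
  proof eventually_elim
    case (elim x)
    note hyp = elim(1) and int = elim(2) and rmax = elim(3) and small = elim(4)
    have x: "x \<in> space S" using elim(5) by (simp add: space_\<pi>)
    interpret L: prob_space "K.law x" using x by (rule K.prob_space_law)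
    show ?case
    proof (intro allI impI)
      fix \<epsilon> \<eta> :: real assume \<epsilon>: "\<epsilon> > 0" and \<eta>: "\<eta> > 0"
      \<comment> \<open>The budget: \<open>\<epsilon> / 8\<close> for the averages, \<open>\<epsilon> / 4\<close> for the truncation error and for each of the two
        boundary terms. The hypothesis is available for the countably many levels \<open>1 / (p + 1)\<close>.\<close>
      obtain p where p: "inverse (real (Suc p)) < \<epsilon> / 8" using \<epsilon> reals_Archimedean[of "\<epsilon> / 8"] by auto
      define \<delta> where "\<delta> = inverse (real (Suc p))"
      define A where "A m n = {\<omega> \<in> space (K.law x).
         (MAX j\<in>{1..n}. \<bar>partial_sum (markov_avg Q f m) j \<omega>\<bar> / sqrt (real n)) > \<delta>}" for m n :: nat
      define D where "D m n = {\<omega> \<in> space K.paths. \<exists>j\<le>n. (\<epsilon> / 4) * sqrt n \<le> \<bar>K.increments_sum (K.mart_diff (\<lambda>z. g m z - c m z)) j \<omega>\<bar>}" for m n :: nat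
      define G where "G m n = {\<omega> \<in> space K.paths. \<not> (\<forall>i\<le>n. \<bar>markov_op Q (g m) (\<omega> i)\<bar> < (\<epsilon> / 4) * sqrt n)}" for m n :: nat
      define E where "E m n = {\<omega> \<in> space K.paths. \<exists>j\<le>n. \<epsilon> * sqrt n
        \<le> \<bar>partial_sum f j \<omega> - K.increments_sum (K.mart_diff (c m)) j \<omega>\<bar>}" for m n :: nat
      note [measurable] = K.increments_sum_measurable[OF K.mart_diff_measurable[OF r_meas]]
        K.increments_sum_measurable[OF K.mart_diff_measurable[OF c_meas]] K.markov_op_measurable[OF g_meas]
        partial_sum_measurable[OF f_meas] partial_sum_measurable[OF avg_meas]
      have A_sets: "A m n \<in> sets (K.law x)" for m n
        unfolding A_def K.space_law[OF x] K.sets_law[OF x] by (cases "n = 0") (auto intro!: borel_measurable_Max)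
      have D_sets: "D m n \<in> sets (K.law x)" for m n unfolding D_def K.sets_law[OF x] by measurable
      have G_sets: "G m n \<in> sets (K.law x)" for m n unfolding G_def K.sets_law[OF x] by measurable
      have E_sets: "E m n \<in> sets (K.law x)" for m n unfolding E_def K.sets_law[OF x] by measurable
      have "(\<lambda>m. limsup (\<lambda>n. ereal (measure (K.law x) (A m n)))) \<longlonglongrightarrow> 0"
        using hyp unfolding A_def \<delta>_def by blast
      then have "\<forall>\<^sub>F m in sequentially. limsup (\<lambda>n. ereal (measure (K.law x) (A m n))) < ereal (\<eta> / 4)"
        using \<eta> by (intro order_tendstoD(2)) auto
      then obtain m1 where m1: "\<And>m. m \<ge> m1 \<Longrightarrow> limsup (\<lambda>n. ereal (measure (K.law x) (A m n))) < ereal (\<eta> / 4)"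
        unfolding eventually_sequentially by blast
      have "(\<lambda>m. 2 * (1 / real (Suc m)) / (\<epsilon> / 4)\<^sup>2) \<longlonglongrightarrow> 0" using \<epsilon> by real_asymp
      then have "\<forall>\<^sub>F m in sequentially. 2 * (1 / real (Suc m)) / (\<epsilon> / 4)\<^sup>2 < \<eta> / 4"
        using \<eta> by (intro order_tendstoD(2)) auto
      then obtain m2 where m2: "\<And>m. m \<ge> m2 \<Longrightarrow> 2 * (1 / real (Suc m)) / (\<epsilon> / 4)\<^sup>2 < \<eta> / 4"
        unfolding eventually_sequentially by blast
      have "\<forall>\<^sub>F n in sequentially. measure (K.law x) (E m n) \<le> \<eta>" if m: "m \<ge> max (Suc m1) m2" for m
      proof -
        have "\<forall>\<^sub>F n in sequentially. ereal (measure (K.law x) (A m n)) < ereal (\<eta> / 4)"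
          using m1[of m] m by (intro Limsup_lessD) auto
        moreover have "\<forall>\<^sub>F n in sequentially. measure (K.law x) (D m n) \<le> 2 * (1 / real (Suc m)) / (\<epsilon> / 4)\<^sup>2 + \<eta> / 4"
          unfolding D_def by (intro small[rule_format]) (use \<epsilon> \<eta> in auto)
        moreover have "(\<lambda>n. measure (K.law x) (G m n)) \<longlonglongrightarrow> 0"
        proof (rule AE_eventually_not_imp_prob_tendsto_0[OF L.prob_space_axioms G_sets])
          show "AE \<omega> in K.law x. \<forall>\<^sub>F n in sequentially. \<omega> \<notin> G m n"
            using rmax[rule_format, of m]
          proof eventually_elim
            case (elim \<omega>)
            have "\<forall>\<^sub>F n in sequentially. \<forall>i\<le>n. \<bar>markov_op Q (g m) (\<omega> i)\<bar> < (\<epsilon> / 4) * sqrt n"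
              by (rule elim[THEN spec, THEN mp]) (use \<epsilon> in simp)
            then show ?case by eventually_elim (simp add: G_def)
          qed
        qed
        then have "\<forall>\<^sub>F n in sequentially. measure (K.law x) (G m n) < \<eta> / 4" using \<eta> by (intro order_tendstoD(2)) auto
        ultimately show ?thesis
          using eventually_gt_at_top[of 0]
        proof eventually_elim
          case (elim n)
          have "AE \<omega> in K.law x. \<omega> \<in> E m n \<longrightarrow> \<omega> \<in> A m n \<union> D m n \<union> G m n"
            using int AE_space
          proof eventually_elim
            case \<omega>: (elim \<omega>)
            have sp: "\<omega> \<in> space K.paths" using \<omega>(2) by (simp add: K.space_law[OF x])
            show ?case
            proof (intro impI, rule ccontr)
              assume "\<omega> \<in> E m n" and no: "\<omega> \<notin> A m n \<union> D m n \<union> G m n"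
              then obtain j where j: "j \<le> n" and big: "\<epsilon> * sqrt n \<le> \<bar>partial_sum f j \<omega> - K.increments_sum (K.mart_diff (c m)) j \<omega>\<bar>"
                by (auto simp: E_def)
              have "0 < \<epsilon> * sqrt n" using \<epsilon> elim by simp
              have "j \<noteq> 0"
              proof
                assume "j = 0"
                then show False using big \<open>0 < \<epsilon> * sqrt n\<close> by (simp add: partial_sum_def K.increments_sum_def)
              qed
              have "\<bar>partial_sum (markov_avg Q f m) j \<omega>\<bar> / sqrt n \<le> (MAX j\<in>{1..n}. \<bar>partial_sum (markov_avg Q f m) j \<omega>\<bar> / sqrt n)"
                using j \<open>j \<noteq> 0\<close> by (intro Max_ge) auto
              also have "\<dots> \<le> \<delta>" using no \<omega>(2) by (simp add: A_def not_less)
              finally have "\<bar>partial_sum (markov_avg Q f m) j \<omega>\<bar> \<le> \<delta> * sqrt n"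
                using elim by (simp add: pos_divide_le_eq)
              also have "\<dots> \<le> \<epsilon> / 8 * sqrt n" using p unfolding \<delta>_def by (intro mult_right_mono) auto
              finally have 1: "\<bar>partial_sum (markov_avg Q f m) j \<omega>\<bar> \<le> \<epsilon> / 8 * sqrt n" .
              have 2: "\<bar>K.increments_sum (K.mart_diff (\<lambda>z. g m z - c m z)) j \<omega>\<bar> < \<epsilon> / 4 * sqrt n"
              proof (rule ccontr)
                assume "\<not> ?thesis"
                then have "\<omega> \<in> D m n" using j sp unfolding D_def not_less by blast
                then show False using no by blast
              qed
              have 3: "\<bar>markov_op Q (g m) (\<omega> i)\<bar> < \<epsilon> / 4 * sqrt n" if "i \<le> n" for i
                using no that sp unfolding G_def by blast
              have "partial_sum f j \<omega> - K.increments_sum (K.mart_diff (c m)) j \<omega>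
                  = partial_sum (markov_avg Q f m) j \<omega> + K.increments_sum (K.mart_diff (\<lambda>z. g m z - c m z)) j \<omega>
                    + markov_op Q (g m) (\<omega> 0) - markov_op Q (g m) (\<omega> j)"
                unfolding g_def using \<omega>(1) m
                by (intro K.martingale_decomposition[OF sp _ _ c_meas c_bdd, unfolded g_def]) auto
              then have "\<bar>partial_sum f j \<omega> - K.increments_sum (K.mart_diff (c m)) j \<omega>\<bar>
                  < \<epsilon> / 8 * sqrt n + \<epsilon> / 4 * sqrt n + \<epsilon> / 4 * sqrt n + \<epsilon> / 4 * sqrt n"
                using 1 2 3[of 0] 3[OF j] by linarith
              also have "\<dots> = 7 / 8 * (\<epsilon> * sqrt n)" by simp
              finally show False using big \<open>0 < \<epsilon> * sqrt n\<close> by linarith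
            qed
          qed
          then have "measure (K.law x) (E m n) \<le> measure (K.law x) (A m n \<union> D m n \<union> G m n)"
            using A_sets D_sets G_sets by (intro L.finite_measure_mono_AE) auto
          also have "\<dots> \<le> measure (K.law x) (A m n) + measure (K.law x) (D m n) + measure (K.law x) (G m n)"
            using A_sets[of m n] D_sets[of m n] G_sets[of m n]
            by (intro order_trans[OF measure_Un_le] add_mono measure_Un_le) auto
          also have "\<dots> \<le> \<eta>" using elim m2[of m] m by simp
          finally show ?case .
        qed
      qed
      then show "\<exists>m0. \<forall>m\<ge>m0. \<forall>\<^sub>F n in sequentially. measure (K.law x) {\<omega> \<in> space K.paths. \<exists>j\<le>n. \<epsilon> * sqrt n
        \<le> \<bar>partial_sum f j \<omega> - K.increments_sum (K.mart_diff (c m)) j \<omega>\<bar>} \<le> \<eta>"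
        unfolding E_def by blast
    qed
  qed
  moreover have "\<forall>m. c m \<in> borel_measurable S" "\<forall>m z. \<bar>c m z\<bar> \<le> real (k m)"
    using c_meas c_bdd by blast+
  ultimately show ?thesis
    by (intro exI[of _ c] exI[of _ "\<lambda>m. real (k m)"]) (intro conjI)
qed

end

text \<open>At \<open>t = 1\<close> the Gaussian characteristic functions form a Cauchy sequence, and \<open>\<sigma>\<close> is a continuous
  function of their values as long as the limit is not zero. A zero limit would mean
  \<open>\<sigma> \<longlonglongrightarrow> \<infinity>\<close>, so that the characteristic functions tend to \<open>0\<close> off the origin; this contradicts the
  Cauchy estimate near \<open>t = 0\<close>, where they are close to one.\<close>

lemma gaussian_scale_converges:
  fixes \<sigma> :: "nat \<Rightarrow> real"
  assumes \<sigma>: "\<And>m. 0 \<le> \<sigma> m"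
    and cauchy: "\<And>\<epsilon> \<eta>. \<epsilon> > 0 \<Longrightarrow> \<eta> > 0 \<Longrightarrow> \<exists>m0. \<forall>m\<ge>m0. \<forall>l\<ge>m0. \<forall>t.
      \<bar>exp (- (t * \<sigma> m)\<^sup>2 / 2) - exp (- (t * \<sigma> l)\<^sup>2 / 2)\<bar> \<le> 2 * \<bar>t\<bar> * \<epsilon> + \<eta>"
  shows "\<exists>s\<ge>0. \<sigma> \<longlonglongrightarrow> s"
proof -
  define \<phi> where "\<phi> m t = exp (- (t * \<sigma> m)\<^sup>2 / 2)" for m and t :: real
  have "Cauchy (\<lambda>m. \<phi> m 1)"
  proof (rule metric_CauchyI)
    fix e :: real assume "e > 0"
    then obtain m0 where "\<forall>m\<ge>m0. \<forall>l\<ge>m0. \<forall>t. \<bar>\<phi> m t - \<phi> l t\<bar> \<le> 2 * \<bar>t\<bar> * (e / 8) + e / 4"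
      using cauchy[of "e / 8" "e / 4"] unfolding \<phi>_def by auto
    then have "\<forall>m\<ge>m0. \<forall>l\<ge>m0. dist (\<phi> m 1) (\<phi> l 1) < e"
      using \<open>e > 0\<close> by (fastforce simp: dist_real_def dest: spec[of _ 1])
    then show "\<exists>M. \<forall>m\<ge>M. \<forall>n\<ge>M. dist (\<phi> m 1) (\<phi> n 1) < e" by blast
  qed
  then obtain a where a: "(\<lambda>m. \<phi> m 1) \<longlonglongrightarrow> a" using Cauchy_convergent_iff convergent_def by blast
  have "0 \<le> a" by (rule LIMSEQ_le_const[OF a]) (simp add: \<phi>_def)
  have "a \<noteq> 0"
  proof
    assume "a = 0"
    obtain m0 where m0: "\<And>m l t. m \<ge> m0 \<Longrightarrow> l \<ge> m0 \<Longrightarrow> \<bar>\<phi> m t - \<phi> l t\<bar> \<le> 2 * \<bar>t\<bar> * 1 + 1 / 8"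
      using cauchy[of 1 "1 / 8"] unfolding \<phi>_def by fastforce
    \<comment> \<open>Small enough for \<open>\<phi> m0 t \<ge> 1 / 2\<close> and for \<open>2 t + 1 / 8 \<le> 1 / 4\<close>.\<close>
    define t where "t = min (1 / 16) (1 / (\<sigma> m0 + 1))"
    have t: "0 < t" "t \<le> 1 / 16" "t * \<sigma> m0 \<le> 1"
    proof -
      show "0 < t" "t \<le> 1 / 16" using \<sigma>[of m0] by (auto simp: t_def)
      have "t * \<sigma> m0 \<le> 1 / (\<sigma> m0 + 1) * \<sigma> m0" using \<sigma>[of m0] by (intro mult_right_mono) (auto simp: t_def)
      also have "\<dots> \<le> 1" using \<sigma>[of m0] by (simp add: divide_simps)
      finally show "t * \<sigma> m0 \<le> 1" .
    qed
    have "\<phi> l t = \<phi> l 1 powr (t\<^sup>2)" for l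
      by (simp add: \<phi>_def exp_powr_real power_mult_distrib mult.commute)
    moreover have "(\<lambda>l. \<phi> l 1 powr (t\<^sup>2)) \<longlonglongrightarrow> a powr (t\<^sup>2)"
      using t \<open>a = 0\<close> by (intro tendsto_powr2 a tendsto_const) (auto simp: \<phi>_def)
    ultimately have "(\<lambda>l. \<phi> l t) \<longlonglongrightarrow> 0" using \<open>a = 0\<close> by simp
    then have "(\<lambda>l. \<bar>\<phi> m0 t - \<phi> l t\<bar>) \<longlonglongrightarrow> \<bar>\<phi> m0 t - 0\<bar>" by (intro tendsto_intros)
    then have "\<bar>\<phi> m0 t - 0\<bar> \<le> 2 * \<bar>t\<bar> * 1 + 1 / 8"
      by (rule LIMSEQ_le_const2) (use m0 in blast)
    then have "\<phi> m0 t \<le> 1 / 4" using t by simp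
    moreover have "1 / 2 \<le> \<phi> m0 t"
    proof -
      have "(t * \<sigma> m0)\<^sup>2 \<le> 1" using t \<sigma>[of m0] by (intro power_le_one) auto
      then show ?thesis using exp_ge_add_one_self[of "- ((t * \<sigma> m0)\<^sup>2 / 2)"] by (simp add: \<phi>_def)
    qed
    ultimately show False by simp
  qed
  then have "a > 0" using \<open>0 \<le> a\<close> by simp
  have \<sigma>_eq: "\<sigma> = (\<lambda>m. sqrt (- 2 * ln (\<phi> m 1)))"
  proof
    fix m show "\<sigma> m = sqrt (- 2 * ln (\<phi> m 1))" using \<sigma>[of m] by (simp add: \<phi>_def)
  qed
  have lim: "\<sigma> \<longlonglongrightarrow> sqrt (- 2 * ln a)"
    unfolding \<sigma>_eq using \<open>a > 0\<close> by (intro tendsto_intros a) auto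
  show ?thesis using \<sigma> by (intro exI[of _ "sqrt (- 2 * ln a)"] conjI LIMSEQ_le_const[OF lim] lim) auto
qed

lemma cf_close:
  assumes M: "prob_space M" and X: "X \<in> borel_measurable M" and Y: "Y \<in> borel_measurable M" and E: "E \<in> sets M"
    and \<epsilon>: "0 \<le> \<epsilon>" and close: "\<And>\<omega>. \<omega> \<in> space M \<Longrightarrow> \<omega> \<notin> E \<Longrightarrow> \<bar>X \<omega> - Y \<omega>\<bar> \<le> \<epsilon>"
  shows "norm ((\<integral>\<omega>. iexp (t * X \<omega>) \<partial>M) - (\<integral>\<omega>. iexp (t * Y \<omega>) \<partial>M)) \<le> \<bar>t\<bar> * \<epsilon> + 2 * measure M E"
proof -
  interpret prob_space M by (rule M)
  note [measurable] = X Y E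
  have int: "integrable M (\<lambda>\<omega>. iexp (t * X \<omega>))" "integrable M (\<lambda>\<omega>. iexp (t * Y \<omega>))"
    by (rule integrable_const_bound[where B=1], simp, measurable)+
  have iE: "integrable M (indicator E :: _ \<Rightarrow> real)" by (intro integrable_real_indicator) (auto simp: emeasure_eq_measure)
  have "norm ((\<integral>\<omega>. iexp (t * X \<omega>) \<partial>M) - (\<integral>\<omega>. iexp (t * Y \<omega>) \<partial>M)) = norm (\<integral>\<omega>. iexp (t * X \<omega>) - iexp (t * Y \<omega>) \<partial>M)"
    using int by (simp only: Bochner_Integration.integral_diff)
  also have "\<dots> \<le> (\<integral>\<omega>. norm (iexp (t * X \<omega>) - iexp (t * Y \<omega>)) \<partial>M)" by (rule integral_norm_bound)
  also have "\<dots> \<le> (\<integral>\<omega>. \<bar>t\<bar> * \<epsilon> + 2 * indicator E \<omega> \<partial>M)"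
  proof (rule integral_mono)
    show "integrable M (\<lambda>\<omega>. norm (iexp (t * X \<omega>) - iexp (t * Y \<omega>)))"
      by (intro integrable_norm Bochner_Integration.integrable_diff int)
    show "integrable M (\<lambda>\<omega>. \<bar>t\<bar> * \<epsilon> + 2 * indicator E \<omega>)" using iE by simp
    fix \<omega> assume \<omega>: "\<omega> \<in> space M"
    show "norm (iexp (t * X \<omega>) - iexp (t * Y \<omega>)) \<le> \<bar>t\<bar> * \<epsilon> + 2 * indicator E \<omega>"
    proof (cases "\<omega> \<in> E")
      case True
      have "norm (iexp (t * X \<omega>) - iexp (t * Y \<omega>)) \<le> 1 + 1"
        by (rule order_trans[OF norm_triangle_ineq4]) simp
      moreover have "0 \<le> \<bar>t\<bar> * \<epsilon>" using \<epsilon> by simp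
      ultimately show ?thesis using True by simp
    next
      case False
      have "iexp (t * X \<omega>) = iexp (t * (X \<omega> - Y \<omega>)) * iexp (t * Y \<omega>)"
        by (simp add: exp_add[symmetric] algebra_simps)
      then have "iexp (t * X \<omega>) - iexp (t * Y \<omega>) = (iexp (t * (X \<omega> - Y \<omega>)) - 1) * iexp (t * Y \<omega>)"
        by (simp only: left_diff_distrib mult_1)
      then have "norm (iexp (t * X \<omega>) - iexp (t * Y \<omega>)) = norm (iexp (t * (X \<omega> - Y \<omega>)) - 1)"
        by (simp only: norm_mult norm_exp_i_times mult_1_right)
      also have "\<dots> \<le> \<bar>t * (X \<omega> - Y \<omega>)\<bar>"
        using iexp_approx1[of "t * (X \<omega> - Y \<omega>)" 0] by simp
      also have "\<dots> \<le> \<bar>t\<bar> * \<epsilon>" using close[OF \<omega> False] by (simp add: abs_mult mult_left_mono)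
      finally show ?thesis using False by simp
    qed
  qed
  also have "\<dots> = \<bar>t\<bar> * \<epsilon> + 2 * measure M E" using iE by (simp add: prob_space)
  finally show ?thesis .
qed

lemma brownian_path_scale_tendsto:
  assumes W: "brownian_motion N W" and \<omega>: "\<omega> \<in> space N" and \<sigma>: "\<sigma> \<longlonglongrightarrow> s"
  shows "(\<lambda>m. skorohod_dist (brownian_path W (\<sigma> m) \<omega>) (brownian_path W s \<omega>)) \<longlonglongrightarrow> 0"
proof -
  have "continuous_on {0..1} (\<lambda>t. W t \<omega>)" using W \<omega> by (simp add: brownian_motion_def)
  then have "bounded ((\<lambda>t. W t \<omega>) ` {0..1})" by (intro compact_imp_bounded compact_continuous_image) auto
  then obtain b where "\<forall>y\<in>(\<lambda>t. W t \<omega>) ` {0..1}. norm y \<le> b" unfolding bounded_iff by blast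
  then have b: "\<And>t. t \<in> {0..1} \<Longrightarrow> \<bar>W t \<omega>\<bar> \<le> b" by simp
  have b0: "0 \<le> b" using b[of 0] by simp
  show ?thesis
  proof (rule Lim_null_comparison)
    show "(\<lambda>m. \<bar>\<sigma> m - s\<bar> * b) \<longlonglongrightarrow> 0"
      using tendsto_mult[OF tendsto_rabs_zero[OF Lim_null[THEN iffD1, OF \<sigma>]] tendsto_const, of b] by simp
    have "skorohod_dist (brownian_path W (\<sigma> m) \<omega>) (brownian_path W s \<omega>) \<le> \<bar>\<sigma> m - s\<bar> * b" for m
    proof (intro skorohod_dist_le_sup brownian_path_in_skorohod[OF W \<omega>])
      fix t :: real assume t: "t \<in> {0..1}"
      then have "\<bar>brownian_path W (\<sigma> m) \<omega> t - brownian_path W s \<omega> t\<bar> = \<bar>\<sigma> m - s\<bar> * \<bar>W t \<omega>\<bar>"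
        by (simp add: brownian_path_def abs_mult[symmetric] left_diff_distrib)
      then show "\<bar>brownian_path W (\<sigma> m) \<omega> t - brownian_path W s \<omega> t\<bar> \<le> \<bar>\<sigma> m - s\<bar> * b"
        using b[OF t] by (simp add: mult_left_mono)
    qed (use b0 in simp)
    then show "\<forall>\<^sub>F m in sequentially. norm (skorohod_dist (brownian_path W (\<sigma> m) \<omega>) (brownian_path W s \<omega>)) \<le> \<bar>\<sigma> m - s\<bar> * b"
      by simp
  qed
qed

text \<open>What remains to be done once a starting point \<open>x\<close> outside the exceptional null sets is fixed: the
  partial sums are approximated by bounded martingales whose conditional variances obey the ergodic
  theorem.\<close>

locale approximated_sums = markov_kernel S Q
  for S :: "'a measure" and Q +
  fixes f :: "'a \<Rightarrow> real" and c :: "nat \<Rightarrow> 'a \<Rightarrow> real" and C :: "nat \<Rightarrow> real" and \<sigma> :: "nat \<Rightarrow> real" and x :: 'a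
  assumes x: "x \<in> space S" and f_meas: "f \<in> borel_measurable S"
    and c_meas: "\<And>m. c m \<in> borel_measurable S" and c_bdd: "\<And>m z. \<bar>c m z\<bar> \<le> C m"
    and \<sigma>_nonneg: "\<And>m. 0 \<le> \<sigma> m"
    and V: "\<And>m. AE \<omega> in law x. (\<lambda>n. (\<Sum>l<n. bounded_increments.cond_var Q (mart_diff (c m)) (\<omega> l)) / real n) \<longlonglongrightarrow> (\<sigma> m)\<^sup>2"
    and approx: "\<And>\<epsilon> \<eta>. \<epsilon> > 0 \<Longrightarrow> \<eta> > 0 \<Longrightarrow> \<exists>m0. \<forall>m\<ge>m0. \<forall>\<^sub>F n in sequentially.
      measure (law x) {\<omega> \<in> space paths. \<exists>j\<le>n. \<epsilon> * sqrt n
        \<le> \<bar>partial_sum f j \<omega> - increments_sum (mart_diff (c m)) j \<omega>\<bar>} \<le> \<eta>"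
begin

sublocale B: bounded_increments S Q "mart_diff (c m)" "2 * C m" for m
  by (rule bounded_increments_mart_diff[OF c_meas c_bdd])

abbreviation "mart m \<equiv> increments_sum (mart_diff (c m))"

definition far :: "real \<Rightarrow> nat \<Rightarrow> nat \<Rightarrow> (nat \<Rightarrow> 'a) set" where
  "far \<epsilon> m n = {\<omega> \<in> space paths. \<exists>j\<le>n. \<epsilon> * sqrt n \<le> \<bar>partial_sum f j \<omega> - mart m j \<omega>\<bar>}"

lemma far_sets: "far \<epsilon> m n \<in> sets (law x)"
proof -
  note [measurable] = partial_sum_measurable[OF f_meas]
  show ?thesis unfolding far_def sets_law[OF x] by measurable
qed

lemma not_far:
  assumes "\<omega> \<in> space (law x)" "\<omega> \<notin> far \<epsilon> m n" "j \<le> n" "n > 0"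
  shows "\<bar>partial_sum f j \<omega> / sqrt n - mart m j \<omega> / sqrt n\<bar> \<le> \<epsilon>"
proof -
  have "\<bar>partial_sum f j \<omega> - mart m j \<omega>\<bar> < \<epsilon> * sqrt n"
  proof (rule ccontr)
    assume "\<not> ?thesis"
    then have "\<omega> \<in> far \<epsilon> m n" using assms(1,3) by (auto simp: far_def space_law[OF x] not_less)
    then show False using assms(2) by simp
  qed
  moreover have "\<bar>partial_sum f j \<omega> / sqrt n - mart m j \<omega> / sqrt n\<bar> = \<bar>partial_sum f j \<omega> - mart m j \<omega>\<bar> / sqrt n"
    by (simp add: diff_divide_distrib[symmetric])
  ultimately show ?thesis using assms(4) by (simp add: pos_divide_le_eq)
qed

text \<open>All the martingales approximate the same partial sums, so their characteristic functions at time
  \<open>n\<close> are close to each other; let \<open>n\<close> tend to infinity.\<close>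

lemma scale_converges: "\<exists>s\<ge>0. \<sigma> \<longlonglongrightarrow> s"
proof (rule gaussian_scale_converges[OF \<sigma>_nonneg])
  fix \<epsilon> \<eta> :: real assume \<epsilon>: "\<epsilon> > 0" and \<eta>: "\<eta> > 0"
  interpret L: prob_space "law x" using x by (rule prob_space_law)
  obtain m0 where m0: "\<And>m. m \<ge> m0 \<Longrightarrow> \<forall>\<^sub>F n in sequentially. measure (law x) (far \<epsilon> m n) \<le> \<eta> / 4"
    using approx[OF \<epsilon>, of "\<eta> / 4"] \<eta> unfolding far_def by auto
  define \<psi> where "\<psi> m n t = (\<integral>\<omega>. iexp (t * (mart m n \<omega> / sqrt n)) \<partial>law x)" for m n t
  define \<rho> where "\<rho> n t = (\<integral>\<omega>. iexp (t * (partial_sum f n \<omega> / sqrt n)) \<partial>law x)" for n t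
  have ev: "\<forall>\<^sub>F n in sequentially. norm (\<rho> n t - \<psi> m n t) \<le> \<bar>t\<bar> * \<epsilon> + \<eta> / 2" if m: "m \<ge> m0" for m t
    using m0[OF m] eventually_gt_at_top[of 0]
  proof eventually_elim
    case (elim n)
    have "norm (\<rho> n t - \<psi> m n t) \<le> \<bar>t\<bar> * \<epsilon> + 2 * measure (law x) (far \<epsilon> m n)"
      unfolding \<rho>_def \<psi>_def
    proof (rule cf_close[OF L.prob_space_axioms _ _ far_sets])
      show "(\<lambda>\<omega>. partial_sum f n \<omega> / sqrt n) \<in> borel_measurable (law x)" "(\<lambda>\<omega>. mart m n \<omega> / sqrt n) \<in> borel_measurable (law x)"
        unfolding measurable_law[OF x] using partial_sum_measurable[OF f_meas] by measurable
    qed (use \<epsilon> elim in \<open>auto intro: not_far\<close>)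
    then show ?case using elim(1) by linarith
  qed
  show "\<exists>m0. \<forall>m\<ge>m0. \<forall>l\<ge>m0. \<forall>t. \<bar>exp (- (t * \<sigma> m)\<^sup>2 / 2) - exp (- (t * \<sigma> l)\<^sup>2 / 2)\<bar> \<le> 2 * \<bar>t\<bar> * \<epsilon> + \<eta>"
  proof (intro exI allI impI)
    fix m l t assume ml: "m \<ge> m0" "l \<ge> m0"
    have lim: "(\<lambda>n. \<psi> m n t) \<longlonglongrightarrow> complex_of_real (exp (- (t * \<sigma> m)\<^sup>2 / 2))" for m
      unfolding \<psi>_def by (rule B.martingale_cf_limit[OF x V])
    have "(\<lambda>n. norm (\<psi> m n t - \<psi> l n t)) \<longlonglongrightarrow> norm (complex_of_real (exp (- (t * \<sigma> m)\<^sup>2 / 2)) - complex_of_real (exp (- (t * \<sigma> l)\<^sup>2 / 2)))"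
      by (intro tendsto_norm tendsto_diff lim)
    moreover have "\<forall>\<^sub>F n in sequentially. norm (\<psi> m n t - \<psi> l n t) \<le> 2 * \<bar>t\<bar> * \<epsilon> + \<eta>"
      using ev[OF ml(1), of t] ev[OF ml(2), of t]
    proof eventually_elim
      case (elim n)
      have "norm (\<psi> m n t - \<psi> l n t) \<le> norm (\<rho> n t - \<psi> m n t) + norm (\<rho> n t - \<psi> l n t)"
        using norm_triangle_ineq4[of "\<rho> n t - \<psi> l n t" "\<rho> n t - \<psi> m n t"] by simp
      then show ?case using elim by linarith
    qed
    ultimately have "norm (complex_of_real (exp (- (t * \<sigma> m)\<^sup>2 / 2)) - complex_of_real (exp (- (t * \<sigma> l)\<^sup>2 / 2))) \<le> 2 * \<bar>t\<bar> * \<epsilon> + \<eta>"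
      by (rule tendsto_upperbound) simp
    then show "\<bar>exp (- (t * \<sigma> m)\<^sup>2 / 2) - exp (- (t * \<sigma> l)\<^sup>2 / 2)\<bar> \<le> 2 * \<bar>t\<bar> * \<epsilon> + \<eta>"
      by (simp only: of_real_diff[symmetric] norm_of_real)
  qed
qed

lemma sum_process_eq: "sum_process f n \<omega> = step_path n (\<lambda>j. partial_sum f j \<omega> / sqrt n)"
  by (simp add: sum_process_def step_path_def)

lemma sum_process_measurable: "sum_process f n \<in> law x \<rightarrow>\<^sub>M borel_sigma skorohod_topology"
proof -
  have "(\<lambda>\<omega>. step_path n (\<lambda>j. partial_sum f j \<omega> / sqrt n)) \<in> law x \<rightarrow>\<^sub>M borel_sigma skorohod_topology"
    by (intro B.scaled_path_measurable[OF x] borel_measurable_divide partial_sum_measurable[OF f_meas]) auto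
  then show ?thesis by (simp add: sum_process_eq[abs_def])
qed

text \<open>For large \<open>m\<close> the sum process is close to a martingale path, whose limit \<open>\<sigma> m W\<close> is close to \<open>s W\<close>.\<close>

lemma functional_clt:
  fixes N :: "'b measure"
  assumes W: "brownian_motion N W" and s: "\<sigma> \<longlonglongrightarrow> s"
  shows "converges_in_distribution skorohod_topology (law x) (sum_process f) N (brownian_path W s)"
proof -
  interpret L: prob_space "law x" using x by (rule prob_space_law)
  have N: "prob_space N" using W by (simp add: brownian_motion_def)
  show ?thesis
  proof (rule converges_in_distribution_lipschitz[OF L.prob_space_axioms N sum_process_measurable brownian_path_measurable[OF W]])
    fix h L H assume h: "skorohod_lipschitz L h" and H: "\<And>y. y \<in> skorohod_space \<Longrightarrow> \<bar>h y\<bar> \<le> H"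
    have L0: "0 \<le> L" using h by (simp add: skorohod_lipschitz_def)
    have H0: "0 \<le> H" using order_trans[OF abs_ge_zero H[OF step_path_in_skorohod]] .
    show "(\<lambda>n. \<integral>\<omega>. h (sum_process f n \<omega>) \<partial>law x) \<longlonglongrightarrow> (\<integral>\<omega>. h (brownian_path W s \<omega>) \<partial>N)"
    proof (rule tendsto_by_approximation)
      fix e :: real assume e: "e > 0"
      define \<epsilon> where "\<epsilon> = e / (2 * (L + 1))"
      have \<epsilon>: "\<epsilon> > 0" "L * \<epsilon> \<le> e / 2" using e L0 by (auto simp: \<epsilon>_def field_simps)
      define \<eta> where "\<eta> = e / (4 * (H + 1))"
      have \<eta>: "\<eta> > 0" "2 * H * \<eta> \<le> e / 2" using e H0 by (auto simp: \<eta>_def field_simps)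
      have "(\<lambda>m. \<integral>\<omega>. h (brownian_path W (\<sigma> m) \<omega>) \<partial>N) \<longlonglongrightarrow> (\<integral>\<omega>. h (brownian_path W s \<omega>) \<partial>N)"
        by (intro lipschitz_expectation_limit[OF N h H] brownian_path_measurable[OF W] brownian_path_scale_tendsto[OF W _ s])
      then have "\<forall>\<^sub>F m in sequentially. dist (\<integral>\<omega>. h (brownian_path W (\<sigma> m) \<omega>) \<partial>N) (\<integral>\<omega>. h (brownian_path W s \<omega>) \<partial>N) < e"
        using e by (rule tendstoD)
      then obtain m1 where m1: "\<And>m. m \<ge> m1 \<Longrightarrow> dist (\<integral>\<omega>. h (brownian_path W (\<sigma> m) \<omega>) \<partial>N) (\<integral>\<omega>. h (brownian_path W s \<omega>) \<partial>N) < e"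
        unfolding eventually_sequentially by blast
      obtain m0 where m0: "\<And>m. m \<ge> m0 \<Longrightarrow> \<forall>\<^sub>F n in sequentially. measure (law x) (far \<epsilon> m n) \<le> \<eta>"
        using approx[OF \<epsilon>(1) \<eta>(1)] unfolding far_def by auto
      define m where "m = max m0 m1"
      have "\<forall>\<^sub>F n in sequentially. measure (law x) (far \<epsilon> m n) \<le> \<eta>" by (rule m0) (simp add: m_def)
      then have close: "\<forall>\<^sub>F n in sequentially. dist (\<integral>\<omega>. h (sum_process f n \<omega>) \<partial>law x) (\<integral>\<omega>. h (B.martingale_path m n \<omega>) \<partial>law x) \<le> e"
        using eventually_gt_at_top[of 0]
      proof eventually_elim
        case (elim n)
        have "\<bar>(\<integral>\<omega>. h (sum_process f n \<omega>) \<partial>law x) - (\<integral>\<omega>. h (B.martingale_path m n \<omega>) \<partial>law x)\<bar>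
            \<le> L * \<epsilon> + 2 * H * measure (law x) (far \<epsilon> m n)"
        proof (rule lipschitz_expectation_close[OF L.prob_space_axioms h H sum_process_measurable B.martingale_path_measurable[OF x] far_sets])
          fix \<omega> assume \<omega>: "\<omega> \<in> space (law x)" "\<omega> \<notin> far \<epsilon> m n"
          show "skorohod_dist (sum_process f n \<omega>) (B.martingale_path m n \<omega>) \<le> \<epsilon>"
            unfolding sum_process_eq B.martingale_path_def
            by (intro step_path_dist less_imp_le[OF \<epsilon>(1)] not_far[OF \<omega>]) (use elim in auto)
        qed (assumption, rule less_imp_le[OF \<epsilon>(1)])
        also have "2 * H * measure (law x) (far \<epsilon> m n) \<le> 2 * H * \<eta>"
          using elim(1) H0 by (intro mult_left_mono) auto
        finally show ?case using \<epsilon>(2) \<eta>(2) by (simp add: dist_real_def)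
      qed
      have "(\<lambda>n. \<integral>\<omega>. h (B.martingale_path m n \<omega>) \<partial>law x) \<longlonglongrightarrow> (\<integral>\<omega>. h (brownian_path W (\<sigma> m) \<omega>) \<partial>N)"
        by (rule B.bounded_martingale_fclt[OF x W \<sigma>_nonneg V h H])
      then show "\<exists>b \<beta>. b \<longlonglongrightarrow> \<beta> \<and> (\<forall>\<^sub>F n in sequentially. dist (\<integral>\<omega>. h (sum_process f n \<omega>) \<partial>law x) (b n) \<le> e)
          \<and> dist \<beta> (\<integral>\<omega>. h (brownian_path W s \<omega>) \<partial>N) \<le> e"
        using close m1[of m] by (intro exI[of _ "\<lambda>n. \<integral>\<omega>. h (B.martingale_path m n \<omega>) \<partial>law x"]
          exI[of _ "\<integral>\<omega>. h (brownian_path W (\<sigma> m) \<omega>) \<partial>N"]) (simp add: m_def less_imp_le)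
    qed
  qed
qed

end

context stationary_ergodic_markov_chain
begin

lemma quenched_functional_clt:
  assumes f: "square_integrable f"
    and maximal: "\<And>\<epsilon>::real. \<epsilon> > 0 \<Longrightarrow> AE x in \<pi>.
      (\<lambda>m. limsup (\<lambda>n. ereal (\<P>(\<omega> in K.law x.
         (MAX j\<in>{1..n}. \<bar>partial_sum (markov_avg Q f m) j \<omega>\<bar> / sqrt (real n)) > \<epsilon>)))) \<longlonglongrightarrow> 0"
  shows "\<exists>s\<ge>0. AE x in \<pi>. \<forall>(N :: 'b measure) W. brownian_motion N W \<longrightarrow>
    converges_in_distribution skorohod_topology (K.law x) (sum_process f) N (brownian_path W s)"
proof -
  interpret p: prob_space \<pi> by (rule prob_space_\<pi>)
  have "\<exists>(c :: nat \<Rightarrow> 'a \<Rightarrow> real) C. (\<forall>m. c m \<in> borel_measurable S) \<and> (\<forall>m z. \<bar>c m z\<bar> \<le> C m) \<and>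
    (AE x in \<pi>. \<forall>\<epsilon>>0. \<forall>\<eta>>0. \<exists>m0. \<forall>m\<ge>m0. \<forall>\<^sub>F n in sequentially.
      measure (K.law x) {\<omega> \<in> space K.paths. \<exists>j\<le>n. \<epsilon> * sqrt n
        \<le> \<bar>partial_sum f j \<omega> - K.increments_sum (K.mart_diff (c m)) j \<omega>\<bar>} \<le> \<eta>)"
    by (rule quenched_martingale_approximation[OF f]) (rule maximal)
  then obtain c :: "nat \<Rightarrow> 'a \<Rightarrow> real" and C
    where c: "\<And>m. c m \<in> borel_measurable S" "\<And>m z. \<bar>c m z\<bar> \<le> C m"
    and approx: "AE x in \<pi>. \<forall>\<epsilon>>0. \<forall>\<eta>>0. \<exists>m0. \<forall>m\<ge>m0. \<forall>\<^sub>F n in sequentially.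
      measure (K.law x) {\<omega> \<in> space K.paths. \<exists>j\<le>n. \<epsilon> * sqrt n
        \<le> \<bar>partial_sum f j \<omega> - K.increments_sum (K.mart_diff (c m)) j \<omega>\<bar>} \<le> \<eta>"
    by (elim exE conjE) blast
  let ?v = "\<lambda>m. bounded_increments.cond_var Q (K.mart_diff (c m))"
  have B: "bounded_increments S Q (K.mart_diff (c m)) (2 * C m)" for m
    by (rule K.bounded_increments_mart_diff[OF c])
  define \<sigma> where "\<sigma> m = sqrt (\<integral>y. ?v m y \<partial>\<pi>)" for m
  have v_int: "integrable \<pi> (?v m)" for m
  proof (rule p.integrable_const_bound[where B="(2 * C m)\<^sup>2"])
    interpret bounded_increments S Q "K.mart_diff (c m)" "2 * C m" by (rule B)
    show "AE y in \<pi>. norm (cond_var y) \<le> (2 * C m)\<^sup>2"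
      using cond_var_nonneg cond_var_le by (intro AE_I2) (simp add: space_\<pi>)
    show "cond_var \<in> borel_measurable \<pi>" unfolding measurable_\<pi> by measurable
  qed
  have \<sigma>_sq: "(\<sigma> m)\<^sup>2 = (\<integral>y. ?v m y \<partial>\<pi>)" for m
    unfolding \<sigma>_def using bounded_increments.cond_var_nonneg[OF B, of m]
    by (intro real_sqrt_pow2 integral_nonneg_AE AE_I2) auto
  have "AE x in \<pi>. \<forall>m. AE \<omega> in K.law x. (\<lambda>n. (\<Sum>l<n. ?v m (\<omega> l)) / real n) \<longlonglongrightarrow> (\<sigma> m)\<^sup>2"
    unfolding AE_all_countable \<sigma>_sq by (intro allI chain_ergodic_theorem v_int)
  with approx have good: "AE x in \<pi>. approximated_sums S Q f c C \<sigma> x"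
    using AE_space
  proof eventually_elim
    case (elim x)
    show ?case
    proof (unfold_locales)
      show "x \<in> space S" using elim(3) by (simp add: space_\<pi>)
      show "f \<in> borel_measurable S" using f by (simp add: square_integrable_def)
      show "0 \<le> \<sigma> m" for m
        unfolding \<sigma>_def using bounded_increments.cond_var_nonneg[OF B, of m]
        by (intro real_sqrt_ge_zero integral_nonneg_AE AE_I2) auto
    qed (use c elim in auto)
  qed
  have "\<exists>x. approximated_sums S Q f c C \<sigma> x"
  proof (rule ccontr)
    assume "\<not> ?thesis"
    then have "AE x in \<pi>. False" using good by simp
    then show False by simp
  qed
  then obtain s where s: "0 \<le> s" "\<sigma> \<longlonglongrightarrow> s" using approximated_sums.scale_converges by metis
  have "AE x in \<pi>. \<forall>(N :: 'b measure) W. brownian_motion N W \<longrightarrow>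
    converges_in_distribution skorohod_topology (K.law x) (sum_process f) N (brownian_path W s)"
    using good by eventually_elim (intro allI impI approximated_sums.functional_clt[OF _ _ s(2)])
  then show ?thesis using s(1) by blast
qed

end

theorem theorem2:
  fixes S :: "'a measure" and \<pi> :: "'a measure" and Q :: "'a \<Rightarrow> 'a measure"
    and P :: "(int \<Rightarrow> 'a) measure" and f :: "'a \<Rightarrow> real"
  assumes chain: "stationary_ergodic_markov_chain S \<pi> Q P"
    and f: "f \<in> L20 \<pi>"
    and maximal: "\<And>\<epsilon>::real. \<epsilon> > 0 \<Longrightarrow> AE x in \<pi>.
      (\<lambda>m. limsup (\<lambda>n. ereal (\<P>(\<omega> in chain_law S Q x.
         (MAX j\<in>{1..n}. \<bar>partial_sum (markov_avg Q f m) j \<omega>\<bar> / sqrt (real n)) > \<epsilon>))))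
      \<longlonglongrightarrow> 0"
  shows "\<exists>\<sigma>::real. 0 \<le> \<sigma> \<and> (\<exists>S'\<in>sets S. measure \<pi> S' = 1 \<and>
    (\<forall>x\<in>S'. \<forall>(B :: 'b measure) W. brownian_motion B W \<longrightarrow>
       converges_in_distribution skorohod_topology
         (chain_law S Q x) (sum_process f)
         B (\<lambda>\<omega>. \<lambda>t\<in>{0..1}. \<sigma> * W t \<omega>)))"
proof -
  interpret stationary_ergodic_markov_chain S \<pi> Q P by (rule chain)
  interpret p: prob_space \<pi> by (rule prob_space_\<pi>)
  have "integrable \<pi> (\<lambda>x. (f x)\<^sup>2)" "f \<in> borel_measurable S" using f by (auto simp: L20_def measurable_\<pi>)
  then have "square_integrable f" by (auto simp: square_integrable_def nn_integral_eq_integral)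
  then have "\<exists>s\<ge>0. AE x in \<pi>. \<forall>(N :: 'b measure) W. brownian_motion N W \<longrightarrow>
    converges_in_distribution skorohod_topology (chain_law S Q x) (sum_process f) N (brownian_path W s)"
    by (rule quenched_functional_clt) (rule maximal)
  then obtain \<sigma> where \<sigma>: "0 \<le> \<sigma>" and AE: "AE x in \<pi>. \<forall>(N :: 'b measure) W. brownian_motion N W \<longrightarrow>
    converges_in_distribution skorohod_topology (chain_law S Q x) (sum_process f) N (brownian_path W \<sigma>)"
    by blast
  from AE obtain Z where Z: "{x \<in> space \<pi>. \<not> (\<forall>(N :: 'b measure) W. brownian_motion N W \<longrightarrow>
    converges_in_distribution skorohod_topology (chain_law S Q x) (sum_process f) N (brownian_path W \<sigma>))} \<subseteq> Z"
    "emeasure \<pi> Z = 0" "Z \<in> sets \<pi>"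
    by (rule AE_E)
  have "space \<pi> - Z \<in> sets S" using Z(3) sets_\<pi> by (metis sets.compl_sets)
  moreover have "measure \<pi> (space \<pi> - Z) = 1" using Z(2,3) by (simp add: p.prob_compl p.emeasure_eq_measure)
  moreover have "\<forall>x\<in>space \<pi> - Z. \<forall>(B :: 'b measure) W. brownian_motion B W \<longrightarrow>
       converges_in_distribution skorohod_topology (chain_law S Q x) (sum_process f)
         B (\<lambda>\<omega>. \<lambda>t\<in>{0..1}. \<sigma> * W t \<omega>)"
    using Z(1) by (auto simp: brownian_path_def[abs_def])
  ultimately show ?thesis using \<sigma> by blast
qed

end
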